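(* Assume: (H1) $A,\bar A,C,\bar C\in C([0,T];\mathbb R^{n\times n})$ and $B,\bar B,D,\bar D\in C([0,T];\mathbb R^{n\times m})$. (H2) $Q,\bar Q\in C([0,T]^2;\mathbb S^n)$, $R,\bar R\in C([0,T]^2;\mathbb S^m)$, $G,\bar G\in C([0,T];\mathbb S^n)$, and for some $\delta>0$: $Q(s,t),\widehat Q(s,t)\ge0$, $R(s,t),\widehat R(s,t)\ge\delta I$ for $0\le t\le s\le T$, and $G(t),\widehat G(t)\ge0$ for $0\le t\le T$. (H3) For $0\le t\le\tau\le s\le T$: $Q(s,t)\le Q(s,\tau)$, $\widehat Q(s,t)\le\widehat Q(s,\tau)$, $R(s,t)\le R(s,\tau)$, $\widehat R(s,t)\le\widehat R(s,\tau)$, $G(t)\le G(\tau)$, $\widehat G(t)\le\widehat G(\tau)$. Let $\widetilde\Gamma^\Delta,\Gamma^\Delta,\widehat\Gamma^\Delta,P^\Delta,\widehat P^\Delta$ be the functions associated with a partition $\Delta$ of $[0,T]$ as in the context. Then, as $\|\Delta\|\to0$, $$|\widetilde\Gamma^\Delta(s,\tau)-\Gamma(s,\tau)|+|\Gamma^\Delta(s,\tau)-\Gamma(s,\tau)|+|\widehat\Gamma^\Delta(s,\tau)-\widehat\Gamma(s,\tau)|+|P^\Delta(s)-\Gamma(s,s)|+|\widehat P^\Delta(s)-\widehat\Gamma(s,s)|\to0$$ uniformly in $(s,\tau)\in[0,T]\times[0,T]$, where $\Gamma,\widehat\Gamma$ satisfy, on $0\le t\le s\le T$, $$\begin{cases}\Gamma_s(s,t)+\Gamma(s,t)[\widehat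 A(s)-\widehat B(s)\widehat\Theta(s)]+[\widehat A(s)-\widehat B(s)\widehat\Theta(s)]^T\Gamma(s,t)+Q(s,t)\\ \quad+[\widehat C(s)-\widehat D(s)\widehat\Theta(s)]^T\Gamma(s,t)[\widehat C(s)-\widehat D(s)\widehat\Theta(s)]+\widehat\Theta(s)^TR(s,t)\widehat\Theta(s)=0,\\ \widehat\Gamma_s(s,t)+\widehat\Gamma(s,t)[\widehat A(s)-\widehat B(s)\widehat\Theta(s)]+[\widehat A(s)-\widehat B(s)\widehat\Theta(s)]^T\widehat\Gamma(s,t)+\widehat Q(s,t)\\ \quad+[\widehat C(s)-\widehat D(s)\widehat\Theta(s)]^T\Gamma(s,t)[\widehat C(s)-\widehat D(s)\widehat\Theta(s)]+\widehat\Theta(s)^T\widehat R(s,t)\widehat\Theta(s)=0,\\ \Gamma(T,t)=G(t),\quad\widehat\Gamma(T,t)=\widehat G(t),\end{cases}$$ with $\widehat\Theta(s)=[\widehat R(s,s)+\widehat D(s)^T\Gamma(s,s)\widehat D(s)]^{-1}[\widehat B(s)^T\widehat\Gamma(s,s)+\widehat D(s)^T\Gamma(s,s)\widehat C(s)]$, and $\Gamma,\widehat\Gamma$ are extended by $\Gamma(s,\tau)=\Gamma(\tau,\tau)$, $\widehat\Gamma(s,\tau)=\widehat\Gamma(\tau,\tau)$ for $0\le s\le\tau\le T$.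
   Context: $\mathbb S^n$ = symmetric $n\times n$ matrices with the Loewner order. Hats: $\widehat A=A+\bar A$, $\widehat B=B+\bar B$, $\widehat C=C+\bar C$, $\widehat D=D+\bar D$, $\widehat Q=Q+\bar Q$, $\widehat R=R+\bar R$, $\widehat G=G+\bar G$. For a partition $\Delta:0=t_0<t_1<\dots<t_N=T$ put $\|\Delta\|=\max_k(t_{k+1}-t_k)$ and $Q_k(s)=Q(s,t_k)$, $\bar Q_k(s)=\bar Q(s,t_k)$, $R_k(s)=R(s,t_k)$, $\bar R_k(s)=\bar R(s,t_k)$, $G_k=G(t_k)$, $\bar G_k=\bar G(t_k)$, $\widehat Q_k=Q_k+\bar Q_k$, $\widehat R_k=R_k+\bar R_k$, $\widehat G_k=G_k+\bar G_k$. Construction, backward in $k=N-1,N-2,\dots,0$ (argument $s$ suppressed): (a) If $k\le N-2$, then $\Theta^\Delta,\widehat\Theta^\Delta$ are already known on $[t_{k+1},T]$; define $\widetilde\Gamma_k,\Gamma_k,\bar\Gamma_k$ on $[t_{k+1},T]$ by $\dot{\widetilde\Gamma}_k+\widetilde\Gamma_k(A-B\Theta^\Delta)+(A-B\Theta^\Delta)^T\widetilde\Gamma_k+Q_k+(C-D\Theta^\Delta)^T\widetilde\Gamma_k(C-D\Theta^\Delta)+(\Theta^\Delta)^TR_k\Theta^\Delta=0$ on each $(t_i,t_{i+1})$, $k+1\le i\le N-1$, with $\widetilde\Gamma_k(t_{i+1})=\widetilde\Gamma_k(t_{i+1}-)=\Gamma_k(t_{i+1})$ (so $\widetilde\Gamma_k$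 may jump at interior partition points), and $\widetilde\Gamma_k(t_{k+1}):=\Gamma_k(t_{k+1})$; $\dot\Gamma_k+\Gamma_k(\widehat A-\widehat B\widehat\Theta^\Delta)+(\widehat A-\widehat B\widehat\Theta^\Delta)^T\Gamma_k+Q_k+(\widehat C-\widehat D\widehat\Theta^\Delta)^T\widetilde\Gamma_k(\widehat C-\widehat D\widehat\Theta^\Delta)+(\widehat\Theta^\Delta)^TR_k\widehat\Theta^\Delta=0$, $\Gamma_k(T)=G_k$, $\Gamma_k$ continuous; $\dot{\bar\Gamma}_k+\bar\Gamma_k(\widehat A-\widehat B\widehat\Theta^\Delta)+(\widehat A-\widehat B\widehat\Theta^\Delta)^T\bar\Gamma_k+\bar Q_k+(\widehat\Theta^\Delta)^T\bar R_k\widehat\Theta^\Delta=0$, $\bar\Gamma_k(T)=\bar G_k$, $\bar\Gamma_k$ continuous. (The equations for $\widetilde\Gamma_k$ and $\Gamma_k$ are solved successively on $[t_{N-1},t_N],\dots,[t_{k+1},t_{k+2}]$.) Put $\widehat\Gamma_k=\Gamma_k+\bar\Gamma_k$. For $k=N-1$ use the convention $\Gamma_{N-1}(t_N)=G_{N-1}$, $\widehat\Gamma_{N-1}(t_N)=\widehat G_{N-1}$. (b) $(P_k,\widehat P_k)$ is the $\mathbb S^n$-valued solution on $[t_k,t_{k+1}]$ of $\dot P_k+P_kA+A^TP_k+C^TP_kC+Q_k-(P_kB+C^TP_kD)(R_k+D^TP_kD)^{-1}(B^TP_k+D^TP_kC)=0$, $P_k(t_{k+1})=\Gamma_k(t_{k+1})$;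 $\dot{\widehat P}_k+\widehat P_k\widehat A+\widehat A^T\widehat P_k+\widehat C^TP_k\widehat C+\widehat Q_k-(\widehat P_k\widehat B+\widehat C^TP_k\widehat D)(\widehat R_k+\widehat D^TP_k\widehat D)^{-1}(\widehat B^T\widehat P_k+\widehat D^TP_k\widehat C)=0$, $\widehat P_k(t_{k+1})=\widehat\Gamma_k(t_{k+1})$. (c) On $[t_k,t_{k+1})$ (on $[t_{N-1},t_N]$ if $k=N-1$): $\Theta^\Delta=(R_k+D^TP_kD)^{-1}(B^TP_k+D^TP_kC)$, $\widehat\Theta^\Delta=(\widehat R_k+\widehat D^TP_k\widehat D)^{-1}(\widehat B^T\widehat P_k+\widehat D^TP_k\widehat C)$. Interpolations: $P^\Delta(s)=P_k(s)$, $\widehat P^\Delta(s)=\widehat P_k(s)$ for $s\in(t_k,t_{k+1}]$ (and $P^\Delta(0)=P_0(0)$, $\widehat P^\Delta(0)=\widehat P_0(0)$). For $\tau\in(t_{k+1},t_{k+2}]$, $0\le k\le N-2$, and $s\in[\tau,T]$: $\widetilde\Gamma^\Delta(s,\tau)=\widetilde\Gamma_k(s)$, $\Gamma^\Delta(s,\tau)=\Gamma_k(s)$, $\widehat\Gamma^\Delta(s,\tau)=\widehat\Gamma_k(s)$; for $s\in[0,\tau]$ the values at $(s,\tau)$ are those at $(\tau,\tau)$. For $\tau\in[0,t_1]$: $\widetilde\Gamma^\Delta(s,\tau)=\widetilde\Gamma_0(\max(s,t_1))$, and similarly for $\Gamma^\Delta,\widehat\Gamma^\Delta$. *)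

theory Defs
  imports "HOL-Analysis.Analysis"
begin

text \<open>
  An \<open>n \<times> m\<close> matrix has type \<^typ>\<open>real^'m^'n\<close>, and \<^const>\<open>norm\<close> on this type is the
  Frobenius norm.  \<open>C([0,T])\<close> is rendered by \<^const>\<open>continuous_on\<close> for total functions whose
  values outside \<open>[0,T]\<close> are never used.
\<close>

definition sym_mat :: "real^'n^'n \<Rightarrow> bool" where
  "sym_mat M \<longleftrightarrow> transpose M = M"

definition loewner_le :: "real^'n^'n \<Rightarrow> real^'n^'n \<Rightarrow> bool"  (infix \<open>\<preceq>\<close> 50) where
  "M \<preceq> N \<longleftrightarrow> sym_mat (N - M) \<and> (\<forall>x. 0 \<le> x \<bullet> ((N - M) *v x))"

record ('n::finite, 'm::finite) lq_data =
  cA :: "real \<Rightarrow> real^'n^'n"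
  cAbar :: "real \<Rightarrow> real^'n^'n"
  cB :: "real \<Rightarrow> real^'m^'n"
  cBbar :: "real \<Rightarrow> real^'m^'n"
  cC :: "real \<Rightarrow> real^'n^'n"
  cCbar :: "real \<Rightarrow> real^'n^'n"
  cD :: "real \<Rightarrow> real^'m^'n"
  cDbar :: "real \<Rightarrow> real^'m^'n"
  cQ :: "real \<Rightarrow> real \<Rightarrow> real^'n^'n"
  cQbar :: "real \<Rightarrow> real \<Rightarrow> real^'n^'n"
  cR :: "real \<Rightarrow> real \<Rightarrow> real^'m^'m"
  cRbar :: "real \<Rightarrow> real \<Rightarrow> real^'m^'m"
  cG :: "real \<Rightarrow> real^'n^'n"
  cGbar :: "real \<Rightarrow> real^'n^'n"

definition hA :: "('n::finite, 'm::finite) lq_data \<Rightarrow> real \<Rightarrow> real^'n^'n" where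
  "hA d s = cA d s + cAbar d s"
definition hB :: "('n::finite, 'm::finite) lq_data \<Rightarrow> real \<Rightarrow> real^'m^'n" where
  "hB d s = cB d s + cBbar d s"
definition hC :: "('n::finite, 'm::finite) lq_data \<Rightarrow> real \<Rightarrow> real^'n^'n" where
  "hC d s = cC d s + cCbar d s"
definition hD :: "('n::finite, 'm::finite) lq_data \<Rightarrow> real \<Rightarrow> real^'m^'n" where
  "hD d s = cD d s + cDbar d s"
definition hQ :: "('n::finite, 'm::finite) lq_data \<Rightarrow> real \<Rightarrow> real \<Rightarrow> real^'n^'n" where
  "hQ d s t = cQ d s t + cQbar d s t"
definition hR :: "('n::finite, 'm::finite) lq_data \<Rightarrow> real \<Rightarrow> real \<Rightarrow> real^'m^'m" where
  "hR d s t = cR d s t + cRbar d s t"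
definition hG :: "('n::finite, 'm::finite) lq_data \<Rightarrow> real \<Rightarrow> real^'n^'n" where
  "hG d t = cG d t + cGbar d t"

definition H1 :: "real \<Rightarrow> ('n::finite, 'm::finite) lq_data \<Rightarrow> bool" where
  "H1 T d \<longleftrightarrow>
     continuous_on {0..T} (cA d) \<and> continuous_on {0..T} (cAbar d) \<and>
     continuous_on {0..T} (cC d) \<and> continuous_on {0..T} (cCbar d) \<and>
     continuous_on {0..T} (cB d) \<and> continuous_on {0..T} (cBbar d) \<and>
     continuous_on {0..T} (cD d) \<and> continuous_on {0..T} (cDbar d)"

definition H2 :: "real \<Rightarrow> ('n::finite, 'm::finite) lq_data \<Rightarrow> bool" where
  "H2 T d \<longleftrightarrow>
     continuous_on ({0..T} \<times> {0..T}) (\<lambda>(s, t). cQ d s t) \<and>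
     continuous_on ({0..T} \<times> {0..T}) (\<lambda>(s, t). cQbar d s t) \<and>
     continuous_on ({0..T} \<times> {0..T}) (\<lambda>(s, t). cR d s t) \<and>
     continuous_on ({0..T} \<times> {0..T}) (\<lambda>(s, t). cRbar d s t) \<and>
     continuous_on {0..T} (cG d) \<and> continuous_on {0..T} (cGbar d) \<and>
     (\<forall>s\<in>{0..T}. \<forall>t\<in>{0..T}. sym_mat (cQ d s t) \<and> sym_mat (cQbar d s t) \<and>
        sym_mat (cR d s t) \<and> sym_mat (cRbar d s t)) \<and>
     (\<forall>t\<in>{0..T}. sym_mat (cG d t) \<and> sym_mat (cGbar d t)) \<and>
     (\<exists>\<delta>>0.
        (\<forall>s t. 0 \<le> t \<and> t \<le> s \<and> s \<le> T \<longrightarrow>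
           0 \<preceq> cQ d s t \<and> 0 \<preceq> hQ d s t \<and>
           \<delta> *\<^sub>R mat 1 \<preceq> cR d s t \<and> \<delta> *\<^sub>R mat 1 \<preceq> hR d s t) \<and>
        (\<forall>t. 0 \<le> t \<and> t \<le> T \<longrightarrow> 0 \<preceq> cG d t \<and> 0 \<preceq> hG d t))"

definition H3 :: "real \<Rightarrow> ('n::finite, 'm::finite) lq_data \<Rightarrow> bool" where
  "H3 T d \<longleftrightarrow>
     (\<forall>t \<tau> s. 0 \<le> t \<and> t \<le> \<tau> \<and> \<tau> \<le> s \<and> s \<le> T \<longrightarrow>
        cQ d s t \<preceq> cQ d s \<tau> \<and> hQ d s t \<preceq> hQ d s \<tau> \<and>
        cR d s t \<preceq> cR d s \<tau> \<and> hR d s t \<preceq> hR d s \<tau> \<and>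
        cG d t \<preceq> cG d \<tau> \<and> hG d t \<preceq> hG d \<tau>)"

text \<open>
  Differential equations are written \<open>X' + F = 0\<close>; \<open>lyapunov_op\<close> and \<open>riccati_op\<close> are the two
  possible \<open>F\<close>.  Here \<open>X\<close> is the unknown and \<open>Y\<close> is the matrix placed between the diffusion
  coefficients \<open>C\<close> and \<open>D\<close>: it is \<open>X\<close> itself for a self-contained equation, and another
  function, solved for beforehand or simultaneously, otherwise.
\<close>

definition lyapunov_op ::
  "real^'n^'n \<Rightarrow> real^'m^'n \<Rightarrow> real^'n^'n \<Rightarrow> real^'m^'n \<Rightarrow> real^'n^'n \<Rightarrow> real^'m^'m \<Rightarrow>
   real^'n^'m \<Rightarrow> real^'n^'n \<Rightarrow> real^'n^'n \<Rightarrow> real^'n^'n" where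
  "lyapunov_op A B C D Q R \<Theta> X Y =
     X ** (A - B ** \<Theta>) + transpose (A - B ** \<Theta>) ** X + Q
     + transpose (C - D ** \<Theta>) ** Y ** (C - D ** \<Theta>) + transpose \<Theta> ** R ** \<Theta>"

definition riccati_op ::
  "real^'n^'n \<Rightarrow> real^'m^'n \<Rightarrow> real^'n^'n \<Rightarrow> real^'m^'n \<Rightarrow> real^'n^'n \<Rightarrow> real^'m^'m \<Rightarrow>
   real^'n^'n \<Rightarrow> real^'n^'n \<Rightarrow> real^'n^'n" where
  "riccati_op A B C D Q R X Y =
     X ** A + transpose A ** X + transpose C ** Y ** C + Q
     - (X ** B + transpose C ** Y ** D) ** matrix_inv (R + transpose D ** Y ** D)
       ** (transpose B ** X + transpose D ** Y ** C)"

definition feedback_gain ::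
  "real^'m^'n \<Rightarrow> real^'n^'n \<Rightarrow> real^'m^'n \<Rightarrow> real^'m^'m \<Rightarrow> real^'n^'n \<Rightarrow> real^'n^'n \<Rightarrow>
   real^'n^'m" where
  "feedback_gain B C D R X Y =
     matrix_inv (R + transpose D ** Y ** D) ** (transpose B ** X + transpose D ** Y ** C)"

text \<open>A partition is the pair of \<open>N\<close> and the sequence \<open>t\<close> of which only \<open>t 0, \<dots>, t N\<close> matter.\<close>

definition is_partition :: "real \<Rightarrow> nat \<Rightarrow> (nat \<Rightarrow> real) \<Rightarrow> bool" where
  "is_partition T N t \<longleftrightarrow> 0 < N \<and> t 0 = 0 \<and> t N = T \<and> (\<forall>k<N. t k < t (Suc k))"

definition mesh :: "nat \<Rightarrow> (nat \<Rightarrow> real) \<Rightarrow> real" where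
  "mesh N t = Max ((\<lambda>k. t (Suc k) - t k) ` {..<N})"

record ('n::finite, 'm::finite) scheme =
  Gam_tilde :: "nat \<Rightarrow> real \<Rightarrow> real^'n^'n"
  Gam :: "nat \<Rightarrow> real \<Rightarrow> real^'n^'n"
  Gam_bar :: "nat \<Rightarrow> real \<Rightarrow> real^'n^'n"
  Pk :: "nat \<Rightarrow> real \<Rightarrow> real^'n^'n"
  Pk_hat :: "nat \<Rightarrow> real \<Rightarrow> real^'n^'n"
  Th :: "real \<Rightarrow> real^'n^'m"
  Th_hat :: "real \<Rightarrow> real^'n^'m"

definition Gam_hat :: "('n::finite, 'm::finite) scheme \<Rightarrow> nat \<Rightarrow> real \<Rightarrow> real^'n^'n" where
  "Gam_hat S k s = Gam S k s + Gam_bar S k s"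

text \<open>
  The equations for the three \<open>\<Gamma>\<close>-functions with index \<open>k\<close> on \<open>[t (k+1), T]\<close>.  For \<open>k = N - 1\<close> the
  interval is the point \<open>T\<close>, there are no differential equations left, and the terminal
  conditions are the convention for that index.
\<close>

definition Gam_equations ::
  "('n::finite, 'm::finite) lq_data \<Rightarrow> real \<Rightarrow> nat \<Rightarrow> (nat \<Rightarrow> real) \<Rightarrow> ('n, 'm) scheme \<Rightarrow> nat \<Rightarrow> bool"
where
  "Gam_equations d T N t S k \<longleftrightarrow>
     Gam S k T = cG d (t k) \<and> Gam_bar S k T = cGbar d (t k) \<and>
     continuous_on {t (Suc k)..T} (Gam S k) \<and> continuous_on {t (Suc k)..T} (Gam_bar S k) \<and>
     Gam_tilde S k (t (Suc k)) = Gam S k (t (Suc k)) \<and>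
     (\<forall>i. Suc k \<le> i \<and> i < N \<longrightarrow>
        Gam_tilde S k (t (Suc i)) = Gam S k (t (Suc i)) \<and>
        (Gam_tilde S k \<longlongrightarrow> Gam_tilde S k (t (Suc i))) (at_left (t (Suc i))) \<and>
        (\<forall>s\<in>{t i<..<t (Suc i)}.
          (Gam_tilde S k has_vector_derivative
             - lyapunov_op (cA d s) (cB d s) (cC d s) (cD d s) (cQ d s (t k)) (cR d s (t k))
                 (Th S s) (Gam_tilde S k s) (Gam_tilde S k s)) (at s) \<and>
          (Gam S k has_vector_derivative
             - lyapunov_op (hA d s) (hB d s) (hC d s) (hD d s) (cQ d s (t k)) (cR d s (t k))
                 (Th_hat S s) (Gam S k s) (Gam_tilde S k s)) (at s) \<and>
          (Gam_bar S k has_vector_derivative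
             - (Gam_bar S k s ** (hA d s - hB d s ** Th_hat S s)
                + transpose (hA d s - hB d s ** Th_hat S s) ** Gam_bar S k s
                + cQbar d s (t k)
                + transpose (Th_hat S s) ** cRbar d s (t k) ** Th_hat S s)) (at s)))"

text \<open>
  \<^const>\<open>matrix_inv\<close> is total, so solving a Riccati equation includes the invertibility of the
  matrices that are inverted.
\<close>

definition P_equations ::
  "('n::finite, 'm::finite) lq_data \<Rightarrow> (nat \<Rightarrow> real) \<Rightarrow> ('n, 'm) scheme \<Rightarrow> nat \<Rightarrow> bool"
where
  "P_equations d t S k \<longleftrightarrow>
     Pk S k (t (Suc k)) = Gam S k (t (Suc k)) \<and>
     Pk_hat S k (t (Suc k)) = Gam_hat S k (t (Suc k)) \<and>
     (\<forall>s\<in>{t k..t (Suc k)}.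
        sym_mat (Pk S k s) \<and> sym_mat (Pk_hat S k s) \<and>
        invertible (cR d s (t k) + transpose (cD d s) ** Pk S k s ** cD d s) \<and>
        invertible (hR d s (t k) + transpose (hD d s) ** Pk S k s ** hD d s) \<and>
        (Pk S k has_vector_derivative
           - riccati_op (cA d s) (cB d s) (cC d s) (cD d s) (cQ d s (t k)) (cR d s (t k))
               (Pk S k s) (Pk S k s)) (at s within {t k..t (Suc k)}) \<and>
        (Pk_hat S k has_vector_derivative
           - riccati_op (hA d s) (hB d s) (hC d s) (hD d s) (hQ d s (t k)) (hR d s (t k))
               (Pk_hat S k s) (Pk S k s)) (at s within {t k..t (Suc k)}))"

definition Th_equations ::
  "('n::finite, 'm::finite) lq_data \<Rightarrow> nat \<Rightarrow> (nat \<Rightarrow> real) \<Rightarrow> ('n, 'm) scheme \<Rightarrow> nat \<Rightarrow> bool"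
where
  "Th_equations d N t S k \<longleftrightarrow>
     (\<forall>s\<in>(if Suc k = N then {t k..t (Suc k)} else {t k..<t (Suc k)}).
        Th S s = feedback_gain (cB d s) (cC d s) (cD d s) (cR d s (t k)) (Pk S k s) (Pk S k s) \<and>
        Th_hat S s = feedback_gain (hB d s) (hC d s) (hD d s) (hR d s (t k)) (Pk_hat S k s) (Pk S k s))"

text \<open>
  The equations with index \<open>k\<close> only refer to the scheme on \<open>[t k, T]\<close>, so this system of
  conditions is the backward recursion \<open>k = N - 1, \<dots>, 0\<close>.
\<close>

definition is_scheme ::
  "('n::finite, 'm::finite) lq_data \<Rightarrow> real \<Rightarrow> nat \<Rightarrow> (nat \<Rightarrow> real) \<Rightarrow> ('n, 'm) scheme \<Rightarrow> bool"
where
  "is_scheme d T N t S \<longleftrightarrow>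
     (\<forall>k<N. Gam_equations d T N t S k \<and> P_equations d t S k \<and> Th_equations d N t S k)"

text \<open>The index \<open>k\<close> with \<open>s \<in> (t k, t (k+1)]\<close>, and \<open>0\<close> if \<open>s = t 0\<close>.\<close>

definition cell :: "(nat \<Rightarrow> real) \<Rightarrow> real \<Rightarrow> nat" where
  "cell t s = (LEAST k. s \<le> t (Suc k))"

definition interp1 :: "(nat \<Rightarrow> real) \<Rightarrow> (nat \<Rightarrow> real \<Rightarrow> real^'n^'n) \<Rightarrow> real \<Rightarrow> real^'n^'n" where
  "interp1 t F s = F (cell t s) s"

text \<open>If \<open>\<tau> \<in> (t (k+1), t (k+2)]\<close>, then \<^term>\<open>cell t \<tau> - 1\<close> is \<open>k\<close>.\<close>

definition interp2 ::
  "(nat \<Rightarrow> real) \<Rightarrow> (nat \<Rightarrow> real \<Rightarrow> real^'n^'n) \<Rightarrow> real \<Rightarrow> real \<Rightarrow> real^'n^'n" where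
  "interp2 t F s \<tau> =
     (if \<tau> \<le> t 1 then F 0 (max s (t 1)) else F (cell t \<tau> - 1) (max s \<tau>))"

definition equilibrium_gain ::
  "('n::finite, 'm::finite) lq_data \<Rightarrow> (real \<Rightarrow> real \<Rightarrow> real^'n^'n) \<Rightarrow>
   (real \<Rightarrow> real \<Rightarrow> real^'n^'n) \<Rightarrow> real \<Rightarrow> real^'n^'m" where
  "equilibrium_gain d \<Gamma> \<Gamma>h s =
     feedback_gain (hB d s) (hC d s) (hD d s) (hR d s s) (\<Gamma>h s s) (\<Gamma> s s)"

definition equilibrium_riccati ::
  "('n::finite, 'm::finite) lq_data \<Rightarrow> real \<Rightarrow> (real \<Rightarrow> real \<Rightarrow> real^'n^'n) \<Rightarrow>
   (real \<Rightarrow> real \<Rightarrow> real^'n^'n) \<Rightarrow> bool" where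
  "equilibrium_riccati d T \<Gamma> \<Gamma>h \<longleftrightarrow>
     (\<forall>s\<in>{0..T}. invertible (hR d s s + transpose (hD d s) ** \<Gamma> s s ** hD d s)) \<and>
     (\<forall>t\<in>{0..T}. \<Gamma> T t = cG d t \<and> \<Gamma>h T t = hG d t \<and>
        (\<forall>s\<in>{t..T}.
          ((\<lambda>r. \<Gamma> r t) has_vector_derivative
             - lyapunov_op (hA d s) (hB d s) (hC d s) (hD d s) (cQ d s t) (cR d s t)
                 (equilibrium_gain d \<Gamma> \<Gamma>h s) (\<Gamma> s t) (\<Gamma> s t)) (at s within {t..T}) \<and>
          ((\<lambda>r. \<Gamma>h r t) has_vector_derivative
             - lyapunov_op (hA d s) (hB d s) (hC d s) (hD d s) (hQ d s t) (hR d s t)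
                 (equilibrium_gain d \<Gamma> \<Gamma>h s) (\<Gamma>h s t) (\<Gamma> s t)) (at s within {t..T})))"

end

theory Submission
  imports Defs
begin

text \<open>
  Monotonicity of the weights in the frozen time makes the cost kernels frozen at \<open>t k\<close> at
  most those frozen at \<open>t (k+1)\<close>, so the terminal value of \<open>Pk_hat\<close> on the cell of \<open>k\<close> is at most its
  initial value on the next cell; the non-mean-field kernels are dominated by multiples of the
  hatted ones. A backward Gronwall argument along the cells for the trace of \<open>Pk_hat\<close> then bounds
  all functions of all schemes uniformly in the partition. With these bounds, the gains are Lipschitz
  functions of the kernels near the diagonal, and a comparison of two schemes of small mesh in a
  weighted supremum norm shows that their kernels are uniformly close. Hence the interpolations along
  any sequence of partitions with vanishing mesh are Cauchy, and the integrated equations pass to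
  the limit.
\<close>

section \<open>Matrices and the Loewner order\<close>

text \<open>That the limit system has a solution is part of the claim, so there is no exact solution
  with which a scheme could be compared; comparing two schemes supplies one. The obstacle to the a
  priori bound is that a naive estimate loses a factor on every cell, and the number of cells is
  unbounded. On the hatted side the Loewner comparison loses nothing. On the other side it fails:
  \<open>Pk\<close> restarts from \<open>Gam\<close>, which follows the hatted gain, while only
  \<open>Gam_tilde\<close> lies below the next \<open>Pk\<close>. Hence \<open>Gam\<close> is
  bounded at each time by \<open>Gam_hat\<close>, with a factor that does not accumulate over the
  cells: the hatted \<open>R\<close> is coercive, so the running costs of the same feedback are
  comparable. The gain \<open>Th\<close> leaves no trace in the limit, because
  \<open>Gam_tilde\<close> restarts from \<open>Gam\<close> at the right end of every cell and
  cannot drift away by more than a multiple of the mesh. Positivity, on which all inverses depend,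
  cannot be assumed while a Riccati equation is being solved; half of the coercivity of
  \<open>R\<close> is therefore reserved for a slightly negative \<open>P\<close>.\<close>

lemma norm_matrix_vector_le:
  fixes A :: "real^'n^'m"
  shows "norm (A *v x) \<le> norm A * norm x"
proof -
  have "norm (A *v x) = L2_set (\<lambda>i. norm ((A *v x) $ i)) UNIV"
    by (simp add: norm_vec_def)
  also have "\<dots> \<le> L2_set (\<lambda>i. norm (A $ i) * norm x) UNIV"
    by (intro L2_set_mono) (auto simp: matrix_vector_mul_component Cauchy_Schwarz_ineq2)
  also have "\<dots> = norm A * norm x"
    by (simp add: norm_vec_def L2_set_left_distrib)
  finally show ?thesis .
qed

lemma norm_transpose:
  fixes A :: "real^'n^'m"
  shows "norm (transpose A) = norm A"
proof -
  have "norm (transpose A)^2 = (\<Sum>i\<in>UNIV. \<Sum>j\<in>UNIV. A$j$i * A$j$i)"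
    by (simp add: power2_norm_eq_inner inner_vec_def transpose_def)
  also have "\<dots> = (\<Sum>j\<in>UNIV. \<Sum>i\<in>UNIV. A$j$i * A$j$i)"
    by (rule sum.swap)
  also have "\<dots> = norm A ^ 2"
    by (simp add: power2_norm_eq_inner inner_vec_def)
  finally show ?thesis
    by (simp add: power2_eq_iff_nonneg)
qed

text \<open>Each row of the product is \<open>transpose B\<close> applied to a row of
  \<open>A\<close>, so the vector bound applies row by row and the rows reassemble in the Euclidean
  norm.\<close>

lemma norm_matrix_mult_le:
  fixes A :: "real^'n^'m" and B :: "real^'p^'n"
  shows "norm (A ** B) \<le> norm A * norm B"
proof -
  have row: "(A ** B) $ i = transpose B *v (A $ i)" for i
    by (simp add: vec_eq_iff matrix_matrix_mult_def vector_matrix_mult_def mult.commute)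
  have "norm (A ** B) = L2_set (\<lambda>i. norm (transpose B *v (A $ i))) UNIV"
    by (simp only: norm_vec_def row)
  also have "\<dots> \<le> L2_set (\<lambda>i. norm B * norm (A $ i)) UNIV"
    using norm_matrix_vector_le[of "transpose B"]
    by (intro L2_set_mono) (auto simp: norm_transpose simp del: transpose_matrix_vector)
  also have "\<dots> = norm B * norm A"
    by (subst (2) norm_vec_def) (simp add: L2_set_right_distrib)
  finally show ?thesis by (simp add: mult.commute)
qed

lemma bounded_bilinear_matrix_mult:
  "bounded_bilinear ((**) :: real^'n^'m \<Rightarrow> real^'p^'n \<Rightarrow> real^'p^'m)"
proof
  show "\<exists>K. \<forall>(a::real^'n^'m) (b::real^'p^'n). norm (a ** b) \<le> norm a * norm b * K"
    by (rule exI[of _ 1]) (simp add: norm_matrix_mult_le)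
qed (simp_all add: vec_eq_iff matrix_matrix_mult_def sum.distrib sum_distrib_left algebra_simps)

lemma bounded_bilinear_matrix_vector_mult:
  "bounded_bilinear ((*v) :: real^'n^'m \<Rightarrow> real^'n \<Rightarrow> real^'m)"
proof
  show "\<exists>K. \<forall>(a::real^'n^'m) b. norm (a *v b) \<le> norm a * norm b * K"
    by (rule exI[of _ 1]) (simp add: norm_matrix_vector_le)
qed (simp_all add: algebra_simps scaleR_matrix_vector_assoc)

lemma bounded_linear_transpose: "bounded_linear (transpose :: real^'n^'m \<Rightarrow> real^'m^'n)"
proof (rule bounded_linear_intro[of _ 1])
  show "norm (transpose A) \<le> norm A * 1" for A :: "real^'n^'m"
    by (simp add: norm_transpose)
qed (simp_all add: transpose_def vec_eq_iff)

lemmas matrix_mult_bilinear =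
  bounded_bilinear.add_left[OF bounded_bilinear_matrix_mult]
  bounded_bilinear.add_right[OF bounded_bilinear_matrix_mult]
  bounded_bilinear.diff_left[OF bounded_bilinear_matrix_mult]
  bounded_bilinear.diff_right[OF bounded_bilinear_matrix_mult]
  bounded_bilinear.minus_left[OF bounded_bilinear_matrix_mult]
  bounded_bilinear.minus_right[OF bounded_bilinear_matrix_mult]
  bounded_bilinear.zero_left[OF bounded_bilinear_matrix_mult]
  bounded_bilinear.zero_right[OF bounded_bilinear_matrix_mult]
  bounded_bilinear.scaleR_left[OF bounded_bilinear_matrix_mult]
  bounded_bilinear.scaleR_right[OF bounded_bilinear_matrix_mult]

lemmas matrix_vector_bilinear =
  bounded_bilinear.add_left[OF bounded_bilinear_matrix_vector_mult]
  bounded_bilinear.add_right[OF bounded_bilinear_matrix_vector_mult]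
  bounded_bilinear.diff_left[OF bounded_bilinear_matrix_vector_mult]
  bounded_bilinear.diff_right[OF bounded_bilinear_matrix_vector_mult]
  bounded_bilinear.minus_left[OF bounded_bilinear_matrix_vector_mult]
  bounded_bilinear.minus_right[OF bounded_bilinear_matrix_vector_mult]
  bounded_bilinear.zero_left[OF bounded_bilinear_matrix_vector_mult]
  bounded_bilinear.scaleR_left[OF bounded_bilinear_matrix_vector_mult]
  bounded_bilinear.scaleR_right[OF bounded_bilinear_matrix_vector_mult]

lemmas transpose_linear =
  linear_add[OF bounded_linear.linear[OF bounded_linear_transpose]]
  linear_diff[OF bounded_linear.linear[OF bounded_linear_transpose]]
  linear_neg[OF bounded_linear.linear[OF bounded_linear_transpose]]
  linear_0[OF bounded_linear.linear[OF bounded_linear_transpose]]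

lemmas continuous_on_matrix_mult [continuous_intros] =
  bounded_bilinear.continuous_on[OF bounded_bilinear_matrix_mult]

lemmas continuous_on_transpose [continuous_intros] =
  bounded_linear.continuous_on[OF bounded_linear_transpose]

lemma bounded_linear_quadratic_form:
  "bounded_linear (\<lambda>M :: real^'n^'n. x \<bullet> (M *v x))"
  using bounded_linear_compose[OF bounded_linear_inner_right
      bounded_bilinear.bounded_linear_left[OF bounded_bilinear_matrix_vector_mult]] .

lemma trace_scaleR: "trace (c *\<^sub>R M) = c * trace M" for M :: "real^'n^'n"
  by (simp add: trace_def sum_distrib_left)

lemma trace_minus: "trace (- M) = - trace M" for M :: "real^'n^'n"
  by (simp add: trace_def sum_negf)

lemma trace_abs_le: "\<bar>trace M\<bar> \<le> CARD('n) * norm M" for M :: "real^'n^'n"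
proof -
  have "\<bar>M $ i $ i\<bar> \<le> norm M" for i
    by (meson component_le_norm_cart Finite_Cartesian_Product.norm_nth_le order_trans)
  then have "\<bar>trace M\<bar> \<le> (\<Sum>i\<in>(UNIV::'n set). norm M)"
    unfolding trace_def by (intro order_trans[OF sum_abs] sum_mono)
  then show ?thesis by simp
qed

lemma bounded_linear_trace: "bounded_linear (trace :: real^'n^'n \<Rightarrow> real)"
  using trace_abs_le
  by (intro bounded_linear_intro[of _ "CARD('n)"]) (auto simp: trace_add trace_scaleR mult.commute)

section \<open>Quadratic forms, the Loewner order and the trace\<close>

lemma inner_transpose_mult: "x \<bullet> (transpose N *v y) = (N *v x) \<bullet> y" for N :: "real^'n^'m"
  by (metis dot_lmul_matrix inner_commute transpose_matrix_vector)

lemma quadratic_form_congruence: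
  "x \<bullet> ((transpose N ** M ** N) *v x) = (N *v x) \<bullet> (M *v (N *v x))" for N :: "real^'n^'m"
  by (simp only: matrix_vector_mul_assoc[symmetric] inner_transpose_mult)

lemma sym_mat_transpose: "sym_mat M \<Longrightarrow> transpose M = M"
  by (simp add: sym_mat_def)

lemma sym_mat_congruence: "sym_mat M \<Longrightarrow> sym_mat (transpose N ** M ** N)"
  for M :: "real^'n^'n"
  by (simp add: sym_mat_def matrix_transpose_mul matrix_mul_assoc)

lemma sym_mat_lin:
  fixes M N :: "real^'n^'n"
  shows "sym_mat M \<Longrightarrow> sym_mat N \<Longrightarrow> sym_mat (M + N)"
    and "sym_mat M \<Longrightarrow> sym_mat N \<Longrightarrow> sym_mat (M - N)"
    and "sym_mat M \<Longrightarrow> sym_mat (- M)"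
    and "sym_mat M \<Longrightarrow> sym_mat (c *\<^sub>R M)"
    and "sym_mat (0 :: real^'n^'n)"
    and "sym_mat (mat 1 :: real^'n^'n)"
  by (simp_all add: sym_mat_def transpose_linear transpose_scalar)

lemma psd_iff: "0 \<preceq> M \<longleftrightarrow> sym_mat M \<and> (\<forall>x. 0 \<le> x \<bullet> (M *v x))"
  by (simp add: loewner_le_def)

lemma loewner_le_iff_psd: "M \<preceq> N \<longleftrightarrow> 0 \<preceq> N - M"
  by (simp add: loewner_le_def)

lemma loewner_refl: "M \<preceq> M"
  by (simp add: loewner_le_def sym_mat_lin)

lemma loewner_quadratic_form: "M \<preceq> N \<Longrightarrow> x \<bullet> (M *v x) \<le> x \<bullet> (N *v x)"
  by (auto simp: loewner_le_def matrix_vector_bilinear inner_diff_right)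

lemma psd_add: "0 \<preceq> M \<Longrightarrow> 0 \<preceq> N \<Longrightarrow> 0 \<preceq> M + N"
  by (simp add: psd_iff sym_mat_lin matrix_vector_bilinear inner_add_right)

lemma psd_scaleR: "0 \<preceq> M \<Longrightarrow> 0 \<le> c \<Longrightarrow> 0 \<preceq> c *\<^sub>R M"
  by (simp add: psd_iff sym_mat_lin matrix_vector_bilinear)

lemma psd_mat_1: "0 \<preceq> mat 1"
  by (simp add: psd_iff sym_mat_lin)

lemma loewner_trans: "L \<preceq> M \<Longrightarrow> M \<preceq> N \<Longrightarrow> L \<preceq> N"
  using psd_add[of "M - L" "N - M"] by (simp add: loewner_le_iff_psd[of _ M] loewner_le_iff_psd[of _ N])

lemma psd_congruence: "0 \<preceq> M \<Longrightarrow> 0 \<preceq> transpose N ** M ** N" for N :: "real^'n^'m"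
  by (simp only: psd_iff sym_mat_congruence quadratic_form_congruence simp_thms)

text \<open>Positivity is first obtained on half-open cells and for approximations; closedness
  carries it to endpoints and to limits.\<close>

lemma closed_psd: "closed {M :: real^'n^'n. 0 \<preceq> M}"
proof -
  have "{M :: real^'n^'n. 0 \<preceq> M} = {M. transpose M = M} \<inter> (\<Inter>x. {M. 0 \<le> x \<bullet> (M *v x)})"
    by (auto simp: psd_iff sym_mat_def)
  moreover have "closed {M :: real^'n^'n. transpose M = M}"
    by (intro closed_Collect_eq continuous_intros linear_continuous_on bounded_linear_transpose)
  moreover have "closed {M :: real^'n^'n. 0 \<le> x \<bullet> (M *v x)}" for x
    by (intro closed_Collect_le continuous_intros linear_continuous_on bounded_linear_quadratic_form)
  ultimately show ?thesis by (auto intro!: closed_Int closed_INT)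
qed

lemma quadratic_form_lower: "- norm M * (x \<bullet> x) \<le> x \<bullet> (M *v x)" for M :: "real^'n^'n"
proof -
  have "\<bar>x \<bullet> (M *v x)\<bar> \<le> norm x * (norm M * norm x)"
    by (intro order_trans[OF Cauchy_Schwarz_ineq2] mult_left_mono norm_matrix_vector_le) auto
  also have "\<dots> = norm M * (x \<bullet> x)"
    by (simp add: power2_norm_eq_inner[symmetric] power2_eq_square)
  finally show ?thesis by linarith
qed

lemma quadratic_form_upper: "x \<bullet> (M *v x) \<le> norm M * (x \<bullet> x)" for M :: "real^'n^'n"
  using quadratic_form_lower[of "- M" x] by (simp add: matrix_vector_bilinear)

lemma trace_nonneg:
  fixes M :: "real^'n^'n"
  assumes "\<And>x. 0 \<le> x \<bullet> (M *v x)"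
  shows "0 \<le> trace M"
proof -
  have "0 \<le> M $ i $ i" for i
    using assms[of "axis i 1"] by (simp add: matrix_vector_mult_basis inner_axis' column_def)
  then show ?thesis by (simp add: trace_def sum_nonneg)
qed

lemma trace_psd_nonneg: "0 \<preceq> M \<Longrightarrow> 0 \<le> trace M"
  by (rule trace_nonneg) (simp add: psd_iff)

lemma trace_mono: "M \<preceq> N \<Longrightarrow> trace M \<le> trace N"
  using trace_psd_nonneg[of "N - M"] by (simp add: loewner_le_iff_psd[of M] trace_sub)

lemma norm_le_sum_rows: "norm M \<le> (\<Sum>i\<in>UNIV. norm (M $ i))" for M :: "real^'n^'m"
  by (simp add: norm_vec_def L2_set_le_sum)

text \<open>The trace is linear and monotone in the order, so this turns every a priori bound on
  matrices into a scalar Gronwall estimate. Testing the form on e_i + e_j and e_i - e_j bounds each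
  entry by the mean of two diagonal entries.\<close>

lemma norm_psd_le_trace:
  fixes M :: "real^'n^'n"
  assumes "0 \<preceq> M"
  shows "norm M \<le> CARD('n) * trace M"
proof -
  have sym: "M $ i $ j = M $ j $ i" for i j
    using assms unfolding psd_iff sym_mat_def transpose_def by (metis vec_lambda_beta)
  have entry: "\<bar>M $ i $ j\<bar> \<le> (M $ i $ i + M $ j $ j) / 2" for i j
  proof -
    have e: "(axis i 1 + c *\<^sub>R axis j 1) \<bullet> (M *v (axis i 1 + c *\<^sub>R axis j 1))
        = M $ i $ i + 2 * c * M $ i $ j + c * c * M $ j $ j" for c
      by (simp add: matrix_vector_bilinear inner_add_left inner_add_right matrix_vector_mult_basis
          inner_axis' column_def sym[of j i] algebra_simps)
    have "0 \<le> M $ i $ i + 2 * c * M $ i $ j + c * c * M $ j $ j" for c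
      unfolding e[symmetric] using assms by (simp add: psd_iff)
    from this[of 1] this[of "-1"] show ?thesis by (simp add: abs_le_iff)
  qed
  have "norm M \<le> (\<Sum>i\<in>UNIV. \<Sum>j\<in>UNIV. \<bar>M $ i $ j\<bar>)"
    by (intro order_trans[OF norm_le_sum_rows] sum_mono norm_le_l1_cart)
  also have "\<dots> \<le> (\<Sum>i\<in>UNIV. \<Sum>j\<in>UNIV. (M $ i $ i + M $ j $ j) / 2)"
    by (intro sum_mono entry)
  also have "\<dots> = CARD('n) * trace M"
    by (simp add: trace_def sum.distrib add_divide_distrib flip: sum_divide_distrib sum_distrib_left)
  finally show ?thesis .
qed

section \<open>Coercive matrices and their inverses\<close>

lemma matrix_inv_inverse:
  fixes S :: "real^'n^'n"
  assumes "invertible S"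
  shows "S ** matrix_inv S = mat 1" "matrix_inv S ** S = mat 1"
  using someI_ex[of "\<lambda>A'. S ** A' = mat 1 \<and> A' ** S = mat 1"] assms
  by (auto simp: invertible_def matrix_inv_def)

text \<open>The lower bound is separated from symmetry: it alone gives invertibility, a bound for
  the inverse and its Lipschitz dependence.\<close>

definition coercive :: "real \<Rightarrow> real^'n^'n \<Rightarrow> bool" where
  "coercive \<delta> S \<longleftrightarrow> (\<forall>x. \<delta> * (x \<bullet> x) \<le> x \<bullet> (S *v x))"

lemma coercive_invertible:
  fixes S :: "real^'n^'n"
  assumes "\<delta> > 0" "coercive \<delta> S"
  shows "invertible S"
proof -
  have "x = 0" if "S *v x = 0" for x
  proof -
    have "\<delta> * (x \<bullet> x) \<le> x \<bullet> (S *v x)"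
      using assms(2) by (simp add: coercive_def)
    then have "x \<bullet> x \<le> 0"
      using assms(1) that by (simp add: mult_le_0_iff)
    then show ?thesis
      using inner_gt_zero_iff[of x] by linarith
  qed
  then show ?thesis
    by (simp add: invertible_left_inverse matrix_left_invertible_ker)
qed

text \<open>Column j of the inverse solves S y = e_j, and coercivity with Cauchy-Schwarz gives it
  norm at most 1 / \<delta>. Summing the columns produces the factor
  \<open>CARD('n)\<close>.\<close>

lemma coercive_inverse_norm:
  fixes S :: "real^'n^'n"
  assumes "\<delta> > 0" "coercive \<delta> S"
  shows "norm (matrix_inv S) \<le> CARD('n) / \<delta>"
proof -
  note inv = matrix_inv_inverse[OF coercive_invertible[OF assms]]
  have col: "norm (transpose (matrix_inv S) $ j) \<le> 1 / \<delta>" for j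
  proof -
    define y where "y = matrix_inv S *v axis j 1"
    have "S *v y = axis j 1"
      unfolding y_def by (simp only: matrix_vector_mul_assoc inv matrix_vector_mul_lid)
    then have "\<delta> * (y \<bullet> y) \<le> y \<bullet> axis j 1"
      using assms(2) by (metis coercive_def)
    also have "\<dots> \<le> norm y"
      using norm_cauchy_schwarz[of y "axis j 1"] by (simp add: norm_axis_1)
    finally have "norm y * (\<delta> * norm y) \<le> norm y * 1"
      by (simp add: power2_norm_eq_inner[symmetric] power2_eq_square algebra_simps)
    then have "\<delta> * norm y \<le> 1"
      by (cases "norm y = 0") auto
    moreover have "transpose (matrix_inv S) $ j = y"
      by (simp add: y_def matrix_vector_mult_basis column_def transpose_def)
    ultimately show ?thesis
      using assms(1) by (simp add: field_simps)
  qed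
  have "norm (matrix_inv S) = norm (transpose (matrix_inv S))"
    by (simp add: norm_transpose)
  also have "\<dots> \<le> (\<Sum>j\<in>(UNIV::'n set). 1 / \<delta>)"
    by (intro order_trans[OF norm_le_sum_rows] sum_mono col)
  finally show ?thesis by simp
qed

text \<open>A defect r of positivity in \<open>Y\<close> costs at most r \<kappa>^2 after
  conjugation by \<open>D\<close>, and half of the coercivity of \<open>R\<close> pays for it. So
  the inverse exists on a whole neighbourhood of the positive matrices, which leaves room for
  continuation arguments.\<close>

lemma coercive_gram:
  fixes D :: "real^'m^'n"
  assumes R: "coercive \<delta> R" and Y: "\<And>x. - r * (x \<bullet> x) \<le> x \<bullet> (Y *v x)"
    and r: "0 \<le> r" "norm D \<le> \<kappa>" "r * \<kappa>\<^sup>2 \<le> \<delta> / 2"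
  shows "coercive (\<delta> / 2) (R + transpose D ** Y ** D)"
  unfolding coercive_def
proof
  fix x
  have "(norm (D *v x))\<^sup>2 \<le> (\<kappa> * norm x)\<^sup>2"
    using order_trans[OF norm_matrix_vector_le[of D x] mult_right_mono[OF r(2) norm_ge_zero]]
    by (intro power_mono) auto
  then have "r * ((D *v x) \<bullet> (D *v x)) \<le> r * (\<kappa>\<^sup>2 * (x \<bullet> x))"
    using r(1) by (intro mult_left_mono) (auto simp: power2_norm_eq_inner power_mult_distrib)
  also have "\<dots> \<le> \<delta> / 2 * (x \<bullet> x)"
    unfolding mult.assoc[symmetric] using r(3) by (intro mult_right_mono) auto
  finally have "- (\<delta> / 2) * (x \<bullet> x) \<le> - r * ((D *v x) \<bullet> (D *v x))" by simp
  also have "\<dots> \<le> x \<bullet> ((transpose D ** Y ** D) *v x)"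
    unfolding quadratic_form_congruence by (rule Y)
  finally show "\<delta> / 2 * (x \<bullet> x) \<le> x \<bullet> ((R + transpose D ** Y ** D) *v x)"
    using R by (simp add: matrix_vector_bilinear inner_add_right coercive_def)
      (smt (verit, best) field_sum_of_halves mult.commute ring_class.ring_distribs(2))
qed

lemma norm_mult_bound:
  fixes A :: "real^'n^'m" and B :: "real^'p^'n"
  assumes "norm A \<le> a" "norm B \<le> b"
  shows "norm (A ** B) \<le> a * b"
  by (rule order_trans[OF norm_matrix_mult_le]) (use assms norm_ge_zero order_trans in \<open>intro mult_mono; blast\<close>)

text \<open>Telescoping as A (B - B') + (A - A') B' asks for bounds on the first left factor and the
  second right factor. This decides which arguments carry norm assumptions in the Lipschitz lemmas
  below.\<close>

lemma norm_mult_diff: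
  fixes A A' :: "real^'n^'m" and B B' :: "real^'p^'n"
  assumes "norm A \<le> a" "norm B' \<le> b" "norm (A - A') \<le> u" "norm (B - B') \<le> v"
  shows "norm (A ** B - A' ** B') \<le> a * v + b * u"
proof -
  have "A ** B - A' ** B' = A ** (B - B') + (A - A') ** B'"
    by (simp add: matrix_mult_bilinear)
  then show ?thesis
    using norm_triangle_mono[OF norm_mult_bound[OF assms(1,4)] norm_mult_bound[OF assms(3,2)]]
    by (simp add: mult.commute)
qed

lemma norm_matrix_inv_diff:
  fixes S S' :: "real^'m^'m"
  assumes "\<delta> > 0" "coercive \<delta> S" "coercive \<delta> S'"
  shows "norm (matrix_inv S - matrix_inv S') \<le> (CARD('m) / \<delta>)\<^sup>2 * norm (S - S')"
proof -
  note i = matrix_inv_inverse[OF coercive_invertible[OF assms(1,2)]]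
  note i' = matrix_inv_inverse[OF coercive_invertible[OF assms(1,3)]]
  \<comment> \<open>The resolvent identity.\<close>
  have "matrix_inv S ** (S' - S) ** matrix_inv S' = matrix_inv S - matrix_inv S'"
    by (simp add: matrix_mult_bilinear i i' flip: matrix_mul_assoc)
  then show ?thesis
    using norm_mult_bound[OF norm_mult_bound[OF coercive_inverse_norm[OF assms(1,2)] order_refl[of "norm (S' - S)"]]
        coercive_inverse_norm[OF assms(1,3)]]
    by (simp add: power2_eq_square norm_minus_commute mult_ac)
qed

section \<open>Feedback gains\<close>

lemma continuous_on_matrix_inv:
  fixes S :: "'a::topological_space \<Rightarrow> real^'m^'m"
  assumes "\<delta> > 0" "\<And>s. s \<in> I \<Longrightarrow> coercive \<delta> (S s)" "continuous_on I S"
  shows "continuous_on I (\<lambda>s. matrix_inv (S s))"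
  unfolding continuous_on_def
proof
  fix s assume s: "s \<in> I"
  have "((\<lambda>r. (CARD('m) / \<delta>)\<^sup>2 * norm (S r - S s)) \<longlongrightarrow> 0) (at s within I)"
    using assms(3) s by (auto simp: continuous_on_def intro!: tendsto_eq_intros)
  then have "((\<lambda>r. matrix_inv (S r) - matrix_inv (S s)) \<longlongrightarrow> 0) (at s within I)"
    using norm_matrix_inv_diff[OF assms(1) assms(2) assms(2)[OF s]]
    by (elim Lim_null_comparison[rotated]) (auto simp: eventually_at_filter)
  then show "((\<lambda>s. matrix_inv (S s)) \<longlongrightarrow> matrix_inv (S s)) (at s within I)"
    by (simp add: Lim_null[symmetric])
qed

lemma continuous_on_feedback_gain:
  fixes B :: "'a::topological_space \<Rightarrow> real^'m^'n"
  assumes "\<delta> > 0"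
    and "\<And>s. s \<in> I \<Longrightarrow> coercive \<delta> (R s + transpose (D s) ** Y s ** D s)"
    and "continuous_on I B" "continuous_on I C" "continuous_on I D" "continuous_on I R"
      "continuous_on I X" "continuous_on I Y"
  shows "continuous_on I (\<lambda>s. feedback_gain (B s) (C s) (D s) (R s) (X s) (Y s))"
  unfolding feedback_gain_def
  by (intro continuous_intros continuous_on_matrix_inv[OF assms(1)] assms)

lemma continuous_on_lyapunov_op:
  assumes "continuous_on I A" "continuous_on I B" "continuous_on I C" "continuous_on I D"
    "continuous_on I Q" "continuous_on I R" "continuous_on I \<Theta>" "continuous_on I X" "continuous_on I Y"
  shows "continuous_on I (\<lambda>s. lyapunov_op (A s) (B s) (C s) (D s) (Q s) (R s) (\<Theta> s) (X s) (Y s))"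
  unfolding lyapunov_op_def by (intro continuous_intros assms)

text \<open>For a fixed gain the operator is linear in weights and unknowns jointly. Hence the
  difference of two solutions with the same gain solves an equation of the same type, and comparison
  in the order reduces to positivity.\<close>

lemma lyapunov_op_diff:
  "lyapunov_op A B C D Q R \<Theta> X Y - lyapunov_op A B C D Q' R' \<Theta> X' Y'
    = lyapunov_op A B C D (Q - Q') (R - R') \<Theta> (X - X') (Y - Y')"
  by (simp add: lyapunov_op_def matrix_mult_bilinear)

lemma norm_lyapunov_op_le:
  assumes \<kappa>: "norm A \<le> \<kappa>" "norm B \<le> \<kappa>" "norm C \<le> \<kappa>" "norm D \<le> \<kappa>" "norm \<Theta> \<le> \<kappa>"
  shows "norm (lyapunov_op A B C D Q R \<Theta> X Y)
    \<le> 2 * (\<kappa> + \<kappa> * \<kappa>) * norm X + norm Q + (\<kappa> + \<kappa> * \<kappa>)\<^sup>2 * norm Y + \<kappa> * \<kappa> * norm R"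
proof -
  have M: "norm (A - B ** \<Theta>) \<le> \<kappa> + \<kappa> * \<kappa>" and N: "norm (C - D ** \<Theta>) \<le> \<kappa> + \<kappa> * \<kappa>"
    by (intro order_trans[OF norm_triangle_ineq4] add_mono norm_mult_bound \<kappa>)+
  have "norm (lyapunov_op A B C D Q R \<Theta> X Y) \<le> norm X * (\<kappa> + \<kappa> * \<kappa>) + (\<kappa> + \<kappa> * \<kappa>) * norm X + norm Q
      + (\<kappa> + \<kappa> * \<kappa>) * norm Y * (\<kappa> + \<kappa> * \<kappa>) + \<kappa> * norm R * \<kappa>"
    unfolding lyapunov_op_def
    by (intro norm_triangle_mono norm_mult_bound order_refl) (use M N \<kappa> in \<open>simp_all add: norm_transpose\<close>)
  then show ?thesis by (simp add: power2_eq_square algebra_simps)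
qed

lemma sym_mat_lyapunov_op:
  assumes "sym_mat Q" "sym_mat R" "sym_mat X" "sym_mat Y"
  shows "sym_mat (lyapunov_op A B C D Q R \<Theta> X Y)"
  using assms unfolding lyapunov_op_def sym_mat_def
  by (simp add: transpose_linear matrix_transpose_mul matrix_mul_assoc add_ac)

lemma psd_lyapunov_source:
  assumes "0 \<preceq> Q" "0 \<preceq> R" "0 \<preceq> Y"
  shows "0 \<preceq> Q + transpose N ** Y ** N + transpose \<Theta> ** R ** \<Theta>"
  by (intro psd_add psd_congruence assms)

text \<open>Completion of the square: a Riccati equation is the Lyapunov equation of its own optimal
  gain. Expanding in the gain leaves \<open>transpose \<Theta>\<close> times the defect of the
  normal equation that defines the gain, and this vanishes. Positivity and comparison are proved in
  the Lyapunov form.\<close>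

lemma riccati_eq_lyapunov:
  fixes B :: "real^'m^'n"
  assumes "invertible (R + transpose D ** Y ** D)"
  shows "riccati_op A B C D Q R X Y = lyapunov_op A B C D Q R (feedback_gain B C D R X Y) X Y"
proof -
  define S where "S = R + transpose D ** Y ** D"
  define \<Theta> where "\<Theta> = feedback_gain B C D R X Y"
  have "S ** \<Theta> = S ** matrix_inv S ** (transpose B ** X + transpose D ** Y ** C)"
    unfolding S_def \<Theta>_def feedback_gain_def by (simp only: matrix_mul_assoc)
  then have S\<Theta>: "S ** \<Theta> = transpose B ** X + transpose D ** Y ** C"
    using matrix_inv_inverse[OF assms] by (simp add: S_def)
  have "lyapunov_op A B C D Q R \<Theta> X Y
      = X ** A + transpose A ** X + transpose C ** Y ** C + Q
        - (X ** B + transpose C ** Y ** D) ** \<Theta>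
        + transpose \<Theta> ** (S ** \<Theta> - (transpose B ** X + transpose D ** Y ** C))"
    by (simp add: lyapunov_op_def S_def matrix_mult_bilinear transpose_linear matrix_transpose_mul
        matrix_mul_assoc)
  then show ?thesis
    unfolding S\<Theta> by (simp add: riccati_op_def \<Theta>_def feedback_gain_def matrix_mult_bilinear matrix_mul_assoc)
qed

text \<open>The quadratic term is subtracted and positive, so it may be dropped, and what remains
  grows linearly. This excludes blow-up backward in time.\<close>

lemma trace_riccati_le:
  fixes A :: "real^'n^'n" and B :: "real^'m^'n" and \<kappa> :: real
  assumes \<delta>: "\<delta> > 0" and S: "coercive \<delta> (R + transpose D ** Y ** D)"
    and X: "0 \<preceq> X" and Y: "0 \<preceq> Y"
    and \<kappa>: "norm A \<le> \<kappa>" "norm C \<le> \<kappa>" "norm Q \<le> \<kappa>"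
  shows "trace (riccati_op A B C D Q R X Y)
    \<le> CARD('n) * CARD('n) * (2 * \<kappa> + \<kappa>\<^sup>2) * (trace X + trace Y + 1)"
proof -
  define W where "W = transpose B ** X + transpose D ** Y ** C"
  define J where "J = matrix_inv (R + transpose D ** Y ** D)"
  have \<kappa>0: "0 \<le> \<kappa>" using \<kappa>(1) norm_ge_zero order_trans by blast
  have "0 \<le> x \<bullet> ((transpose W ** J ** W) *v x)" for x
  proof -
    \<comment> \<open>With \<open>y\<close> the solution of S y = W x, the form of
      \<open>transpose W ** J ** W\<close> at \<open>x\<close> is y . S y, which coercivity bounds
      below.\<close>
    define y where "y = J *v (W *v x)"
    have "(R + transpose D ** Y ** D) *v y = W *v x"
      using matrix_inv_inverse[OF coercive_invertible[OF \<delta> S]]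
      by (simp add: y_def J_def matrix_vector_mul_assoc matrix_mul_assoc)
    then have "\<delta> * (y \<bullet> y) \<le> y \<bullet> (W *v x)"
      using S by (metis coercive_def)
    then have "0 \<le> y \<bullet> (W *v x)"
      using \<delta> by (smt (verit) inner_ge_zero mult_nonneg_nonneg)
    then show ?thesis
      unfolding quadratic_form_congruence y_def by (simp add: inner_commute)
  qed
  then have *: "0 \<le> trace (transpose W ** J ** W)" by (rule trace_nonneg)
  have W: "transpose W = X ** B + transpose C ** Y ** D"
    using X Y by (simp add: W_def psd_iff sym_mat_def transpose_linear matrix_transpose_mul matrix_mul_assoc)
  define Z where "Z = X ** A + transpose A ** X + transpose C ** Y ** C + Q"
  have "riccati_op A B C D Q R X Y = Z - transpose W ** J ** W"
    by (simp add: riccati_op_def W) (simp add: W_def J_def Z_def)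
  then have "trace (riccati_op A B C D Q R X Y) \<le> trace Z"
    using * by (simp add: trace_sub)
  also have "\<dots> \<le> CARD('n) * norm Z"
    using trace_abs_le[of Z] by linarith
  also have "norm Z \<le> CARD('n) * ((2 * \<kappa> + \<kappa>\<^sup>2) * (trace X + trace Y + 1))"
  proof -
    have n: "1 \<le> real CARD('n)" by simp
    note t = trace_psd_nonneg[OF X] trace_psd_nonneg[OF Y]
    have "norm (X ** A) \<le> norm X * \<kappa>" "norm (transpose A ** X) \<le> \<kappa> * norm X"
      "norm (transpose C ** Y ** C) \<le> \<kappa> * norm Y * \<kappa>"
      using \<kappa> by (auto intro!: norm_mult_bound simp: norm_transpose)
    then have "norm Z \<le> norm X * \<kappa> + \<kappa> * norm X + \<kappa> * norm Y * \<kappa> + \<kappa>"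
      unfolding Z_def by (intro norm_triangle_mono \<kappa>)
    also have "\<dots> = 2 * \<kappa> * norm X + \<kappa>\<^sup>2 * norm Y + \<kappa>"
      by (simp add: power2_eq_square)
    also have "\<dots> \<le> 2 * \<kappa> * (CARD('n) * trace X) + \<kappa>\<^sup>2 * (CARD('n) * trace Y) + CARD('n) * \<kappa>"
      using mult_right_mono[of 1 "real CARD('n)" \<kappa>] n \<kappa>0
      by (intro add_mono mult_left_mono norm_psd_le_trace X Y) auto
    also have "\<dots> = CARD('n) * (2 * \<kappa> * trace X + \<kappa>\<^sup>2 * trace Y + \<kappa>)"
      by (simp add: algebra_simps)
    also have "\<dots> \<le> CARD('n) * ((2 * \<kappa> + \<kappa>\<^sup>2) * (trace X + trace Y + 1))"
    proof (intro mult_left_mono)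
      have "0 \<le> \<kappa>\<^sup>2 * trace X + 2 * \<kappa> * trace Y + \<kappa> + \<kappa>\<^sup>2"
        using t \<kappa>0 by simp
      then show "2 * \<kappa> * trace X + \<kappa>\<^sup>2 * trace Y + \<kappa> \<le> (2 * \<kappa> + \<kappa>\<^sup>2) * (trace X + trace Y + 1)"
        by (simp add: algebra_simps)
    qed simp
    finally show ?thesis .
  qed
  finally show ?thesis by (simp add: algebra_simps)
qed

lemma norm_feedback_gain_le:
  fixes B :: "real^'m^'n"
  assumes "\<delta> > 0" "coercive \<delta> (R + transpose D ** Y ** D)"
    and \<kappa>: "norm B \<le> \<kappa>" "norm C \<le> \<kappa>" "norm D \<le> \<kappa>" "norm X \<le> \<kappa>" "norm Y \<le> \<kappa>"
  shows "norm (feedback_gain B C D R X Y) \<le> CARD('m) / \<delta> * (\<kappa> * \<kappa> + \<kappa> * \<kappa> * \<kappa>)"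
  unfolding feedback_gain_def
  by (intro norm_mult_bound coercive_inverse_norm norm_triangle_mono) (simp_all add: assms norm_transpose)

text \<open>The constant is the product rule: the bound of the inverse times the Lipschitz constant
  of the right factor, plus the bound of the right factor times the Lipschitz constant of the
  inverse. It depends only on \<delta>, \<kappa> and the dimension, hence is the same for all
  partitions.\<close>

lemma feedback_gain_Lipschitz:
  assumes \<delta>: "\<delta> > 0" and \<kappa>0: "0 \<le> \<kappa>"
  obtains L where "0 \<le> L" and "\<And>(B::real^'m^'n) C D R R' X X' Y Y'.
    norm B \<le> \<kappa> \<Longrightarrow> norm C \<le> \<kappa> \<Longrightarrow> norm D \<le> \<kappa> \<Longrightarrow>
    norm X' \<le> \<kappa> \<Longrightarrow> norm Y' \<le> \<kappa> \<Longrightarrow>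
    coercive \<delta> (R + transpose D ** Y ** D) \<Longrightarrow> coercive \<delta> (R' + transpose D ** Y' ** D) \<Longrightarrow>
    norm (feedback_gain B C D R X Y - feedback_gain B C D R' X' Y')
      \<le> L * (norm (R - R') + norm (X - X') + norm (Y - Y'))"
proof (rule that[of "CARD('m) / \<delta> * (\<kappa> + \<kappa> * \<kappa>)
      + (\<kappa> * \<kappa> + \<kappa> * \<kappa> * \<kappa>) * ((CARD('m) / \<delta>)\<^sup>2 * (1 + \<kappa> * \<kappa>))"])
  show "0 \<le> CARD('m) / \<delta> * (\<kappa> + \<kappa> * \<kappa>)
      + (\<kappa> * \<kappa> + \<kappa> * \<kappa> * \<kappa>) * ((CARD('m) / \<delta>)\<^sup>2 * (1 + \<kappa> * \<kappa>))"
    using assms by (intro add_nonneg_nonneg mult_nonneg_nonneg divide_nonneg_nonneg) auto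
next
  fix B D :: "real^'m^'n" and C X X' Y Y' :: "real^'n^'n" and R R' :: "real^'m^'m"
  assume bd: "norm B \<le> \<kappa>" "norm C \<le> \<kappa>" "norm D \<le> \<kappa>" "norm X' \<le> \<kappa>" "norm Y' \<le> \<kappa>"
  define S where "S = R + transpose D ** Y ** D"
  define S' where "S' = R' + transpose D ** Y' ** D"
  define W where "W = transpose B ** X + transpose D ** Y ** C"
  define W' where "W' = transpose B ** X' + transpose D ** Y' ** C"
  assume co: "coercive \<delta> (R + transpose D ** Y ** D)" "coercive \<delta> (R' + transpose D ** Y' ** D)"
  note co = co[folded S_def S'_def]
  define e where "e = norm (R - R') + norm (X - X') + norm (Y - Y')"
  have e: "norm (R - R') \<le> e" "norm (X - X') \<le> e" "norm (Y - Y') \<le> e"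
    by (simp_all add: e_def)
  have "S - S' = (R - R') + transpose D ** (Y - Y') ** D"
    by (simp add: S_def S'_def matrix_mult_bilinear)
  also have "norm \<dots> \<le> e + \<kappa> * e * \<kappa>"
    by (intro norm_triangle_mono norm_mult_bound e) (simp_all add: norm_transpose bd)
  finally have "(CARD('m) / \<delta>)\<^sup>2 * norm (S - S') \<le> (CARD('m) / \<delta>)\<^sup>2 * (e + \<kappa> * e * \<kappa>)"
    by (intro mult_left_mono) auto
  with norm_matrix_inv_diff[OF \<delta> co]
  have J: "norm (matrix_inv S - matrix_inv S') \<le> (CARD('m) / \<delta>)\<^sup>2 * (e + \<kappa> * e * \<kappa>)"
    by linarith
  have "W - W' = transpose B ** (X - X') + transpose D ** (Y - Y') ** C"
    by (simp add: W_def W'_def matrix_mult_bilinear)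
  also have "norm \<dots> \<le> \<kappa> * e + \<kappa> * e * \<kappa>"
    by (intro norm_triangle_mono norm_mult_bound e) (simp_all add: norm_transpose bd)
  finally have W: "norm (W - W') \<le> \<kappa> * e + \<kappa> * e * \<kappa>" .
  have W': "norm W' \<le> \<kappa> * \<kappa> + \<kappa> * \<kappa> * \<kappa>"
    unfolding W'_def by (intro norm_triangle_mono norm_mult_bound) (simp_all add: norm_transpose bd)
  have "norm (matrix_inv S ** W - matrix_inv S' ** W')
      \<le> CARD('m) / \<delta> * (\<kappa> * e + \<kappa> * e * \<kappa>)
        + (\<kappa> * \<kappa> + \<kappa> * \<kappa> * \<kappa>) * ((CARD('m) / \<delta>)\<^sup>2 * (e + \<kappa> * e * \<kappa>))"
    by (rule norm_mult_diff[OF coercive_inverse_norm[OF \<delta> co(1)] W' J W])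
  also have "\<dots> = (CARD('m) / \<delta> * (\<kappa> + \<kappa> * \<kappa>)
      + (\<kappa> * \<kappa> + \<kappa> * \<kappa> * \<kappa>) * ((CARD('m) / \<delta>)\<^sup>2 * (1 + \<kappa> * \<kappa>))) * e"
    by (simp add: algebra_simps add_divide_distrib)
  finally show "norm (feedback_gain B C D R X Y - feedback_gain B C D R' X' Y')
      \<le> (CARD('m) / \<delta> * (\<kappa> + \<kappa> * \<kappa>)
      + (\<kappa> * \<kappa> + \<kappa> * \<kappa> * \<kappa>) * ((CARD('m) / \<delta>)\<^sup>2 * (1 + \<kappa> * \<kappa>)))
        * (norm (R - R') + norm (X - X') + norm (Y - Y'))"
    by (simp add: feedback_gain_def S_def S'_def W_def W'_def e_def)
qed

text \<open>In contrast to \<open>lyapunov_op_diff\<close> the gains may differ here. This is the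
  form needed to compare two schemes, or a scheme and the limit.\<close>

lemma lyapunov_op_Lipschitz:
  assumes \<kappa>0: "0 \<le> \<kappa>"
  obtains L where "0 \<le> L" and "\<And>(A::real^'n^'n) (B::real^'m^'n) C D Q Q' R R' \<Theta> \<Theta>' X X' Y Y'.
    norm A \<le> \<kappa> \<Longrightarrow> norm B \<le> \<kappa> \<Longrightarrow> norm C \<le> \<kappa> \<Longrightarrow> norm D \<le> \<kappa> \<Longrightarrow>
    norm R' \<le> \<kappa> \<Longrightarrow> norm \<Theta> \<le> \<kappa> \<Longrightarrow> norm \<Theta>' \<le> \<kappa> \<Longrightarrow>
    norm X \<le> \<kappa> \<Longrightarrow> norm X' \<le> \<kappa> \<Longrightarrow> norm Y' \<le> \<kappa> \<Longrightarrow>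
    norm (lyapunov_op A B C D Q R \<Theta> X Y - lyapunov_op A B C D Q' R' \<Theta>' X' Y')
      \<le> L * (norm (Q - Q') + norm (R - R') + norm (\<Theta> - \<Theta>') + norm (X - X') + norm (Y - Y'))"
proof -
  define \<mu> where "\<mu> = \<kappa> + \<kappa> * \<kappa>"
  show ?thesis
  proof (rule that[of "(\<kappa> * \<kappa> + \<mu>) + (\<mu> + \<kappa> * \<kappa>) + 1
      + (\<mu> * (\<mu> + \<kappa> * \<kappa>) + \<mu> * \<kappa> * \<kappa>) + (\<kappa> * \<kappa> + \<kappa> * \<kappa> + \<kappa> * \<kappa>)"])
    show "0 \<le> (\<kappa> * \<kappa> + \<mu>) + (\<mu> + \<kappa> * \<kappa>) + 1
      + (\<mu> * (\<mu> + \<kappa> * \<kappa>) + \<mu> * \<kappa> * \<kappa>) + (\<kappa> * \<kappa> + \<kappa> * \<kappa> + \<kappa> * \<kappa>)"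
      using \<kappa>0 by (simp add: \<mu>_def)
  next
    fix A C Q Q' X X' Y Y' :: "real^'n^'n" and B D :: "real^'m^'n" and R R' :: "real^'m^'m"
      and \<Theta> \<Theta>' :: "real^'n^'m"
    assume bd: "norm A \<le> \<kappa>" "norm B \<le> \<kappa>" "norm C \<le> \<kappa>" "norm D \<le> \<kappa>" "norm R' \<le> \<kappa>"
      "norm \<Theta> \<le> \<kappa>" "norm \<Theta>' \<le> \<kappa>" "norm X \<le> \<kappa>" "norm X' \<le> \<kappa>" "norm Y' \<le> \<kappa>"
    define e where "e = norm (Q - Q') + norm (R - R') + norm (\<Theta> - \<Theta>') + norm (X - X') + norm (Y - Y')"
    have e: "norm (Q - Q') \<le> e" "norm (R - R') \<le> e" "norm (\<Theta> - \<Theta>') \<le> e"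
      "norm (X - X') \<le> e" "norm (Y - Y') \<le> e"
      by (simp_all add: e_def)
    define M where "M = A - B ** \<Theta>"
    define M' where "M' = A - B ** \<Theta>'"
    define N where "N = C - D ** \<Theta>"
    define N' where "N' = C - D ** \<Theta>'"
    have MN: "norm M \<le> \<mu>" "norm M' \<le> \<mu>" "norm N \<le> \<mu>" "norm N' \<le> \<mu>"
      unfolding M_def M'_def N_def N'_def \<mu>_def
      by (intro order_trans[OF norm_triangle_ineq4] add_mono norm_mult_bound bd)+
    have "M - M' = B ** (\<Theta>' - \<Theta>)" "N - N' = D ** (\<Theta>' - \<Theta>)"
      by (simp_all add: M_def M'_def N_def N'_def matrix_mult_bilinear)
    then have dMN: "norm (M - M') \<le> \<kappa> * e" "norm (N - N') \<le> \<kappa> * e"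
      using e(3) by (simp_all only:) (intro norm_mult_bound bd, simp add: norm_minus_commute)+
    have t: "norm (transpose U - transpose V) = norm (U - V)" for U V :: "real^'k^'l"
      by (metis norm_transpose transpose_linear(2))
    have 1: "norm (X ** M - X' ** M') \<le> \<kappa> * (\<kappa> * e) + \<mu> * e"
      by (intro norm_mult_diff bd MN e dMN)
    have 2: "norm (transpose M ** X - transpose M' ** X') \<le> \<mu> * e + \<kappa> * (\<kappa> * e)"
      by (intro norm_mult_diff) (simp_all add: norm_transpose t bd MN e dMN)
    have Y: "norm (transpose N ** Y - transpose N' ** Y') \<le> \<mu> * e + \<kappa> * (\<kappa> * e)"
      by (intro norm_mult_diff) (simp_all add: norm_transpose t bd MN e dMN)
    have Y': "norm (transpose N' ** Y') \<le> \<mu> * \<kappa>"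
      by (intro norm_mult_bound) (simp_all add: norm_transpose bd MN)
    \<comment> \<open>Transposing puts the factor with \<open>Y\<close> on the right, where
      \<open>norm_mult_diff\<close> asks for a bound on the primed product only: a bound is
      available for \<open>Y'\<close> and not for \<open>Y\<close>. The same device serves for
      \<open>R\<close> below.\<close>
    have "norm (transpose N ** Y ** N - transpose N' ** Y' ** N')
        = norm (transpose (transpose N ** Y ** N - transpose N' ** Y' ** N'))"
      by (simp add: norm_transpose)
    also have "\<dots> = norm (transpose N ** transpose (transpose N ** Y) - transpose N' ** transpose (transpose N' ** Y'))"
      by (simp add: transpose_linear matrix_transpose_mul matrix_mul_assoc)
    also have "\<dots> \<le> \<mu> * (\<mu> * e + \<kappa> * (\<kappa> * e)) + \<mu> * \<kappa> * (\<kappa> * e)"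
      by (intro norm_mult_diff) (simp_all only: norm_transpose t MN Y Y' dMN)
    finally have 3: "norm (transpose N ** Y ** N - transpose N' ** Y' ** N')
        \<le> \<mu> * (\<mu> * e + \<kappa> * (\<kappa> * e)) + \<mu> * \<kappa> * (\<kappa> * e)" .
    have R: "norm (transpose \<Theta> ** R - transpose \<Theta>' ** R') \<le> \<kappa> * e + \<kappa> * e"
      by (intro norm_mult_diff) (simp_all add: norm_transpose t bd MN e dMN)
    have R': "norm (transpose \<Theta>' ** R') \<le> \<kappa> * \<kappa>"
      by (intro norm_mult_bound) (simp_all add: norm_transpose bd)
    have "norm (transpose \<Theta> ** R ** \<Theta> - transpose \<Theta>' ** R' ** \<Theta>')
        = norm (transpose (transpose \<Theta> ** R ** \<Theta> - transpose \<Theta>' ** R' ** \<Theta>'))"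
      by (simp add: norm_transpose)
    also have "\<dots> = norm (transpose \<Theta> ** transpose (transpose \<Theta> ** R) - transpose \<Theta>' ** transpose (transpose \<Theta>' ** R'))"
      by (simp add: transpose_linear matrix_transpose_mul matrix_mul_assoc)
    also have "\<dots> \<le> \<kappa> * (\<kappa> * e + \<kappa> * e) + \<kappa> * \<kappa> * e"
      by (intro norm_mult_diff) (simp_all only: norm_transpose t bd R R' e)
    finally have 4: "norm (transpose \<Theta> ** R ** \<Theta> - transpose \<Theta>' ** R' ** \<Theta>')
        \<le> \<kappa> * (\<kappa> * e + \<kappa> * e) + \<kappa> * \<kappa> * e" .
    have "lyapunov_op A B C D Q R \<Theta> X Y - lyapunov_op A B C D Q' R' \<Theta>' X' Y'
        = (X ** M - X' ** M') + (transpose M ** X - transpose M' ** X') + (Q - Q')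
          + (transpose N ** Y ** N - transpose N' ** Y' ** N')
          + (transpose \<Theta> ** R ** \<Theta> - transpose \<Theta>' ** R' ** \<Theta>')"
      by (simp add: lyapunov_op_def M_def M'_def N_def N'_def)
    also have "norm \<dots> \<le> (\<kappa> * (\<kappa> * e) + \<mu> * e) + (\<mu> * e + \<kappa> * (\<kappa> * e)) + e
        + (\<mu> * (\<mu> * e + \<kappa> * (\<kappa> * e)) + \<mu> * \<kappa> * (\<kappa> * e)) + (\<kappa> * (\<kappa> * e + \<kappa> * e) + \<kappa> * \<kappa> * e)"
      by (intro norm_triangle_mono 1 2 3 4 e)
    also have "\<dots> = ((\<kappa> * \<kappa> + \<mu>) + (\<mu> + \<kappa> * \<kappa>) + 1
      + (\<mu> * (\<mu> + \<kappa> * \<kappa>) + \<mu> * \<kappa> * \<kappa>) + (\<kappa> * \<kappa> + \<kappa> * \<kappa> + \<kappa> * \<kappa>)) * e"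
      by (simp add: algebra_simps)
    finally show "norm (lyapunov_op A B C D Q R \<Theta> X Y - lyapunov_op A B C D Q' R' \<Theta>' X' Y')
      \<le> ((\<kappa> * \<kappa> + \<mu>) + (\<mu> + \<kappa> * \<kappa>) + 1
      + (\<mu> * (\<mu> + \<kappa> * \<kappa>) + \<mu> * \<kappa> * \<kappa>) + (\<kappa> * \<kappa> + \<kappa> * \<kappa> + \<kappa> * \<kappa>))
        * (norm (Q - Q') + norm (R - R') + norm (\<Theta> - \<Theta>') + norm (X - X') + norm (Y - Y'))"
      by (simp add: e_def)
  qed
qed

section \<open>Backward differential equations\<close>

text \<open>A mean value inequality with finitely many exceptional points: the kernels are
  continuous, but their derivatives jump at partition points. Extending both derivatives by 0 lets
  the increments be compared as integrals.\<close>

lemma norm_increment_bound: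
  fixes f :: "real \<Rightarrow> 'a::banach" and \<phi> :: "real \<Rightarrow> real"
  assumes S: "finite S" and "a \<le> b" and f: "continuous_on {a..b} f" and \<phi>: "continuous_on {a..b} \<phi>"
    and f': "\<And>x. x \<in> {a<..<b} - S \<Longrightarrow> (f has_vector_derivative f' x) (at x)"
    and \<phi>': "\<And>x. x \<in> {a<..<b} - S \<Longrightarrow> (\<phi> has_real_derivative \<phi>' x) (at x)"
    and le: "\<And>x. x \<in> {a<..<b} - S \<Longrightarrow> norm (f' x) \<le> \<phi>' x"
  shows "norm (f b - f a) \<le> \<phi> b - \<phi> a"
proof -
  define T where "T = {a<..<b} - S"
  have 1: "((\<lambda>x. if x \<in> T then f' x else 0) has_integral (f b - f a)) {a..b}"
    using f' by (intro fundamental_theorem_of_calculus_interior_strong[OF S \<open>a \<le> b\<close> _ f]) (auto simp: T_def)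
  have 2: "((\<lambda>x. if x \<in> T then \<phi>' x else 0) has_integral (\<phi> b - \<phi> a)) {a..b}"
    using \<phi>' by (intro fundamental_theorem_of_calculus_interior_strong[OF S \<open>a \<le> b\<close> _ \<phi>])
      (auto simp: T_def has_real_derivative_iff_has_vector_derivative)
  have "norm (integral {a..b} (\<lambda>x. if x \<in> T then f' x else 0))
      \<le> integral {a..b} (\<lambda>x. if x \<in> T then \<phi>' x else 0)"
    using 1 2 le by (intro integral_norm_bound_integral) (auto simp: T_def has_integral_integrable_integral)
  then show ?thesis
    using 1 2 by (simp add: integral_unique)
qed

lemma has_vector_derivative_at_of_within:
  assumes "(x has_vector_derivative D) (at s within {a..b})" "s \<in> {a<..<b}"
  shows "(x has_vector_derivative D) (at s)"
  using assms at_within_Icc_at[of a s b] by auto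

lemma continuous_on_of_vector_derivative:
  assumes "\<And>s. s \<in> I \<Longrightarrow> (x has_vector_derivative x' s) (at s within I)"
  shows "continuous_on I x"
  using assms has_vector_derivative_continuous continuous_on_eq_continuous_within by blast

text \<open>The weight \<open>exp (\<nu> (b - s))\<close> makes the Picard map a contraction on the whole interval.\<close>

lemma backward_ode_exists:
  fixes f :: "real \<Rightarrow> 'a::banach \<Rightarrow> 'a"
  assumes "a \<le> b" and L: "0 \<le> L"
    and cont: "continuous_on ({a..b} \<times> UNIV) (\<lambda>(s, x). f s x)"
    and lip: "\<And>s x y. s \<in> {a..b} \<Longrightarrow> norm (f s x - f s y) \<le> L * norm (x - y)"
  shows "\<exists>x. x b = x0 \<and> (\<forall>s\<in>{a..b}. (x has_vector_derivative f s (x s)) (at s within {a..b}))"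
proof -
  define \<Phi> where "\<Phi> = (\<lambda>x s. x0 + (integral {a..s} (\<lambda>r. f r (x r)) - integral {a..b} (\<lambda>r. f r (x r))))"
  have cf: "continuous_on {a..b} (\<lambda>r. f r (x r))" if "continuous_on {a..b} x" for x
    using continuous_on_compose2[OF cont continuous_on_Pair[OF continuous_on_id that]] by auto
  have der: "(\<Phi> x has_vector_derivative f s (x s)) (at s within {a..b})"
    if "continuous_on {a..b} x" "s \<in> {a..b}" for x s
    unfolding \<Phi>_def
    by (auto intro!: derivative_eq_intros integral_has_vector_derivative[OF cf] that)
  have \<Phi>b: "\<Phi> x b = x0" for x by (simp add: \<Phi>_def)
  have c\<Phi>: "continuous_on {a..b} (\<Phi> x)" if "continuous_on {a..b} x" for x
    using der[OF that] by (rule continuous_on_of_vector_derivative)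
  define X where "X n = (\<Phi> ^^ n) (\<lambda>_. x0)" for n
  have XS: "X (Suc n) = \<Phi> (X n)" for n by (simp add: X_def)
  have cX: "continuous_on {a..b} (X n)" for n
    by (induction n) (auto simp: XS c\<Phi>, simp add: X_def)
  \<comment> \<open>Integrating L c exp (\<nu> (b - r)) over r gains the factor L / \<nu>, which
    this choice keeps below 1/2.\<close>
  define \<nu> where "\<nu> = 2 * L + 1"
  have \<nu>: "\<nu> > 0" "L / \<nu> \<le> 1 / 2" using L by (auto simp: \<nu>_def field_simps)
  have contr: "norm (\<Phi> x s - \<Phi> y s) \<le> c / 2 * exp (\<nu> * (b - s))"
    if x: "continuous_on {a..b} x" and y: "continuous_on {a..b} y" and s: "s \<in> {a..b}" and c: "0 \<le> c"
      and le: "\<And>s. s \<in> {a..b} \<Longrightarrow> norm (x s - y s) \<le> c * exp (\<nu> * (b - s))" for x y c s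
  proof -
    define \<phi> where "\<phi> s = - (L * c / \<nu> * exp (\<nu> * (b - s)))" for s
    have "norm ((\<Phi> x b - \<Phi> y b) - (\<Phi> x s - \<Phi> y s)) \<le> \<phi> b - \<phi> s"
    proof (rule norm_increment_bound[where S="{}" and f="\<lambda>r. \<Phi> x r - \<Phi> y r"])
      show "continuous_on {s..b} (\<lambda>r. \<Phi> x r - \<Phi> y r)"
        using s by (intro continuous_intros continuous_on_subset[OF c\<Phi>[OF x]] continuous_on_subset[OF c\<Phi>[OF y]]) auto
      show "continuous_on {s..b} \<phi>" unfolding \<phi>_def by (intro continuous_intros)
      fix r assume r: "r \<in> {s<..<b} - {}"
      show "((\<lambda>r. \<Phi> x r - \<Phi> y r) has_vector_derivative f r (x r) - f r (y r)) (at r)"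
        using r s by (intro has_vector_derivative_diff has_vector_derivative_at_of_within[OF der] x y) auto
      show "(\<phi> has_real_derivative L * c * exp (\<nu> * (b - r))) (at r)"
        unfolding \<phi>_def using \<nu>(1) by (auto intro!: derivative_eq_intros)
      have "norm (f r (x r) - f r (y r)) \<le> L * norm (x r - y r)"
        using r s by (intro lip) auto
      also have "\<dots> \<le> L * (c * exp (\<nu> * (b - r)))"
        using r s L by (intro mult_left_mono le) auto
      finally show "norm (f r (x r) - f r (y r)) \<le> L * c * exp (\<nu> * (b - r))" by simp
    qed (use s in auto)
    also have "\<dots> \<le> L / \<nu> * (c * exp (\<nu> * (b - s)))"
    proof -
      have "0 \<le> L * c / \<nu>" using L c \<nu>(1) by simp
      then show ?thesis by (simp add: \<phi>_def mult.assoc)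
    qed
    also have "\<dots> \<le> 1 / 2 * (c * exp (\<nu> * (b - s)))"
      using c by (intro mult_right_mono \<nu>) auto
    finally show ?thesis
      by (simp add: \<Phi>b norm_minus_commute)
  qed
  have "bounded ((\<lambda>s. X 1 s - X 0 s) ` {a..b})"
    by (intro compact_imp_bounded compact_continuous_image continuous_intros cX compact_Icc)
  then obtain M where M: "M > 0" "\<And>s. s \<in> {a..b} \<Longrightarrow> norm (X 1 s - X 0 s) \<le> M"
    by (auto simp: bounded_pos)
  have step: "norm (X (Suc n) s - X n s) \<le> M * (1 / 2) ^ n * exp (\<nu> * (b - s))" if "s \<in> {a..b}" for n s
    using that
  proof (induction n arbitrary: s)
    case 0
    have "M * 1 \<le> M * exp (\<nu> * (b - s))"
      using 0 M(1) \<nu>(1) by (intro mult_left_mono) auto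
    with M(2)[OF 0] show ?case by simp
  next
    case (Suc n)
    have "norm (\<Phi> (X (Suc n)) s - \<Phi> (X n) s) \<le> M * (1 / 2) ^ n / 2 * exp (\<nu> * (b - s))"
      using Suc M(1) by (intro contr cX) auto
    then show ?case by (simp only: XS) simp
  qed
  have "uniform_limit {a..b} (\<lambda>n s. \<Sum>i<n. X (Suc i) s - X i s) (\<lambda>s. \<Sum>i. X (Suc i) s - X i s) sequentially"
  proof (rule Weierstrass_m_test)
    show "norm (X (Suc n) s - X n s) \<le> M * exp (\<nu> * (b - a)) * (1 / 2) ^ n" if "s \<in> {a..b}" for n s
    proof -
      have "exp (\<nu> * (b - s)) \<le> exp (\<nu> * (b - a))"
        using that \<nu>(1) by auto
      then have "M * (1 / 2) ^ n * exp (\<nu> * (b - s)) \<le> M * (1 / 2) ^ n * exp (\<nu> * (b - a))"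
        using M(1) by (intro mult_left_mono) auto
      with step[OF that, of n] show ?thesis by (simp add: mult_ac)
    qed
    show "summable (\<lambda>n. M * exp (\<nu> * (b - a)) * (1 / 2) ^ n)"
      by (intro summable_mult summable_geometric) auto
  qed
  then have "uniform_limit {a..b} (\<lambda>n s. X 0 s + (\<Sum>i<n. X (Suc i) s - X i s))
      (\<lambda>s. X 0 s + (\<Sum>i. X (Suc i) s - X i s)) sequentially"
    by (intro uniform_limit_intros)
  moreover have "X 0 s + (\<Sum>i<n. X (Suc i) s - X i s) = X n s" for n s
    using sum_lessThan_telescope[of "\<lambda>i. X i s" n] by simp
  ultimately obtain x where x: "uniform_limit {a..b} X x sequentially"
    by auto
  have cx: "continuous_on {a..b} x"
    by (rule uniform_limit_theorem[OF _ x]) (auto simp: cX)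
  \<comment> \<open>The iterates converge uniformly, and \<open>contr\<close> bounds the distance
    between their images and \<open>\<Phi> x\<close>, so the limit is a fixed point.\<close>
  have "\<Phi> x s = x s" if s: "s \<in> {a..b}" for s
  proof (rule LIMSEQ_unique)
    show "(\<lambda>n. X (Suc n) s) \<longlonglongrightarrow> x s"
      using tendsto_uniform_limitI[OF x s] by (rule LIMSEQ_Suc)
    show "(\<lambda>n. X (Suc n) s) \<longlonglongrightarrow> \<Phi> x s"
    proof (rule LIMSEQ_I)
      fix r :: real assume "r > 0"
      define c where "c = r / exp (\<nu> * (b - s))"
      have c: "c > 0" using \<open>r > 0\<close> by (simp add: c_def)
      from uniform_limitD[OF x c] obtain n0
        where n0: "\<And>n s. n \<ge> n0 \<Longrightarrow> s \<in> {a..b} \<Longrightarrow> dist (X n s) (x s) < c"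
        unfolding eventually_sequentially by blast
      show "\<exists>no. \<forall>n\<ge>no. norm (X (Suc n) s - \<Phi> x s) < r"
      proof (intro exI allI impI)
        fix n assume n: "n \<ge> n0"
        have "norm (\<Phi> (X n) s - \<Phi> x s) \<le> c / 2 * exp (\<nu> * (b - s))"
        proof (rule contr[OF cX cx s])
          fix u assume u: "u \<in> {a..b}"
          have "c * 1 \<le> c * exp (\<nu> * (b - u))"
            using u c \<nu>(1) by (intro mult_left_mono) auto
          then show "norm (X n u - x u) \<le> c * exp (\<nu> * (b - u))"
            using n0[OF n u] by (simp add: dist_norm)
        qed (use c in auto)
        also have "\<dots> < r" using \<open>r > 0\<close> by (simp add: c_def)
        finally show "norm (X (Suc n) s - \<Phi> x s) < r" by (simp add: XS)
      qed
    qed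
  qed
  then have "(x has_vector_derivative f s (x s)) (at s within {a..b})" if "s \<in> {a..b}" for s
    using has_vector_derivative_transform[OF that _ der[OF cx that], of x] by auto
  moreover have "x b = x0"
    using \<open>\<And>s. s \<in> {a..b} \<Longrightarrow> \<Phi> x s = x s\<close>[of b] \<Phi>b[of x] \<open>a \<le> b\<close> by auto
  ultimately show ?thesis by blast
qed

section \<open>Gronwall, uniqueness and continuation backward in time\<close>

lemma gronwall_backward:
  fixes w :: "real \<Rightarrow> real"
  assumes "a \<le> b" and w: "continuous_on {a..b} w"
    and w': "\<And>s. s \<in> {a<..<b} \<Longrightarrow> (w has_real_derivative w' s) (at s)"
    and le: "\<And>s. s \<in> {a<..<b} \<Longrightarrow> - K * w s - c \<le> w' s"
    and "0 \<le> c" "0 \<le> K"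
  shows "w a \<le> (w b + c * (b - a)) * exp (K * (b - a))"
proof -
  \<comment> \<open>The integrating factor is 1 at \<open>b\<close> and at most 1 before, so the
    source costs at most \<open>c\<close> per unit of time; the resulting bound involves no division
    by \<open>K\<close>.\<close>
  define v where "v s = exp (K * (s - b)) * w s + c * s" for s
  have "v a \<le> v b"
  proof (rule DERIV_nonneg_imp_increasing_open[OF \<open>a \<le> b\<close>])
    show "continuous_on {a..b} v"
      unfolding v_def by (intro continuous_intros w)
    fix s assume "a < s" "s < b"
    then have s: "s \<in> {a<..<b}" by auto
    have d: "(v has_real_derivative exp (K * (s - b)) * (w' s + K * w s) + c) (at s)"
      unfolding v_def
      by (rule derivative_eq_intros w'[OF s] refl)+ (simp add: algebra_simps)
    have "exp (K * (s - b)) * - c \<le> exp (K * (s - b)) * (w' s + K * w s)"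
      using le[OF s] by (intro mult_left_mono) auto
    moreover have "exp (K * (s - b)) * c \<le> 1 * c"
      using s \<open>0 \<le> c\<close> \<open>0 \<le> K\<close> by (intro mult_right_mono) (auto simp: mult_le_0_iff)
    ultimately show "\<exists>y. (v has_real_derivative y) (at s) \<and> 0 \<le> y"
      using d by (intro exI[of _ "exp (K * (s - b)) * (w' s + K * w s) + c"]) auto
  qed
  then have "exp (K * (a - b)) * w a \<le> w b + c * (b - a)"
    by (simp add: v_def algebra_simps)
  then have le: "exp (K * (b - a)) * (exp (K * (a - b)) * w a) \<le> exp (K * (b - a)) * (w b + c * (b - a))"
    by (intro mult_left_mono) auto
  have "exp (K * (b - a)) * exp (K * (a - b)) = 1"
    by (simp add: algebra_simps flip: exp_add)
  then have "exp (K * (b - a)) * (exp (K * (a - b)) * w a) = w a"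
    by (simp only: mult.assoc[symmetric] mult_1_left)
  with le show ?thesis by (simp only: mult.commute)
qed

text \<open>Uniqueness for linear backward equations, applied to skew parts. Gronwall is used for
  the square of the norm, which is differentiable also where \<open>E\<close> vanishes.\<close>

lemma backward_ode_zero:
  fixes E :: "real \<Rightarrow> 'a::real_inner"
  assumes "a \<le> b" and E: "continuous_on {a..b} E"
    and E': "\<And>s. s \<in> {a<..<b} \<Longrightarrow> (E has_vector_derivative E' s) (at s)"
    and le: "\<And>s. s \<in> {a<..<b} \<Longrightarrow> norm (E' s) \<le> L * norm (E s)"
    and "E b = 0" "0 \<le> L"
  shows "E a = 0"
proof -
  have "E a \<bullet> E a \<le> (E b \<bullet> E b + 0 * (b - a)) * exp (2 * L * (b - a))"
  proof (rule gronwall_backward[OF \<open>a \<le> b\<close>])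
    show "continuous_on {a..b} (\<lambda>s. E s \<bullet> E s)"
      by (intro continuous_intros E)
    fix s assume s: "s \<in> {a<..<b}"
    show "((\<lambda>s. E s \<bullet> E s) has_real_derivative 2 * (E s \<bullet> E' s)) (at s)"
      using has_derivative_inner[OF E'[OF s, unfolded has_vector_derivative_def] E'[OF s, unfolded has_vector_derivative_def]]
      unfolding has_field_derivative_def
      by (rule has_derivative_eq_rhs) (auto simp: inner_commute algebra_simps)
    have "\<bar>E s \<bullet> E' s\<bar> \<le> norm (E s) * (L * norm (E s))"
      by (intro order_trans[OF Cauchy_Schwarz_ineq2] mult_left_mono le s) auto
    also have "\<dots> = L * (E s \<bullet> E s)"
      by (simp add: power2_norm_eq_inner[symmetric] power2_eq_square)
    finally show "- (2 * L) * (E s \<bullet> E s) - 0 \<le> 2 * (E s \<bullet> E' s)" by (simp add: abs_le_iff)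
  qed (use \<open>0 \<le> L\<close> in auto)
  then show ?thesis
    using \<open>E b = 0\<close> inner_gt_zero_iff[of "E a"] by (simp add: not_less[symmetric])
qed

text \<open>Continuous induction from the right end, for a \<phi> that measures the distance from a
  set of good states: a priori bounds hold only while the solution is near that set, and when they
  hold they put it inside. The gap between 0 and r makes the property propagate.\<close>

lemma backward_bootstrap:
  fixes \<phi> :: "real \<Rightarrow> real"
  assumes \<phi>: "continuous_on {a..b} \<phi>" and "\<phi> b \<le> 0" "r > 0" and s0: "s \<in> {a..b}"
    and step: "\<And>s. s \<in> {a..b} \<Longrightarrow> \<forall>u\<in>{s..b}. \<phi> u \<le> r \<Longrightarrow> \<phi> s \<le> 0"
  shows "\<phi> s \<le> 0"
proof -
  \<comment> \<open>The level lies strictly between 0 and r. At the latest time of \<open>B\<close>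
    the value is exactly r / 2 by the intermediate value theorem, and \<phi> is at most r from there
    on, so \<open>step\<close> gives a contradiction.\<close>
  define B where "B = {u \<in> {a..b}. r / 2 \<le> \<phi> u}"
  have "B = {}"
  proof (rule ccontr)
    assume "B \<noteq> {}"
    have "closed B"
      unfolding B_def
      by (rule continuous_on_closed_Collect_le[OF continuous_on_const \<phi> closed_atLeastAtMost])
    then have "compact ({a..b} \<inter> B)"
      by (rule compact_Int_closed[OF compact_Icc])
    moreover have "{a..b} \<inter> B = B" by (auto simp: B_def)
    ultimately have "compact B" by simp
    then obtain m where m: "m \<in> B" "\<And>u. u \<in> B \<Longrightarrow> u \<le> m"
      using compact_attains_sup[OF _ \<open>B \<noteq> {}\<close>] by blast
    have mab: "m \<in> {a..b}" "r / 2 \<le> \<phi> m" using m(1) by (auto simp: B_def)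
    have "\<exists>u\<ge>m. u \<le> b \<and> \<phi> u = r / 2"
      using mab \<open>\<phi> b \<le> 0\<close> \<open>r > 0\<close>
      by (intro IVT2') (auto intro: continuous_on_subset[OF \<phi>])
    then obtain u where u: "m \<le> u" "u \<le> b" "\<phi> u = r / 2" by blast
    then have "u \<in> B" using mab by (auto simp: B_def)
    with m(2) u have "u = m" by force
    have "\<phi> v \<le> r" if "v \<in> {m..b}" for v
    proof (cases "v = m")
      case False
      then have "v \<notin> B" using that m(2)[of v] by auto
      then show ?thesis using that mab \<open>r > 0\<close> by (auto simp: B_def)
    qed (use u \<open>u = m\<close> \<open>r > 0\<close> in auto)
    then have "\<phi> m \<le> 0" using step[OF mab(1)] by blast
    with mab \<open>r > 0\<close> show False by auto
  qed
  then have "\<forall>u\<in>{s..b}. \<phi> u \<le> r"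
    using s0 \<open>r > 0\<close> by (fastforce simp: B_def)
  then show ?thesis using step[OF s0] by blast
qed

section \<open>Positivity for Lyapunov equations\<close>

text \<open>Otherwise a small move from \<open>x\<close> in the direction of - Z x would make the
  form negative.\<close>

lemma psd_kernel:
  fixes Z :: "real^'n^'n"
  assumes "0 \<preceq> Z" "x \<bullet> (Z *v x) = 0"
  shows "Z *v x = 0"
proof (rule ccontr)
  assume ne: "Z *v x \<noteq> 0"
  define y where "y = Z *v x"
  define c where "c = y \<bullet> (Z *v y)"
  define p where "p = y \<bullet> y"
  have p: "p > 0" using ne by (simp add: p_def y_def)
  have c: "c \<ge> 0" using assms(1) by (simp add: c_def psd_iff)
  have sym: "x \<bullet> (Z *v y) = p"
    using inner_transpose_mult[of x Z y] sym_mat_transpose[of Z] assms(1)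
    by (simp only: psd_iff p_def y_def)
  have yx: "y \<bullet> (Z *v x) = p" by (simp add: p_def y_def)
  have e: "0 \<le> 2 * t * p + t * t * c" for t
  proof -
    have "(x + t *\<^sub>R y) \<bullet> (Z *v (x + t *\<^sub>R y)) = 2 * t * p + t * t * c"
      using assms(2) sym yx
      by (simp add: matrix_vector_bilinear inner_add_left inner_add_right c_def algebra_simps)
    moreover have "0 \<le> (x + t *\<^sub>R y) \<bullet> (Z *v (x + t *\<^sub>R y))"
      using assms(1) unfolding psd_iff by blast
    ultimately show ?thesis by simp
  qed
  \<comment> \<open>The summand 1 keeps the denominator positive when c = 0 and still gives t c
    \<ge> - p.\<close>
  define t where "t = - p / (c + 1)"
  have "t < 0" using p c by (simp add: t_def)
  moreover have "0 \<le> t * (2 * p + t * c)"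
    using e[of t] by (simp add: algebra_simps)
  ultimately have "2 * p + t * c \<le> 0"
    by (simp add: zero_le_mult_iff)
  moreover have "- p \<le> t * c"
    using p c by (simp add: t_def field_simps)
  ultimately show False using p by linarith
qed

text \<open>The algebra behind \<open>lyapunov_psd\<close>. Writing the solution as Z - g I
  separates the terms that vanish at a kernel vector of \<open>Z\<close> or have a sign from those
  that are multiples of g.\<close>

lemma quadratic_form_shift:
  fixes Z M N W :: "real^'n^'n"
  assumes nx: "x \<bullet> x = 1"
  shows "x \<bullet> ((- ((Z - g *\<^sub>R mat 1) ** M + transpose M ** (Z - g *\<^sub>R mat 1) + transpose N ** (Z - g *\<^sub>R mat 1) ** N + W)
      + (- \<nu> * g) *\<^sub>R mat 1) *v x) = - (x \<bullet> ((Z ** M) *v x)) - x \<bullet> ((transpose M ** Z) *v x)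
        - x \<bullet> ((transpose N ** Z ** N) *v x) - x \<bullet> (W *v x)
        + g * (x \<bullet> (M *v x) + x \<bullet> (transpose M *v x) + x \<bullet> ((transpose N ** N) *v x) - \<nu>)"
  by (simp add: matrix_vector_bilinear inner_simps nx algebra_simps flip: matrix_vector_mul_assoc del: transpose_matrix_vector)

text \<open>
  After the perturbation by \<open>\<epsilon> exp (\<nu> (b - s))\<close> times the identity, a vector \<open>x\<close> on which the
  quadratic form vanishes for the first time (coming from \<open>b\<close>) lies in the kernel of the matrix;
  there the equation forces the form to be strictly decreasing in time, which is absurd.
\<close>

lemma lyapunov_psd:
  fixes X :: "real \<Rightarrow> real^'n^'n"
  assumes X: "continuous_on {a<..b} X"
    and X': "\<And>s. s \<in> {a<..<b} \<Longrightarrow> (X has_vector_derivative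
        - (X s ** M s + transpose (M s) ** X s + transpose (N s) ** X s ** N s + W s)) (at s)"
    and \<kappa>: "\<And>s. s \<in> {a<..<b} \<Longrightarrow> norm (M s) \<le> \<kappa>" "\<And>s. s \<in> {a<..<b} \<Longrightarrow> norm (N s) \<le> \<kappa>"
    and W: "\<And>s. s \<in> {a<..<b} \<Longrightarrow> 0 \<preceq> W s"
    and Xb: "0 \<preceq> X b" and s: "s \<in> {a<..b}"
  shows "0 \<preceq> X s"
proof (cases "s = b")
  case False
  define \<kappa>' where "\<kappa>' = 2 * \<kappa> + \<kappa> * \<kappa>"
  have \<kappa>0: "0 \<le> \<kappa>" using order_trans[OF norm_ge_zero \<kappa>(1)[of s]] s False by auto
  \<comment> \<open>The skew part solves the homogeneous equation with terminal value 0, because the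
    source is symmetric, so uniqueness applies.\<close>
  have sym: "sym_mat (X r)" if r: "r \<in> {a<..b}" for r
  proof -
    define E where "E r = X r - transpose (X r)" for r
    define E' where "E' r = - (E r ** M r + transpose (M r) ** E r + transpose (N r) ** E r ** N r)" for r
    have "E r = 0"
    proof (rule backward_ode_zero[where b=b and L=\<kappa>' and E'=E'])
      show "continuous_on {r..b} E"
        unfolding E_def using r by (intro continuous_intros continuous_on_subset[OF X]) auto
      show "E b = 0" using Xb by (simp add: E_def psd_iff sym_mat_def)
      show "0 \<le> \<kappa>'" using \<kappa>0 by (simp add: \<kappa>'_def)
      fix u assume u: "u \<in> {r<..<b}"
      then have u': "u \<in> {a<..<b}" using r by auto
      have Wu: "transpose (W u) = W u" using W[OF u'] by (simp add: psd_iff sym_mat_def)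
      show "(E has_vector_derivative E' u) (at u)"
        unfolding E_def
        by (rule has_vector_derivative_eq_rhs[OF has_vector_derivative_diff[OF X'[OF u']
            bounded_linear.has_vector_derivative[OF bounded_linear_transpose X'[OF u']]]])
          (simp add: E'_def E_def transpose_linear matrix_transpose_mul matrix_mult_bilinear matrix_mul_assoc Wu)
      have "norm (E' u) \<le> norm (E u) * \<kappa> + \<kappa> * norm (E u) + \<kappa> * norm (E u) * \<kappa>"
        unfolding E'_def norm_minus_cancel
        by (intro norm_triangle_mono norm_mult_bound) (use \<kappa>[OF u'] in \<open>simp_all add: norm_transpose\<close>)
      then show "norm (E' u) \<le> \<kappa>' * norm (E u)" by (simp add: \<kappa>'_def algebra_simps)
    qed (use r in auto)
    then show ?thesis by (simp add: E_def sym_mat_def)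
  qed
  \<comment> \<open>One more than the largest rate 2 \<kappa> + \<kappa>^2 at which the equation can
    move the identity; the surplus makes the final inequality strict.\<close>
  define \<nu> where "\<nu> = \<kappa>' + 1"
  have pos: "0 \<le> x0 \<bullet> (X s *v x0) + \<epsilon> * exp (\<nu> * (b - s))" if "norm x0 = 1" "\<epsilon> > 0" for x0 \<epsilon>
  proof (rule ccontr)
    assume neg: "\<not> ?thesis"
    define g where "g r = \<epsilon> * exp (\<nu> * (b - r))" for r
    have g: "g r > 0" for r using \<open>\<epsilon> > 0\<close> by (simp add: g_def)
    define Z where "Z r = X r + g r *\<^sub>R mat 1" for r
    have Zq: "x \<bullet> (Z r *v x) = x \<bullet> (X r *v x) + g r * (x \<bullet> x)" for x r
      by (simp add: Z_def matrix_vector_bilinear inner_add_right)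
    have contZ: "continuous_on {a<..b} Z"
      unfolding Z_def g_def by (intro continuous_intros X)
    have cs: "continuous_on ({s..b} \<times> sphere 0 1) (\<lambda>p. Z (fst p))"
      using s by (intro continuous_on_compose2[OF contZ] continuous_intros) auto
    \<comment> \<open>Time and direction are taken together, so that compactness supplies both the
      contact time and a unit vector in contact.\<close>
    define F where "F = {p \<in> {s..b} \<times> sphere (0::real^'n) 1. snd p \<bullet> (Z (fst p) *v snd p) \<le> 0}"
    have "closed F"
      unfolding F_def
      by (intro continuous_on_closed_Collect_le continuous_on_inner continuous_on_snd continuous_on_id
          bounded_bilinear.continuous_on[OF bounded_bilinear_matrix_vector_mult] cs continuous_on_const
          closed_Times closed_sphere closed_atLeastAtMost)
    then have "compact (({s..b} \<times> sphere (0::real^'n) 1) \<inter> F)"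
      by (intro compact_Int_closed compact_Times compact_Icc compact_sphere)
    moreover have "({s..b} \<times> sphere (0::real^'n) 1) \<inter> F = F"
      by (auto simp: F_def)
    ultimately have "compact F" by simp
    moreover have "(s, x0) \<in> F"
      using neg s that by (auto simp: F_def Zq g_def dot_square_norm)
    ultimately obtain m where m: "m \<in> F" "\<And>p. p \<in> F \<Longrightarrow> fst p \<le> fst m"
      using continuous_attains_sup[OF _ _ continuous_on_fst[OF continuous_on_id], of F] by blast
    obtain r x where rx: "m = (r, x)" by (cases m)
    have r: "r \<in> {s..b}" and nx: "x \<bullet> x = 1" and qx: "x \<bullet> (Z r *v x) \<le> 0"
      using m(1) by (auto simp: F_def rx dot_square_norm)
    have right: "0 < y \<bullet> (Z u *v y)" if "u \<in> {r<..b}" "norm y = 1" for u y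
      using m(2)[of "(u, y)"] that r by (force simp: F_def rx)
    have "r \<noteq> b"
    proof
      assume "r = b"
      then have "0 \<le> x \<bullet> (X r *v x)" using Xb by (simp add: psd_iff)
      then show False using qx g[of r] nx by (simp add: Zq)
    qed
    then have r': "r \<in> {a<..<b}" using r s by auto
    have contq: "continuous_on {a<..b} (\<lambda>u. y \<bullet> (Z u *v y))" for y
      by (intro continuous_on_inner bounded_bilinear.continuous_on[OF bounded_bilinear_matrix_vector_mult]
          contZ continuous_on_const)
    \<comment> \<open>At the contact time itself nonnegativity in all directions is a limit from the
      right.\<close>
    have ge1: "0 \<le> y \<bullet> (Z r *v y)" if "norm y = 1" for y
    proof (rule tendsto_lowerbound)
      have "continuous_on {a<..<b} (\<lambda>u. y \<bullet> (Z u *v y))"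
        by (rule continuous_on_subset[OF contq]) auto
      then have "continuous (at r) (\<lambda>u. y \<bullet> (Z u *v y))"
        using r' by (simp add: continuous_on_eq_continuous_at)
      then show "((\<lambda>u. y \<bullet> (Z u *v y)) \<longlongrightarrow> y \<bullet> (Z r *v y)) (at_right r)"
        by (metis continuous_within filterlim_at_split)
      show "\<forall>\<^sub>F u in at_right r. 0 \<le> y \<bullet> (Z u *v y)"
        unfolding eventually_at_right_field
        using r' right[OF _ that] by (intro exI[of _ b]) (auto intro: less_imp_le)
    qed simp
    have "0 \<preceq> Z r"
      unfolding psd_iff
    proof (intro conjI allI)
      show "sym_mat (Z r)" using sym[of r] r' by (simp add: Z_def sym_mat_lin)
      fix y
      show "0 \<le> y \<bullet> (Z r *v y)"
      proof (cases "y = 0")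
        case False
        have "0 \<le> (y /\<^sub>R norm y) \<bullet> (Z r *v (y /\<^sub>R norm y))"
          using False by (intro ge1) simp
        also have "\<dots> = (y \<bullet> (Z r *v y)) / (norm y)\<^sup>2"
          by (simp add: matrix_vector_bilinear power2_eq_square divide_inverse mult_ac)
        finally show ?thesis using False by (simp add: zero_le_divide_iff)
      qed simp
    qed
    have q0: "x \<bullet> (Z r *v x) = 0"
      using qx ge1[of x] nx by (simp add: norm_eq_1)
    have Zx: "Z r *v x = 0"
      using psd_kernel[OF \<open>0 \<preceq> Z r\<close> q0] .
    define D where "D = - (X r ** M r + transpose (M r) ** X r + transpose (N r) ** X r ** N r + W r)
      + (- \<nu> * g r) *\<^sub>R mat 1"
    have "(Z has_vector_derivative D) (at r)"
      unfolding Z_def D_def g_def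
      by (intro has_vector_derivative_add X'[OF r'])
        (auto intro!: derivative_eq_intros simp: has_real_derivative_iff_has_vector_derivative[symmetric])
    from bounded_linear.has_vector_derivative[OF bounded_linear_quadratic_form this, of x]
    have der: "((\<lambda>u. x \<bullet> (Z u *v x)) has_real_derivative x \<bullet> (D *v x)) (at r)"
      by (simp add: has_real_derivative_iff_has_vector_derivative)
    have sZ: "y \<bullet> (Z r *v x) = 0" "x \<bullet> (Z r *v y) = 0" for y
      using Zx \<open>0 \<preceq> Z r\<close> inner_transpose_mult[of x "Z r" y] by (auto simp: psd_iff sym_mat_def)
    have XZ: "X r = Z r - g r *\<^sub>R mat 1" by (simp add: Z_def)
    have "x \<bullet> (D *v x) = - (x \<bullet> ((Z r ** M r) *v x)) - x \<bullet> ((transpose (M r) ** Z r) *v x)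
        - x \<bullet> ((transpose (N r) ** Z r ** N r) *v x) - x \<bullet> (W r *v x)
        + g r * (x \<bullet> (M r *v x) + x \<bullet> (transpose (M r) *v x) + x \<bullet> ((transpose (N r) ** N r) *v x) - \<nu>)"
      unfolding D_def XZ by (rule quadratic_form_shift[OF nx])
    also have "x \<bullet> ((Z r ** M r) *v x) = 0"
      using sZ(2) by (simp flip: matrix_vector_mul_assoc)
    also have "x \<bullet> ((transpose (M r) ** Z r) *v x) = 0"
      using Zx by (simp flip: matrix_vector_mul_assoc del: transpose_matrix_vector)
    also have "x \<bullet> (M r *v x) + x \<bullet> (transpose (M r) *v x) + x \<bullet> ((transpose (N r) ** N r) *v x) - \<nu> \<le> -1"
    proof -
      have "norm (transpose (N r) ** N r) \<le> \<kappa> * \<kappa>"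
        using \<kappa>(2)[OF r'] by (intro norm_mult_bound) (auto simp: norm_transpose)
      moreover have "norm (transpose (M r)) \<le> \<kappa>" "norm (M r) \<le> \<kappa>"
        using \<kappa>(1)[OF r'] by (auto simp: norm_transpose)
      ultimately show ?thesis
        using quadratic_form_upper[of x "M r"] quadratic_form_upper[of x "transpose (M r)"]
          quadratic_form_upper[of x "transpose (N r) ** N r"]
        unfolding nx mult_1_right \<nu>_def \<kappa>'_def by linarith
    qed
    finally have "x \<bullet> (D *v x) \<le> - (x \<bullet> ((transpose (N r) ** Z r ** N r) *v x)) - x \<bullet> (W r *v x) + g r * -1"
      using g[of r] by (simp add: mult_left_mono)
    moreover have "0 \<le> x \<bullet> ((transpose (N r) ** Z r ** N r) *v x)" "0 \<le> x \<bullet> (W r *v x)"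
      using psd_congruence[OF \<open>0 \<preceq> Z r\<close>] W[OF r'] unfolding psd_iff by blast+
    ultimately have "x \<bullet> (D *v x) < 0" using g[of r] by linarith
    from DERIV_neg_dec_right[OF der this] obtain d where d: "d > 0"
      "\<And>h. h > 0 \<Longrightarrow> h < d \<Longrightarrow> x \<bullet> (Z (r + h) *v x) < x \<bullet> (Z r *v x)" by blast
    define h where "h = min (d / 2) (b - r)"
    have "h > 0" "h < d" "r + h \<in> {r<..b}" using d(1) r' by (auto simp: h_def)
    then show False
      using d(2)[of h] right[of "r + h" x] q0 nx by (simp add: norm_eq_1)
  qed
  show ?thesis
    unfolding psd_iff
  proof (intro conjI allI)
    show "sym_mat (X s)" by (rule sym[OF s])
    fix x
    show "0 \<le> x \<bullet> (X s *v x)"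
    proof (cases "x = 0")
      case False
      define y where "y = x /\<^sub>R norm x"
      \<comment> \<open>The perturbation is scaled so that its size at time \<open>s\<close> is
        exactly e.\<close>
      have "0 \<le> y \<bullet> (X s *v y) + e" if "e > 0" for e
        using pos[of y "e / exp (\<nu> * (b - s))"] that False by (simp add: y_def)
      then have "0 \<le> y \<bullet> (X s *v y)"
        by (rule field_le_epsilon)
      also have "\<dots> = (x \<bullet> (X s *v x)) / (norm x)\<^sup>2"
        by (simp add: y_def matrix_vector_bilinear power2_eq_square divide_inverse mult_ac)
      finally show ?thesis using False by (simp add: zero_le_divide_iff)
    qed simp
  qed
qed (use Xb in simp)

section \<open>Bounds on the data\<close>

lemma lyapunov_op_psd_self:
  fixes X :: "real \<Rightarrow> real^'n^'n" and B :: "real \<Rightarrow> real^'m^'n"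
  assumes X: "continuous_on {a<..b} X"
    and X': "\<And>s. s \<in> {a<..<b} \<Longrightarrow> (X has_vector_derivative
        - lyapunov_op (A s) (B s) (C s) (D s) (Q s) (R s) (\<Theta> s) (X s) (X s)) (at s)"
    and \<kappa>: "\<And>s. s \<in> {a<..<b} \<Longrightarrow> norm (A s) \<le> \<kappa> \<and> norm (B s) \<le> \<kappa> \<and> norm (C s) \<le> \<kappa> \<and>
        norm (D s) \<le> \<kappa> \<and> norm (\<Theta> s) \<le> \<kappa>"
    and QR: "\<And>s. s \<in> {a<..<b} \<Longrightarrow> 0 \<preceq> Q s \<and> 0 \<preceq> R s"
    and Xb: "0 \<preceq> X b" and s: "s \<in> {a<..b}"
  shows "0 \<preceq> X s"
proof (rule lyapunov_psd[OF X _ _ _ _ Xb s])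
  fix s assume s: "s \<in> {a<..<b}"
  show "(X has_vector_derivative - (X s ** (A s - B s ** \<Theta> s) + transpose (A s - B s ** \<Theta> s) ** X s
      + transpose (C s - D s ** \<Theta> s) ** X s ** (C s - D s ** \<Theta> s)
      + (Q s + transpose (\<Theta> s) ** R s ** \<Theta> s))) (at s)"
    using X'[OF s] by (simp add: lyapunov_op_def algebra_simps)
  show "norm (A s - B s ** \<Theta> s) \<le> \<kappa> + \<kappa> * \<kappa>" "norm (C s - D s ** \<Theta> s) \<le> \<kappa> + \<kappa> * \<kappa>"
    using \<kappa>[OF s] by (auto intro!: order_trans[OF norm_triangle_ineq4] add_mono norm_mult_bound)
  show "0 \<preceq> Q s + transpose (\<Theta> s) ** R s ** \<Theta> s"
    using QR[OF s] by (auto intro!: psd_add psd_congruence)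
qed

text \<open>Once \<open>Y\<close> is known to be positive, its term is part of the source, and
  \<open>lyapunov_psd\<close> applies with N = 0.\<close>

lemma lyapunov_op_psd_given:
  fixes X :: "real \<Rightarrow> real^'n^'n" and B :: "real \<Rightarrow> real^'m^'n"
  assumes X: "continuous_on {a<..b} X"
    and X': "\<And>s. s \<in> {a<..<b} \<Longrightarrow> (X has_vector_derivative
        - lyapunov_op (A s) (B s) (C s) (D s) (Q s) (R s) (\<Theta> s) (X s) (Y s)) (at s)"
    and \<kappa>: "\<And>s. s \<in> {a<..<b} \<Longrightarrow> norm (A s) \<le> \<kappa> \<and> norm (B s) \<le> \<kappa> \<and> norm (\<Theta> s) \<le> \<kappa>"
    and QR: "\<And>s. s \<in> {a<..<b} \<Longrightarrow> 0 \<preceq> Q s \<and> 0 \<preceq> R s \<and> 0 \<preceq> Y s"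
    and Xb: "0 \<preceq> X b" and s: "s \<in> {a<..b}"
  shows "0 \<preceq> X s"
proof (rule lyapunov_psd[OF X _ _ _ _ Xb s])
  fix s assume s: "s \<in> {a<..<b}"
  show "(X has_vector_derivative - (X s ** (A s - B s ** \<Theta> s) + transpose (A s - B s ** \<Theta> s) ** X s
      + transpose 0 ** X s ** 0
      + (Q s + transpose (C s - D s ** \<Theta> s) ** Y s ** (C s - D s ** \<Theta> s) + transpose (\<Theta> s) ** R s ** \<Theta> s))) (at s)"
    using X'[OF s] by (simp add: lyapunov_op_def matrix_mult_bilinear(8) algebra_simps)
  show "norm (A s - B s ** \<Theta> s) \<le> \<kappa> + \<kappa> * \<kappa>"
    using \<kappa>[OF s] by (auto intro!: order_trans[OF norm_triangle_ineq4] add_mono norm_mult_bound)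
  show "norm (0::real^'n^'n) \<le> \<kappa> + \<kappa> * \<kappa>"
    using \<kappa>[OF s] order_trans[OF norm_ge_zero] by (smt (verit) mult_nonneg_nonneg norm_zero)
  show "0 \<preceq> Q s + transpose (C s - D s ** \<Theta> s) ** Y s ** (C s - D s ** \<Theta> s) + transpose (\<Theta> s) ** R s ** \<Theta> s"
    using QR[OF s] by (intro psd_lyapunov_source) auto
qed

text \<open>Positivity is proved on left-open cells, because \<open>Gam_tilde\<close> may jump at
  the left end. For the continuous unknowns the endpoint is added here.\<close>

lemma psd_left_endpoint:
  fixes X :: "real \<Rightarrow> real^'n^'n"
  assumes "continuous_on {a..b} X" "a < b" "\<And>s. s \<in> {a<..b} \<Longrightarrow> 0 \<preceq> X s"
  shows "0 \<preceq> X a"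
proof -
  have "(X \<longlongrightarrow> X a) (at a within {a..b})"
    using assms(1,2) by (auto simp: continuous_on_def)
  then have "(X \<longlongrightarrow> X a) (at_right a)"
    using assms(2) by (simp add: at_within_Icc_at_right)
  moreover have "\<forall>\<^sub>F s in at_right a. X s \<in> {M. 0 \<preceq> M}"
    unfolding eventually_at_right_field using assms(2,3) by (intro exI[of _ b]) auto
  ultimately have "X a \<in> {M. 0 \<preceq> M}"
    using Lim_in_closed_set[OF closed_psd] by (metis trivial_limit_at_right_real)
  then show ?thesis by simp
qed

section \<open>Constants for the data\<close>

text \<open>Stated for all large \<kappa>, so that finitely many bounds combine into a single
  constant.\<close>

lemma eventually_norm_bound:
  assumes "compact S" "continuous_on S f"
  shows "\<forall>\<^sub>F \<kappa>::real in at_top. \<forall>x\<in>S. norm (f x) \<le> \<kappa>"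
proof -
  have "bounded (f ` S)"
    using assms by (intro compact_imp_bounded compact_continuous_image)
  then obtain B where "\<And>x. x \<in> S \<Longrightarrow> norm (f x) \<le> B" by (auto simp: bounded_iff)
  then show ?thesis
    unfolding eventually_at_top_linorder by (intro exI[of _ B]) force
qed

text \<open>With \<kappa> and \<delta> as parameters, every constant defined inside depends on the
  data alone and is thereby uniform over all partitions.\<close>

locale lq_problem =
  fixes d :: "('n::finite, 'm::finite) lq_data" and T \<kappa> \<delta> :: real
  assumes T_pos: "0 < T" and H1: "H1 T d" and H2: "H2 T d" and H3: "H3 T d"
    and \<delta>_pos: "0 < \<delta>" and \<kappa>_ge1: "1 \<le> \<kappa>"
    and coef_bound: "s \<in> {0..T} \<Longrightarrow> norm (cA d s) \<le> \<kappa> \<and> norm (cB d s) \<le> \<kappa> \<and> norm (cC d s) \<le> \<kappa> \<and>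
      norm (cD d s) \<le> \<kappa> \<and> norm (hA d s) \<le> \<kappa> \<and> norm (hB d s) \<le> \<kappa> \<and> norm (hC d s) \<le> \<kappa> \<and> norm (hD d s) \<le> \<kappa>"
    and weight_bound: "s \<in> {0..T} \<Longrightarrow> t \<in> {0..T} \<Longrightarrow> norm (cQ d s t) \<le> \<kappa> \<and> norm (hQ d s t) \<le> \<kappa> \<and>
      norm (cR d s t) \<le> \<kappa> \<and> norm (hR d s t) \<le> \<kappa>"
    and terminal_bound: "t \<in> {0..T} \<Longrightarrow> norm (cG d t) \<le> \<kappa> \<and> norm (hG d t) \<le> \<kappa>"
    and weight_psd: "0 \<le> t \<Longrightarrow> t \<le> s \<Longrightarrow> s \<le> T \<Longrightarrow>
      0 \<preceq> cQ d s t \<and> 0 \<preceq> hQ d s t \<and> \<delta> *\<^sub>R mat 1 \<preceq> cR d s t \<and> \<delta> *\<^sub>R mat 1 \<preceq> hR d s t"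
    and terminal_psd: "0 \<le> t \<Longrightarrow> t \<le> T \<Longrightarrow> 0 \<preceq> cG d t \<and> 0 \<preceq> hG d t"

lemma H1_continuous:
  assumes "H1 T d"
  shows "continuous_on {0..T} (cA d)" "continuous_on {0..T} (cB d)" "continuous_on {0..T} (cC d)"
    "continuous_on {0..T} (cD d)" "continuous_on {0..T} (hA d)" "continuous_on {0..T} (hB d)"
    "continuous_on {0..T} (hC d)" "continuous_on {0..T} (hD d)"
  using assms unfolding H1_def hA_def[abs_def] hB_def[abs_def] hC_def[abs_def] hD_def[abs_def]
  by (auto intro!: continuous_intros)

lemma H2_continuous:
  assumes "H2 T d"
  shows "continuous_on ({0..T} \<times> {0..T}) (\<lambda>(s, t). cQ d s t)" "continuous_on ({0..T} \<times> {0..T}) (\<lambda>(s, t). hQ d s t)"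
    "continuous_on ({0..T} \<times> {0..T}) (\<lambda>(s, t). cR d s t)" "continuous_on ({0..T} \<times> {0..T}) (\<lambda>(s, t). hR d s t)"
    "continuous_on {0..T} (cG d)" "continuous_on {0..T} (hG d)"
  using assms unfolding H2_def hQ_def[abs_def] hR_def[abs_def] hG_def[abs_def]
  by (auto intro!: continuous_intros simp: case_prod_unfold)

lemma lq_problem_exists:
  assumes T: "0 < T" and H1: "H1 T d" and H2: "H2 T d" and H3: "H3 T d"
  shows "\<exists>\<kappa> \<delta>. lq_problem d T \<kappa> \<delta>"
proof -
  obtain \<delta> where \<delta>: "\<delta> > 0"
    "\<And>s t. 0 \<le> t \<Longrightarrow> t \<le> s \<Longrightarrow> s \<le> T \<Longrightarrow>
      0 \<preceq> cQ d s t \<and> 0 \<preceq> hQ d s t \<and> \<delta> *\<^sub>R mat 1 \<preceq> cR d s t \<and> \<delta> *\<^sub>R mat 1 \<preceq> hR d s t"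
    "\<And>t. 0 \<le> t \<Longrightarrow> t \<le> T \<Longrightarrow> 0 \<preceq> cG d t \<and> 0 \<preceq> hG d t"
    using H2 unfolding H2_def by metis
  note c = H1_continuous[OF H1, THEN eventually_norm_bound[OF compact_Icc]]
    H2_continuous(1-4)[OF H2, THEN eventually_norm_bound[OF compact_Times[OF compact_Icc compact_Icc]]]
    H2_continuous(5-6)[OF H2, THEN eventually_norm_bound[OF compact_Icc]]
  have "\<forall>\<^sub>F \<kappa> in at_top. 1 \<le> \<kappa> \<and> lq_problem d T \<kappa> \<delta>"
    using c eventually_ge_at_top[of 1]
  proof eventually_elim
    case (elim \<kappa>)
    then show ?case
      by (intro conjI lq_problem.intro T H1 H2 H3 \<delta>) (auto simp: \<delta>)
  qed
  then show ?thesis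
    using eventually_happens[of _ "at_top :: real filter"] by force
qed

context lq_problem
begin

lemmas coef_continuous = H1_continuous[OF H1]
lemmas weight_continuous = H2_continuous(1-4)[OF H2]
lemmas terminal_continuous = H2_continuous(5-6)[OF H2]

lemma weight_continuous_on:
  assumes "I \<subseteq> {0..T}" "\<tau> \<in> {0..T}"
  shows "continuous_on I (\<lambda>s. cQ d s \<tau>)" "continuous_on I (\<lambda>s. hQ d s \<tau>)"
    "continuous_on I (\<lambda>s. cR d s \<tau>)" "continuous_on I (\<lambda>s. hR d s \<tau>)"
proof -
  have c: "continuous_on I (\<lambda>s. (s, \<tau>))" by (intro continuous_intros)
  have "(\<lambda>s. (s, \<tau>)) ` I \<subseteq> {0..T} \<times> {0..T}" using assms by auto
  from weight_continuous[THEN continuous_on_compose2, OF c this]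
  show "continuous_on I (\<lambda>s. cQ d s \<tau>)" "continuous_on I (\<lambda>s. hQ d s \<tau>)"
    "continuous_on I (\<lambda>s. cR d s \<tau>)" "continuous_on I (\<lambda>s. hR d s \<tau>)"
    by simp_all
qed

lemma weight_coercive:
  assumes "0 \<le> t" "t \<le> s" "s \<le> T"
  shows "coercive \<delta> (cR d s t)" "coercive \<delta> (hR d s t)"
  using weight_psd[OF assms]
  by (auto simp: coercive_def matrix_vector_bilinear dest: loewner_quadratic_form)

lemma weight_psd':
  assumes "0 \<le> t" "t \<le> s" "s \<le> T"
  shows "0 \<preceq> cQ d s t" "0 \<preceq> hQ d s t" "0 \<preceq> cR d s t" "0 \<preceq> hR d s t"
  using weight_psd[OF assms] loewner_trans[OF psd_scaleR[OF psd_mat_1 less_imp_le[OF \<delta>_pos]]] by auto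

text \<open>The largest defect of positivity that \<open>coercive_gram\<close> tolerates for
  diffusion coefficients bounded by \<kappa>.\<close>

definition lower_radius :: real where "lower_radius = \<delta> / (2 * \<kappa>\<^sup>2)"

lemma lower_radius: "0 < lower_radius" "0 \<le> lower_radius" "lower_radius * \<kappa>\<^sup>2 \<le> \<delta> / 2"
  using \<delta>_pos \<kappa>_ge1 by (simp_all add: lower_radius_def)

lemma gram_coercive:
  assumes "0 \<le> t" "t \<le> s" "s \<le> T" "\<And>x. - lower_radius * (x \<bullet> x) \<le> x \<bullet> (Y *v x)"
  shows "coercive (\<delta> / 2) (cR d s t + transpose (cD d s) ** Y ** cD d s)"
    "coercive (\<delta> / 2) (hR d s t + transpose (hD d s) ** Y ** hD d s)"
  using assms coef_bound[of s]
  by (auto intro!: coercive_gram[OF _ assms(4) lower_radius(2) _ lower_radius(3)] weight_coercive)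

lemma gram_coercive_psd:
  assumes "0 \<le> t" "t \<le> s" "s \<le> T" "0 \<preceq> Y"
  shows "coercive (\<delta> / 2) (cR d s t + transpose (cD d s) ** Y ** cD d s)"
    "coercive (\<delta> / 2) (hR d s t + transpose (hD d s) ** Y ** hD d s)"
proof -
  have "- lower_radius * (x \<bullet> x) \<le> x \<bullet> (Y *v x)" for x
    using assms(4) lower_radius(2) unfolding psd_iff
    by (smt (verit) inner_ge_zero mult_minus_left mult_nonneg_nonneg)
  from gram_coercive[OF assms(1-3) this]
  show "coercive (\<delta> / 2) (cR d s t + transpose (cD d s) ** Y ** cD d s)"
    "coercive (\<delta> / 2) (hR d s t + transpose (hD d s) ** Y ** hD d s)" .
qed

end

section \<open>Riccati equations on one cell\<close>

context lq_problem
begin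

text \<open>Only the differential equations are recorded, so that the notion passes to subintervals;
  the matrices under the inverse are controlled separately, through lower bounds on
  \<open>P\<close>.\<close>

definition riccati_pair :: "real \<Rightarrow> real \<Rightarrow> real \<Rightarrow> (real \<Rightarrow> real^'n^'n) \<Rightarrow> (real \<Rightarrow> real^'n^'n) \<Rightarrow> bool" where
  "riccati_pair \<tau> a b P Ph \<longleftrightarrow> (\<forall>s\<in>{a..b}.
     (P has_vector_derivative - riccati_op (cA d s) (cB d s) (cC d s) (cD d s) (cQ d s \<tau>) (cR d s \<tau>)
        (P s) (P s)) (at s within {a..b}) \<and>
     (Ph has_vector_derivative - riccati_op (hA d s) (hB d s) (hC d s) (hD d s) (hQ d s \<tau>) (hR d s \<tau>)
        (Ph s) (P s)) (at s within {a..b}))"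

lemma riccati_pair_continuous:
  assumes "riccati_pair \<tau> a b P Ph"
  shows "continuous_on {a..b} P" "continuous_on {a..b} Ph"
  using assms unfolding riccati_pair_def
  by (auto intro!: continuous_on_of_vector_derivative)

lemma riccati_pair_subinterval:
  assumes "riccati_pair \<tau> a b P Ph" "a \<le> a'" "b' \<le> b"
  shows "riccati_pair \<tau> a' b' P Ph"
  unfolding riccati_pair_def
proof
  fix s assume "s \<in> {a'..b'}"
  moreover have sub: "{a'..b'} \<subseteq> {a..b}" using assms by auto
  ultimately have "s \<in> {a..b}" by blast
  from assms(1)[unfolded riccati_pair_def, THEN bspec, OF this]
  show "(P has_vector_derivative - riccati_op (cA d s) (cB d s) (cC d s) (cD d s) (cQ d s \<tau>) (cR d s \<tau>)
        (P s) (P s)) (at s within {a'..b'}) \<and>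
     (Ph has_vector_derivative - riccati_op (hA d s) (hB d s) (hC d s) (hD d s) (hQ d s \<tau>) (hR d s \<tau>)
        (Ph s) (P s)) (at s within {a'..b'})"
    using has_vector_derivative_within_subset[OF _ sub] by blast
qed

text \<open>The bound of \<open>norm_feedback_gain_le\<close> for coercivity \<delta> / 2, with
  coefficients and unknowns bounded by \<open>max \<kappa> c\<close>.\<close>

definition gain_bound :: "real \<Rightarrow> real" where
  "gain_bound c = CARD('m) / (\<delta> / 2) * (max \<kappa> c * max \<kappa> c + max \<kappa> c * max \<kappa> c * max \<kappa> c)"

lemma gain_norm_le:
  assumes "0 \<le> \<tau>" "\<tau> \<le> s" "s \<le> T" and Y: "\<And>x. - lower_radius * (x \<bullet> x) \<le> x \<bullet> (Y *v x)"
    and "norm X \<le> c" "norm Y \<le> c"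
  shows "norm (feedback_gain (cB d s) (cC d s) (cD d s) (cR d s \<tau>) X Y) \<le> gain_bound c"
    "norm (feedback_gain (hB d s) (hC d s) (hD d s) (hR d s \<tau>) X Y) \<le> gain_bound c"
proof -
  have "s \<in> {0..T}" using assms by simp
  from coef_bound[OF this] have
    "norm (cB d s) \<le> max \<kappa> c" "norm (cC d s) \<le> max \<kappa> c" "norm (cD d s) \<le> max \<kappa> c"
    "norm (hB d s) \<le> max \<kappa> c" "norm (hC d s) \<le> max \<kappa> c" "norm (hD d s) \<le> max \<kappa> c"
    "norm X \<le> max \<kappa> c" "norm Y \<le> max \<kappa> c" "0 < \<delta> / 2"
    using assms(5,6) \<delta>_pos by auto
  note bd = this
  show "norm (feedback_gain (cB d s) (cC d s) (cD d s) (cR d s \<tau>) X Y) \<le> gain_bound c"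
    "norm (feedback_gain (hB d s) (hC d s) (hD d s) (hR d s \<tau>) X Y) \<le> gain_bound c"
    unfolding gain_bound_def
    by (intro norm_feedback_gain_le gram_coercive[OF assms(1-3) Y] bd)+
qed

lemma riccati_op_eq:
  assumes "0 \<le> \<tau>" "\<tau> \<le> s" "s \<le> T" and Y: "\<And>x. - lower_radius * (x \<bullet> x) \<le> x \<bullet> (Y *v x)"
  shows "riccati_op (cA d s) (cB d s) (cC d s) (cD d s) (cQ d s \<tau>) (cR d s \<tau>) X Y
      = lyapunov_op (cA d s) (cB d s) (cC d s) (cD d s) (cQ d s \<tau>) (cR d s \<tau>)
          (feedback_gain (cB d s) (cC d s) (cD d s) (cR d s \<tau>) X Y) X Y"
    "riccati_op (hA d s) (hB d s) (hC d s) (hD d s) (hQ d s \<tau>) (hR d s \<tau>) X Y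
      = lyapunov_op (hA d s) (hB d s) (hC d s) (hD d s) (hQ d s \<tau>) (hR d s \<tau>)
          (feedback_gain (hB d s) (hC d s) (hD d s) (hR d s \<tau>) X Y) X Y"
  using \<delta>_pos
  by (auto intro!: riccati_eq_lyapunov coercive_invertible[of "\<delta> / 2"] gram_coercive[OF assms(1-3) Y])

text \<open>Self-improvement: while \<open>P\<close> is only slightly negative the gains exist and
  are bounded, so both unknowns solve Lyapunov equations with positive sources and are in fact
  positive. \<open>P\<close> comes first, since it is the source for \<open>Ph\<close>.\<close>

lemma riccati_pair_psd:
  assumes ric: "riccati_pair \<tau> a b P Ph" and ab: "0 \<le> \<tau>" "\<tau> \<le> a" "a \<le> b" "b \<le> T"
    and low: "\<And>s x. s \<in> {a..b} \<Longrightarrow> - lower_radius * (x \<bullet> x) \<le> x \<bullet> (P s *v x)"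
    and fin: "0 \<preceq> P b" "0 \<preceq> Ph b" and s: "s \<in> {a..b}"
  shows "0 \<preceq> P s" "0 \<preceq> Ph s"
proof -
  note cont = riccati_pair_continuous[OF ric]
  have "\<forall>\<^sub>F c::real in at_top. (\<forall>s\<in>{a..b}. norm (P s) \<le> c) \<and> (\<forall>s\<in>{a..b}. norm (Ph s) \<le> c)"
    using cont by (intro eventually_conj eventually_norm_bound compact_Icc)
  then obtain c where c: "\<And>s. s \<in> {a..b} \<Longrightarrow> norm (P s) \<le> c" "\<And>s. s \<in> {a..b} \<Longrightarrow> norm (Ph s) \<le> c"
    using eventually_happens[of _ "at_top :: real filter"] by force
  define \<Theta> where "\<Theta> s = feedback_gain (cB d s) (cC d s) (cD d s) (cR d s \<tau>) (P s) (P s)" for s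
  define \<Theta>h where "\<Theta>h s = feedback_gain (hB d s) (hC d s) (hD d s) (hR d s \<tau>) (Ph s) (P s)" for s
  define c' where "c' = max \<kappa> (gain_bound c)"
  have bound: "norm (\<Theta> s) \<le> c'" "norm (\<Theta>h s) \<le> c'" if "s \<in> {a<..<b}" for s
    unfolding \<Theta>_def \<Theta>h_def c'_def using that ab c low[of s]
    by (auto intro!: max.coboundedI2 gain_norm_le)
  have coef: "norm (cA d s) \<le> c' \<and> norm (cB d s) \<le> c' \<and> norm (cC d s) \<le> c' \<and> norm (cD d s) \<le> c'"
    "norm (hA d s) \<le> c' \<and> norm (hB d s) \<le> c' \<and> norm (hC d s) \<le> c' \<and> norm (hD d s) \<le> c'"
    if "s \<in> {a<..<b}" for s
    unfolding c'_def using coef_bound[of s] that ab by (auto intro!: max.coboundedI1)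
  have P: "0 \<preceq> P s" if s: "s \<in> {a<..b}" for s
  proof (rule lyapunov_op_psd_self[where a=a and b=b and \<Theta>=\<Theta> and \<kappa>=c'])
    show "continuous_on {a<..b} P"
      by (rule continuous_on_subset[OF cont(1)]) auto
    fix s assume s: "s \<in> {a<..<b}"
    show "(P has_vector_derivative - lyapunov_op (cA d s) (cB d s) (cC d s) (cD d s) (cQ d s \<tau>) (cR d s \<tau>)
        (\<Theta> s) (P s) (P s)) (at s)"
      unfolding \<Theta>_def using s ab low[of s] ric[unfolded riccati_pair_def, THEN bspec[of _ _ s]]
      by (subst riccati_op_eq(1)[symmetric]) (auto intro: has_vector_derivative_at_of_within)
    show "norm (cA d s) \<le> c' \<and> norm (cB d s) \<le> c' \<and> norm (cC d s) \<le> c' \<and> norm (cD d s) \<le> c' \<and> norm (\<Theta> s) \<le> c'"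
      using coef[OF s] bound[OF s] by simp
    show "0 \<preceq> cQ d s \<tau> \<and> 0 \<preceq> cR d s \<tau>"
      using s ab by (auto intro!: weight_psd')
  qed (use s fin in auto)
  have Pall: "0 \<preceq> P s" if "s \<in> {a..b}" for s
    using P[of s] that psd_left_endpoint[OF cont(1) _ P] fin by (cases "s = a"; cases "a = b") auto
  have Ph: "0 \<preceq> Ph s" if s: "s \<in> {a<..b}" for s
  proof (rule lyapunov_op_psd_given[where a=a and b=b and \<Theta>=\<Theta>h and \<kappa>=c' and Y=P])
    show "continuous_on {a<..b} Ph"
      by (rule continuous_on_subset[OF cont(2)]) auto
    fix s assume s: "s \<in> {a<..<b}"
    show "(Ph has_vector_derivative - lyapunov_op (hA d s) (hB d s) (hC d s) (hD d s) (hQ d s \<tau>) (hR d s \<tau>)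
        (\<Theta>h s) (Ph s) (P s)) (at s)"
      unfolding \<Theta>h_def using s ab low[of s] ric[unfolded riccati_pair_def, THEN bspec[of _ _ s]]
      by (subst riccati_op_eq(2)[symmetric]) (auto intro: has_vector_derivative_at_of_within)
    show "norm (hA d s) \<le> c' \<and> norm (hB d s) \<le> c' \<and> norm (\<Theta>h s) \<le> c'"
      using coef[OF s] bound[OF s] by simp
    show "0 \<preceq> hQ d s \<tau> \<and> 0 \<preceq> hR d s \<tau> \<and> 0 \<preceq> P s"
      using s ab by (auto intro!: weight_psd' P)
  qed (use s fin in auto)
  show "0 \<preceq> P s" by (rule Pall[OF s])
  show "0 \<preceq> Ph s"
    using Ph[of s] s psd_left_endpoint[OF cont(2) _ Ph] fin by (cases "s = a"; cases "a = b") auto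
qed

definition trace_rate :: real where
  "trace_rate = CARD('n) * CARD('n) * (2 * \<kappa> + \<kappa>\<^sup>2)"

lemma trace_rate_nonneg: "0 \<le> trace_rate"
  using \<kappa>_ge1 by (simp add: trace_rate_def)

text \<open>In the first bound the rate is doubled because the trace of \<open>P\<close> enters
  through both unknowns of the Riccati operator. In the second the bound p on that trace is part of
  the source.\<close>

lemma riccati_pair_trace_le:
  assumes ric: "riccati_pair \<tau> a b P Ph" and ab: "0 \<le> \<tau>" "\<tau> \<le> a" "a \<le> b" "b \<le> T"
    and psd: "\<And>s. s \<in> {a..b} \<Longrightarrow> 0 \<preceq> P s" "\<And>s. s \<in> {a..b} \<Longrightarrow> 0 \<preceq> Ph s"
  shows "trace (P a) \<le> (trace (P b) + trace_rate * (b - a)) * exp (2 * trace_rate * (b - a))"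
    "(\<And>s. s \<in> {a..b} \<Longrightarrow> trace (P s) \<le> p) \<Longrightarrow>
      trace (Ph a) \<le> (trace (Ph b) + trace_rate * (p + 1) * (b - a)) * exp (trace_rate * (b - a))"
proof -
  note cont = riccati_pair_continuous[OF ric]
  have tr: "continuous_on {a..b} (\<lambda>s. trace (X s))" if "continuous_on {a..b} X" for X :: "real \<Rightarrow> real^'n^'n"
    using that by (rule bounded_linear.continuous_on[OF bounded_linear_trace])
  have step: "trace (riccati_op (cA d s) (cB d s) (cC d s) (cD d s) (cQ d s \<tau>) (cR d s \<tau>) (P s) (P s))
      \<le> trace_rate * (trace (P s) + trace (P s) + 1)"
    "trace (riccati_op (hA d s) (hB d s) (hC d s) (hD d s) (hQ d s \<tau>) (hR d s \<tau>) (Ph s) (P s))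
      \<le> trace_rate * (trace (Ph s) + trace (P s) + 1)"
    if s: "s \<in> {a<..<b}" for s
  proof -
    from s ab have i: "s \<in> {0..T}" "\<tau> \<in> {0..T}" "0 \<le> \<tau>" "\<tau> \<le> s" "s \<le> T" "s \<in> {a..b}"
      by auto
    have bd: "norm (cA d s) \<le> \<kappa>" "norm (cC d s) \<le> \<kappa>" "norm (cQ d s \<tau>) \<le> \<kappa>"
      "norm (hA d s) \<le> \<kappa>" "norm (hC d s) \<le> \<kappa>" "norm (hQ d s \<tau>) \<le> \<kappa>" "0 < \<delta> / 2"
      using coef_bound[OF i(1)] weight_bound[OF i(1,2)] \<delta>_pos by auto
    show "trace (riccati_op (cA d s) (cB d s) (cC d s) (cD d s) (cQ d s \<tau>) (cR d s \<tau>) (P s) (P s))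
      \<le> trace_rate * (trace (P s) + trace (P s) + 1)"
      unfolding trace_rate_def
      by (intro trace_riccati_le[of "\<delta> / 2"] gram_coercive_psd psd bd i)
    show "trace (riccati_op (hA d s) (hB d s) (hC d s) (hD d s) (hQ d s \<tau>) (hR d s \<tau>) (Ph s) (P s))
      \<le> trace_rate * (trace (Ph s) + trace (P s) + 1)"
      unfolding trace_rate_def
      by (intro trace_riccati_le[of "\<delta> / 2"] gram_coercive_psd psd bd i)
  qed
  have der: "((\<lambda>s. trace (P s)) has_real_derivative
      - trace (riccati_op (cA d s) (cB d s) (cC d s) (cD d s) (cQ d s \<tau>) (cR d s \<tau>) (P s) (P s))) (at s)"
    "((\<lambda>s. trace (Ph s)) has_real_derivative
      - trace (riccati_op (hA d s) (hB d s) (hC d s) (hD d s) (hQ d s \<tau>) (hR d s \<tau>) (Ph s) (P s))) (at s)"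
    if s: "s \<in> {a<..<b}" for s
  proof -
    from s have "s \<in> {a..b}" by simp
    note r = ric[unfolded riccati_pair_def, THEN bspec, OF this]
    note r1 = has_vector_derivative_at_of_within[OF conjunct1[OF r] s]
      and r2 = has_vector_derivative_at_of_within[OF conjunct2[OF r] s]
    show "((\<lambda>s. trace (P s)) has_real_derivative
      - trace (riccati_op (cA d s) (cB d s) (cC d s) (cD d s) (cQ d s \<tau>) (cR d s \<tau>) (P s) (P s))) (at s)"
      "((\<lambda>s. trace (Ph s)) has_real_derivative
      - trace (riccati_op (hA d s) (hB d s) (hC d s) (hD d s) (hQ d s \<tau>) (hR d s \<tau>) (Ph s) (P s))) (at s)"
      using bounded_linear.has_vector_derivative[OF bounded_linear_trace r1]
        bounded_linear.has_vector_derivative[OF bounded_linear_trace r2]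
      by (simp_all add: has_real_derivative_iff_has_vector_derivative trace_minus)
  qed
  show "trace (P a) \<le> (trace (P b) + trace_rate * (b - a)) * exp (2 * trace_rate * (b - a))"
  proof (intro gronwall_backward[OF ab(3) tr[OF cont(1)] der(1)])
    fix s assume s: "s \<in> {a<..<b}"
    show "- (2 * trace_rate) * trace (P s) - trace_rate
      \<le> - trace (riccati_op (cA d s) (cB d s) (cC d s) (cD d s) (cQ d s \<tau>) (cR d s \<tau>) (P s) (P s))"
      using step(1)[OF s] by (simp add: algebra_simps)
  qed (use trace_rate_nonneg in auto)
  assume p: "\<And>s. s \<in> {a..b} \<Longrightarrow> trace (P s) \<le> p"
  have p0: "0 \<le> p" using trace_psd_nonneg[OF psd(1)[of a]] p[of a] ab by auto
  show "trace (Ph a) \<le> (trace (Ph b) + trace_rate * (p + 1) * (b - a)) * exp (trace_rate * (b - a))"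
  proof (intro gronwall_backward[OF ab(3) tr[OF cont(2)] der(2)])
    fix s assume s: "s \<in> {a<..<b}"
    have "trace_rate * (trace (Ph s) + trace (P s) + 1) \<le> trace_rate * (trace (Ph s) + p + 1)"
      using trace_rate_nonneg p[of s] s by (intro mult_left_mono) auto
    with step(2)[OF s] show "- trace_rate * trace (Ph s) - trace_rate * (p + 1)
      \<le> - trace (riccati_op (hA d s) (hB d s) (hC d s) (hD d s) (hQ d s \<tau>) (hR d s \<tau>) (Ph s) (P s))"
      by (simp add: algebra_simps)
  qed (use trace_rate_nonneg p0 in auto)
qed

text \<open>
  The vector field is Lipschitz on the convex set \<open>K'\<close>, a neighbourhood of the set \<open>K\<close> of pairs
  of positive semidefinite matrices of bounded norm.  The equation with the field composed with
  the projection onto \<open>K'\<close> has a global solution, and the a priori bounds keep it inside \<open>K\<close>.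
\<close>

lemma riccati_pair_exists:
  assumes ab: "0 \<le> \<tau>" "\<tau> \<le> a" "a \<le> b" "b \<le> T" and X0: "0 \<preceq> X0" and Z0: "0 \<preceq> Z0"
  shows "\<exists>P Ph. riccati_pair \<tau> a b P Ph \<and> P b = X0 \<and> Ph b = Z0 \<and> (\<forall>s\<in>{a..b}. 0 \<preceq> P s \<and> 0 \<preceq> Ph s)"
proof -
  define n where "n = real CARD('n)"
  \<comment> \<open>\<open>c1\<close> and \<open>c2\<close> are the trace bounds of
    \<open>riccati_pair_trace_le\<close> taken over the whole interval; \<open>c\<close> converts
    them into bounds on norms.\<close>
  define c1 where "c1 = (trace X0 + trace_rate * (b - a)) * exp (2 * trace_rate * (b - a))"
  define c2 where "c2 = (trace Z0 + trace_rate * (c1 + 1) * (b - a)) * exp (trace_rate * (b - a))"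
  define c where "c = max (n * c1) (n * c2)"
  define K where "K = {p :: (real^'n^'n) \<times> (real^'n^'n). 0 \<preceq> fst p \<and> 0 \<preceq> snd p \<and> norm (fst p) \<le> c \<and> norm (snd p) \<le> c}"
  \<comment> \<open>Convex constraints make the projection nonexpansive. They contain every
    symmetric pair within \<open>lower_radius\<close> of \<open>K\<close>, and the gains are still
    defined under them.\<close>
  define K' where "K' = {p :: (real^'n^'n) \<times> (real^'n^'n). (transpose (fst p) = fst p \<and> transpose (snd p) = snd p) \<and>
    (\<forall>x. - lower_radius * (x \<bullet> x) \<le> x \<bullet> (fst p *v x)) \<and> norm (fst p) \<le> c + lower_radius \<and> norm (snd p) \<le> c + lower_radius}"
  note rad = lower_radius
  have c1: "0 \<le> c1" unfolding c1_def
    using trace_psd_nonneg[OF X0] trace_rate_nonneg ab by auto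
  have c: "0 \<le> c" "n * c1 \<le> c" "n * c2 \<le> c" using c1 by (auto simp: c_def n_def le_max_iff_disj)
  have closedK: "closed K"
  proof -
    have "K = {p. fst p \<in> {M. 0 \<preceq> M}} \<inter> {p. snd p \<in> {M. 0 \<preceq> M}} \<inter> {p. norm (fst p) \<le> c} \<inter> {p. norm (snd p) \<le> c}"
      by (auto simp: K_def)
    moreover have "closed {p :: (real^'n^'n) \<times> (real^'n^'n). fst p \<in> {M. 0 \<preceq> M}}"
      "closed {p :: (real^'n^'n) \<times> (real^'n^'n). snd p \<in> {M. 0 \<preceq> M}}"
      using continuous_closed_vimage[OF closed_psd, of fst] continuous_closed_vimage[OF closed_psd, of snd]
      by (auto simp: vimage_def)
    ultimately show ?thesis
      by (auto intro!: closed_Int closed_Collect_le continuous_intros)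
  qed
  have K0: "(0, 0) \<in> K" using c by (auto simp: K_def loewner_refl)
  have KK': "p \<in> K'" if "infdist p K \<le> lower_radius" "transpose (fst p) = fst p" "transpose (snd p) = snd p" for p
  proof -
    obtain k where k: "k \<in> K" "infdist p K = dist p k"
      using infdist_attains_inf[OF closedK] K0 by blast
    have dd: "norm (fst p - fst k) \<le> lower_radius" "norm (snd p - snd k) \<le> lower_radius"
      using k(2) that(1) norm_fst_le[of "fst p - fst k" "snd p - snd k"] norm_snd_le[of "snd p - snd k" "fst p - fst k"]
      by (auto simp: dist_norm minus_prod_def)
    have "- lower_radius * (x \<bullet> x) \<le> x \<bullet> (fst p *v x)" for x
    proof -
      have "- lower_radius * (x \<bullet> x) \<le> - norm (fst p - fst k) * (x \<bullet> x)"
        using dd(1) by (intro mult_right_mono) auto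
      also have "\<dots> \<le> x \<bullet> ((fst p - fst k) *v x)" by (rule quadratic_form_lower)
      also have "\<dots> \<le> x \<bullet> (fst p *v x)"
        using k(1) by (auto simp: K_def psd_iff matrix_vector_bilinear inner_diff_right)
      finally show ?thesis .
    qed
    moreover have "norm (fst p) \<le> c + lower_radius" "norm (snd p) \<le> c + lower_radius"
      using dd k(1) norm_triangle_sub[of "fst p" "fst k"] norm_triangle_sub[of "snd p" "snd k"]
      by (auto simp: K_def)
    ultimately show ?thesis using that by (auto simp: K'_def)
  qed
  have K'0: "(0, 0) \<in> K'" using KK'[of "(0,0)"] K0 rad(2) by (simp add: transpose_linear)
  have K'_eq: "K' = {p. transpose (fst p) = fst p} \<inter> {p. transpose (snd p) = snd p}
      \<inter> (\<Inter>x. {p. - lower_radius * (x \<bullet> x) \<le> x \<bullet> (fst p *v x)}) \<inter> {p. norm (fst p) \<le> c + lower_radius}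
      \<inter> {p. norm (snd p) \<le> c + lower_radius}"
    by (auto simp: K'_def)
  have "continuous_on UNIV (\<lambda>p :: (real^'n^'n) \<times> (real^'n^'n). x \<bullet> (fst p *v x))" for x
    by (intro bounded_linear.continuous_on[OF bounded_linear_quadratic_form] continuous_intros)
  then have "closed {p :: (real^'n^'n) \<times> (real^'n^'n). - lower_radius * (x \<bullet> x) \<le> x \<bullet> (fst p *v x)}" for x
    by (intro closed_Collect_le continuous_on_const)
  then have cl1: "closed (\<Inter>x. {p :: (real^'n^'n) \<times> (real^'n^'n). - lower_radius * (x \<bullet> x) \<le> x \<bullet> (fst p *v x)})"
    by blast
  have cl2: "closed {p :: (real^'n^'n) \<times> (real^'n^'n). transpose (fst p) = fst p}"
    "closed {p :: (real^'n^'n) \<times> (real^'n^'n). transpose (snd p) = snd p}"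
    "closed {p :: (real^'n^'n) \<times> (real^'n^'n). norm (fst p) \<le> c + lower_radius}"
    "closed {p :: (real^'n^'n) \<times> (real^'n^'n). norm (snd p) \<le> c + lower_radius}"
    by (intro closed_Collect_le closed_Collect_eq continuous_intros)+
  have closedK': "closed K'"
    unfolding K'_eq by (intro closed_Int cl1 cl2)
  have convexK': "convex K'"
  proof (rule convexI)
    fix p q and u v :: real assume pq: "p \<in> K'" "q \<in> K'" and uv: "0 \<le> u" "0 \<le> v" "u + v = 1"
    have nn: "norm (u *\<^sub>R X + v *\<^sub>R Y) \<le> C" if "norm X \<le> C" "norm Y \<le> C" for X Y :: "real^'n^'n" and C
    proof -
      have "norm (u *\<^sub>R X + v *\<^sub>R Y) \<le> u * norm X + v * norm Y"
        using norm_triangle_ineq[of "u *\<^sub>R X" "v *\<^sub>R Y"] uv by simp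
      also have "\<dots> \<le> u * C + v * C" using that uv by (intro add_mono mult_left_mono) auto
      also have "\<dots> = C" using uv by (simp flip: distrib_right)
      finally show ?thesis .
    qed
    have qq: "- lower_radius * (x \<bullet> x) \<le> x \<bullet> ((u *\<^sub>R fst p + v *\<^sub>R fst q) *v x)" for x
    proof -
      have "u * (- lower_radius * (x \<bullet> x)) + v * (- lower_radius * (x \<bullet> x))
          \<le> u * (x \<bullet> (fst p *v x)) + v * (x \<bullet> (fst q *v x))"
        using pq uv by (intro add_mono mult_left_mono) (auto simp: K'_def)
      also have "u * (- lower_radius * (x \<bullet> x)) + v * (- lower_radius * (x \<bullet> x)) = - lower_radius * (x \<bullet> x)"
        using uv(3) by (simp only: distrib_right[symmetric] mult_1_left)
      finally show ?thesis
        by (simp add: matrix_vector_bilinear inner_add_right)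
    qed
    show "u *\<^sub>R p + v *\<^sub>R q \<in> K'"
      using pq nn qq by (simp add: K'_def transpose_linear transpose_scalar)
  qed
  define c' where "c' = max (max \<kappa> (c + lower_radius)) (gain_bound (c + lower_radius))"
  have c': "0 \<le> c'" "\<kappa> \<le> c'" "c + lower_radius \<le> c'" "gain_bound (c + lower_radius) \<le> c'"
    using \<kappa>_ge1 by (auto simp: c'_def)
  define F where "F s p = - riccati_op (cA d s) (cB d s) (cC d s) (cD d s) (cQ d s \<tau>) (cR d s \<tau>) (fst p) (fst p)"
    for s and p :: "(real^'n^'n) \<times> (real^'n^'n)"
  define Fh where "Fh s p = - riccati_op (hA d s) (hB d s) (hC d s) (hD d s) (hQ d s \<tau>) (hR d s \<tau>) (snd p) (fst p)"
    for s and p :: "(real^'n^'n) \<times> (real^'n^'n)"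
  have half_pos: "0 < \<delta> / 2" using \<delta>_pos by simp
  obtain L1 where L1: "0 \<le> L1" "\<And>(B::real^'m^'n) C D R R' X X' Y Y'.
    norm B \<le> c' \<Longrightarrow> norm C \<le> c' \<Longrightarrow> norm D \<le> c' \<Longrightarrow> norm X' \<le> c' \<Longrightarrow> norm Y' \<le> c' \<Longrightarrow>
    coercive (\<delta> / 2) (R + transpose D ** Y ** D) \<Longrightarrow> coercive (\<delta> / 2) (R' + transpose D ** Y' ** D) \<Longrightarrow>
    norm (feedback_gain B C D R X Y - feedback_gain B C D R' X' Y') \<le> L1 * (norm (R - R') + norm (X - X') + norm (Y - Y'))"
    by (rule feedback_gain_Lipschitz[OF half_pos c'(1)], rule that)
  obtain L2 where L2: "0 \<le> L2" "\<And>(A::real^'n^'n) (B::real^'m^'n) C D Q Q' R R' \<Theta> \<Theta>' X X' Y Y'.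
    norm A \<le> c' \<Longrightarrow> norm B \<le> c' \<Longrightarrow> norm C \<le> c' \<Longrightarrow> norm D \<le> c' \<Longrightarrow> norm R' \<le> c' \<Longrightarrow> norm \<Theta> \<le> c' \<Longrightarrow> norm \<Theta>' \<le> c' \<Longrightarrow>
    norm X \<le> c' \<Longrightarrow> norm X' \<le> c' \<Longrightarrow> norm Y' \<le> c' \<Longrightarrow>
    norm (lyapunov_op A B C D Q R \<Theta> X Y - lyapunov_op A B C D Q' R' \<Theta>' X' Y')
      \<le> L2 * (norm (Q - Q') + norm (R - R') + norm (\<Theta> - \<Theta>') + norm (X - X') + norm (Y - Y'))"
    by (rule lyapunov_op_Lipschitz[OF c'(1)], rule that)
  \<comment> \<open>The gain moves by at most 2 L1 times the distance, since both its arguments may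
    change; the two unknowns of the operator add one distance each.\<close>
  define L where "L = L2 * (2 * L1 + 2)"
  have lip: "norm (F s p - F s q) \<le> L * norm (p - q)" "norm (Fh s p - Fh s q) \<le> L * norm (p - q)"
    if s: "s \<in> {a..b}" and p: "p \<in> K'" and q: "q \<in> K'" for s p q
  proof -
    have s': "0 \<le> \<tau>" "\<tau> \<le> s" "s \<le> T" "s \<in> {0..T}" "\<tau> \<in> {0..T}" using s ab by auto
    have low: "\<And>x. - lower_radius * (x \<bullet> x) \<le> x \<bullet> (fst p *v x)" "\<And>x. - lower_radius * (x \<bullet> x) \<le> x \<bullet> (fst q *v x)"
      and nrm: "norm (fst p) \<le> c + lower_radius" "norm (snd p) \<le> c + lower_radius"
        "norm (fst q) \<le> c + lower_radius" "norm (snd q) \<le> c + lower_radius"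
      using p q by (auto simp: K'_def)
    note nrm' = nrm[THEN order_trans[OF _ c'(3)]]
    have cb: "norm (cA d s) \<le> c'" "norm (cB d s) \<le> c'" "norm (cC d s) \<le> c'" "norm (cD d s) \<le> c'"
      "norm (hA d s) \<le> c'" "norm (hB d s) \<le> c'" "norm (hC d s) \<le> c'" "norm (hD d s) \<le> c'"
      "norm (cR d s \<tau>) \<le> c'" "norm (hR d s \<tau>) \<le> c'"
      using coef_bound[OF s'(4)] weight_bound[OF s'(4,5)] c'(2) by auto
    have dpq: "norm (fst p - fst q) \<le> norm (p - q)" "norm (snd p - snd q) \<le> norm (p - q)"
      using norm_fst_le[of "fst p - fst q" "snd p - snd q"] norm_snd_le[of "snd p - snd q" "fst p - fst q"]
      by (auto simp: minus_prod_def)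
    let ?G = "\<lambda>p. feedback_gain (cB d s) (cC d s) (cD d s) (cR d s \<tau>) (fst p) (fst p)"
    let ?Gh = "\<lambda>p. feedback_gain (hB d s) (hC d s) (hD d s) (hR d s \<tau>) (snd p) (fst p)"
    have g: "norm (?G p - ?G q) \<le> L1 * (2 * norm (p - q))" "norm (?Gh p - ?Gh q) \<le> L1 * (2 * norm (p - q))"
      by (rule order_trans[OF L1(2) mult_left_mono[OF _ L1(1)]],
          use cb nrm' low s' dpq in \<open>auto intro!: gram_coercive\<close>)+
    have gb: "norm (?G p) \<le> c'" "norm (?G q) \<le> c'" "norm (?Gh p) \<le> c'" "norm (?Gh q) \<le> c'"
      by (rule order_trans[OF gain_norm_le(1) c'(4)] order_trans[OF gain_norm_le(2) c'(4)], use low s' nrm in auto)+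
    have "norm (F s p - F s q) \<le> L2 * (L1 * (2 * norm (p - q)) + norm (p - q) + norm (p - q))"
      unfolding F_def riccati_op_eq(1)[OF s'(1-3) low(1)] riccati_op_eq(1)[OF s'(1-3) low(2)] minus_diff_minus norm_minus_cancel
      by (rule order_trans[OF L2(2) mult_left_mono[OF _ L2(1)]]) (use cb nrm' gb g dpq in auto)
    then show "norm (F s p - F s q) \<le> L * norm (p - q)" by (simp add: L_def algebra_simps)
    have "norm (Fh s p - Fh s q) \<le> L2 * (L1 * (2 * norm (p - q)) + norm (p - q) + norm (p - q))"
      unfolding Fh_def riccati_op_eq(2)[OF s'(1-3) low(1)] riccati_op_eq(2)[OF s'(1-3) low(2)] minus_diff_minus norm_minus_cancel
      by (rule order_trans[OF L2(2) mult_left_mono[OF _ L2(1)]]) (use cb nrm' gb g dpq in auto)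
    then show "norm (Fh s p - Fh s q) \<le> L * norm (p - q)" by (simp add: L_def algebra_simps)
  qed
  define \<pi> where "\<pi> = closest_point K'"
  have \<pi>: "\<pi> p \<in> K'" for p
    unfolding \<pi>_def using closedK' K'0 by (intro closest_point_in_set) auto
  have \<pi>lip: "norm (\<pi> p - \<pi> q) \<le> norm (p - q)" for p q
    unfolding \<pi>_def using closest_point_lipschitz[OF convexK' closedK', of p q] K'0 by (auto simp: dist_norm)
  have \<pi>cont: "continuous_on UNIV \<pi>"
    unfolding \<pi>_def using convexK' closedK' K'0 by (intro continuous_on_closest_point) auto
  define f where "f s p = (F s (\<pi> p), Fh s (\<pi> p))" for s p
  have contf: "continuous_on ({a..b} \<times> UNIV) (\<lambda>(s, p). f s p)"
  proof -
    have cc: "continuous_on ({a..b} \<times> (UNIV :: ((real^'n^'n) \<times> (real^'n^'n)) set)) (\<lambda>z. h (fst z))"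
      if "continuous_on {a..b} h" for h :: "real \<Rightarrow> 'x::topological_space"
      by (rule continuous_on_compose2[OF that continuous_on_fst[OF continuous_on_id]]) auto
    note cs = coef_continuous[THEN continuous_on_subset, of "{a..b}"] weight_continuous_on[of "{a..b}" \<tau>]
    have cp: "continuous_on ({a..b} \<times> UNIV) (\<lambda>z::real \<times> (real^'n^'n) \<times> (real^'n^'n). \<pi> (snd z))"
      by (rule continuous_on_compose2[OF \<pi>cont continuous_on_snd[OF continuous_on_id]]) auto
    have co: "coercive (\<delta> / 2) (cR d (fst z) \<tau> + transpose (cD d (fst z)) ** fst (\<pi> (snd z)) ** cD d (fst z))"
      "coercive (\<delta> / 2) (hR d (fst z) \<tau> + transpose (hD d (fst z)) ** fst (\<pi> (snd z)) ** hD d (fst z))"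
      if "z \<in> {a..b} \<times> UNIV" for z :: "real \<times> (real^'n^'n) \<times> (real^'n^'n)"
      using that ab \<pi>[of "snd z"] by (auto intro!: gram_coercive simp: K'_def)
    have "continuous_on ({a..b} \<times> UNIV) (\<lambda>z. F (fst z) (\<pi> (snd z)))"
      "continuous_on ({a..b} \<times> UNIV) (\<lambda>z. Fh (fst z) (\<pi> (snd z)))"
      unfolding F_def Fh_def riccati_op_def
      using ab \<delta>_pos
      by (intro continuous_intros continuous_on_matrix_inv[of "\<delta> / 2"] co cp cc cs; simp)+
    then show ?thesis
      unfolding f_def case_prod_unfold by (intro continuous_intros)
  qed
  have lipf: "norm (f s p - f s q) \<le> 2 * L * norm (p - q)" if "s \<in> {a..b}" for s p q
  proof -
    have "norm (f s p - f s q) \<le> norm (F s (\<pi> p) - F s (\<pi> q)) + norm (Fh s (\<pi> p) - Fh s (\<pi> q))"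
      unfolding f_def diff_Pair by (rule norm_Pair_le)
    also have "\<dots> \<le> L * norm (\<pi> p - \<pi> q) + L * norm (\<pi> p - \<pi> q)"
      by (intro add_mono lip that \<pi>)
    also have "\<dots> \<le> L * norm (p - q) + L * norm (p - q)"
      using L1(1) L2(1) by (intro add_mono mult_left_mono \<pi>lip) (auto simp: L_def)
    finally show ?thesis by simp
  qed
  have "0 \<le> 2 * L" using L1(1) L2(1) by (simp add: L_def)
  from backward_ode_exists[OF ab(3) this contf lipf, of "(X0, Z0)"] obtain p
    where pb: "p b = (X0, Z0)" and p': "\<And>s. s \<in> {a..b} \<Longrightarrow> (p has_vector_derivative f s (p s)) (at s within {a..b})"
    by blast
  have contp: "continuous_on {a..b} p"
    using p' by (rule continuous_on_of_vector_derivative)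
  have P': "((\<lambda>s. fst (p s)) has_vector_derivative F s (\<pi> (p s))) (at s within {a..b})"
    "((\<lambda>s. snd (p s)) has_vector_derivative Fh s (\<pi> (p s))) (at s within {a..b})" if "s \<in> {a..b}" for s
    using bounded_linear.has_vector_derivative[OF bounded_linear_fst p'[OF that]]
      bounded_linear.has_vector_derivative[OF bounded_linear_snd p'[OF that]] by (auto simp: f_def)
  have symF: "transpose (F s q) = F s q" "transpose (Fh s q) = Fh s q" if "s \<in> {a..b}" "q \<in> K'" for s q
  proof -
    have s': "0 \<le> \<tau>" "\<tau> \<le> s" "s \<le> T" using that ab by auto
    have low: "\<And>x. - lower_radius * (x \<bullet> x) \<le> x \<bullet> (fst q *v x)" using that by (auto simp: K'_def)
    have sy: "sym_mat (cQ d s \<tau>)" "sym_mat (hQ d s \<tau>)" "sym_mat (cR d s \<tau>)" "sym_mat (hR d s \<tau>)"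
      "sym_mat (fst q)" "sym_mat (snd q)"
      using weight_psd'[OF s'] that by (auto simp: psd_iff K'_def sym_mat_def)
    show "transpose (F s q) = F s q" "transpose (Fh s q) = Fh s q"
      unfolding F_def Fh_def riccati_op_eq[OF s' low] transpose_linear
      by (intro arg_cong[of _ _ uminus] sym_mat_transpose sym_mat_lyapunov_op sy)+
  qed
  \<comment> \<open>The field is symmetric because \<pi> takes values in \<open>K'\<close>. Hence
    the solution is symmetric before it is known to stay in \<open>K'\<close>, as \<open>KK'\<close>
    requires.\<close>
  have symp: "transpose (fst (p s)) = fst (p s)" "transpose (snd (p s)) = snd (p s)" if s: "s \<in> {a..b}" for s
  proof -
    have z: "transpose (Y s) - Y s = 0"
      if Y: "\<And>s. s \<in> {a..b} \<Longrightarrow> (Y has_vector_derivative Y' s) (at s within {a..b})"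
        and sy: "\<And>s. s \<in> {a..b} \<Longrightarrow> transpose (Y' s) = Y' s" "transpose (Y b) = Y b" for Y Y' :: "real \<Rightarrow> real^'n^'n"
    proof (rule backward_ode_zero[where b=b and L=0 and E="\<lambda>s. transpose (Y s) - Y s" and E'="\<lambda>s. 0"])
      show "continuous_on {s..b} (\<lambda>s. transpose (Y s) - Y s)"
        using s by (intro continuous_intros continuous_on_subset[OF continuous_on_of_vector_derivative[OF Y]]) auto
      fix u assume "u \<in> {s<..<b}"
      then have u: "u \<in> {a..b}" "u \<in> {a<..<b}" using s by auto
      have Yu: "(Y has_vector_derivative Y' u) (at u)"
        by (rule has_vector_derivative_at_of_within[OF Y[OF u(1)] u(2)])
      have "((\<lambda>s. transpose (Y s) - Y s) has_vector_derivative transpose (Y' u) - Y' u) (at u)"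
        by (intro has_vector_derivative_diff bounded_linear.has_vector_derivative[OF bounded_linear_transpose] Yu)
      then show "((\<lambda>s. transpose (Y s) - Y s) has_vector_derivative 0) (at u)"
        using sy(1)[OF u(1)] by simp
    qed (use s sy(2) in auto)
    show "transpose (fst (p s)) = fst (p s)" "transpose (snd (p s)) = snd (p s)"
      using z[OF P'(1) symF(1)[OF _ \<pi>]] z[OF P'(2) symF(2)[OF _ \<pi>]] pb X0 Z0 by (auto simp: psd_iff sym_mat_def)
  qed
  have ric: "riccati_pair \<tau> s b (\<lambda>s. fst (p s)) (\<lambda>s. snd (p s))"
    if "s \<in> {a..b}" "\<forall>u\<in>{s..b}. p u \<in> K'" for s
    unfolding riccati_pair_def
  proof
    fix u assume u: "u \<in> {s..b}"
    have "\<pi> (p u) = p u"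
      unfolding \<pi>_def using u that by (intro closest_point_self) auto
    then show "((\<lambda>s. fst (p s)) has_vector_derivative - riccati_op (cA d u) (cB d u) (cC d u) (cD d u)
          (cQ d u \<tau>) (cR d u \<tau>) (fst (p u)) (fst (p u))) (at u within {s..b}) \<and>
        ((\<lambda>s. snd (p s)) has_vector_derivative - riccati_op (hA d u) (hB d u) (hC d u) (hD d u)
          (hQ d u \<tau>) (hR d u \<tau>) (snd (p u)) (fst (p u))) (at u within {s..b})"
      using has_vector_derivative_within_subset[OF P'(1), of u "{s..b}"]
        has_vector_derivative_within_subset[OF P'(2), of u "{s..b}"] u that
      by (auto simp: F_def Fh_def)
  qed
  have inK: "p s \<in> K" if s: "s \<in> {a..b}" and K': "\<forall>u\<in>{s..b}. p u \<in> K'" for s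
  proof -
    note r = ric[OF s K']
    have psd: "0 \<preceq> fst (p u)" "0 \<preceq> snd (p u)" if "u \<in> {s..b}" for u
      using riccati_pair_psd[OF r, of u] s ab K' that X0 Z0 pb by (auto simp: K'_def)
    have exp_mono: "(x + y * (b - u)) * exp (z * (b - u)) \<le> (x + y * (b - a)) * exp (z * (b - a))"
      if "0 \<le> x" "0 \<le> y" "0 \<le> z" "u \<in> {a..b}" for x y z u
      using that by (intro mult_mono add_mono mult_left_mono) (auto intro!: mult_left_mono)
    have t1: "trace (fst (p u)) \<le> c1" if u: "u \<in> {s..b}" for u
    proof -
      have "riccati_pair \<tau> u b (\<lambda>s. fst (p s)) (\<lambda>s. snd (p s))"
        using u by (intro riccati_pair_subinterval[OF r]) auto
      from riccati_pair_trace_le(1)[OF this] have "trace (fst (p u))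
          \<le> (trace X0 + trace_rate * (b - u)) * exp (2 * trace_rate * (b - u))"
        using psd u s ab pb by auto
      also have "\<dots> \<le> c1"
        unfolding c1_def using trace_psd_nonneg[OF X0] trace_rate_nonneg u s by (intro exp_mono) auto
      finally show ?thesis .
    qed
    have "trace (snd (p s)) \<le> (trace Z0 + trace_rate * (c1 + 1) * (b - s)) * exp (trace_rate * (b - s))"
      using riccati_pair_trace_le(2)[OF r _ _ _ _ psd t1] s ab pb by auto
    also have "\<dots> \<le> c2"
      unfolding c2_def using trace_psd_nonneg[OF Z0] trace_rate_nonneg s c1 by (intro exp_mono) auto
    finally have t2: "trace (snd (p s)) \<le> c2" .
    have ss: "s \<in> {s..b}" using s by auto
    have "norm (fst (p s)) \<le> n * c1" "norm (snd (p s)) \<le> n * c2"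
      using norm_psd_le_trace[OF psd(1)[OF ss]] norm_psd_le_trace[OF psd(2)[OF ss]] t1[OF ss] t2
      unfolding n_def by (meson mult_left_mono of_nat_0_le_iff order_trans)+
    then show ?thesis using psd[OF ss] c by (auto simp: K_def)
  qed
  \<comment> \<open>As long as the solution is within \<open>lower_radius\<close> of
    \<open>K\<close> the projection is inactive and the a priori bounds apply; this is the situation
    of \<open>backward_bootstrap\<close>.\<close>
  have inf0: "infdist (p s) K \<le> 0" if "s \<in> {a..b}" for s
  proof (rule backward_bootstrap[where \<phi>="\<lambda>s. infdist (p s) K" and b=b and r=lower_radius])
    show "continuous_on {a..b} (\<lambda>s. infdist (p s) K)"
      by (intro continuous_intros contp)
    have "norm X0 \<le> n * trace X0" "norm Z0 \<le> n * trace Z0"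
      unfolding n_def using X0 Z0 norm_psd_le_trace by auto
    moreover have "trace X0 * 1 \<le> c1" "trace Z0 * 1 \<le> c2"
      unfolding c1_def c2_def using trace_psd_nonneg[OF X0] trace_psd_nonneg[OF Z0] trace_rate_nonneg c1 ab
      by (intro mult_mono; auto)+
    then have "n * trace X0 \<le> n * c1" "n * trace Z0 \<le> n * c2"
      by (simp_all add: n_def)
    ultimately have "norm X0 \<le> c" "norm Z0 \<le> c"
      using c(2,3) by linarith+
    then have "p b \<in> K" using pb X0 Z0 by (auto simp: K_def)
    then show "infdist (p b) K \<le> 0" by simp
    fix s assume s: "s \<in> {a..b}" and le: "\<forall>u\<in>{s..b}. infdist (p u) K \<le> lower_radius"
    have "p s \<in> K"
      using le s by (intro inK ballI KK' symp) auto
    then show "infdist (p s) K \<le> 0" by simp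
  qed (use rad that in auto)
  have K: "p s \<in> K" if "s \<in> {a..b}" for s
    using inf0[OF that] closedK K0 infdist_nonneg[of "p s" K] in_closed_iff_infdist_zero[of K "p s"] by force
  then have K': "p s \<in> K'" if "s \<in> {a..b}" for s
    using that inf0[OF that] rad(2) by (intro KK' symp) auto
  have "riccati_pair \<tau> a b (\<lambda>s. fst (p s)) (\<lambda>s. snd (p s))"
    using ab K' by (intro ric) auto
  then show ?thesis
    using K pb by (intro exI[of _ "\<lambda>s. fst (p s)"] exI[of _ "\<lambda>s. snd (p s)"]) (auto simp: K_def)
qed

end

section \<open>The equations for the cost kernels\<close>

lemma partition_less:
  assumes "is_partition T N t" "i < j" "j \<le> N"
  shows "t i < t j"
  using assms(2,3)
proof (induction j)
  case (Suc j)
  have "t j < t (Suc j)" using Suc assms(1) by (auto simp: is_partition_def)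
  then show ?case using Suc by (cases "i = j") auto
qed simp

lemma partition_le:
  assumes "is_partition T N t" "i \<le> j" "j \<le> N"
  shows "t i \<le> t j"
  using partition_less[OF assms(1), of i j] assms(2,3) by (cases "i = j") auto

lemma partition_ends: "is_partition T N t \<Longrightarrow> t 0 = 0" "is_partition T N t \<Longrightarrow> t N = T" "is_partition T N t \<Longrightarrow> 0 < N"
  by (auto simp: is_partition_def)

lemma partition_range:
  assumes "is_partition T N t" "i \<le> N"
  shows "0 \<le> t i" "t i \<le> T"
  using partition_le[OF assms(1), of 0 i] partition_le[OF assms(1), of i N] assms
  by (auto simp: is_partition_def)

lemma partition_mesh: "k < N \<Longrightarrow> t (Suc k) - t k \<le> mesh N t"
  unfolding mesh_def by (intro Max_ge) auto

lemma partition_cell_left: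
  assumes "is_partition T N t" "m \<le> N" "s \<in> {t m..<T}"
  obtains i where "m \<le> i" "i < N" "s \<in> {t i..<t (Suc i)}"
proof -
  define I where "I = {i. i \<le> N \<and> t i \<le> s}"
  define i where "i = Max I"
  have I: "finite I" "I \<noteq> {}" using assms by (auto simp: I_def)
  have i: "i \<le> N \<and> t i \<le> s" "\<And>j. j \<le> N \<and> t j \<le> s \<Longrightarrow> j \<le> i"
    using Max_in[OF I] Max_ge[OF I(1)] by (auto simp: i_def I_def)
  have "i \<noteq> N" using i(1) assms partition_ends[OF assms(1)] by auto
  then show ?thesis
    using that[of i] i(1) i(2)[of "Suc i"] i(2)[of m] assms by force
qed

text \<open>Right-closed cells are those on which \<open>Gam_tilde\<close> is continuous;
  left-closed ones, as in \<open>partition_cell_left\<close>, are those on which the gain follows a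
  single formula.\<close>

lemma partition_cell_right:
  assumes "is_partition T N t" "m \<le> N" "s \<in> {t m<..T}"
  obtains i where "m \<le> i" "i < N" "s \<in> {t i<..t (Suc i)}"
proof -
  define I where "I = {i. i \<le> N \<and> t i < s}"
  define i where "i = Max I"
  have I: "finite I" "I \<noteq> {}" using assms by (auto simp: I_def)
  have i: "i \<le> N \<and> t i < s" "\<And>j. j \<le> N \<and> t j < s \<Longrightarrow> j \<le> i"
    using Max_in[OF I] Max_ge[OF I(1)] by (auto simp: i_def I_def)
  have "i \<noteq> N" using i(1) assms partition_ends[OF assms(1)] by auto
  then show ?thesis
    using that[of i] i(1) i(2)[of "Suc i"] i(2)[of m] assms by force
qed

text \<open>The step passes from the right node of a cell to the cell and its left node, which is
  the right node of the preceding cell.\<close>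

lemma partition_backward_induct:
  assumes part: "is_partition T N t" and m: "m \<le> N" and s: "s \<in> {t m..T}"
    and base: "P T"
    and step: "\<And>i s. m \<le> i \<Longrightarrow> i < N \<Longrightarrow> P (t (Suc i)) \<Longrightarrow> s \<in> {t i..<t (Suc i)} \<Longrightarrow> P s"
  shows "P s"
proof -
  have node: "P (t (N - j))" if "j \<le> N - m" for j
    using that
  proof (induction j)
    case 0 then show ?case using base partition_ends[OF part] by simp
  next
    case (Suc j)
    then have "m \<le> N - Suc j" "N - Suc j < N" "Suc (N - Suc j) = N - j" by auto
    then show ?case
      using step[of "N - Suc j" "t (N - Suc j)"] Suc partition_less[OF part, of "N - Suc j" "N - j"] by auto
  qed
  show ?thesis
  proof (cases "s = T")
    case False
    then obtain i where i: "m \<le> i" "i < N" "s \<in> {t i..<t (Suc i)}"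
      using partition_cell_left[OF part m, of s] s by auto
    have "P (t (N - (N - Suc i)))" using i by (intro node) auto
    then show ?thesis using step[OF i(1,2) _ i(3)] i by simp
  qed (use base in simp)
qed

section \<open>Kernel systems: solvability, structure and positivity\<close>

text \<open>The scalar \<open>u\<close> merges the two kinds of equation: u = 1 with Y = 0 is the
  self-contained one, u = 0 has a given \<open>Y\<close>.\<close>

lemma lyapunov_op_solution:
  fixes A :: "real \<Rightarrow> real^'n^'n" and B :: "real \<Rightarrow> real^'m^'n"
  assumes "a \<le> b"
    and cont: "continuous_on {a..b} A" "continuous_on {a..b} B" "continuous_on {a..b} C" "continuous_on {a..b} D"
      "continuous_on {a..b} Q" "continuous_on {a..b} R" "continuous_on {a..b} \<Theta>" "continuous_on {a..b} Y"
  shows "\<exists>X. X b = X0 \<and> (\<forall>s\<in>{a..b}. (X has_vector_derivative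
      - lyapunov_op (A s) (B s) (C s) (D s) (Q s) (R s) (\<Theta> s) (X s) (u *\<^sub>R X s + Y s)) (at s within {a..b}))"
proof -
  have "\<forall>\<^sub>F \<kappa>::real in at_top. (\<forall>s\<in>{a..b}. norm (A s) \<le> \<kappa>) \<and> (\<forall>s\<in>{a..b}. norm (B s) \<le> \<kappa>) \<and>
      (\<forall>s\<in>{a..b}. norm (C s) \<le> \<kappa>) \<and> (\<forall>s\<in>{a..b}. norm (D s) \<le> \<kappa>) \<and> (\<forall>s\<in>{a..b}. norm (\<Theta> s) \<le> \<kappa>) \<and> 0 \<le> \<kappa>"
    using cont by (intro eventually_conj eventually_norm_bound compact_Icc eventually_ge_at_top)
  from eventually_happens'[OF trivial_limit_at_top_linorder this] obtain \<kappa>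
    where \<kappa>0: "(\<forall>s\<in>{a..b}. norm (A s) \<le> \<kappa>) \<and> (\<forall>s\<in>{a..b}. norm (B s) \<le> \<kappa>) \<and>
      (\<forall>s\<in>{a..b}. norm (C s) \<le> \<kappa>) \<and> (\<forall>s\<in>{a..b}. norm (D s) \<le> \<kappa>) \<and> (\<forall>s\<in>{a..b}. norm (\<Theta> s) \<le> \<kappa>) \<and> 0 \<le> \<kappa>" ..
  then have \<kappa>: "norm (A s) \<le> \<kappa>" "norm (B s) \<le> \<kappa>" "norm (C s) \<le> \<kappa>" "norm (D s) \<le> \<kappa>" "norm (\<Theta> s) \<le> \<kappa>"
    if "s \<in> {a..b}" for s
    using that by blast+
  define L where "L = 2 * (\<kappa> + \<kappa> * \<kappa>) + (\<kappa> + \<kappa> * \<kappa>)\<^sup>2 * \<bar>u\<bar>"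
  show ?thesis
  proof (rule backward_ode_exists[OF \<open>a \<le> b\<close>])
    show "0 \<le> L" using \<kappa>0 by (simp add: L_def)
    have cc: "continuous_on ({a..b} \<times> (UNIV :: (real^'n^'n) set)) (\<lambda>z. h (fst z))"
      if "continuous_on {a..b} h" for h :: "real \<Rightarrow> 'x::topological_space"
      by (rule continuous_on_compose2[OF that continuous_on_fst[OF continuous_on_id]]) auto
    show "continuous_on ({a..b} \<times> UNIV) (\<lambda>(s, X). - lyapunov_op (A s) (B s) (C s) (D s) (Q s) (R s) (\<Theta> s) X (u *\<^sub>R X + Y s))"
      unfolding case_prod_unfold
    proof (intro continuous_on_minus continuous_on_lyapunov_op)
      show "continuous_on ({a..b} \<times> UNIV) (\<lambda>z. u *\<^sub>R snd z + Y (fst z))"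
        by (rule continuous_on_add[OF continuous_on_scaleR[OF continuous_on_const continuous_on_snd[OF continuous_on_id]] cc[OF cont(8)]])
      show "continuous_on ({a..b} \<times> (UNIV :: (real^'n^'n) set)) snd"
        by (rule continuous_on_snd[OF continuous_on_id])
    qed (rule cc, rule cont)+
    fix s and X X' :: "real^'n^'n" assume s: "s \<in> {a..b}"
    have e: "u *\<^sub>R X + Y s - (u *\<^sub>R X' + Y s) = u *\<^sub>R (X - X')"
      by (simp add: scaleR_diff_right)
    have "norm (- lyapunov_op (A s) (B s) (C s) (D s) (Q s) (R s) (\<Theta> s) X (u *\<^sub>R X + Y s)
        - - lyapunov_op (A s) (B s) (C s) (D s) (Q s) (R s) (\<Theta> s) X' (u *\<^sub>R X' + Y s))
      = norm (lyapunov_op (A s) (B s) (C s) (D s) 0 0 (\<Theta> s) (X - X') (u *\<^sub>R (X - X')))"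
      unfolding minus_diff_minus norm_minus_cancel lyapunov_op_diff e by simp
    also have "\<dots> \<le> 2 * (\<kappa> + \<kappa> * \<kappa>) * norm (X - X') + norm (0::real^'n^'n)
        + (\<kappa> + \<kappa> * \<kappa>)\<^sup>2 * norm (u *\<^sub>R (X - X')) + \<kappa> * \<kappa> * norm (0::real^'m^'m)"
      by (rule norm_lyapunov_op_le[OF \<kappa>[OF s]])
    also have "\<dots> = L * norm (X - X')"
      by (simp add: L_def distrib_right)
    finally show "norm (- lyapunov_op (A s) (B s) (C s) (D s) (Q s) (R s) (\<Theta> s) X (u *\<^sub>R X + Y s)
        - - lyapunov_op (A s) (B s) (C s) (D s) (Q s) (R s) (\<Theta> s) X' (u *\<^sub>R X' + Y s)) \<le> L * norm (X - X')" .
  qed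
qed

context lq_problem
begin

text \<open>
  The equations of step (a) of the construction on \<open>[t m, T]\<close>, with arbitrary weights \<open>q, r\<close> and
  \<open>qh, rh\<close> in place of those frozen at a partition point, and with \<open>gh\<close> for the sum of the last
  two unknowns.  In this form the system is linear in weights and unknowns together.
\<close>

definition gamma_system where
  "gamma_system N t m \<Theta> \<Theta>h q r g0 qh rh gh0 gt g gh \<longleftrightarrow>
     g T = g0 \<and> gh T = gh0 \<and> continuous_on {t m..T} g \<and> continuous_on {t m..T} gh \<and> gt (t m) = g (t m) \<and>
     (\<forall>i. m \<le> i \<and> i < N \<longrightarrow> gt (t (Suc i)) = g (t (Suc i)) \<and> (gt \<longlongrightarrow> gt (t (Suc i))) (at_left (t (Suc i))) \<and>
       (\<forall>s\<in>{t i<..<t (Suc i)}.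
         (gt has_vector_derivative - lyapunov_op (cA d s) (cB d s) (cC d s) (cD d s) (q s) (r s) (\<Theta> s) (gt s) (gt s)) (at s) \<and>
         (g has_vector_derivative - lyapunov_op (hA d s) (hB d s) (hC d s) (hD d s) (q s) (r s) (\<Theta>h s) (g s) (gt s)) (at s) \<and>
         (gh has_vector_derivative - lyapunov_op (hA d s) (hB d s) (hC d s) (hD d s) (qh s) (rh s) (\<Theta>h s) (gh s) (gt s)) (at s)))"

definition frozen_system where
  "frozen_system N t m \<Theta> \<Theta>h \<tau> gt g gh \<longleftrightarrow>
     gamma_system N t m \<Theta> \<Theta>h (\<lambda>s. cQ d s \<tau>) (\<lambda>s. cR d s \<tau>) (cG d \<tau>) (\<lambda>s. hQ d s \<tau>) (\<lambda>s. hR d s \<tau>) (hG d \<tau>) gt g gh"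

text \<open>Adding the equations of \<open>Gam\<close> and \<open>Gam_bar\<close> adds their weights
  and keeps a single \<open>Gam_tilde\<close> term, so the sum solves a Lyapunov equation with the
  hatted weights.\<close>

lemma frozen_system_of_Gam_equations:
  assumes "Gam_equations d T N t S k"
  shows "frozen_system N t (Suc k) (Th S) (Th_hat S) (t k) (Gam_tilde S k) (Gam S k) (Gam_hat S k)"
proof -
  have hat: "(Gam_hat S k has_vector_derivative
      - lyapunov_op (hA d s) (hB d s) (hC d s) (hD d s) (hQ d s (t k)) (hR d s (t k)) (Th_hat S s) (Gam_hat S k s) (Gam_tilde S k s)) (at s)"
    if "(Gam S k has_vector_derivative - lyapunov_op (hA d s) (hB d s) (hC d s) (hD d s) (cQ d s (t k)) (cR d s (t k))
                 (Th_hat S s) (Gam S k s) (Gam_tilde S k s)) (at s)"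
      "(Gam_bar S k has_vector_derivative
             - (Gam_bar S k s ** (hA d s - hB d s ** Th_hat S s)
                + transpose (hA d s - hB d s ** Th_hat S s) ** Gam_bar S k s
                + cQbar d s (t k)
                + transpose (Th_hat S s) ** cRbar d s (t k) ** Th_hat S s)) (at s)" for s
    using has_vector_derivative_add[OF that] unfolding Gam_hat_def[abs_def]
    by (rule has_vector_derivative_eq_rhs)
      (simp add: lyapunov_op_def hQ_def hR_def matrix_mult_bilinear)
  show ?thesis
    using assms unfolding frozen_system_def gamma_system_def Gam_equations_def
    by (auto simp: Gam_hat_def[abs_def] hG_def intro!: continuous_on_add hat[unfolded Gam_hat_def[abs_def]])
qed

lemma Gam_equations_of_frozen_system:
  assumes sys: "frozen_system N t (Suc k) (Th S) (Th_hat S) (t k) (Gam_tilde S k) (Gam S k) gh"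
    and bar: "Gam_bar S k = (\<lambda>s. gh s - Gam S k s)"
  shows "Gam_equations d T N t S k"
proof -
  have bar': "((\<lambda>s. gh s - Gam S k s) has_vector_derivative
             - ((gh s - Gam S k s) ** (hA d s - hB d s ** Th_hat S s)
                + transpose (hA d s - hB d s ** Th_hat S s) ** (gh s - Gam S k s)
                + cQbar d s (t k)
                + transpose (Th_hat S s) ** cRbar d s (t k) ** Th_hat S s)) (at s)"
    if "(Gam S k has_vector_derivative - lyapunov_op (hA d s) (hB d s) (hC d s) (hD d s) (cQ d s (t k)) (cR d s (t k))
                 (Th_hat S s) (Gam S k s) (Gam_tilde S k s)) (at s)"
      "(gh has_vector_derivative
      - lyapunov_op (hA d s) (hB d s) (hC d s) (hD d s) (hQ d s (t k)) (hR d s (t k)) (Th_hat S s) (gh s) (Gam_tilde S k s)) (at s)" for s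
    using has_vector_derivative_diff[OF that(2,1)]
    by (rule has_vector_derivative_eq_rhs)
      (simp add: lyapunov_op_def hQ_def hR_def matrix_mult_bilinear)
  note F = sys[unfolded frozen_system_def gamma_system_def]
  show ?thesis
    unfolding Gam_equations_def
  proof (intro conjI allI impI ballI)
    show "Gam S k T = cG d (t k)" "continuous_on {t (Suc k)..T} (Gam S k)"
      "Gam_tilde S k (t (Suc k)) = Gam S k (t (Suc k))"
      using F by blast+
    show "Gam_bar S k T = cGbar d (t k)" using F by (simp add: bar hG_def)
    show "continuous_on {t (Suc k)..T} (Gam_bar S k)"
      unfolding bar using F by (intro continuous_on_diff) blast+
  next
    fix i assume i: "Suc k \<le> i \<and> i < N"
    show "Gam_tilde S k (t (Suc i)) = Gam S k (t (Suc i))"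
      "(Gam_tilde S k \<longlongrightarrow> Gam_tilde S k (t (Suc i))) (at_left (t (Suc i)))"
      using F i by blast+
    fix s assume s: "s \<in> {t i<..<t (Suc i)}"
    have g: "(Gam S k has_vector_derivative - lyapunov_op (hA d s) (hB d s) (hC d s) (hD d s) (cQ d s (t k)) (cR d s (t k))
                 (Th_hat S s) (Gam S k s) (Gam_tilde S k s)) (at s)"
      and gh: "(gh has_vector_derivative - lyapunov_op (hA d s) (hB d s) (hC d s) (hD d s) (hQ d s (t k)) (hR d s (t k))
                 (Th_hat S s) (gh s) (Gam_tilde S k s)) (at s)"
      using F i s by blast+
    show "(Gam_tilde S k has_vector_derivative - lyapunov_op (cA d s) (cB d s) (cC d s) (cD d s) (cQ d s (t k)) (cR d s (t k))
                 (Th S s) (Gam_tilde S k s) (Gam_tilde S k s)) (at s)"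
      using F i s by blast
    show "(Gam S k has_vector_derivative - lyapunov_op (hA d s) (hB d s) (hC d s) (hD d s) (cQ d s (t k)) (cR d s (t k))
                 (Th_hat S s) (Gam S k s) (Gam_tilde S k s)) (at s)"
      by (rule g)
    show "(Gam_bar S k has_vector_derivative
             - (Gam_bar S k s ** (hA d s - hB d s ** Th_hat S s)
                + transpose (hA d s - hB d s ** Th_hat S s) ** Gam_bar S k s
                + cQbar d s (t k)
                + transpose (Th_hat S s) ** cRbar d s (t k) ** Th_hat S s)) (at s)"
      unfolding bar by (rule bar'[OF g gh])
  qed
qed

lemma gamma_system_node:
  assumes "gamma_system N t m \<Theta> \<Theta>h q r g0 qh rh gh0 gt g gh" "m \<le> i" "i \<le> N"
  shows "gt (t i) = g (t i)"
proof (cases "i = m")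
  case False
  then obtain j where "i = Suc j" "m \<le> j" "j < N" using assms(2,3) by (cases i) auto
  then show ?thesis using assms(1) by (auto simp: gamma_system_def)
qed (use assms(1) in \<open>simp add: gamma_system_def\<close>)

lemma gamma_system_continuous:
  assumes sys: "gamma_system N t m \<Theta> \<Theta>h q r g0 qh rh gh0 gt g gh" and i: "m \<le> i" "i < N"
  shows "continuous_on {t i<..t (Suc i)} gt"
  unfolding continuous_on_def
proof
  fix s assume s: "s \<in> {t i<..t (Suc i)}"
  show "(gt \<longlongrightarrow> gt s) (at s within {t i<..t (Suc i)})"
  proof (cases "s = t (Suc i)")
    case True
    have "(gt \<longlongrightarrow> gt s) (at_left s)" using sys i True by (auto simp: gamma_system_def)
    moreover have "at s within {t i<..t (Suc i)} \<le> at_left s"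
      unfolding at_within_def by (intro inf_mono order_refl) (use True in \<open>auto simp: principal_le_iff\<close>)
    ultimately show ?thesis
      by (rule tendsto_mono[rotated])
  next
    case False
    then have "s \<in> {t i<..<t (Suc i)}" using s by auto
    then have "isCont gt s"
      using sys i unfolding gamma_system_def
      by (meson has_vector_derivative_continuous)
    then show ?thesis
      unfolding isCont_def by (rule tendsto_within_subset) simp
  qed
qed

lemma gamma_system_diff:
  assumes "gamma_system N t m \<Theta> \<Theta>h q r g0 qh rh gh0 gt g gh"
    "gamma_system N t m \<Theta> \<Theta>h q' r' g0' qh' rh' gh0' gt' g' gh'"
  shows "gamma_system N t m \<Theta> \<Theta>h (\<lambda>s. q s - q' s) (\<lambda>s. r s - r' s) (g0 - g0')
     (\<lambda>s. qh s - qh' s) (\<lambda>s. rh s - rh' s) (gh0 - gh0') (\<lambda>s. gt s - gt' s) (\<lambda>s. g s - g' s) (\<lambda>s. gh s - gh' s)"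
proof -
  note F = assms(1)[unfolded gamma_system_def] and F' = assms(2)[unfolded gamma_system_def]
  show ?thesis
    unfolding gamma_system_def
  proof (intro conjI allI impI ballI)
    show "g T - g' T = g0 - g0'" "gh T - gh' T = gh0 - gh0'" "gt (t m) - gt' (t m) = g (t m) - g' (t m)"
      using F F' by simp_all
    show "continuous_on {t m..T} (\<lambda>s. g s - g' s)" "continuous_on {t m..T} (\<lambda>s. gh s - gh' s)"
      using F F' by (blast intro: continuous_on_diff)+
  next
    fix i assume i: "m \<le> i \<and> i < N"
    have Fi: "gt (t (Suc i)) = g (t (Suc i))" "gt' (t (Suc i)) = g' (t (Suc i))"
      "(gt \<longlongrightarrow> gt (t (Suc i))) (at_left (t (Suc i)))" "(gt' \<longlongrightarrow> gt' (t (Suc i))) (at_left (t (Suc i)))"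
      using F F' i by blast+
    show "gt (t (Suc i)) - gt' (t (Suc i)) = g (t (Suc i)) - g' (t (Suc i))"
      using Fi by simp
    show "((\<lambda>s. gt s - gt' s) \<longlongrightarrow> gt (t (Suc i)) - gt' (t (Suc i))) (at_left (t (Suc i)))"
      by (intro tendsto_diff Fi)
    fix s assume s: "s \<in> {t i<..<t (Suc i)}"
    have d: "(gt has_vector_derivative - lyapunov_op (cA d s) (cB d s) (cC d s) (cD d s) (q s) (r s) (\<Theta> s) (gt s) (gt s)) (at s)"
      "(g has_vector_derivative - lyapunov_op (hA d s) (hB d s) (hC d s) (hD d s) (q s) (r s) (\<Theta>h s) (g s) (gt s)) (at s)"
      "(gh has_vector_derivative - lyapunov_op (hA d s) (hB d s) (hC d s) (hD d s) (qh s) (rh s) (\<Theta>h s) (gh s) (gt s)) (at s)"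
      using F i s by blast+
    have d': "(gt' has_vector_derivative - lyapunov_op (cA d s) (cB d s) (cC d s) (cD d s) (q' s) (r' s) (\<Theta> s) (gt' s) (gt' s)) (at s)"
      "(g' has_vector_derivative - lyapunov_op (hA d s) (hB d s) (hC d s) (hD d s) (q' s) (r' s) (\<Theta>h s) (g' s) (gt' s)) (at s)"
      "(gh' has_vector_derivative - lyapunov_op (hA d s) (hB d s) (hC d s) (hD d s) (qh' s) (rh' s) (\<Theta>h s) (gh' s) (gt' s)) (at s)"
      using F' i s by blast+
    note dd = has_vector_derivative_eq_rhs[OF has_vector_derivative_diff]
    show "((\<lambda>s. gt s - gt' s) has_vector_derivative - lyapunov_op (cA d s) (cB d s) (cC d s) (cD d s)
        (q s - q' s) (r s - r' s) (\<Theta> s) (gt s - gt' s) (gt s - gt' s)) (at s)"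
      by (rule dd[OF d(1) d'(1)]) (simp only: minus_diff_minus lyapunov_op_diff)
    show "((\<lambda>s. g s - g' s) has_vector_derivative - lyapunov_op (hA d s) (hB d s) (hC d s) (hD d s)
        (q s - q' s) (r s - r' s) (\<Theta>h s) (g s - g' s) (gt s - gt' s)) (at s)"
      by (rule dd[OF d(2) d'(2)]) (simp only: minus_diff_minus lyapunov_op_diff)
    show "((\<lambda>s. gh s - gh' s) has_vector_derivative - lyapunov_op (hA d s) (hB d s) (hC d s) (hD d s)
        (qh s - qh' s) (rh s - rh' s) (\<Theta>h s) (gh s - gh' s) (gt s - gt' s)) (at s)"
      by (rule dd[OF d(3) d'(3)]) (simp only: minus_diff_minus lyapunov_op_diff)
  qed
qed

text \<open>The bound may depend on the cell: positivity needs no more, and it has to precede the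
  uniform bounds.\<close>

definition gains_bounded where
  "gains_bounded N t m \<Theta> \<Theta>h \<longleftrightarrow>
     (\<forall>i. m \<le> i \<and> i < N \<longrightarrow> (\<exists>c. \<forall>s\<in>{t i<..<t (Suc i)}. norm (\<Theta> s) \<le> c \<and> norm (\<Theta>h s) \<le> c))"

text \<open>Gains jump at the nodes, so continuity is asked of functions on the closed cell that
  agree with them inside. These are the coefficients when the kernels are prolonged by a
  cell.\<close>

definition gains_continuous where
  "gains_continuous N t m \<Theta> \<Theta>h \<longleftrightarrow>
     (\<forall>i. m \<le> i \<and> i < N \<longrightarrow> (\<exists>\<theta> \<theta>h. continuous_on {t i..t (Suc i)} \<theta> \<and> continuous_on {t i..t (Suc i)} \<theta>h \<and>
        (\<forall>s\<in>{t i<..<t (Suc i)}. \<Theta> s = \<theta> s \<and> \<Theta>h s = \<theta>h s)))"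

lemma gains_bounded_of_continuous:
  fixes \<Theta> \<Theta>h :: "real \<Rightarrow> real^'n^'m"
  assumes "gains_continuous N t m \<Theta> \<Theta>h"
  shows "gains_bounded N t m \<Theta> \<Theta>h"
  unfolding gains_bounded_def
proof (intro allI impI)
  fix i assume i: "m \<le> i \<and> i < N"
  then obtain \<theta> \<theta>h where th: "continuous_on {t i..t (Suc i)} \<theta>" "continuous_on {t i..t (Suc i)} \<theta>h"
    "\<forall>s\<in>{t i<..<t (Suc i)}. \<Theta> s = \<theta> s \<and> \<Theta>h s = \<theta>h s"
    using assms unfolding gains_continuous_def by blast
  have "\<forall>\<^sub>F c::real in at_top. (\<forall>s\<in>{t i..t (Suc i)}. norm (\<theta> s) \<le> c) \<and> (\<forall>s\<in>{t i..t (Suc i)}. norm (\<theta>h s) \<le> c)"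
    using th by (intro eventually_conj eventually_norm_bound compact_Icc)
  then obtain c where "(\<forall>s\<in>{t i..t (Suc i)}. norm (\<theta> s) \<le> c) \<and> (\<forall>s\<in>{t i..t (Suc i)}. norm (\<theta>h s) \<le> c)"
    using eventually_happens[of _ "at_top :: real filter"] by force
  then show "\<exists>c. \<forall>s\<in>{t i<..<t (Suc i)}. norm (\<Theta> s) \<le> c \<and> norm (\<Theta>h s) \<le> c"
    using th(3) by (intro exI[of _ c]) auto
qed

text \<open>On each cell \<open>gt\<close> comes first, since its equation is self-contained, and
  then serves as a source for \<open>g\<close> and \<open>gh\<close>. At the left node
  \<open>gt\<close> restarts from \<open>g\<close>, so positivity of all three passes to the
  preceding cell.\<close>

lemma gamma_system_psd:
  fixes \<Theta> \<Theta>h :: "real \<Rightarrow> real^'n^'m"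
  assumes part: "is_partition T N t" and m: "m \<le> N"
    and sys: "gamma_system N t m \<Theta> \<Theta>h q r g0 qh rh gh0 gt g gh" and gains: "gains_bounded N t m \<Theta> \<Theta>h"
    and W: "\<And>s. s \<in> {t m..T} \<Longrightarrow> 0 \<preceq> q s \<and> 0 \<preceq> r s \<and> 0 \<preceq> qh s \<and> 0 \<preceq> rh s" "0 \<preceq> g0" "0 \<preceq> gh0"
    and s: "s \<in> {t m..T}"
  shows "0 \<preceq> gt s \<and> 0 \<preceq> g s \<and> 0 \<preceq> gh s"
proof (rule partition_backward_induct[OF part m s])
  have "gt T = g T" using gamma_system_node[OF sys m order_refl] partition_ends[OF part] by simp
  then show "0 \<preceq> gt T \<and> 0 \<preceq> g T \<and> 0 \<preceq> gh T"
    using sys W by (simp add: gamma_system_def)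
next
  fix i s assume i: "m \<le> i" "i < N" and nxt: "0 \<preceq> gt (t (Suc i)) \<and> 0 \<preceq> g (t (Suc i)) \<and> 0 \<preceq> gh (t (Suc i))"
    and s: "s \<in> {t i..<t (Suc i)}"
  let ?a = "t i" and ?b = "t (Suc i)"
  have tt: "t m \<le> ?a" "?a < ?b" "?b \<le> T" "0 \<le> ?a"
    using partition_le[OF part, of m i] partition_less[OF part, of i "Suc i"] partition_range[OF part, of "Suc i"]
      partition_range[OF part, of i] i by auto
  obtain c where c: "\<And>s. s \<in> {?a<..<?b} \<Longrightarrow> norm (\<Theta> s) \<le> c \<and> norm (\<Theta>h s) \<le> c"
    using gains i unfolding gains_bounded_def by metis
  define c' where "c' = max \<kappa> c"
  have bd: "norm (cA d s) \<le> c' \<and> norm (cB d s) \<le> c' \<and> norm (cC d s) \<le> c' \<and> norm (cD d s) \<le> c' \<and> norm (\<Theta> s) \<le> c'"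
    "norm (hA d s) \<le> c' \<and> norm (hB d s) \<le> c' \<and> norm (\<Theta>h s) \<le> c'" if "s \<in> {?a<..<?b}" for s
  proof -
    have "s \<in> {0..T}" using that tt by auto
    from coef_bound[OF this] c[OF that]
    show "norm (cA d s) \<le> c' \<and> norm (cB d s) \<le> c' \<and> norm (cC d s) \<le> c' \<and> norm (cD d s) \<le> c' \<and> norm (\<Theta> s) \<le> c'"
      "norm (hA d s) \<le> c' \<and> norm (hB d s) \<le> c' \<and> norm (\<Theta>h s) \<le> c'"
      by (simp_all add: c'_def le_max_iff_disj)
  qed
  have der: "(gt has_vector_derivative - lyapunov_op (cA d s) (cB d s) (cC d s) (cD d s) (q s) (r s) (\<Theta> s) (gt s) (gt s)) (at s)"
    "(g has_vector_derivative - lyapunov_op (hA d s) (hB d s) (hC d s) (hD d s) (q s) (r s) (\<Theta>h s) (g s) (gt s)) (at s)"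
    "(gh has_vector_derivative - lyapunov_op (hA d s) (hB d s) (hC d s) (hD d s) (qh s) (rh s) (\<Theta>h s) (gh s) (gt s)) (at s)"
    if "s \<in> {?a<..<?b}" for s
    using sys i that unfolding gamma_system_def by blast+
  have cont: "continuous_on {?a..?b} g" "continuous_on {?a..?b} gh"
    using sys tt unfolding gamma_system_def by (auto elim!: continuous_on_subset)
  have W': "0 \<preceq> q s" "0 \<preceq> r s" "0 \<preceq> qh s" "0 \<preceq> rh s" if "s \<in> {?a<..<?b}" for s
    using W(1)[of s] that tt by auto
  have 1: "0 \<preceq> gt s" if s: "s \<in> {?a<..?b}" for s
  proof (rule lyapunov_op_psd_self[where \<kappa>=c', OF gamma_system_continuous[OF sys i] der(1) bd(1) _ _ s])
    show "0 \<preceq> q s \<and> 0 \<preceq> r s" if "s \<in> {?a<..<?b}" for s using W'[OF that] by simp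
  qed (use nxt in simp_all)
  have YW: "0 \<preceq> q s \<and> 0 \<preceq> r s \<and> 0 \<preceq> gt s" "0 \<preceq> qh s \<and> 0 \<preceq> rh s \<and> 0 \<preceq> gt s" if "s \<in> {?a<..<?b}" for s
    using W'[OF that] 1[of s] that by simp_all
  have cont': "continuous_on {?a<..?b} g" "continuous_on {?a<..?b} gh"
    by (rule continuous_on_subset[OF cont(1)] continuous_on_subset[OF cont(2)], auto)+
  have 2: "0 \<preceq> g s" if s: "s \<in> {?a<..?b}" for s
    using nxt by (intro lyapunov_op_psd_given[where \<kappa>=c', OF cont'(1) der(2) bd(2) YW(1) _ s]) simp_all
  have 3: "0 \<preceq> gh s" if s: "s \<in> {?a<..?b}" for s
    using nxt by (intro lyapunov_op_psd_given[where \<kappa>=c', OF cont'(2) der(3) bd(2) YW(2) _ s]) simp_all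
  have "0 \<preceq> g ?a" "0 \<preceq> gh ?a"
    using psd_left_endpoint[OF cont(1) tt(2) 2] psd_left_endpoint[OF cont(2) tt(2) 3] by auto
  moreover have "gt ?a = g ?a" using gamma_system_node[OF sys i(1)] i by simp
  ultimately show "0 \<preceq> gt s \<and> 0 \<preceq> g s \<and> 0 \<preceq> gh s"
    using 1[of s] 2[of s] 3[of s] s by (cases "s = ?a") auto
qed

lemma gamma_system_extend:
  fixes \<Theta> \<Theta>h :: "real \<Rightarrow> real^'n^'m"
  assumes part: "is_partition T N t" and m: "m < N"
    and sys: "gamma_system N t (Suc m) \<Theta> \<Theta>h q r g0 qh rh gh0 gt g gh"
    and th: "continuous_on {t m..t (Suc m)} \<theta>" "continuous_on {t m..t (Suc m)} \<theta>h"
      "\<And>s. s \<in> {t m<..<t (Suc m)} \<Longrightarrow> \<Theta> s = \<theta> s \<and> \<Theta>h s = \<theta>h s"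
    and W: "continuous_on {t m..T} q" "continuous_on {t m..T} r" "continuous_on {t m..T} qh" "continuous_on {t m..T} rh"
  shows "\<exists>gt g gh. gamma_system N t m \<Theta> \<Theta>h q r g0 qh rh gh0 gt g gh"
proof -
  let ?a = "t m" and ?b = "t (Suc m)"
  have tt: "?a < ?b" "?b \<le> T" "0 \<le> ?a"
    using partition_less[OF part, of m "Suc m"] partition_range[OF part, of "Suc m"] partition_range[OF part, of m] m by auto
  have sub: "{?a..?b} \<subseteq> {0..T}" "{?a..?b} \<subseteq> {?a..T}" using tt by auto
  note cs = coef_continuous[THEN continuous_on_subset, OF sub(1)] and Ws = W[THEN continuous_on_subset, OF sub(2)]
  note sol = lyapunov_op_solution[OF less_imp_le[OF tt(1)]]
  obtain ht where ht: "ht ?b = g ?b" "\<And>s. s \<in> {?a..?b} \<Longrightarrow> (ht has_vector_derivative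
      - lyapunov_op (cA d s) (cB d s) (cC d s) (cD d s) (q s) (r s) (\<theta> s) (ht s) (ht s)) (at s within {?a..?b})"
    using sol[OF cs(1-4) Ws(1,2) th(1) continuous_on_const[of _ 0], of "g ?b" 1, simplified] by blast
  have cht: "continuous_on {?a..?b} ht" using ht(2) by (rule continuous_on_of_vector_derivative)
  obtain h where h: "h ?b = g ?b" "\<And>s. s \<in> {?a..?b} \<Longrightarrow> (h has_vector_derivative
      - lyapunov_op (hA d s) (hB d s) (hC d s) (hD d s) (q s) (r s) (\<theta>h s) (h s) (ht s)) (at s within {?a..?b})"
    using sol[OF cs(5-8) Ws(1,2) th(2) cht, of "g ?b" 0, simplified] by blast
  obtain hh where hh: "hh ?b = gh ?b" "\<And>s. s \<in> {?a..?b} \<Longrightarrow> (hh has_vector_derivative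
      - lyapunov_op (hA d s) (hB d s) (hC d s) (hD d s) (qh s) (rh s) (\<theta>h s) (hh s) (ht s)) (at s within {?a..?b})"
    using sol[OF cs(5-8) Ws(3,4) th(2) cht, of "gh ?b" 0, simplified] by blast
  have ch: "continuous_on {?a..?b} h" "continuous_on {?a..?b} hh"
    by (rule continuous_on_of_vector_derivative[OF h(2)] continuous_on_of_vector_derivative[OF hh(2)], assumption)+
  \<comment> \<open>Three branches: the left node takes the value of \<open>h\<close> as the system
    demands, the open cell the new solution, and from the right node on nothing changes. The new
    solution joins on because \<open>gt\<close> and \<open>g\<close> agree at that node.\<close>
  define Gt where "Gt s = (if s = ?a then h ?a else if s < ?b then ht s else gt s)" for s
  define G where "G s = (if s \<le> ?b then h s else g s)" for s
  define Gh where "Gh s = (if s \<le> ?b then hh s else gh s)" for s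
  have union: "{?a..T} = {?a..?b} \<union> {?b..T}" using tt by auto
  have sg: "continuous_on {?b..T} g" "continuous_on {?b..T} gh"
    using sys by (simp_all add: gamma_system_def)
  have cG: "continuous_on {?a..T} G" "continuous_on {?a..T} Gh"
    unfolding G_def[abs_def] Gh_def[abs_def] union
    by (rule continuous_on_cases[OF closed_atLeastAtMost closed_atLeastAtMost ch(1) sg(1)]
          continuous_on_cases[OF closed_atLeastAtMost closed_atLeastAtMost ch(2) sg(2)],
        use h(1) hh(1) in force)+
  have node: "gt ?b = g ?b" using sys by (simp add: gamma_system_def)
  have new: "(Gt has_vector_derivative - lyapunov_op (cA d s) (cB d s) (cC d s) (cD d s) (q s) (r s) (\<Theta> s) (Gt s) (Gt s)) (at s)"
    "(G has_vector_derivative - lyapunov_op (hA d s) (hB d s) (hC d s) (hD d s) (q s) (r s) (\<Theta>h s) (G s) (Gt s)) (at s)"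
    "(Gh has_vector_derivative - lyapunov_op (hA d s) (hB d s) (hC d s) (hD d s) (qh s) (rh s) (\<Theta>h s) (Gh s) (Gt s)) (at s)"
    if s: "s \<in> {?a<..<?b}" for s
  proof -
    have e: "Gt s = ht s" "G s = h s" "Gh s = hh s" and s': "s \<in> {?a..?b}"
      using s by (auto simp: Gt_def G_def Gh_def)
    have d: "(ht has_vector_derivative - lyapunov_op (cA d s) (cB d s) (cC d s) (cD d s) (q s) (r s) (\<Theta> s) (ht s) (ht s)) (at s)"
      "(h has_vector_derivative - lyapunov_op (hA d s) (hB d s) (hC d s) (hD d s) (q s) (r s) (\<Theta>h s) (h s) (ht s)) (at s)"
      "(hh has_vector_derivative - lyapunov_op (hA d s) (hB d s) (hC d s) (hD d s) (qh s) (rh s) (\<Theta>h s) (hh s) (ht s)) (at s)"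
      using has_vector_derivative_at_of_within[OF ht(2)[OF s'] s] has_vector_derivative_at_of_within[OF h(2)[OF s'] s]
        has_vector_derivative_at_of_within[OF hh(2)[OF s'] s] th(3)[OF s] by simp_all
    note tr = has_vector_derivative_transform_within_open[OF _ open_greaterThanLessThan s]
    show "(Gt has_vector_derivative - lyapunov_op (cA d s) (cB d s) (cC d s) (cD d s) (q s) (r s) (\<Theta> s) (Gt s) (Gt s)) (at s)"
      unfolding e by (rule tr[OF d(1)]) (simp add: Gt_def)
    show "(G has_vector_derivative - lyapunov_op (hA d s) (hB d s) (hC d s) (hD d s) (q s) (r s) (\<Theta>h s) (G s) (Gt s)) (at s)"
      unfolding e by (rule tr[OF d(2)]) (simp add: G_def)
    show "(Gh has_vector_derivative - lyapunov_op (hA d s) (hB d s) (hC d s) (hD d s) (qh s) (rh s) (\<Theta>h s) (Gh s) (Gt s)) (at s)"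
      unfolding e by (rule tr[OF d(3)]) (simp add: Gh_def)
  qed
  have Gtb: "Gt ?b = G ?b" using tt node h(1) by (auto simp: Gt_def G_def)
  have left: "(Gt \<longlongrightarrow> Gt ?b) (at_left ?b)"
  proof -
    have "(ht \<longlongrightarrow> ht ?b) (at ?b within {?a..?b})" using cht tt by (auto simp: continuous_on_def)
    then have "(ht \<longlongrightarrow> ht ?b) (at_left ?b)" using tt by (simp add: at_within_Icc_at_left)
    moreover have "\<forall>\<^sub>F s in at_left ?b. ht s = Gt s"
      unfolding eventually_at_left_field using tt by (intro exI[of _ ?a]) (auto simp: Gt_def)
    moreover have "ht ?b = Gt ?b" using ht(1) Gtb h(1) by (simp add: G_def)
    ultimately show ?thesis by (simp add: tendsto_cong)
  qed
  have old: "Gt s = gt s" "G s = g s" "Gh s = gh s" if "s \<in> {?b..}" for s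
    using that tt h(1) hh(1) by (auto simp: Gt_def G_def Gh_def)
  have "gamma_system N t m \<Theta> \<Theta>h q r g0 qh rh gh0 Gt G Gh"
    unfolding gamma_system_def
  proof (intro conjI allI impI)
    show "G T = g0" "Gh T = gh0" using old[of T] tt sys by (auto simp: gamma_system_def)
    show "Gt ?a = G ?a" using tt by (simp add: Gt_def G_def)
    fix i assume i: "m \<le> i \<and> i < N"
    show "Gt (t (Suc i)) = G (t (Suc i))" (is ?A)
      and "(Gt \<longlongrightarrow> Gt (t (Suc i))) (at_left (t (Suc i)))" (is ?B)
      and "\<forall>s\<in>{t i<..<t (Suc i)}.
         (Gt has_vector_derivative - lyapunov_op (cA d s) (cB d s) (cC d s) (cD d s) (q s) (r s) (\<Theta> s) (Gt s) (Gt s)) (at s) \<and>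
         (G has_vector_derivative - lyapunov_op (hA d s) (hB d s) (hC d s) (hD d s) (q s) (r s) (\<Theta>h s) (G s) (Gt s)) (at s) \<and>
         (Gh has_vector_derivative - lyapunov_op (hA d s) (hB d s) (hC d s) (hD d s) (qh s) (rh s) (\<Theta>h s) (Gh s) (Gt s)) (at s)" (is ?C)
    proof -
      have "(?A \<and> ?B) \<and> ?C"
      proof (cases "i = m")
        case True
        then show ?thesis using Gtb left new by auto
      next
        case False
        then have i': "Suc m \<le> i" "i < N" using i by auto
        have ti: "?b \<le> t i" "t i < t (Suc i)"
          using partition_le[OF part i'(1)] partition_less[OF part, of i "Suc i"] i' by auto
        have sysi: "gt (t (Suc i)) = g (t (Suc i))" "(gt \<longlongrightarrow> gt (t (Suc i))) (at_left (t (Suc i)))"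
          using sys i' by (auto simp: gamma_system_def)
        have "\<forall>\<^sub>F s in at_left (t (Suc i)). gt s = Gt s"
          unfolding eventually_at_left_field using ti old by (intro exI[of _ "t i"]) auto
        then have "(Gt \<longlongrightarrow> gt (t (Suc i))) (at_left (t (Suc i)))"
          using sysi(2) by (simp add: tendsto_cong)
        moreover have ?C
        proof
          fix s assume s: "s \<in> {t i<..<t (Suc i)}"
          have e: "Gt s = gt s" "G s = g s" "Gh s = gh s" using old[of s] s ti by auto
          have d1: "(gt has_vector_derivative - lyapunov_op (cA d s) (cB d s) (cC d s) (cD d s) (q s) (r s) (\<Theta> s) (gt s) (gt s)) (at s)"
            "(g has_vector_derivative - lyapunov_op (hA d s) (hB d s) (hC d s) (hD d s) (q s) (r s) (\<Theta>h s) (g s) (gt s)) (at s)"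
            "(gh has_vector_derivative - lyapunov_op (hA d s) (hB d s) (hC d s) (hD d s) (qh s) (rh s) (\<Theta>h s) (gh s) (gt s)) (at s)"
            using sys i' s unfolding gamma_system_def by blast+
          have tr: "(X has_vector_derivative D) (at s)"
            if "(Y has_vector_derivative D) (at s)" "\<And>u. u \<in> {t i<..<t (Suc i)} \<Longrightarrow> Y u = X u" for X Y :: "real \<Rightarrow> real^'n^'n" and D
            by (rule has_vector_derivative_transform_within_open[OF that(1) open_greaterThanLessThan s that(2)])
          show "(Gt has_vector_derivative - lyapunov_op (cA d s) (cB d s) (cC d s) (cD d s) (q s) (r s) (\<Theta> s) (Gt s) (Gt s)) (at s) \<and>
            (G has_vector_derivative - lyapunov_op (hA d s) (hB d s) (hC d s) (hD d s) (q s) (r s) (\<Theta>h s) (G s) (Gt s)) (at s) \<and>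
            (Gh has_vector_derivative - lyapunov_op (hA d s) (hB d s) (hC d s) (hD d s) (qh s) (rh s) (\<Theta>h s) (Gh s) (Gt s)) (at s)"
            unfolding e using old ti by (intro conjI tr[OF d1(1)] tr[OF d1(2)] tr[OF d1(3)]) auto
        qed
        ultimately show ?thesis using old[of "t (Suc i)"] sysi(1) ti by auto
      qed
      then show ?A ?B ?C by blast+
    qed
  qed (rule cG)+
  then show ?thesis by blast
qed

lemma frozen_system_exists:
  fixes \<Theta> \<Theta>h :: "real \<Rightarrow> real^'n^'m"
  assumes part: "is_partition T N t" and m: "m \<le> N" and \<tau>: "\<tau> \<in> {0..T}" and gains: "gains_continuous N t m \<Theta> \<Theta>h"
  shows "\<exists>gt g gh. frozen_system N t m \<Theta> \<Theta>h \<tau> gt g gh"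
  using m gains
proof (induction rule: inc_induct)
  case base
  show ?case
    unfolding frozen_system_def gamma_system_def using partition_ends[OF part]
    by (intro exI[of _ "\<lambda>_. cG d \<tau>"] exI[of _ "\<lambda>_. hG d \<tau>"]) auto
next
  case (step n)
  have "gains_continuous N t (Suc n) \<Theta> \<Theta>h" using step.prems by (auto simp: gains_continuous_def)
  then obtain gt g gh where sys: "frozen_system N t (Suc n) \<Theta> \<Theta>h \<tau> gt g gh" using step.IH by blast
  obtain \<theta> \<theta>h where th: "continuous_on {t n..t (Suc n)} \<theta>" "continuous_on {t n..t (Suc n)} \<theta>h"
      "\<And>s. s \<in> {t n<..<t (Suc n)} \<Longrightarrow> \<Theta> s = \<theta> s \<and> \<Theta>h s = \<theta>h s"
    using step.prems step.hyps unfolding gains_continuous_def by (metis order_refl)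
  have sub: "{t n..T} \<subseteq> {0..T}" using partition_range[OF part, of n] step.hyps by auto
  show ?case
    using gamma_system_extend[OF part step.hyps(2) sys[unfolded frozen_system_def] th weight_continuous_on(1,3,2,4)[OF sub \<tau>]]
    unfolding frozen_system_def by blast
qed

end

section \<open>Existence and positivity of the scheme\<close>

context lq_problem
begin

lemma infdist_psd_lower:
  fixes M :: "real^'n^'n"
  assumes "infdist M {M. 0 \<preceq> M} \<le> r"
  shows "- r * (x \<bullet> x) \<le> x \<bullet> (M *v x)"
proof -
  obtain k where k: "0 \<preceq> k" "infdist M {M. 0 \<preceq> M} = dist M k"
    using infdist_attains_inf[OF closed_psd, of M] loewner_refl[of "0 :: real^'n^'n"] by blast
  have "- r * (x \<bullet> x) \<le> - norm (M - k) * (x \<bullet> x)"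
    using assms k(2) by (intro mult_right_mono) (auto simp: dist_norm)
  also have "\<dots> \<le> x \<bullet> ((M - k) *v x)" by (rule quadratic_form_lower)
  also have "\<dots> \<le> x \<bullet> (M *v x)"
    using k(1) by (simp add: psd_iff matrix_vector_bilinear inner_diff_right)
  finally show ?thesis .
qed

text \<open>This concerns any solution, since convergence is claimed for every scheme. The distance
  of \<open>P\<close> to the positive cone is the bootstrap quantity; \<open>Ph\<close> does not
  enter the inverted matrices.\<close>

lemma riccati_pair_psd_bootstrap:
  assumes ric: "riccati_pair \<tau> a b P Ph" and ab: "0 \<le> \<tau>" "\<tau> \<le> a" "a \<le> b" "b \<le> T"
    and fin: "0 \<preceq> P b" "0 \<preceq> Ph b" and s: "s \<in> {a..b}"
  shows "0 \<preceq> P s \<and> 0 \<preceq> Ph s"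
proof -
  let ?psd = "{M :: real^'n^'n. 0 \<preceq> M}"
  have "infdist (P u) ?psd \<le> 0" if "u \<in> {a..b}" for u
  proof (rule backward_bootstrap[where \<phi>="\<lambda>u. infdist (P u) ?psd" and b=b and r=lower_radius])
    show "continuous_on {a..b} (\<lambda>u. infdist (P u) ?psd)"
      by (intro continuous_intros riccati_pair_continuous[OF ric])
    show "infdist (P b) ?psd \<le> 0" using fin by simp
    fix u assume u: "u \<in> {a..b}" and le: "\<forall>v\<in>{u..b}. infdist (P v) ?psd \<le> lower_radius"
    have r: "riccati_pair \<tau> u b P Ph" using u by (intro riccati_pair_subinterval[OF ric]) auto
    have "0 \<preceq> P u"
      using u ab le by (intro riccati_pair_psd(1)[OF r _ _ _ _ infdist_psd_lower fin]) auto
    then show "infdist (P u) ?psd \<le> 0" by simp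
  qed (use lower_radius that in auto)
  then have "- lower_radius * (x \<bullet> x) \<le> x \<bullet> (P u *v x)" if "u \<in> {a..b}" for u x
    using that lower_radius by (intro infdist_psd_lower) force
  then show ?thesis
    using riccati_pair_psd[OF ric ab _ fin s] by blast
qed

lemma P_equations_riccati:
  "P_equations d t S k \<Longrightarrow> riccati_pair (t k) (t k) (t (Suc k)) (Pk S k) (Pk_hat S k)"
  by (auto simp: P_equations_def riccati_pair_def)

text \<open>The recursion stopped at index \<open>m\<close>, which is the induction hypothesis of
  the backward construction.\<close>

definition scheme_from where
  "scheme_from N t m S \<longleftrightarrow>
    (\<forall>k. m \<le> k \<and> k < N \<longrightarrow> Gam_equations d T N t S k \<and> P_equations d t S k \<and> Th_equations d N t S k)"

definition scheme_psd_at where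
  "scheme_psd_at t S k \<longleftrightarrow>
    (\<forall>s\<in>{t (Suc k)..T}. 0 \<preceq> Gam_tilde S k s \<and> 0 \<preceq> Gam S k s \<and> 0 \<preceq> Gam_hat S k s) \<and>
    (\<forall>s\<in>{t k..t (Suc k)}. 0 \<preceq> Pk S k s \<and> 0 \<preceq> Pk_hat S k s)"

lemma frozen_system_psd:
  fixes \<Theta> \<Theta>h :: "real \<Rightarrow> real^'n^'m"
  assumes "is_partition T N t" "m \<le> N" "frozen_system N t m \<Theta> \<Theta>h \<tau> gt g gh" "gains_bounded N t m \<Theta> \<Theta>h"
    "0 \<le> \<tau>" "\<tau> \<le> t m" "s \<in> {t m..T}"
  shows "0 \<preceq> gt s \<and> 0 \<preceq> g s \<and> 0 \<preceq> gh s"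
proof (rule gamma_system_psd[OF assms(1,2) assms(3)[unfolded frozen_system_def] assms(4) _ _ _ assms(7)])
  have "\<tau> \<le> T" using assms by auto
  then show "0 \<preceq> cG d \<tau>" "0 \<preceq> hG d \<tau>" using terminal_psd[of \<tau>] assms by auto
  fix s assume "s \<in> {t m..T}"
  then have "\<tau> \<le> s" "s \<le> T" using assms by auto
  then show "0 \<preceq> cQ d s \<tau> \<and> 0 \<preceq> cR d s \<tau> \<and> 0 \<preceq> hQ d s \<tau> \<and> 0 \<preceq> hR d s \<tau>"
    using weight_psd'[of \<tau> s] assms by auto
qed

text \<open>Positivity of \<open>Pk\<close> makes the inverted matrices coercive, so the feedback
  formula is continuous up to both ends of the cell, where the gain itself may switch to the formula
  of the next cell.\<close>

lemma scheme_gains_continuous: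
  assumes part: "is_partition T N t" and S: "scheme_from N t m S"
    and psd: "\<And>j. m \<le> j \<Longrightarrow> j < N \<Longrightarrow> scheme_psd_at t S j"
  shows "gains_continuous N t m (Th S) (Th_hat S)"
  unfolding gains_continuous_def
proof (intro allI impI)
  fix i assume i: "m \<le> i \<and> i < N"
  have sub: "{t i..t (Suc i)} \<subseteq> {0..T}" "t i \<in> {0..T}" "t i < t (Suc i)"
    using partition_range[OF part, of i] partition_range[OF part, of "Suc i"] partition_less[OF part, of i "Suc i"] i by auto
  have eqs: "P_equations d t S i" "Th_equations d N t S i" using S i by (auto simp: scheme_from_def)
  note cP = riccati_pair_continuous[OF P_equations_riccati[OF eqs(1)]]
  note cs = coef_continuous[THEN continuous_on_subset, OF sub(1)] weight_continuous_on[OF sub(1,2)]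
  have psd: "0 \<preceq> Pk S i s" if "s \<in> {t i..t (Suc i)}" for s
    using psd[of i] i that by (auto simp: scheme_psd_at_def)
  have co: "coercive (\<delta> / 2) (cR d s (t i) + transpose (cD d s) ** Pk S i s ** cD d s)"
    "coercive (\<delta> / 2) (hR d s (t i) + transpose (hD d s) ** Pk S i s ** hD d s)" if "s \<in> {t i..t (Suc i)}" for s
    using that sub psd[OF that] by (auto intro!: gram_coercive_psd)
  have \<delta>2: "0 < \<delta> / 2" using \<delta>_pos by simp
  show "\<exists>\<theta> \<theta>h. continuous_on {t i..t (Suc i)} \<theta> \<and> continuous_on {t i..t (Suc i)} \<theta>h \<and>
        (\<forall>s\<in>{t i<..<t (Suc i)}. Th S s = \<theta> s \<and> Th_hat S s = \<theta>h s)"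
  proof (intro exI conjI ballI)
    show "continuous_on {t i..t (Suc i)} (\<lambda>s. feedback_gain (cB d s) (cC d s) (cD d s) (cR d s (t i)) (Pk S i s) (Pk S i s))"
      by (intro continuous_on_feedback_gain[OF \<delta>2 co(1)] cs cP)
    show "continuous_on {t i..t (Suc i)} (\<lambda>s. feedback_gain (hB d s) (hC d s) (hD d s) (hR d s (t i)) (Pk_hat S i s) (Pk S i s))"
      by (intro continuous_on_feedback_gain[OF \<delta>2 co(2)] cs cP)
    fix s assume "s \<in> {t i<..<t (Suc i)}"
    then have "s \<in> (if Suc i = N then {t i..t (Suc i)} else {t i..<t (Suc i)})" by auto
    then show "Th S s = feedback_gain (cB d s) (cC d s) (cD d s) (cR d s (t i)) (Pk S i s) (Pk S i s)"
      "Th_hat S s = feedback_gain (hB d s) (hC d s) (hD d s) (hR d s (t i)) (Pk_hat S i s) (Pk S i s)"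
      using eqs(2) unfolding Th_equations_def by blast+
  qed
qed

text \<open>Positivity for the later indices bounds the gains on the later cells. This makes the
  kernels of index \<open>k\<close> positive there, in particular the terminal values of
  \<open>Pk\<close> and \<open>Pk_hat\<close>, and the bootstrap carries positivity over the cell of
  \<open>k\<close>.\<close>

lemma scheme_psd:
  assumes part: "is_partition T N t" and S: "scheme_from N t m S" and k: "m \<le> k" "k < N"
  shows "scheme_psd_at t S k"
  using k
proof (induction "N - k" arbitrary: k rule: less_induct)
  case less
  have Sk: "scheme_from N t (Suc k) S" using S less.prems by (auto simp: scheme_from_def)
  have "gains_continuous N t (Suc k) (Th S) (Th_hat S)"
    using less by (intro scheme_gains_continuous[OF part Sk]) auto
  then have gains: "gains_bounded N t (Suc k) (Th S) (Th_hat S)"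
    by (rule gains_bounded_of_continuous)
  have eqs: "Gam_equations d T N t S k" "P_equations d t S k" using S less.prems by (auto simp: scheme_from_def)
  have tt: "0 \<le> t k" "t k < t (Suc k)" "t (Suc k) \<le> T"
    using partition_range[OF part, of k] partition_range[OF part, of "Suc k"] partition_less[OF part, of k "Suc k"] less.prems by auto
  have 1: "0 \<preceq> Gam_tilde S k s \<and> 0 \<preceq> Gam S k s \<and> 0 \<preceq> Gam_hat S k s" if "s \<in> {t (Suc k)..T}" for s
    using less.prems tt that
    by (intro frozen_system_psd[OF part _ frozen_system_of_Gam_equations[OF eqs(1)] gains]) auto
  have "Pk S k (t (Suc k)) = Gam S k (t (Suc k))" "Pk_hat S k (t (Suc k)) = Gam_hat S k (t (Suc k))"
    using eqs(2) by (auto simp: P_equations_def)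
  then have "0 \<preceq> Pk S k s \<and> 0 \<preceq> Pk_hat S k s" if "s \<in> {t k..t (Suc k)}" for s
    using tt that 1[of "t (Suc k)"]
    by (intro riccati_pair_psd_bootstrap[OF P_equations_riccati[OF eqs(2)]]) auto
  with 1 show ?case by (auto simp: scheme_psd_at_def)
qed

text \<open>Gains enter only on the open cells from \<open>m\<close> on, so redefining them further
  left does not disturb equations already solved.\<close>

lemma frozen_system_cong:
  assumes "frozen_system N t m \<Theta> \<Theta>h \<tau> gt g gh"
    and "\<And>i s. m \<le> i \<Longrightarrow> i < N \<Longrightarrow> s \<in> {t i<..<t (Suc i)} \<Longrightarrow> \<Theta>' s = \<Theta> s \<and> \<Theta>h' s = \<Theta>h s"
  shows "frozen_system N t m \<Theta>' \<Theta>h' \<tau> gt g gh"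
proof -
  note F = assms(1)[unfolded frozen_system_def gamma_system_def]
  have eq: "\<Theta>' s = \<Theta> s" "\<Theta>h' s = \<Theta>h s" if "m \<le> i \<and> i < N" "s \<in> {t i<..<t (Suc i)}" for i s
    using assms(2) that by blast+
  show ?thesis
    unfolding frozen_system_def gamma_system_def
    apply (intro conjI allI impI ballI)
    using F apply blast
    using F apply blast
    using F apply blast
    using F apply blast
    using F apply blast
    using F apply blast
    using F apply blast
    apply (simp only: eq) using F apply blast
    apply (simp only: eq) using F apply blast
    apply (simp only: eq) using F by blast
qed

lemma scheme_exists:
  assumes part: "is_partition T N t"
  shows "\<exists>S. is_scheme d T N t S"
proof -
  have "0 \<le> N" by simp
  then have "\<exists>S. scheme_from N t 0 S"
  proof (induction rule: inc_induct)
    case base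
    \<comment> \<open>At m = N no index is left, so any record will do.\<close>
    show ?case unfolding scheme_from_def by (intro exI[of _ undefined] allI impI) auto
  next
    case (step m)
    then obtain S where S: "scheme_from N t (Suc m) S" by blast
    have tt: "0 \<le> t m" "t m < t (Suc m)" "t (Suc m) \<le> T"
      using partition_range[OF part, of m] partition_range[OF part, of "Suc m"] partition_less[OF part, of m "Suc m"] step.hyps by auto
    have gains: "gains_continuous N t (Suc m) (Th S) (Th_hat S)"
      using scheme_psd[OF part S] by (intro scheme_gains_continuous[OF part S]) auto
    have Sm: "Suc m \<le> N" and tm: "t m \<in> {0..T}" using step.hyps tt by auto
    obtain gt g gh where sys: "frozen_system N t (Suc m) (Th S) (Th_hat S) (t m) gt g gh"
      using frozen_system_exists[OF part Sm tm gains] by blast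
    have psd: "0 \<preceq> g (t (Suc m))" "0 \<preceq> gh (t (Suc m))"
      using frozen_system_psd[OF part Sm sys gains_bounded_of_continuous[OF gains], of "t (Suc m)"] tt by auto
    obtain P Ph where P: "riccati_pair (t m) (t m) (t (Suc m)) P Ph" "P (t (Suc m)) = g (t (Suc m))"
      "Ph (t (Suc m)) = gh (t (Suc m))" "\<And>s. s \<in> {t m..t (Suc m)} \<Longrightarrow> 0 \<preceq> P s \<and> 0 \<preceq> Ph s"
      using riccati_pair_exists[OF tt(1) order_refl _ tt(3) psd] tt(2) by auto
    \<comment> \<open>The last cell is closed at \<open>T\<close>, so for \<open>Suc m = N\<close>
      the gain is set at every time; otherwise only strictly to the left of the right node.\<close>
    define new where "new s \<longleftrightarrow> s < t (Suc m) \<or> Suc m = N" for s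
    define S' where "S' = S\<lparr>Gam_tilde := (Gam_tilde S)(m := gt), Gam := (Gam S)(m := g),
      Gam_bar := (Gam_bar S)(m := (\<lambda>s. gh s - g s)), Pk := (Pk S)(m := P), Pk_hat := (Pk_hat S)(m := Ph),
      Th := (\<lambda>s. if new s then feedback_gain (cB d s) (cC d s) (cD d s) (cR d s (t m)) (P s) (P s) else Th S s),
      Th_hat := (\<lambda>s. if new s then feedback_gain (hB d s) (hC d s) (hD d s) (hR d s (t m)) (Ph s) (P s) else Th_hat S s)\<rparr>"
    have old: "\<not> new s" if "Suc m \<le> i" "i < N" "t i \<le> s" for i s
      using partition_le[OF part, of "Suc m" i] that by (auto simp: new_def)
    have cong: "Th S' s = Th S s \<and> Th_hat S' s = Th_hat S s" if "Suc m \<le> i" "i < N" "s \<in> {t i<..<t (Suc i)}" for i s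
      using old[OF that(1,2), of s] that(3) by (simp add: S'_def)
    have "Gam_equations d T N t S' k \<and> P_equations d t S' k \<and> Th_equations d N t S' k" if k: "m \<le> k" "k < N" for k
    proof (cases "k = m")
      case True
      have "frozen_system N t (Suc m) (Th S') (Th_hat S') (t m) (Gam_tilde S' m) (Gam S' m) gh"
        using frozen_system_cong[OF sys cong] by (simp add: S'_def)
      then have "Gam_equations d T N t S' m"
        by (rule Gam_equations_of_frozen_system) (simp add: S'_def)
      moreover have "P_equations d t S' m"
        unfolding P_equations_def
      proof (intro conjI ballI)
        show "Pk S' m (t (Suc m)) = Gam S' m (t (Suc m))" "Pk_hat S' m (t (Suc m)) = Gam_hat S' m (t (Suc m))"
          using P(2,3) by (simp_all add: S'_def Gam_hat_def)
        fix s assume s: "s \<in> {t m..t (Suc m)}"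
        show "sym_mat (Pk S' m s)" "sym_mat (Pk_hat S' m s)"
          using P(4)[OF s] by (simp_all add: S'_def psd_iff)
        have "coercive (\<delta> / 2) (cR d s (t m) + transpose (cD d s) ** P s ** cD d s)"
          "coercive (\<delta> / 2) (hR d s (t m) + transpose (hD d s) ** P s ** hD d s)"
          using s tt P(4)[OF s] by (auto intro!: gram_coercive_psd)
        then show "invertible (cR d s (t m) + transpose (cD d s) ** Pk S' m s ** cD d s)"
          "invertible (hR d s (t m) + transpose (hD d s) ** Pk S' m s ** hD d s)"
          using \<delta>_pos by (auto simp: S'_def intro: coercive_invertible[of "\<delta> / 2"])
        show "(Pk S' m has_vector_derivative - riccati_op (cA d s) (cB d s) (cC d s) (cD d s) (cQ d s (t m)) (cR d s (t m))
               (Pk S' m s) (Pk S' m s)) (at s within {t m..t (Suc m)})"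
          "(Pk_hat S' m has_vector_derivative - riccati_op (hA d s) (hB d s) (hC d s) (hD d s) (hQ d s (t m)) (hR d s (t m))
               (Pk_hat S' m s) (Pk S' m s)) (at s within {t m..t (Suc m)})"
          using P(1) s by (simp_all add: S'_def riccati_pair_def)
      qed
      moreover have "Th_equations d N t S' m"
        using old by (auto simp: Th_equations_def S'_def new_def split: if_splits)
      ultimately show ?thesis using True by simp
    next
      case False
      then have k': "Suc m \<le> k" using k by simp
      have eqs: "Gam_equations d T N t S k" "P_equations d t S k" "Th_equations d N t S k"
        using S k' k by (auto simp: scheme_from_def)
      have same: "Gam_tilde S' k = Gam_tilde S k" "Gam S' k = Gam S k" "Gam_bar S' k = Gam_bar S k"
        "Pk S' k = Pk S k" "Pk_hat S' k = Pk_hat S k" "Gam_hat S' k = Gam_hat S k"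
        using False by (auto simp: S'_def Gam_hat_def[abs_def])
      have "frozen_system N t (Suc k) (Th S') (Th_hat S') (t k) (Gam_tilde S' k) (Gam S' k) (Gam_hat S' k)"
        unfolding same
      proof (rule frozen_system_cong[OF frozen_system_of_Gam_equations[OF eqs(1)]])
        fix i s assume "Suc k \<le> i" "i < N" and s: "s \<in> {t i<..<t (Suc i)}"
        with k' show "Th S' s = Th S s \<and> Th_hat S' s = Th_hat S s"
          using cong[OF _ _ s] by simp
      qed
      then have "Gam_equations d T N t S' k"
        by (rule Gam_equations_of_frozen_system) (auto simp: Gam_hat_def)
      moreover have "P_equations d t S' k = P_equations d t S k"
        by (simp only: P_equations_def same)
      moreover have "Th_equations d N t S' k"
        unfolding Th_equations_def
      proof
        fix s assume s: "s \<in> (if Suc k = N then {t k..t (Suc k)} else {t k..<t (Suc k)})"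
        then have "\<not> new s" by (intro old[OF k' k(2)]) (auto split: if_splits)
        then have "Th S' s = Th S s" "Th_hat S' s = Th_hat S s" by (simp_all add: S'_def)
        then show "Th S' s = feedback_gain (cB d s) (cC d s) (cD d s) (cR d s (t k)) (Pk S' k s) (Pk S' k s) \<and>
          Th_hat S' s = feedback_gain (hB d s) (hC d s) (hD d s) (hR d s (t k)) (Pk_hat S' k s) (Pk S' k s)"
          using eqs(3) s unfolding Th_equations_def same by metis
      qed
      ultimately show ?thesis using eqs(2) by simp
    qed
    then show ?case unfolding scheme_from_def by blast
  qed
  then show ?thesis by (auto simp: scheme_from_def is_scheme_def)
qed

end

section \<open>A priori bounds\<close>

context lq_problem
begin

lemma is_scheme_from: "is_scheme d T N t S \<Longrightarrow> scheme_from N t 0 S"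
  by (simp add: is_scheme_def scheme_from_def)

lemma is_scheme_psd:
  assumes "is_partition T N t" "is_scheme d T N t S" "k < N"
  shows "s \<in> {t (Suc k)..T} \<Longrightarrow> 0 \<preceq> Gam_tilde S k s" "s \<in> {t (Suc k)..T} \<Longrightarrow> 0 \<preceq> Gam S k s"
    "s \<in> {t (Suc k)..T} \<Longrightarrow> 0 \<preceq> Gam_hat S k s" "s \<in> {t k..t (Suc k)} \<Longrightarrow> 0 \<preceq> Pk S k s"
    "s \<in> {t k..t (Suc k)} \<Longrightarrow> 0 \<preceq> Pk_hat S k s"
  using scheme_psd[OF assms(1) is_scheme_from[OF assms(2)] _ assms(3)] by (auto simp: scheme_psd_at_def)

lemma is_scheme_gains_bounded:
  assumes "is_partition T N t" "is_scheme d T N t S"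
  shows "gains_bounded N t m (Th S) (Th_hat S)"
proof -
  have "gains_bounded N t 0 (Th S) (Th_hat S)"
    using scheme_psd[OF assms(1) is_scheme_from[OF assms(2)]]
    by (intro gains_bounded_of_continuous scheme_gains_continuous[OF assms(1) is_scheme_from[OF assms(2)]]) auto
  then show ?thesis by (simp add: gains_bounded_def)
qed

lemma is_scheme_frozen_system:
  assumes "is_scheme d T N t S" "k < N"
  shows "frozen_system N t (Suc k) (Th S) (Th_hat S) (t k) (Gam_tilde S k) (Gam S k) (Gam_hat S k)"
  using assms by (auto simp: is_scheme_def intro: frozen_system_of_Gam_equations)

lemma is_scheme_riccati_pair:
  assumes "is_scheme d T N t S" "k < N"
  shows "riccati_pair (t k) (t k) (t (Suc k)) (Pk S k) (Pk_hat S k)"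
    "Pk S k (t (Suc k)) = Gam S k (t (Suc k))" "Pk_hat S k (t (Suc k)) = Gam_hat S k (t (Suc k))"
  using assms P_equations_riccati[of t S k] by (auto simp: is_scheme_def P_equations_def)

lemma is_scheme_gain:
  assumes "is_scheme d T N t S" "k < N" "s \<in> {t k..<t (Suc k)}"
  shows "Th S s = feedback_gain (cB d s) (cC d s) (cD d s) (cR d s (t k)) (Pk S k s) (Pk S k s)"
    "Th_hat S s = feedback_gain (hB d s) (hC d s) (hD d s) (hR d s (t k)) (Pk_hat S k s) (Pk S k s)"
proof -
  have "s \<in> (if Suc k = N then {t k..t (Suc k)} else {t k..<t (Suc k)})" using assms(3) by auto
  moreover have "Th_equations d N t S k" using assms by (simp add: is_scheme_def)
  ultimately show "Th S s = feedback_gain (cB d s) (cC d s) (cD d s) (cR d s (t k)) (Pk S k s) (Pk S k s)"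
    "Th_hat S s = feedback_gain (hB d s) (hC d s) (hD d s) (hR d s (t k)) (Pk_hat S k s) (Pk S k s)"
    unfolding Th_equations_def by blast+
qed

lemma gamma_system_restrict:
  assumes sys: "gamma_system N t m \<Theta> \<Theta>h q r g0 qh rh gh0 gt g gh" and part: "is_partition T N t"
    and m: "m \<le> m'" "m' \<le> N"
  shows "gamma_system N t m' \<Theta> \<Theta>h q r g0 qh rh gh0 gt g gh"
proof -
  have sub: "{t m'..T} \<subseteq> {t m..T}" using partition_le[OF part m] by auto
  have node: "gt (t m') = g (t m')" by (rule gamma_system_node[OF sys m])
  have "m \<le> i \<and> i < N" if "m' \<le> i \<and> i < N" for i using that m by simp
  then show ?thesis
    using sys node continuous_on_subset[OF _ sub] unfolding gamma_system_def by blast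
qed

text \<open>This is the only place where the monotonicity assumption (H3) enters.\<close>

lemma scheme_mono:
  assumes part: "is_partition T N t" and S: "is_scheme d T N t S" and kj: "k < j" "j < N"
    and s: "s \<in> {t (Suc j)..T}"
  shows "Gam_tilde S k s \<preceq> Gam_tilde S j s \<and> Gam S k s \<preceq> Gam S j s \<and> Gam_hat S k s \<preceq> Gam_hat S j s"
proof -
  have m: "Suc k \<le> Suc j" "Suc j \<le> N" and k: "k < N" using kj by auto
  \<comment> \<open>Restricted to the shorter interval of \<open>j\<close>, both indices have the
    same gains, so the difference is a system of the same kind with ordered weights as its
    data.\<close>
  note sys = gamma_system_diff[OF is_scheme_frozen_system[OF S kj(2), unfolded frozen_system_def]
      gamma_system_restrict[OF is_scheme_frozen_system[OF S k, unfolded frozen_system_def] part m]]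
  have tt: "0 \<le> t k" "t k \<le> t j" "t j \<le> t (Suc j)" "t (Suc j) \<le> T"
    using partition_range[OF part, of k] partition_le[OF part, of k j] partition_le[OF part, of j "Suc j"]
      partition_range[OF part, of "Suc j"] kj by auto
  have "0 \<preceq> Gam_tilde S j s - Gam_tilde S k s \<and> 0 \<preceq> Gam S j s - Gam S k s \<and> 0 \<preceq> Gam_hat S j s - Gam_hat S k s"
  proof (rule gamma_system_psd[OF part m(2) sys is_scheme_gains_bounded[OF part S] _ _ _ s])
    have h: "cQ d s (t k) \<preceq> cQ d s (t j)" "hQ d s (t k) \<preceq> hQ d s (t j)" "cR d s (t k) \<preceq> cR d s (t j)"
      "hR d s (t k) \<preceq> hR d s (t j)" "cG d (t k) \<preceq> cG d (t j)" "hG d (t k) \<preceq> hG d (t j)"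
      if "t j \<le> s" "s \<le> T" for s
      using H3[unfolded H3_def, rule_format, of "t k" "t j" s] that tt by blast+
    show "0 \<preceq> cG d (t j) - cG d (t k)" "0 \<preceq> hG d (t j) - hG d (t k)"
      using h(5,6)[of T] tt by (simp_all add: loewner_le_iff_psd[of _ "cG d (t j)"] loewner_le_iff_psd[of _ "hG d (t j)"])
    fix s assume "s \<in> {t (Suc j)..T}"
    then have "t j \<le> s" "s \<le> T" using tt by auto
    from h(1-4)[OF this, THEN loewner_le_iff_psd[THEN iffD1]]
    show "0 \<preceq> cQ d s (t j) - cQ d s (t k) \<and> 0 \<preceq> cR d s (t j) - cR d s (t k) \<and>
        0 \<preceq> hQ d s (t j) - hQ d s (t k) \<and> 0 \<preceq> hR d s (t j) - hR d s (t k)"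
      by blast
  qed
  then show ?thesis
    unfolding loewner_le_iff_psd[of "Gam_tilde S k s"] loewner_le_iff_psd[of "Gam S k s"]
      loewner_le_iff_psd[of "Gam_hat S k s"] .
qed

lemma scheme_P_derivative:
  assumes part: "is_partition T N t" and S: "is_scheme d T N t S" and j: "j < N" and s: "s \<in> {t j<..<t (Suc j)}"
  shows "(Pk S j has_vector_derivative - lyapunov_op (cA d s) (cB d s) (cC d s) (cD d s) (cQ d s (t j)) (cR d s (t j))
      (Th S s) (Pk S j s) (Pk S j s)) (at s)"
    "(Pk_hat S j has_vector_derivative - lyapunov_op (hA d s) (hB d s) (hC d s) (hD d s) (hQ d s (t j)) (hR d s (t j))
      (Th_hat S s) (Pk_hat S j s) (Pk S j s)) (at s)"
proof -
  let ?a = "t j" and ?b = "t (Suc j)"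
  have tt: "0 \<le> ?a" "?b \<le> T" using partition_range[OF part, of j] partition_range[OF part, of "Suc j"] j by auto
  have s': "s \<in> {?a..?b}" "s \<in> {?a..<?b}" "?a \<le> s" "s \<le> T" using s tt by auto
  have "- lower_radius * (x \<bullet> x) \<le> x \<bullet> (Pk S j s *v x)" for x
    using is_scheme_psd(4)[OF part S j s'(1)] lower_radius(2) unfolding psd_iff
    by (smt (verit) inner_ge_zero mult_minus_left mult_nonneg_nonneg)
  note eq = riccati_op_eq[OF tt(1) s'(3,4) this]
  from is_scheme_riccati_pair(1)[OF S j, unfolded riccati_pair_def, THEN bspec, OF s'(1)]
  have r: "(Pk S j has_vector_derivative - riccati_op (cA d s) (cB d s) (cC d s) (cD d s) (cQ d s ?a) (cR d s ?a)
      (Pk S j s) (Pk S j s)) (at s within {?a..?b})"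
    "(Pk_hat S j has_vector_derivative - riccati_op (hA d s) (hB d s) (hC d s) (hD d s) (hQ d s ?a) (hR d s ?a)
      (Pk_hat S j s) (Pk S j s)) (at s within {?a..?b})" by blast+
  show "(Pk S j has_vector_derivative - lyapunov_op (cA d s) (cB d s) (cC d s) (cD d s) (cQ d s ?a) (cR d s ?a)
      (Th S s) (Pk S j s) (Pk S j s)) (at s)"
    "(Pk_hat S j has_vector_derivative - lyapunov_op (hA d s) (hB d s) (hC d s) (hD d s) (hQ d s ?a) (hR d s ?a)
      (Th_hat S s) (Pk_hat S j s) (Pk S j s)) (at s)"
    using r[THEN has_vector_derivative_at_of_within, OF s] unfolding eq is_scheme_gain[OF S j s'(2)] .
qed

text \<open>
  On the cell of \<open>j\<close> the gain is optimal for \<open>P\<^sub>j\<close>, so \<open>P\<^sub>j\<close> and \<open>\<Gamma>\<^sub>k\<close> solve Lyapunov equations with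
  the same gain and ordered data.
\<close>

lemma scheme_le_P:
  assumes part: "is_partition T N t" and S: "is_scheme d T N t S" and kj: "k < j" "j < N"
  shows "s \<in> {t j<..t (Suc j)} \<Longrightarrow> Gam_tilde S k s \<preceq> Pk S j s"
    "s \<in> {t j..t (Suc j)} \<Longrightarrow> Gam_hat S k s \<preceq> Pk_hat S j s"
proof -
  let ?a = "t j" and ?b = "t (Suc j)"
  have k: "k < N" and Skj: "Suc k \<le> j" using kj by auto
  note sysk = is_scheme_frozen_system[OF S k, unfolded frozen_system_def]
  note ric = is_scheme_riccati_pair[OF S kj(2)]
  have tt: "0 \<le> t k" "t k \<le> ?a" "?a < ?b" "?b \<le> T" "0 \<le> ?a" "t (Suc k) \<le> ?a"
    using partition_range[OF part, of k] partition_le[OF part, of k j] partition_less[OF part, of j "Suc j"]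
      partition_range[OF part, of "Suc j"] partition_range[OF part, of j] partition_le[OF part, of "Suc k" j] kj by auto
  have "?b \<in> {?b..T}" using tt by simp
  note mono = scheme_mono[OF part S kj this]
  obtain c where c: "\<And>s. s \<in> {?a<..<?b} \<Longrightarrow> norm (Th S s) \<le> c \<and> norm (Th_hat S s) \<le> c"
    using is_scheme_gains_bounded[OF part S, of 0] kj unfolding gains_bounded_def by (metis le0)
  define c' where "c' = max \<kappa> c"
  have bd: "norm (cA d s) \<le> c' \<and> norm (cB d s) \<le> c' \<and> norm (cC d s) \<le> c' \<and> norm (cD d s) \<le> c' \<and> norm (Th S s) \<le> c'"
    "norm (hA d s) \<le> c' \<and> norm (hB d s) \<le> c' \<and> norm (Th_hat S s) \<le> c'" if "s \<in> {?a<..<?b}" for s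
  proof -
    have "s \<in> {0..T}" using that tt by auto
    from coef_bound[OF this] c[OF that]
    show "norm (cA d s) \<le> c' \<and> norm (cB d s) \<le> c' \<and> norm (cC d s) \<le> c' \<and> norm (cD d s) \<le> c' \<and> norm (Th S s) \<le> c'"
      "norm (hA d s) \<le> c' \<and> norm (hB d s) \<le> c' \<and> norm (Th_hat S s) \<le> c'"
      by (simp_all add: c'_def le_max_iff_disj)
  qed
  have W: "0 \<preceq> cQ d s ?a - cQ d s (t k) \<and> 0 \<preceq> cR d s ?a - cR d s (t k)"
    "0 \<preceq> hQ d s ?a - hQ d s (t k) \<and> 0 \<preceq> hR d s ?a - hR d s (t k)" if "s \<in> {?a<..<?b}" for s
  proof -
    have "cQ d s (t k) \<preceq> cQ d s ?a" "hQ d s (t k) \<preceq> hQ d s ?a" "cR d s (t k) \<preceq> cR d s ?a" "hR d s (t k) \<preceq> hR d s ?a"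
      using H3[unfolded H3_def, rule_format, of "t k" ?a s] that tt by auto
    from this[THEN loewner_le_iff_psd[THEN iffD1]]
    show "0 \<preceq> cQ d s ?a - cQ d s (t k) \<and> 0 \<preceq> cR d s ?a - cR d s (t k)"
      "0 \<preceq> hQ d s ?a - hQ d s (t k) \<and> 0 \<preceq> hR d s ?a - hR d s (t k)" by blast+
  qed
  have der: "(Gam_tilde S k has_vector_derivative - lyapunov_op (cA d s) (cB d s) (cC d s) (cD d s) (cQ d s (t k)) (cR d s (t k))
      (Th S s) (Gam_tilde S k s) (Gam_tilde S k s)) (at s)"
    "(Gam_hat S k has_vector_derivative - lyapunov_op (hA d s) (hB d s) (hC d s) (hD d s) (hQ d s (t k)) (hR d s (t k))
      (Th_hat S s) (Gam_hat S k s) (Gam_tilde S k s)) (at s)" if "s \<in> {?a<..<?b}" for s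
    using sysk Skj kj(2) that unfolding gamma_system_def by blast+
  note derP = scheme_P_derivative[OF part S kj(2)]
  note cP = riccati_pair_continuous[OF ric(1)]
  have sub: "{?a<..?b} \<subseteq> {?a..?b}" "{?a..?b} \<subseteq> {t (Suc k)..T}" using tt by auto
  have cgt: "continuous_on {?a<..?b} (Gam_tilde S k)"
    by (rule gamma_system_continuous[OF sysk Skj kj(2)])
  have cgh: "continuous_on {?a..?b} (Gam_hat S k)"
    using sysk continuous_on_subset[OF _ sub(2)] unfolding gamma_system_def by blast
  \<comment> \<open>At the right node \<open>Gam_tilde\<close> equals \<open>Gam\<close>, which
    \<open>scheme_mono\<close> compares with the terminal value of \<open>Pk\<close>. This is what
    lets the two different evolutions be compared.\<close>
  have node: "Gam_tilde S k ?b = Gam S k ?b"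
    using gamma_system_node[OF sysk, of "Suc j"] kj by simp
  note dd = has_vector_derivative_eq_rhs[OF has_vector_derivative_diff]
  have 1: "0 \<preceq> Pk S j s - Gam_tilde S k s" if s: "s \<in> {?a<..?b}" for s
  proof (rule lyapunov_op_psd_self[where \<kappa>=c' and X="\<lambda>s. Pk S j s - Gam_tilde S k s", OF _ _ bd(1) W(1) _ s])
    show "continuous_on {?a<..?b} (\<lambda>s. Pk S j s - Gam_tilde S k s)"
      by (intro continuous_on_diff cgt continuous_on_subset[OF cP(1) sub(1)])
    show "0 \<preceq> Pk S j ?b - Gam_tilde S k ?b"
      using mono[THEN conjunct2, THEN conjunct1] unfolding node ric(2) loewner_le_iff_psd[of "Gam S k ?b"] .
    fix s assume s: "s \<in> {?a<..<?b}"
    show "((\<lambda>s. Pk S j s - Gam_tilde S k s) has_vector_derivative - lyapunov_op (cA d s) (cB d s) (cC d s) (cD d s)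
        (cQ d s ?a - cQ d s (t k)) (cR d s ?a - cR d s (t k)) (Th S s) (Pk S j s - Gam_tilde S k s) (Pk S j s - Gam_tilde S k s)) (at s)"
      by (rule dd[OF derP(1)[OF s] der(1)[OF s]]) (simp only: minus_diff_minus lyapunov_op_diff)
  qed
  \<comment> \<open>The difference from \<open>1\<close> is the source term here, so the hatted
    comparison has to come second.\<close>
  have 2: "0 \<preceq> Pk_hat S j s - Gam_hat S k s" if s: "s \<in> {?a<..?b}" for s
  proof (rule lyapunov_op_psd_given[where \<kappa>=c' and X="\<lambda>s. Pk_hat S j s - Gam_hat S k s", OF _ _ bd(2) _ _ s])
    show "continuous_on {?a<..?b} (\<lambda>s. Pk_hat S j s - Gam_hat S k s)"
      by (rule continuous_on_subset[OF continuous_on_diff[OF cP(2) cgh] sub(1)])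
    show "0 \<preceq> Pk_hat S j ?b - Gam_hat S k ?b"
      using mono[THEN conjunct2, THEN conjunct2] unfolding ric(3) loewner_le_iff_psd[of "Gam_hat S k ?b"] .
    fix s assume s: "s \<in> {?a<..<?b}"
    show "((\<lambda>s. Pk_hat S j s - Gam_hat S k s) has_vector_derivative - lyapunov_op (hA d s) (hB d s) (hC d s) (hD d s)
        (hQ d s ?a - hQ d s (t k)) (hR d s ?a - hR d s (t k)) (Th_hat S s) (Pk_hat S j s - Gam_hat S k s) (Pk S j s - Gam_tilde S k s)) (at s)"
      by (rule dd[OF derP(2)[OF s] der(2)[OF s]]) (simp only: minus_diff_minus lyapunov_op_diff)
    show "0 \<preceq> hQ d s ?a - hQ d s (t k) \<and> 0 \<preceq> hR d s ?a - hR d s (t k) \<and> 0 \<preceq> Pk S j s - Gam_tilde S k s"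
      using W(2)[OF s] 1[of s] s by simp
  qed
  show "Gam_tilde S k s \<preceq> Pk S j s" if "s \<in> {?a<..?b}" for s
    using 1[OF that] unfolding loewner_le_iff_psd[of "Gam_tilde S k s"] .
  have "0 \<preceq> Pk_hat S j ?a - Gam_hat S k ?a"
    by (rule psd_left_endpoint[OF continuous_on_diff[OF cP(2) cgh] tt(3) 2])
  then show "Gam_hat S k s \<preceq> Pk_hat S j s" if "s \<in> {?a..?b}" for s
    using 2[of s] that unfolding loewner_le_iff_psd[of "Gam_hat S k s"] by (cases "s = ?a") auto
qed

section \<open>Domination of the kernel by its hatted counterpart\<close>

text \<open>Bookkeeping for \<open>Gam_le_Gam_hat\<close>, stated in a vector space so that no
  matrix product is expanded. \<open>k\<close> stands for the common \<open>Gam_tilde\<close> term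
  and \<open>v\<close>, \<open>v'\<close> for the terms quadratic in the gain; \<open>f\<close>
  comes from differentiating the exponential weight, and \<open>e\<close> is that weight.\<close>

lemma comparison_identity:
  fixes a1 a2 :: "'a::real_vector"
  shows "c *\<^sub>R - (a1 + a2 + q + k + v) + (- f) *\<^sub>R i - - (b1 + b2 + q' + k + v')
    = - ((c *\<^sub>R a1 + e *\<^sub>R m - b1) + (c *\<^sub>R a2 + e *\<^sub>R m' - b2) + 0
      + (c *\<^sub>R q - q' + (c - 1) *\<^sub>R k + (c *\<^sub>R v - v') + f *\<^sub>R i - e *\<^sub>R (m + m')))"
  by (simp add: algebra_simps)

text \<open>The largest value on [0, T] of the weight \<kappa> exp (4 \<kappa> (T - s)), which
  starts at \<kappa> to dominate the terminal values.\<close>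

definition top_weight :: real where "top_weight = \<kappa> * exp (4 * \<kappa> * T)"
text \<open>Chosen so that this factor times the hatted \<open>R\<close> has lower bound \<kappa> +
  \<kappa> \<open>top_weight\<close>: the first summand dominates \<open>R\<close>, the second
  absorbs the cross term of state and gain. At least 1, so that the surplus of
  \<open>Gam_tilde\<close> terms is positive.\<close>

definition hat_factor :: real where "hat_factor = max 1 ((\<kappa> + \<kappa> * top_weight) / \<delta>)"

text \<open>
  The weight \<open>R\<close> is bounded by a multiple of \<open>R + Rbar\<close>, so the terms of the two equations that
  contain the square of the gain are comparable; what is linear in the gain is absorbed by the
  multiple of the identity.
\<close>

lemma Gam_le_Gam_hat:
  assumes part: "is_partition T N t" and S: "is_scheme d T N t S" and k: "k < N" and s: "s \<in> {t (Suc k)..T}"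
  shows "0 \<preceq> hat_factor *\<^sub>R Gam_hat S k s + (\<kappa> * exp (4 * \<kappa> * (T - s))) *\<^sub>R mat 1 - Gam S k s"
proof -
  define c where "c = hat_factor"
  define e where "e s = \<kappa> * exp (4 * \<kappa> * (T - s))" for s
  define Z where "Z s = c *\<^sub>R Gam_hat S k s + e s *\<^sub>R mat 1 - Gam S k s" for s
  have Sk: "Suc k \<le> N" using k by simp
  note sys = is_scheme_frozen_system[OF S k, unfolded frozen_system_def]
  have c1: "1 \<le> c" and c2: "\<kappa> + \<kappa> * top_weight \<le> c * \<delta>"
  proof -
    show "1 \<le> c" by (simp add: c_def hat_factor_def)
    have "(\<kappa> + \<kappa> * top_weight) / \<delta> \<le> c" by (simp add: c_def hat_factor_def)
    then show "\<kappa> + \<kappa> * top_weight \<le> c * \<delta>" using \<delta>_pos by (simp only: pos_divide_le_eq)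
  qed
  have cont: "continuous_on {t (Suc k)..T} Z"
    unfolding Z_def e_def using sys by (intro continuous_intros) (simp_all add: gamma_system_def)
  have "0 \<preceq> Z s"
  proof (rule partition_backward_induct[OF part Sk s])
    have tk: "t k \<in> {0..T}" "0 \<le> t k" "t k \<le> T" using partition_range[OF part, of k] k by auto
    have GT: "Gam S k T = cG d (t k)" "Gam_hat S k T = hG d (t k)" using sys by (simp_all add: gamma_system_def)
    show "0 \<preceq> Z T"
      unfolding psd_iff
    proof (intro conjI allI)
      show "sym_mat (Z T)"
        unfolding Z_def GT using terminal_psd[OF tk(2,3)] by (intro sym_mat_lin) (auto simp: psd_iff)
      fix x
      have "x \<bullet> (cG d (t k) *v x) \<le> norm (cG d (t k)) * (x \<bullet> x)" by (rule quadratic_form_upper)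
      also have "\<dots> \<le> \<kappa> * (x \<bullet> x)" using terminal_bound[OF tk(1)] by (intro mult_right_mono) auto
      finally have "x \<bullet> (cG d (t k) *v x) \<le> \<kappa> * (x \<bullet> x)" .
      moreover have "0 \<le> c * (x \<bullet> (hG d (t k) *v x))"
        using terminal_psd[OF tk(2,3)] c1 by (simp add: psd_iff)
      ultimately show "0 \<le> x \<bullet> (Z T *v x)"
        by (simp add: Z_def GT e_def matrix_vector_bilinear inner_add_right inner_diff_right)
    qed
  next
    fix i s assume i: "Suc k \<le> i" "i < N" and nxt: "0 \<preceq> Z (t (Suc i))" and s: "s \<in> {t i..<t (Suc i)}"
    let ?a = "t i" and ?b = "t (Suc i)"
    have tt: "t (Suc k) \<le> ?a" "?a < ?b" "?b \<le> T" "0 \<le> t k" "t k \<le> ?a"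
      using partition_le[OF part, of "Suc k" i] partition_less[OF part, of i "Suc i"] partition_range[OF part, of "Suc i"]
        partition_range[OF part, of k] partition_le[OF part, of k i] i k by auto
    obtain cb where cb: "\<And>s. s \<in> {?a<..<?b} \<Longrightarrow> norm (Th S s) \<le> cb \<and> norm (Th_hat S s) \<le> cb"
      using is_scheme_gains_bounded[OF part S, of 0] i unfolding gains_bounded_def by (metis le0)
    define c' where "c' = max \<kappa> cb"
    define M where "M s = hA d s - hB d s ** Th_hat S s" for s
    define N' where "N' s = hC d s - hD d s ** Th_hat S s" for s
    define W where "W s = c *\<^sub>R hQ d s (t k) - cQ d s (t k)
      + (c - 1) *\<^sub>R (transpose (N' s) ** Gam_tilde S k s ** N' s)
      + transpose (Th_hat S s) ** (c *\<^sub>R hR d s (t k) - cR d s (t k)) ** Th_hat S s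
      + (4 * \<kappa> * e s) *\<^sub>R mat 1 - e s *\<^sub>R (M s + transpose (M s))" for s
    have pos: "0 \<preceq> Z s" if "s \<in> {?a<..?b}" for s
    \<comment> \<open>The term with \<open>Gam_tilde\<close> belongs to the source \<open>W\<close>,
      hence N = 0.\<close>
    proof (rule lyapunov_psd[where X=Z and M=M and N="\<lambda>_. 0" and W=W and \<kappa>="c' + c' * c'", OF _ _ _ _ _ nxt that])
      show "continuous_on {?a<..?b} Z"
        by (rule continuous_on_subset[OF cont]) (use tt in auto)
      fix s assume s: "s \<in> {?a<..<?b}"
      have s0: "s \<in> {0..T}" "t k \<in> {0..T}" "0 \<le> t k" "t k \<le> s" "s \<le> T" using s tt by auto
      have nM: "norm (M s) \<le> c' + c' * c'"
        unfolding M_def using coef_bound[OF s0(1)] cb[OF s]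
        by (intro order_trans[OF norm_triangle_ineq4] add_mono norm_mult_bound) (auto simp: c'_def le_max_iff_disj)
      show "norm (M s) \<le> c' + c' * c'" by (rule nM)
      show "norm (0::real^'n^'n) \<le> c' + c' * c'" using order_trans[OF norm_ge_zero nM] by simp
      have d1: "(Gam S k has_vector_derivative - lyapunov_op (hA d s) (hB d s) (hC d s) (hD d s) (cQ d s (t k)) (cR d s (t k))
          (Th_hat S s) (Gam S k s) (Gam_tilde S k s)) (at s)"
        and d2: "(Gam_hat S k has_vector_derivative - lyapunov_op (hA d s) (hB d s) (hC d s) (hD d s) (hQ d s (t k)) (hR d s (t k))
          (Th_hat S s) (Gam_hat S k s) (Gam_tilde S k s)) (at s)"
        using sys i s unfolding gamma_system_def by blast+
      have de: "((\<lambda>s. e s *\<^sub>R (mat 1 :: real^'n^'n)) has_vector_derivative (- (4 * \<kappa> * e s)) *\<^sub>R mat 1) (at s)"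
        unfolding e_def
        by (auto intro!: derivative_eq_intros simp: has_real_derivative_iff_has_vector_derivative[symmetric])
      have dc: "((\<lambda>s. c *\<^sub>R Gam_hat S k s) has_vector_derivative c *\<^sub>R - lyapunov_op (hA d s) (hB d s) (hC d s) (hD d s)
          (hQ d s (t k)) (hR d s (t k)) (Th_hat S s) (Gam_hat S k s) (Gam_tilde S k s)) (at s)"
        by (rule bounded_linear.has_vector_derivative[OF bounded_linear_scaleR_right d2])
      show "(Z has_vector_derivative - (Z s ** M s + transpose (M s) ** Z s + transpose 0 ** Z s ** 0 + W s)) (at s)"
        unfolding Z_def
      proof (rule has_vector_derivative_eq_rhs[OF has_vector_derivative_diff[OF has_vector_derivative_add[OF dc de] d1]])
        have bil: "(c *\<^sub>R Gam_hat S k s + e s *\<^sub>R mat 1 - Gam S k s) ** M s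
            = c *\<^sub>R (Gam_hat S k s ** M s) + e s *\<^sub>R M s - Gam S k s ** M s"
          "transpose (M s) ** (c *\<^sub>R Gam_hat S k s + e s *\<^sub>R mat 1 - Gam S k s)
            = c *\<^sub>R (transpose (M s) ** Gam_hat S k s) + e s *\<^sub>R transpose (M s) - transpose (M s) ** Gam S k s"
          "transpose (Th_hat S s) ** (c *\<^sub>R hR d s (t k) - cR d s (t k)) ** Th_hat S s
            = c *\<^sub>R (transpose (Th_hat S s) ** hR d s (t k) ** Th_hat S s) - transpose (Th_hat S s) ** cR d s (t k) ** Th_hat S s"
          "transpose 0 ** (c *\<^sub>R Gam_hat S k s + e s *\<^sub>R mat 1 - Gam S k s) ** 0 = (0 :: real^'n^'n)"
          by (simp_all only: matrix_mult_bilinear matrix_mul_lid matrix_mul_rid)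
        show "c *\<^sub>R - lyapunov_op (hA d s) (hB d s) (hC d s) (hD d s) (hQ d s (t k)) (hR d s (t k)) (Th_hat S s) (Gam_hat S k s) (Gam_tilde S k s)
            + (- (4 * \<kappa> * e s)) *\<^sub>R mat 1
            - - lyapunov_op (hA d s) (hB d s) (hC d s) (hD d s) (cQ d s (t k)) (cR d s (t k)) (Th_hat S s) (Gam S k s) (Gam_tilde S k s)
          = - ((c *\<^sub>R Gam_hat S k s + e s *\<^sub>R mat 1 - Gam S k s) ** M s
              + transpose (M s) ** (c *\<^sub>R Gam_hat S k s + e s *\<^sub>R mat 1 - Gam S k s)
              + transpose 0 ** (c *\<^sub>R Gam_hat S k s + e s *\<^sub>R mat 1 - Gam S k s) ** 0 + W s)"
          unfolding lyapunov_op_def M_def[symmetric] N'_def[symmetric] W_def bil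
          by (rule comparison_identity)
      qed
      show "0 \<preceq> W s"
        unfolding psd_iff
      proof (intro conjI allI)
        have sy: "sym_mat (hQ d s (t k))" "sym_mat (cQ d s (t k))" "sym_mat (hR d s (t k))" "sym_mat (cR d s (t k))"
          "sym_mat (Gam_tilde S k s)"
          using weight_psd'[OF s0(3-5)] is_scheme_psd(1)[OF part S k, of s] s tt by (auto simp: psd_iff)
        define H where "H = M s + transpose (M s)"
        have H: "sym_mat H"
          by (simp add: H_def sym_mat_def transpose_linear add.commute)
        show "sym_mat (W s)"
          unfolding W_def H_def[symmetric] by (intro sym_mat_lin sym_mat_congruence sy H)
        fix x :: "real^'n"
        define y where "y = Th_hat S s *v x"
        have es: "\<kappa> \<le> e s" "e s \<le> top_weight"
        proof -
          have "\<kappa> * 1 \<le> \<kappa> * exp (4 * \<kappa> * (T - s))"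
            using \<kappa>_ge1 s0 by (intro mult_left_mono) auto
          then show "\<kappa> \<le> e s" by (simp add: e_def)
          have "4 * \<kappa> * (T - s) \<le> 4 * \<kappa> * T" using \<kappa>_ge1 s0 by (intro mult_left_mono) auto
          then show "e s \<le> top_weight"
            unfolding e_def top_weight_def using \<kappa>_ge1 by (intro mult_left_mono) auto
        qed
        have e0: "0 \<le> e s" using es \<kappa>_ge1 by linarith
        have Q1: "0 \<le> c * (x \<bullet> (hQ d s (t k) *v x))"
          using weight_psd'(2)[OF s0(3-5)] c1 by (simp add: psd_iff)
        have Q2: "x \<bullet> (cQ d s (t k) *v x) \<le> \<kappa> * (x \<bullet> x)"
          by (rule order_trans[OF quadratic_form_upper mult_right_mono]) (use weight_bound[OF s0(1,2)] in auto)
        have Y: "0 \<le> (c - 1) * ((N' s *v x) \<bullet> (Gam_tilde S k s *v (N' s *v x)))"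
          using is_scheme_psd(1)[OF part S k, of s] s tt c1 by (simp add: psd_iff)
        have R1: "c * (\<delta> * (y \<bullet> y)) \<le> c * (y \<bullet> (hR d s (t k) *v y))"
          using weight_coercive(2)[OF s0(3-5)] c1 by (intro mult_left_mono) (auto simp: coercive_def)
        have R2: "y \<bullet> (cR d s (t k) *v y) \<le> \<kappa> * (y \<bullet> y)"
          by (rule order_trans[OF quadratic_form_upper mult_right_mono]) (use weight_bound[OF s0(1,2)] in auto)
        \<comment> \<open>The balance is 4 u from the decay of the weight against 3 u + v from the
          drift, after splitting the product of state and gain, and at most u from
          \<open>cQ\<close>. The surplus of the hatted \<open>R\<close> covers v, so the total is
          nonnegative.\<close>
        define u where "u = \<kappa> * e s * (x \<bullet> x)"
        define v where "v = \<kappa> * e s * (y \<bullet> y)"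
        have "(\<kappa> + \<kappa> * top_weight) * (y \<bullet> y) \<le> c * \<delta> * (y \<bullet> y)"
          by (rule mult_right_mono[OF c2]) simp
        moreover have "v \<le> \<kappa> * top_weight * (y \<bullet> y)"
          unfolding v_def using es(2) \<kappa>_ge1 by (intro mult_right_mono mult_left_mono) auto
        ultimately have R: "v \<le> c * (y \<bullet> (hR d s (t k) *v y)) - y \<bullet> (cR d s (t k) *v y)"
          using R1 R2 by (simp add: distrib_right mult.assoc)
        have A: "x \<bullet> (hA d s *v x) \<le> \<kappa> * (x \<bullet> x)"
          by (rule order_trans[OF quadratic_form_upper mult_right_mono]) (use coef_bound[OF s0(1)] in auto)
        have "\<bar>x \<bullet> (hB d s *v y)\<bar> \<le> norm x * (\<kappa> * norm y)"
          using coef_bound[OF s0(1)]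
          by (intro order_trans[OF Cauchy_Schwarz_ineq2] mult_left_mono order_trans[OF norm_matrix_vector_le] mult_right_mono) auto
        also have "\<dots> = \<kappa> * (norm x * norm y)" by simp
        also have "\<dots> \<le> \<kappa> * ((x \<bullet> x + y \<bullet> y) / 2)"
          using sum_squares_bound[of "norm x" "norm y"] \<kappa>_ge1
          by (intro mult_left_mono) (auto simp: power2_norm_eq_inner)
        finally have B: "- (x \<bullet> (hB d s *v y)) \<le> \<kappa> * ((x \<bullet> x + y \<bullet> y) / 2)" by (simp add: abs_le_iff)
        have Mq: "x \<bullet> ((M s + transpose (M s)) *v x) = 2 * (x \<bullet> (hA d s *v x) - x \<bullet> (hB d s *v y))"
        proof -
          have "x \<bullet> (transpose (M s) *v x) = x \<bullet> (M s *v x)"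
            by (simp only: inner_transpose_mult inner_commute)
          moreover have "x \<bullet> (M s *v x) = x \<bullet> (hA d s *v x) - x \<bullet> (hB d s *v y)"
            by (simp add: M_def y_def matrix_vector_bilinear inner_diff_right matrix_vector_mul_assoc)
          ultimately show ?thesis by (simp add: matrix_vector_bilinear inner_add_right del: transpose_matrix_vector)
        qed
        have "2 * (x \<bullet> (hA d s *v x) - x \<bullet> (hB d s *v y)) \<le> 3 * (\<kappa> * (x \<bullet> x)) + \<kappa> * (y \<bullet> y)"
          using A B by (simp add: distrib_left add_divide_distrib)
        from mult_left_mono[OF this e0]
        have Me: "e s * (x \<bullet> ((M s + transpose (M s)) *v x)) \<le> 3 * u + v"
          unfolding Mq u_def v_def by (simp add: distrib_left mult_ac)
        have "\<kappa> * 1 * (x \<bullet> x) \<le> \<kappa> * e s * (x \<bullet> x)"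
          using es \<kappa>_ge1 by (intro mult_right_mono mult_left_mono) auto
        then have k: "\<kappa> * (x \<bullet> x) \<le> u" by (simp add: u_def)
        have "x \<bullet> (W s *v x) = c * (x \<bullet> (hQ d s (t k) *v x)) - x \<bullet> (cQ d s (t k) *v x)
            + (c - 1) * ((N' s *v x) \<bullet> (Gam_tilde S k s *v (N' s *v x)))
            + (c * (y \<bullet> (hR d s (t k) *v y)) - y \<bullet> (cR d s (t k) *v y))
            + 4 * u - e s * (x \<bullet> ((M s + transpose (M s)) *v x))"
        proof -
          have "x \<bullet> ((transpose (Th_hat S s) ** (c *\<^sub>R hR d s (t k) - cR d s (t k)) ** Th_hat S s) *v x)
              = c * (y \<bullet> (hR d s (t k) *v y)) - y \<bullet> (cR d s (t k) *v y)"
            unfolding quadratic_form_congruence y_def[symmetric]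
            by (simp add: matrix_vector_bilinear inner_diff_right)
          then show ?thesis
            unfolding W_def matrix_vector_bilinear inner_add_right inner_diff_right inner_scaleR_right quadratic_form_congruence
            by (simp add: matrix_vector_bilinear inner_add_right u_def del: transpose_matrix_vector)
        qed
        then show "0 \<le> x \<bullet> (W s *v x)"
          using Q1 Q2 Y R Me k by linarith
      qed
    qed
    have "continuous_on {?a..?b} Z" by (rule continuous_on_subset[OF cont]) (use tt in auto)
    then have "0 \<preceq> Z ?a" by (rule psd_left_endpoint[OF _ tt(2) pos])
    then show "0 \<preceq> Z s" using pos[of s] s by (cases "s = ?a") auto
  qed
  then show ?thesis by (simp add: Z_def c_def e_def)
qed

section \<open>Trace estimates along the cells\<close>

lemma exp_rate_mono: "0 \<le> r \<Longrightarrow> u \<le> v \<Longrightarrow> exp (r * u) \<le> exp (r * v)" for r u v :: real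
  by (simp add: mult_left_mono)

lemma hat_factor_ge1: "1 \<le> hat_factor"
  by (simp add: hat_factor_def)

lemma top_weight_nonneg: "0 \<le> top_weight"
  using \<kappa>_ge1 by (simp add: top_weight_def)

lemma trace_Gam_le:
  assumes "is_partition T N t" "is_scheme d T N t S" "k < N" "s \<in> {t (Suc k)..T}"
  shows "trace (Gam S k s) \<le> hat_factor * trace (Gam_hat S k s) + CARD('n) * top_weight"
proof -
  have "0 \<le> s" using assms partition_range[OF assms(1), of "Suc k"] by auto
  then have "4 * \<kappa> * (T - s) \<le> 4 * \<kappa> * T" using \<kappa>_ge1 by (intro mult_left_mono) auto
  then have "\<kappa> * exp (4 * \<kappa> * (T - s)) \<le> top_weight"
    unfolding top_weight_def using \<kappa>_ge1 by (intro mult_left_mono) auto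
  then have "\<kappa> * exp (4 * \<kappa> * (T - s)) * real CARD('n) \<le> top_weight * real CARD('n)"
    by (rule mult_right_mono) simp
  moreover have "0 \<le> hat_factor * trace (Gam_hat S k s) + \<kappa> * exp (4 * \<kappa> * (T - s)) * real CARD('n) - trace (Gam S k s)"
    using trace_psd_nonneg[OF Gam_le_Gam_hat[OF assms]]
    by (simp only: trace_sub trace_add trace_scaleR trace_I)
  ultimately show ?thesis by (simp only: mult.commute[of top_weight])
qed

text \<open>The Gronwall factor over the whole horizon times all constants of the estimate. It
  multiplies 1 plus a trace, so that additive constants are absorbed.\<close>

definition P_factor :: real where
  "P_factor = (hat_factor + CARD('n) * top_weight + trace_rate * T) * exp (2 * trace_rate * T)"

lemma P_factor_nonneg: "0 \<le> P_factor"
  using hat_factor_ge1 top_weight_nonneg trace_rate_nonneg T_pos by (simp add: P_factor_def)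

lemma trace_P_le:
  assumes part: "is_partition T N t" and S: "is_scheme d T N t S" and k: "k < N" and s: "s \<in> {t k..t (Suc k)}"
  shows "trace (Pk S k s) \<le> P_factor * (1 + trace (Gam_hat S k (t (Suc k))))"
proof -
  let ?b = "t (Suc k)"
  have tt: "0 \<le> t k" "?b \<le> T" using partition_range[OF part, of k] partition_range[OF part, of "Suc k"] k by auto
  have b: "?b \<in> {?b..T}" using tt by simp
  have g0: "0 \<le> trace (Gam_hat S k ?b)" "0 \<le> trace (Gam S k ?b)"
    using is_scheme_psd[OF part S k] b by (auto intro: trace_psd_nonneg)
  have ric: "riccati_pair (t k) s ?b (Pk S k) (Pk_hat S k)"
    using s by (intro riccati_pair_subinterval[OF is_scheme_riccati_pair(1)[OF S k]]) auto
  have psd: "0 \<preceq> Pk S k u" "0 \<preceq> Pk_hat S k u" if "u \<in> {s..?b}" for u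
    using is_scheme_psd(4,5)[OF part S k, of u] that s by auto
  have "trace (Pk S k s) \<le> (trace (Gam S k ?b) + trace_rate * (?b - s)) * exp (2 * trace_rate * (?b - s))"
    using riccati_pair_trace_le(1)[OF ric tt(1) _ _ tt(2) psd] s is_scheme_riccati_pair(2)[OF S k] by auto
  also have "\<dots> \<le> ((hat_factor * trace (Gam_hat S k ?b) + CARD('n) * top_weight) + trace_rate * T) * exp (2 * trace_rate * T)"
    using trace_Gam_le[OF part S k b] trace_rate_nonneg s tt g0 hat_factor_ge1 top_weight_nonneg
    by (intro mult_mono add_mono exp_rate_mono mult_left_mono add_nonneg_nonneg mult_nonneg_nonneg) auto
  also have "\<dots> \<le> ((hat_factor + CARD('n) * top_weight + trace_rate * T) * (1 + trace (Gam_hat S k ?b))) * exp (2 * trace_rate * T)"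
  proof (rule mult_right_mono)
    have "0 \<le> hat_factor + (CARD('n) * top_weight + trace_rate * T) * trace (Gam_hat S k ?b)"
      using hat_factor_ge1 top_weight_nonneg trace_rate_nonneg T_pos g0 by (intro add_nonneg_nonneg mult_nonneg_nonneg) auto
    then show "hat_factor * trace (Gam_hat S k ?b) + CARD('n) * top_weight + trace_rate * T
        \<le> (hat_factor + CARD('n) * top_weight + trace_rate * T) * (1 + trace (Gam_hat S k ?b))"
      by (simp add: algebra_simps)
  qed simp
  finally show ?thesis by (simp add: P_factor_def mult_ac)
qed

text \<open>One \<open>trace_rate\<close> is the growth of \<open>Pk_hat\<close> itself;
  \<open>P_factor + 1\<close> of them come from \<open>Pk\<close> and the constant in the
  source.\<close>

definition hat_rate :: real where "hat_rate = trace_rate * (P_factor + 2)"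

lemma hat_rate_nonneg: "0 \<le> hat_rate"
  using trace_rate_nonneg P_factor_nonneg by (simp add: hat_rate_def)

text \<open>With 1 added to the trace, the bound across a cell is a pure factor exp (rate times
  length). Such factors multiply to exp (rate times T), whatever the number of cells.\<close>

lemma trace_P_hat_le:
  assumes part: "is_partition T N t" and S: "is_scheme d T N t S" and k: "k < N" and s: "s \<in> {t k..t (Suc k)}"
  shows "1 + trace (Pk_hat S k s) \<le> (1 + trace (Gam_hat S k (t (Suc k)))) * exp (hat_rate * (t (Suc k) - s))"
proof -
  let ?b = "t (Suc k)"
  define g where "g = 1 + trace (Gam_hat S k ?b)"
  define h where "h = ?b - s"
  have tt: "0 \<le> t k" "?b \<le> T" using partition_range[OF part, of k] partition_range[OF part, of "Suc k"] k by auto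
  have b: "?b \<in> {?b..T}" using tt by simp
  have g1: "1 \<le> g" using is_scheme_psd(3)[OF part S k b] by (auto simp: g_def intro: trace_psd_nonneg)
  have h0: "0 \<le> h" using s by (simp add: h_def)
  have ric: "riccati_pair (t k) s ?b (Pk S k) (Pk_hat S k)"
    using s by (intro riccati_pair_subinterval[OF is_scheme_riccati_pair(1)[OF S k]]) auto
  have psd: "0 \<preceq> Pk S k u" "0 \<preceq> Pk_hat S k u" if "u \<in> {s..?b}" for u
    using is_scheme_psd(4,5)[OF part S k, of u] that s by auto
  have p: "trace (Pk S k u) \<le> P_factor * g" if "u \<in> {s..?b}" for u
    using trace_P_le[OF part S k, of u] that s by (auto simp: g_def)
  have sk: "t k \<le> s" "s \<le> ?b" using s by auto
  have "trace (Pk_hat S k s) \<le> (trace (Pk_hat S k ?b) + trace_rate * (P_factor * g + 1) * (?b - s)) * exp (trace_rate * (?b - s))"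
    by (rule riccati_pair_trace_le(2)[OF ric tt(1) sk tt(2) psd p])
  then have "1 + trace (Pk_hat S k s) \<le> 1 + (g - 1 + trace_rate * (P_factor * g + 1) * h) * exp (trace_rate * h)"
    by (simp add: is_scheme_riccati_pair(3)[OF S k] g_def h_def)
  also have "\<dots> \<le> exp (trace_rate * h) + (g - 1 + trace_rate * (P_factor * g + 1) * h) * exp (trace_rate * h)"
    using trace_rate_nonneg h0 by simp
  also have "\<dots> = (g + trace_rate * (P_factor * g + 1) * h) * exp (trace_rate * h)"
    by (simp add: algebra_simps)
  also have "\<dots> \<le> (g * exp (trace_rate * (P_factor + 1) * h)) * exp (trace_rate * h)"
  proof (rule mult_right_mono)
    \<comment> \<open>Since g is at least 1, the constant source is itself a multiple of g, which
      makes the estimate homogeneous.\<close>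
    have "trace_rate * (P_factor * g + 1) * h \<le> trace_rate * (P_factor * g + g) * h"
      using g1 trace_rate_nonneg h0 by (intro mult_right_mono mult_left_mono) auto
    also have "\<dots> = g * (trace_rate * (P_factor + 1) * h)" by (simp add: algebra_simps)
    finally have "g + trace_rate * (P_factor * g + 1) * h \<le> g * (1 + trace_rate * (P_factor + 1) * h)"
      by (simp add: algebra_simps)
    also have "\<dots> \<le> g * exp (trace_rate * (P_factor + 1) * h)"
      using g1 by (intro mult_left_mono exp_ge_add_one_self) auto
    finally show "g + trace_rate * (P_factor * g + 1) * h \<le> g * exp (trace_rate * (P_factor + 1) * h)" .
  qed simp
  also have "\<dots> = g * exp (hat_rate * h)"
    by (simp add: hat_rate_def mult.assoc flip: exp_add) (simp add: algebra_simps)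
  finally show ?thesis by (simp add: g_def h_def)
qed

text \<open>The terminal trace plus 1, propagated over the whole horizon.\<close>

definition trace_top :: real where "trace_top = (1 + CARD('n) * \<kappa>) * exp (hat_rate * T)"

lemma trace_top_ge: "1 + CARD('n) * \<kappa> \<le> trace_top"
proof -
  have "(1 + CARD('n) * \<kappa>) * 1 \<le> (1 + CARD('n) * \<kappa>) * exp (hat_rate * T)"
    using hat_rate_nonneg T_pos \<kappa>_ge1 by (intro mult_left_mono) auto
  then show ?thesis by (simp add: trace_top_def)
qed

lemma trace_hG_le: "u \<in> {0..T} \<Longrightarrow> trace (hG d u) \<le> CARD('n) * \<kappa>"
  using trace_abs_le[of "hG d u"] terminal_bound[of u]
  by (meson abs_le_D1 mult_left_mono of_nat_0_le_iff order_trans)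

text \<open>The kernel of \<open>k\<close> lies below \<open>Pk_hat\<close> of the next cell, which
  \<open>trace_P_hat_le\<close> traces back to the kernel of the next index. It is essential that
  the order comparison has constant 1: a larger factor would be raised to the number of
  cells.\<close>

lemma trace_hat_step:
  assumes part: "is_partition T N t" and S: "is_scheme d T N t S" and k: "k < N"
  shows "1 + trace (Gam_hat S k (t (Suc k))) \<le> (1 + CARD('n) * \<kappa>) * exp (hat_rate * (T - t (Suc k)))"
  using k
proof (induction "N - k" arbitrary: k rule: less_induct)
  case less
  show ?case
  proof (cases "Suc k = N")
    case True
    have "t k \<in> {0..T}" using partition_range[OF part, of k] less.prems by auto
    moreover have "Gam_hat S k T = hG d (t k)"
      using is_scheme_frozen_system[OF S less.prems] by (simp add: frozen_system_def gamma_system_def)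
    ultimately show ?thesis using True partition_ends[OF part] trace_hG_le by simp
  next
    case False
    then have k': "Suc k < N" using less.prems by simp
    let ?a = "t (Suc k)" and ?b = "t (Suc (Suc k))"
    have tt: "?a < ?b" using partition_less[OF part, of "Suc k" "Suc (Suc k)"] k' by auto
    have a: "?a \<in> {?a..?b}" using tt by simp
    have "1 + trace (Gam_hat S k ?a) \<le> 1 + trace (Pk_hat S (Suc k) ?a)"
      using scheme_le_P(2)[OF part S lessI k' a] by (auto intro: trace_mono)
    also have "\<dots> \<le> (1 + trace (Gam_hat S (Suc k) ?b)) * exp (hat_rate * (?b - ?a))"
      by (rule trace_P_hat_le[OF part S k' a])
    also have "\<dots> \<le> ((1 + CARD('n) * \<kappa>) * exp (hat_rate * (T - ?b))) * exp (hat_rate * (?b - ?a))"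
      using less.hyps[OF _ k'] k' by (intro mult_right_mono) auto
    also have "\<dots> = (1 + CARD('n) * \<kappa>) * exp (hat_rate * (T - ?a))"
      by (simp add: mult.assoc flip: exp_add) (simp add: algebra_simps)
    finally show ?thesis .
  qed
qed

lemma trace_hat_top:
  assumes part: "is_partition T N t" and S: "is_scheme d T N t S" and k: "k < N"
  shows "1 + trace (Gam_hat S k (t (Suc k))) \<le> trace_top"
    "s \<in> {t k..t (Suc k)} \<Longrightarrow> trace (Pk_hat S k s) \<le> trace_top"
    "s \<in> {t k..t (Suc k)} \<Longrightarrow> trace (Pk S k s) \<le> P_factor * trace_top"
proof -
  let ?b = "t (Suc k)"
  have tt: "0 \<le> t k" "?b \<le> T" "t k \<le> ?b"
    using partition_range[OF part, of k] partition_range[OF part, of "Suc k"] partition_le[OF part, of k "Suc k"] k by auto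
  have n: "0 \<le> 1 + CARD('n) * \<kappa>" using \<kappa>_ge1 by simp
  show 1: "1 + trace (Gam_hat S k ?b) \<le> trace_top"
    unfolding trace_top_def using n tt
    by (intro order_trans[OF trace_hat_step[OF part S k]] mult_left_mono exp_rate_mono hat_rate_nonneg) auto
  show "trace (Pk S k s) \<le> P_factor * trace_top" if "s \<in> {t k..?b}"
    by (rule order_trans[OF trace_P_le[OF part S k that] mult_left_mono[OF 1 P_factor_nonneg]])
  show "trace (Pk_hat S k s) \<le> trace_top" if s: "s \<in> {t k..?b}"
  proof -
    have "1 + trace (Pk_hat S k s) \<le> ((1 + CARD('n) * \<kappa>) * exp (hat_rate * (T - ?b))) * exp (hat_rate * (?b - s))"
      by (rule order_trans[OF trace_P_hat_le[OF part S k s] mult_right_mono[OF trace_hat_step[OF part S k]]]) simp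
    also have "\<dots> = (1 + CARD('n) * \<kappa>) * exp (hat_rate * (T - s))"
      by (simp add: mult.assoc flip: exp_add) (simp add: algebra_simps)
    also have "\<dots> \<le> trace_top"
      unfolding trace_top_def using n tt s by (intro mult_left_mono exp_rate_mono hat_rate_nonneg) auto
    finally show ?thesis by simp
  qed
qed

lemma trace_Gam_top:
  assumes part: "is_partition T N t" and S: "is_scheme d T N t S" and k: "k < N" and s: "s \<in> {t (Suc k)..T}"
  shows "trace (Gam_hat S k s) \<le> trace_top"
    "trace (Gam S k s) \<le> hat_factor * trace_top + CARD('n) * top_weight"
    "trace (Gam_tilde S k s) \<le> P_factor * trace_top + (hat_factor * trace_top + CARD('n) * top_weight)"
proof -
  have Sk: "Suc k \<le> N" using k by simp
  show 1: "trace (Gam_hat S k s) \<le> trace_top"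
  proof (cases "s = T")
    case True
    have "t k \<in> {0..T}" using partition_range[OF part, of k] k by auto
    moreover have "Gam_hat S k T = hG d (t k)"
      using is_scheme_frozen_system[OF S k] by (simp add: frozen_system_def gamma_system_def)
    ultimately show ?thesis using True trace_hG_le[of "t k"] trace_top_ge by simp
  next
    case False
    then obtain i where i: "Suc k \<le> i" "i < N" "s \<in> {t i..<t (Suc i)}"
      using partition_cell_left[OF part Sk, of s] s by auto
    then have ki: "k < i" "s \<in> {t i..t (Suc i)}" by auto
    show ?thesis
      by (rule order_trans[OF trace_mono[OF scheme_le_P(2)[OF part S ki(1) i(2) ki(2)]] trace_hat_top(2)[OF part S i(2) ki(2)]])
  qed
  show 2: "trace (Gam S k s) \<le> hat_factor * trace_top + CARD('n) * top_weight"
    using mult_left_mono[OF 1, of hat_factor] hat_factor_ge1 trace_Gam_le[OF part S k s] by linarith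
  have T0: "0 \<le> trace_top" using trace_top_ge \<kappa>_ge1 by (smt (verit) mult_nonneg_nonneg of_nat_0_le_iff)
  show "trace (Gam_tilde S k s) \<le> P_factor * trace_top + (hat_factor * trace_top + CARD('n) * top_weight)"
  \<comment> \<open>The left node belongs to no right-closed cell of this range; there
    \<open>Gam_tilde\<close> equals \<open>Gam\<close>.\<close>
  proof (cases "s = t (Suc k)")
    case True
    then have "Gam_tilde S k s = Gam S k s"
      using is_scheme_frozen_system[OF S k] by (simp add: frozen_system_def gamma_system_def)
    then show ?thesis using 2 mult_nonneg_nonneg[OF P_factor_nonneg T0] by simp
  next
    case False
    then obtain i where i: "Suc k \<le> i" "i < N" "s \<in> {t i<..t (Suc i)}"
      using partition_cell_right[OF part Sk, of s] s by auto
    then have ki: "k < i" "s \<in> {t i..t (Suc i)}" by auto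
    have "trace (Gam_tilde S k s) \<le> P_factor * trace_top"
      by (rule order_trans[OF trace_mono[OF scheme_le_P(1)[OF part S ki(1) i(2,3)]] trace_hat_top(3)[OF part S i(2) ki(2)]])
    then show ?thesis
      using mult_nonneg_nonneg[OF _ T0, of hat_factor] hat_factor_ge1
        mult_nonneg_nonneg[OF of_nat_0_le_iff top_weight_nonneg, of "CARD('n)"] by linarith
  qed
qed

text \<open>One constant for coefficients, kernels, Riccati solutions and gains. \<open>B\<close> is
  the sum of the trace bounds times the dimension, as \<open>norm_psd_le_trace\<close>
  requires.\<close>

definition uniform_bound :: real where
  "uniform_bound = (let B = CARD('n) * (P_factor * trace_top + (hat_factor * trace_top + CARD('n) * top_weight) + trace_top)
    in max \<kappa> (max B (gain_bound B)))"

lemma uniform_bound_ge: "\<kappa> \<le> uniform_bound"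
  by (simp add: uniform_bound_def Let_def)

lemma scheme_bounds:
  assumes part: "is_partition T N t" and S: "is_scheme d T N t S" and k: "k < N"
  shows "s \<in> {t k..t (Suc k)} \<Longrightarrow> norm (Pk S k s) \<le> uniform_bound"
    "s \<in> {t k..t (Suc k)} \<Longrightarrow> norm (Pk_hat S k s) \<le> uniform_bound"
    "s \<in> {t (Suc k)..T} \<Longrightarrow> norm (Gam_tilde S k s) \<le> uniform_bound"
    "s \<in> {t (Suc k)..T} \<Longrightarrow> norm (Gam S k s) \<le> uniform_bound"
    "s \<in> {t (Suc k)..T} \<Longrightarrow> norm (Gam_hat S k s) \<le> uniform_bound"
    "s \<in> {t k..<t (Suc k)} \<Longrightarrow> norm (Th S s) \<le> uniform_bound"
    "s \<in> {t k..<t (Suc k)} \<Longrightarrow> norm (Th_hat S s) \<le> uniform_bound"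
proof -
  define b where "b = P_factor * trace_top + (hat_factor * trace_top + CARD('n) * top_weight) + trace_top"
  define B where "B = CARD('n) * b"
  have ub: "B \<le> uniform_bound" "gain_bound B \<le> uniform_bound"
    by (auto simp: uniform_bound_def Let_def B_def b_def)
  have T0: "0 \<le> trace_top" using trace_top_ge \<kappa>_ge1 by (smt (verit) mult_nonneg_nonneg of_nat_0_le_iff)
  have pos: "0 \<le> P_factor * trace_top" "0 \<le> hat_factor * trace_top" "0 \<le> CARD('n) * top_weight"
    using T0 P_factor_nonneg hat_factor_ge1 top_weight_nonneg by auto
  have nb: "norm X \<le> B" if "0 \<preceq> X" "trace X \<le> b" for X :: "real^'n^'n"
    unfolding B_def using that by (intro order_trans[OF norm_psd_le_trace]) (auto intro: mult_left_mono)
  note psd = is_scheme_psd[OF part S k] and top = trace_hat_top[OF part S k] and gtop = trace_Gam_top[OF part S k]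
  have P: "norm (Pk S k s) \<le> B" "norm (Pk_hat S k s) \<le> B" if "s \<in> {t k..t (Suc k)}" for s
    using top(2,3)[OF that] pos T0 by (intro nb psd that; simp add: b_def)+
  show "norm (Pk S k s) \<le> uniform_bound" "norm (Pk_hat S k s) \<le> uniform_bound" if "s \<in> {t k..t (Suc k)}"
    using P[OF that] ub by auto
  have "norm (Gam_tilde S k s) \<le> B" "norm (Gam S k s) \<le> B" "norm (Gam_hat S k s) \<le> B" if "s \<in> {t (Suc k)..T}"
    using gtop[OF that] pos T0 by (intro nb psd that; simp add: b_def)+
  then show "s \<in> {t (Suc k)..T} \<Longrightarrow> norm (Gam_tilde S k s) \<le> uniform_bound"
    "s \<in> {t (Suc k)..T} \<Longrightarrow> norm (Gam S k s) \<le> uniform_bound"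
    "s \<in> {t (Suc k)..T} \<Longrightarrow> norm (Gam_hat S k s) \<le> uniform_bound"
    using ub by auto
  have tt: "0 \<le> t k" "t (Suc k) \<le> T" using partition_range[OF part, of k] partition_range[OF part, of "Suc k"] k by auto
  show "norm (Th S s) \<le> uniform_bound" "norm (Th_hat S s) \<le> uniform_bound" if s: "s \<in> {t k..<t (Suc k)}"
  proof -
    have s': "s \<in> {t k..t (Suc k)}" "t k \<le> s" "s \<le> T" using s tt by auto
    have low: "- lower_radius * (x \<bullet> x) \<le> x \<bullet> (Pk S k s *v x)" for x
      using psd(4)[OF s'(1)] lower_radius(2) unfolding psd_iff
      by (smt (verit) inner_ge_zero mult_minus_left mult_nonneg_nonneg)
    show "norm (Th S s) \<le> uniform_bound" "norm (Th_hat S s) \<le> uniform_bound"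
      unfolding is_scheme_gain[OF S k s]
      by (rule order_trans[OF gain_norm_le(1)[OF tt(1) s'(2,3) low P(1,1)[OF s'(1)]] ub(2)]
          order_trans[OF gain_norm_le(2)[OF tt(1) s'(2,3) low P(2,1)[OF s'(1)]] ub(2)])+
  qed
qed

end

section \<open>Stability of the scheme\<close>

lemma norm_increment_le:
  fixes f :: "real \<Rightarrow> 'a::banach"
  assumes "finite E" "a \<le> b" "continuous_on {a..b} f"
    and "\<And>x. x \<in> {a<..<b} - E \<Longrightarrow> \<exists>D. (f has_vector_derivative D) (at x) \<and> norm D \<le> L"
  shows "norm (f b - f a) \<le> L * (b - a)"
proof -
  obtain f' where f': "\<And>x. x \<in> {a<..<b} - E \<Longrightarrow> (f has_vector_derivative f' x) (at x) \<and> norm (f' x) \<le> L"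
    using assms(4) by metis
  have "norm (f b - f a) \<le> L * b - L * a"
  proof (rule norm_increment_bound[OF assms(1,2,3)])
    show "continuous_on {a..b} (\<lambda>x. L * x)" by (intro continuous_intros)
    show "((\<lambda>x. L * x) has_real_derivative L) (at x)" for x
      by (auto intro!: derivative_eq_intros)
  qed (use f' in auto)
  then show ?thesis by (simp add: right_diff_distrib)
qed

lemma partition_cell_open:
  assumes "is_partition T N t" "m \<le> N" "s \<in> {t m..T}" "s \<notin> t ` {..N}"
  obtains i where "m \<le> i" "i < N" "s \<in> {t i<..<t (Suc i)}"
proof -
  have "s \<noteq> T" using assms(4) partition_ends[OF assms(1)] by force
  then obtain i where i: "m \<le> i" "i < N" "s \<in> {t i..<t (Suc i)}"
    using partition_cell_left[OF assms(1,2), of s] assms(3) by auto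
  have "s \<noteq> t i" using assms(4) i(2) by auto
  then show ?thesis using that[OF i(1,2)] i(3) by auto
qed

lemma eventually_modulus:
  fixes f :: "'a::metric_space \<Rightarrow> 'b::real_normed_vector"
  assumes "compact K" "continuous_on K f" "0 < \<omega>"
  shows "\<forall>\<^sub>F \<rho> in at_right (0::real). \<forall>x\<in>K. \<forall>y\<in>K. dist x y \<le> \<rho> \<longrightarrow> norm (f x - f y) \<le> \<omega>"
proof -
  from compact_uniformly_continuous[OF assms(2,1)] obtain e
    where e: "0 < e" "\<And>x y. x \<in> K \<Longrightarrow> y \<in> K \<Longrightarrow> dist y x < e \<Longrightarrow> dist (f y) (f x) < \<omega>"
    using assms(3) unfolding uniformly_continuous_on_def by metis
  show ?thesis
    unfolding eventually_at_right_field
  proof (intro exI[of _ e] conjI allI impI ballI e(1))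
    fix \<rho> x y assume "0 < \<rho>" "\<rho> < e" "x \<in> K" "y \<in> K" "dist x y \<le> \<rho>"
    then show "norm (f x - f y) \<le> \<omega>" using e(2)[of y x] by (simp add: dist_norm)
  qed
qed

context lq_problem
begin

section \<open>Regularity in the running time\<close>

text \<open>The bound of \<open>norm_lyapunov_op_le\<close> with every argument at
  \<open>uniform_bound\<close>: a common speed limit for all functions of all schemes.\<close>

definition slope :: real where
  "slope = 2 * (uniform_bound + uniform_bound * uniform_bound) * uniform_bound + uniform_bound
    + (uniform_bound + uniform_bound * uniform_bound)\<^sup>2 * uniform_bound + uniform_bound * uniform_bound * uniform_bound"

lemma uniform_bound_nonneg: "0 \<le> uniform_bound"
  using uniform_bound_ge \<kappa>_ge1 by linarith

lemma slope_nonneg: "0 \<le> slope"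
  using uniform_bound_nonneg by (simp add: slope_def)

lemma coef_uniform_bound:
  assumes "s \<in> {0..T}" "\<tau> \<in> {0..T}"
  shows "norm (cA d s) \<le> uniform_bound" "norm (cB d s) \<le> uniform_bound" "norm (cC d s) \<le> uniform_bound"
    "norm (cD d s) \<le> uniform_bound" "norm (hA d s) \<le> uniform_bound" "norm (hB d s) \<le> uniform_bound"
    "norm (hC d s) \<le> uniform_bound" "norm (hD d s) \<le> uniform_bound" "norm (cQ d s \<tau>) \<le> uniform_bound"
    "norm (hQ d s \<tau>) \<le> uniform_bound" "norm (cR d s \<tau>) \<le> uniform_bound" "norm (hR d s \<tau>) \<le> uniform_bound"
  using coef_bound[OF assms(1)] weight_bound[OF assms] uniform_bound_ge by linarith+

lemma norm_lyapunov_op_le_slope: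
  assumes "norm A \<le> uniform_bound" "norm B \<le> uniform_bound" "norm C \<le> uniform_bound" "norm D \<le> uniform_bound"
    "norm Q \<le> uniform_bound" "norm R \<le> uniform_bound" "norm \<Theta> \<le> uniform_bound"
    "norm X \<le> uniform_bound" "norm Y \<le> uniform_bound"
  shows "norm (- lyapunov_op A B C D Q R \<Theta> X Y) \<le> slope"
  unfolding norm_minus_cancel slope_def
  by (rule order_trans[OF norm_lyapunov_op_le[OF assms(1-4,7)]])
    (intro add_mono mult_left_mono assms; use uniform_bound_nonneg in simp)

lemma scheme_open_cell:
  assumes part: "is_partition T N t" and S: "is_scheme d T N t S" and k: "k < N"
    and i: "Suc k \<le> i" "i < N" and s: "s \<in> {t i<..<t (Suc i)}"
  shows "(Gam_tilde S k has_vector_derivative - lyapunov_op (cA d s) (cB d s) (cC d s) (cD d s) (cQ d s (t k)) (cR d s (t k))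
        (Th S s) (Gam_tilde S k s) (Gam_tilde S k s)) (at s)"
    "(Gam S k has_vector_derivative - lyapunov_op (hA d s) (hB d s) (hC d s) (hD d s) (cQ d s (t k)) (cR d s (t k))
        (Th_hat S s) (Gam S k s) (Gam_tilde S k s)) (at s)"
    "(Gam_hat S k has_vector_derivative - lyapunov_op (hA d s) (hB d s) (hC d s) (hD d s) (hQ d s (t k)) (hR d s (t k))
        (Th_hat S s) (Gam_hat S k s) (Gam_tilde S k s)) (at s)"
    "s \<in> {t (Suc k)..T}" "s \<in> {0..T}" "t k \<in> {0..T}"
    "norm (Th S s) \<le> uniform_bound" "norm (Th_hat S s) \<le> uniform_bound"
proof -
  note sys = is_scheme_frozen_system[OF S k, unfolded frozen_system_def]
  show "(Gam_tilde S k has_vector_derivative - lyapunov_op (cA d s) (cB d s) (cC d s) (cD d s) (cQ d s (t k)) (cR d s (t k))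
        (Th S s) (Gam_tilde S k s) (Gam_tilde S k s)) (at s)"
    "(Gam S k has_vector_derivative - lyapunov_op (hA d s) (hB d s) (hC d s) (hD d s) (cQ d s (t k)) (cR d s (t k))
        (Th_hat S s) (Gam S k s) (Gam_tilde S k s)) (at s)"
    "(Gam_hat S k has_vector_derivative - lyapunov_op (hA d s) (hB d s) (hC d s) (hD d s) (hQ d s (t k)) (hR d s (t k))
        (Th_hat S s) (Gam_hat S k s) (Gam_tilde S k s)) (at s)"
    using sys i s unfolding gamma_system_def by blast+
  show "s \<in> {t (Suc k)..T}" "s \<in> {0..T}" "t k \<in> {0..T}"
    using partition_le[OF part i(1)] partition_range[OF part, of "Suc i"] partition_range[OF part, of k]
      partition_range[OF part, of i] i s k by auto
  have "s \<in> {t i..<t (Suc i)}" using s by auto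
  from scheme_bounds(6,7)[OF part S i(2) this]
  show "norm (Th S s) \<le> uniform_bound" "norm (Th_hat S s) \<le> uniform_bound" .
qed

lemma Gam_continuous:
  assumes "is_scheme d T N t S" "k < N"
  shows "continuous_on {t (Suc k)..T} (Gam S k)" "continuous_on {t (Suc k)..T} (Gam_hat S k)"
  using is_scheme_frozen_system[OF assms] by (simp_all add: frozen_system_def gamma_system_def)

text \<open>The derivative is bounded inside the cells and continuity joins the cells, so its jumps
  at the nodes do no harm.\<close>

lemma Gam_Lipschitz:
  assumes part: "is_partition T N t" and S: "is_scheme d T N t S" and k: "k < N"
    and s: "t (Suc k) \<le> s" "s \<le> T" "t (Suc k) \<le> s'" "s' \<le> T"
  shows "norm (Gam S k s' - Gam S k s) \<le> slope * \<bar>s' - s\<bar>" "norm (Gam_hat S k s' - Gam_hat S k s) \<le> slope * \<bar>s' - s\<bar>"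
proof -
  have Sk: "Suc k \<le> N" using k by simp
  have ordered: "norm (Gam S k v - Gam S k u) \<le> slope * (v - u) \<and> norm (Gam_hat S k v - Gam_hat S k u) \<le> slope * (v - u)"
    if uv: "t (Suc k) \<le> u" "u \<le> v" "v \<le> T" for u v
  proof -
    have fin: "finite (t ` {..N})" by simp
    have sub: "{u..v} \<subseteq> {t (Suc k)..T}" using uv by auto
    have "\<exists>D. (Gam S k has_vector_derivative D) (at x) \<and> norm D \<le> slope"
      "\<exists>D. (Gam_hat S k has_vector_derivative D) (at x) \<and> norm D \<le> slope" if x: "x \<in> {u<..<v} - t ` {..N}" for x
    proof -
      have "x \<in> {t (Suc k)..T}" "x \<notin> t ` {..N}" using x uv by auto
      then obtain i where i: "Suc k \<le> i" "i < N" "x \<in> {t i<..<t (Suc i)}"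
        using partition_cell_open[OF part Sk] by metis
      note c = scheme_open_cell[OF part S k i]
      note b = scheme_bounds(3-5)[OF part S k c(4)] coef_uniform_bound[OF c(5,6)]
      show "\<exists>D. (Gam S k has_vector_derivative D) (at x) \<and> norm D \<le> slope"
        using c(2) norm_lyapunov_op_le_slope[OF b(8-11) b(12) b(14) c(8) b(2) b(1)] by blast
      show "\<exists>D. (Gam_hat S k has_vector_derivative D) (at x) \<and> norm D \<le> slope"
        using c(3) norm_lyapunov_op_le_slope[OF b(8-11) b(13) b(15) c(8) b(3) b(1)] by blast
    qed
    then show ?thesis
      using norm_increment_le[OF fin uv(2) continuous_on_subset[OF Gam_continuous(1)[OF S k] sub]]
        norm_increment_le[OF fin uv(2) continuous_on_subset[OF Gam_continuous(2)[OF S k] sub]] by blast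
  qed
  show "norm (Gam S k s' - Gam S k s) \<le> slope * \<bar>s' - s\<bar>" "norm (Gam_hat S k s' - Gam_hat S k s) \<le> slope * \<bar>s' - s\<bar>"
    using ordered[of s s'] ordered[of s' s] s by (cases "s \<le> s'"; force simp: norm_minus_commute)+
qed

text \<open>Both functions have the same value at the right end of the cell and speed at most
  \<open>slope\<close>, so within one cell their different gains cannot separate them
  further.\<close>

lemma Gam_tilde_close:
  assumes part: "is_partition T N t" and S: "is_scheme d T N t S" and k: "k < N" and s: "s \<in> {t (Suc k)..T}"
  shows "norm (Gam_tilde S k s - Gam S k s) \<le> 2 * slope * mesh N t"
proof (cases "s = t (Suc k)")
  case True
  have "t (Suc 0) - t 0 \<le> mesh N t" "t 0 < t (Suc 0)"
    using partition_mesh[of 0 N t] partition_less[OF part, of 0 "Suc 0"] k by auto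
  then have "0 \<le> mesh N t" by linarith
  moreover have "Gam_tilde S k s = Gam S k s"
    using is_scheme_frozen_system[OF S k] True by (simp add: frozen_system_def gamma_system_def)
  ultimately show ?thesis using slope_nonneg by simp
next
  case False
  have Sk: "Suc k \<le> N" using k by simp
  obtain i where i: "Suc k \<le> i" "i < N" "s \<in> {t i<..t (Suc i)}"
    using partition_cell_right[OF part Sk, of s] s False by auto
  let ?b = "t (Suc i)"
  note sys = is_scheme_frozen_system[OF S k, unfolded frozen_system_def]
  have h: "?b - s \<le> mesh N t" "?b \<le> T" "s \<le> ?b"
    using partition_mesh[OF i(2), of t] partition_range[OF part, of "Suc i"] i by auto
  have "norm (Gam_tilde S k ?b - Gam_tilde S k s) \<le> slope * (?b - s)"
  proof (rule norm_increment_le[of "{}"])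
    show "continuous_on {s..?b} (Gam_tilde S k)"
      by (rule continuous_on_subset[OF gamma_system_continuous[OF sys i(1,2)]]) (use i in auto)
    fix x assume x: "x \<in> {s<..<?b} - {}"
    then have x': "x \<in> {t i<..<?b}" using i(3) by auto
    note c = scheme_open_cell[OF part S k i(1,2) x']
    note b = scheme_bounds(3)[OF part S k c(4)] coef_uniform_bound[OF c(5,6)]
    show "\<exists>D. (Gam_tilde S k has_vector_derivative D) (at x) \<and> norm D \<le> slope"
      using c(1) norm_lyapunov_op_le_slope[OF b(2-5) b(10) b(12) c(7) b(1) b(1)] by blast
  qed (use h in auto)
  moreover have "norm (Gam S k ?b - Gam S k s) \<le> slope * \<bar>?b - s\<bar>"
    using s h by (intro Gam_Lipschitz(1)[OF part S k]) auto
  moreover have "Gam_tilde S k ?b = Gam S k ?b"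
    using gamma_system_node[OF sys, of "Suc i"] i by simp
  moreover have "slope * (?b - s) \<le> slope * mesh N t"
    using h(1) slope_nonneg by (rule mult_left_mono)
  ultimately show ?thesis
    using h(3) norm_triangle_ineq4[of "Gam S k ?b - Gam S k s" "Gam_tilde S k ?b - Gam_tilde S k s"]
    by (simp add: algebra_simps)
qed

text \<open>\<open>Pk\<close> starts from \<open>Gam\<close> at the right end of its cell. Thus the
  gains, which are functions of \<open>Pk\<close> and \<open>Pk_hat\<close>, are up to the mesh
  functions of the kernels near the diagonal.\<close>

lemma P_close:
  assumes part: "is_partition T N t" and S: "is_scheme d T N t S" and k: "k < N" and s: "s \<in> {t k..t (Suc k)}"
  shows "norm (Pk S k s - Gam S k (t (Suc k))) \<le> slope * mesh N t"
    "norm (Pk_hat S k s - Gam_hat S k (t (Suc k))) \<le> slope * mesh N t"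
proof -
  let ?b = "t (Suc k)"
  note ric = is_scheme_riccati_pair[OF S k]
  have h: "?b - s \<le> mesh N t" "?b \<le> T" "s \<le> ?b" "t k \<in> {0..T}"
    using partition_mesh[OF k, of t] partition_range[OF part, of "Suc k"] partition_range[OF part, of k] s k by auto
  have der: "\<exists>D. (Pk S k has_vector_derivative D) (at x) \<and> norm D \<le> slope"
    "\<exists>D. (Pk_hat S k has_vector_derivative D) (at x) \<and> norm D \<le> slope" if x: "x \<in> {s<..<?b} - {}" for x
  proof -
    have x': "x \<in> {t k<..<?b}" "x \<in> {t k..?b}" "x \<in> {t k..<?b}" "x \<in> {0..T}" using x s h by auto
    note b = scheme_bounds(1,2)[OF part S k x'(2)] scheme_bounds(6,7)[OF part S k x'(3)] coef_uniform_bound[OF x'(4) h(4)]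
    show "\<exists>D. (Pk S k has_vector_derivative D) (at x) \<and> norm D \<le> slope"
      using scheme_P_derivative(1)[OF part S k x'(1)] norm_lyapunov_op_le_slope[OF b(5-8) b(13) b(15) b(3) b(1) b(1)] by blast
    show "\<exists>D. (Pk_hat S k has_vector_derivative D) (at x) \<and> norm D \<le> slope"
      using scheme_P_derivative(2)[OF part S k x'(1)] norm_lyapunov_op_le_slope[OF b(9-12) b(14) b(16) b(4) b(2) b(1)] by blast
  qed
  have sub: "{s..?b} \<subseteq> {t k..?b}" using s by auto
  note c = riccati_pair_continuous[OF ric(1), THEN continuous_on_subset, OF sub]
  have m: "slope * (?b - s) \<le> slope * mesh N t"
    using h(1) slope_nonneg by (rule mult_left_mono)
  show "norm (Pk S k s - Gam S k ?b) \<le> slope * mesh N t" "norm (Pk_hat S k s - Gam_hat S k ?b) \<le> slope * mesh N t"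
    using norm_increment_le[OF finite.emptyI h(3) c(1) der(1)] norm_increment_le[OF finite.emptyI h(3) c(2) der(2)] m
    unfolding ric(2,3) by (simp_all add: norm_minus_commute)
qed

section \<open>Comparison of two schemes\<close>

definition modulus :: "real \<Rightarrow> real \<Rightarrow> bool" where
  "modulus \<rho> \<omega> \<longleftrightarrow> (\<forall>s\<in>{0..T}. \<forall>\<tau>\<in>{0..T}. \<forall>\<tau>'\<in>{0..T}. \<bar>\<tau> - \<tau>'\<bar> \<le> \<rho> \<longrightarrow>
     norm (cQ d s \<tau> - cQ d s \<tau>') \<le> \<omega> \<and> norm (hQ d s \<tau> - hQ d s \<tau>') \<le> \<omega> \<and>
     norm (cR d s \<tau> - cR d s \<tau>') \<le> \<omega> \<and> norm (hR d s \<tau> - hR d s \<tau>') \<le> \<omega> \<and>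
     norm (cG d \<tau> - cG d \<tau>') \<le> \<omega> \<and> norm (hG d \<tau> - hG d \<tau>') \<le> \<omega>)"

lemma modulus_exists:
  assumes "0 < \<omega>"
  shows "\<exists>\<rho>>0. modulus \<rho> \<omega>"
proof -
  have K: "compact ({0..T} \<times> {0..T})" by (intro compact_Times compact_Icc)
  have "\<forall>\<^sub>F \<rho> in at_right (0::real). 0 < \<rho> \<and> modulus \<rho> \<omega>"
    using weight_continuous[THEN eventually_modulus[OF K _ assms]] terminal_continuous[THEN eventually_modulus[OF compact_Icc _ assms]]
      eventually_at_right_less[of 0]
  proof eventually_elim
    case (elim \<rho>)
    have w: "norm (f s \<tau> - f s \<tau>') \<le> \<omega>"
      if f: "\<forall>x\<in>{0..T} \<times> {0..T}. \<forall>y\<in>{0..T} \<times> {0..T}. dist x y \<le> \<rho> \<longrightarrow>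
          norm ((case x of (s, t) \<Rightarrow> f s t) - (case y of (s, t) \<Rightarrow> f s t)) \<le> \<omega>"
        and s: "s \<in> {0..T}" "\<tau> \<in> {0..T}" "\<tau>' \<in> {0..T}" "\<bar>\<tau> - \<tau>'\<bar> \<le> \<rho>"
      for f :: "real \<Rightarrow> real \<Rightarrow> 'x::real_normed_vector" and s \<tau> \<tau>'
    proof -
      have "dist (s, \<tau>) (s, \<tau>') \<le> \<rho>" using s(4) by (simp add: dist_Pair_Pair dist_real_def)
      then show ?thesis using f[THEN bspec, of "(s, \<tau>)", THEN bspec, of "(s, \<tau>')"] s by simp
    qed
    have g: "norm (f \<tau> - f \<tau>') \<le> \<omega>"
      if "\<forall>x\<in>{0..T}. \<forall>y\<in>{0..T}. dist x y \<le> \<rho> \<longrightarrow> norm (f x - f y) \<le> \<omega>" "\<tau> \<in> {0..T}" "\<tau>' \<in> {0..T}" "\<bar>\<tau> - \<tau>'\<bar> \<le> \<rho>"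
      for f :: "real \<Rightarrow> real^'n^'n" and \<tau> \<tau>'
      using that by (simp add: dist_real_def)
    show ?case
      unfolding modulus_def
    proof (intro conjI ballI impI)
      show "0 < \<rho>" by (rule elim(7))
      fix s \<tau> \<tau>' assume a: "s \<in> {0..T}" "\<tau> \<in> {0..T}" "\<tau>' \<in> {0..T}" "\<bar>\<tau> - \<tau>'\<bar> \<le> \<rho>"
      show "norm (cQ d s \<tau> - cQ d s \<tau>') \<le> \<omega>" by (rule w[OF elim(1) a])
      show "norm (hQ d s \<tau> - hQ d s \<tau>') \<le> \<omega>" by (rule w[OF elim(2) a])
      show "norm (cR d s \<tau> - cR d s \<tau>') \<le> \<omega>" by (rule w[OF elim(3) a])
      show "norm (hR d s \<tau> - hR d s \<tau>') \<le> \<omega>" by (rule w[OF elim(4) a])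
      show "norm (cG d \<tau> - cG d \<tau>') \<le> \<omega>" by (rule g[OF elim(5) a(2-4)])
      show "norm (hG d \<tau> - hG d \<tau>') \<le> \<omega>" by (rule g[OF elim(6) a(2-4)])
    qed
  qed
  then show ?thesis
    using eventually_happens'[OF trivial_limit_at_right_real] by blast
qed

lemma modulus_mono: "modulus \<rho> \<omega> \<Longrightarrow> \<rho>' \<le> \<rho> \<Longrightarrow> modulus \<rho>' \<omega>"
  unfolding modulus_def by (meson order_trans)

text \<open>
  Both schemes are indexed by partition points that need not coincide, so the comparison is made
  for all pairs of indices whose frozen times are \<open>\<rho>\<close>-close, at once: the difference of the gains
  at time \<open>r\<close> is controlled by another such pair.  The supremum \<open>M\<close> of all the differences,
  weighted with \<open>exp (- \<nu> (T - s))\<close>, then satisfies \<open>M \<le> M / 2 + O(\<omega> + \<rho>)\<close>.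
\<close>

lemma scheme_stability:
  obtains C where "0 \<le> C" and "\<And>\<rho> \<omega> N t S N' t' S' k j s.
    modulus \<rho> \<omega> \<Longrightarrow> 0 \<le> \<omega> \<Longrightarrow> 0 \<le> \<rho> \<Longrightarrow>
    is_partition T N t \<Longrightarrow> is_scheme d T N t S \<Longrightarrow> mesh N t \<le> \<rho> \<Longrightarrow>
    is_partition T N' t' \<Longrightarrow> is_scheme d T N' t' S' \<Longrightarrow> mesh N' t' \<le> \<rho> \<Longrightarrow>
    k < N \<Longrightarrow> j < N' \<Longrightarrow> \<bar>t k - t' j\<bar> \<le> \<rho> \<Longrightarrow> t (Suc k) \<le> s \<Longrightarrow> t' (Suc j) \<le> s \<Longrightarrow> s \<le> T \<Longrightarrow>
    norm (Gam S k s - Gam S' j s) + norm (Gam_hat S k s - Gam_hat S' j s) \<le> C * (\<omega> + \<rho>)"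
proof -
  have \<delta>2: "0 < \<delta> / 2" using \<delta>_pos by simp
  let ?\<beta> = uniform_bound
  obtain L1 where L1: "0 \<le> L1" "\<And>(B::real^'m^'n) C D R R' X X' Y Y'.
    norm B \<le> ?\<beta> \<Longrightarrow> norm C \<le> ?\<beta> \<Longrightarrow> norm D \<le> ?\<beta> \<Longrightarrow> norm X' \<le> ?\<beta> \<Longrightarrow> norm Y' \<le> ?\<beta> \<Longrightarrow>
    coercive (\<delta> / 2) (R + transpose D ** Y ** D) \<Longrightarrow> coercive (\<delta> / 2) (R' + transpose D ** Y' ** D) \<Longrightarrow>
    norm (feedback_gain B C D R X Y - feedback_gain B C D R' X' Y') \<le> L1 * (norm (R - R') + norm (X - X') + norm (Y - Y'))"
    by (rule feedback_gain_Lipschitz[OF \<delta>2 uniform_bound_nonneg], rule that)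
  obtain L2 where L2: "0 \<le> L2" "\<And>(A::real^'n^'n) (B::real^'m^'n) C D Q Q' R R' \<Theta> \<Theta>' X X' Y Y'.
    norm A \<le> ?\<beta> \<Longrightarrow> norm B \<le> ?\<beta> \<Longrightarrow> norm C \<le> ?\<beta> \<Longrightarrow> norm D \<le> ?\<beta> \<Longrightarrow> norm R' \<le> ?\<beta> \<Longrightarrow> norm \<Theta> \<le> ?\<beta> \<Longrightarrow> norm \<Theta>' \<le> ?\<beta> \<Longrightarrow>
    norm X \<le> ?\<beta> \<Longrightarrow> norm X' \<le> ?\<beta> \<Longrightarrow> norm Y' \<le> ?\<beta> \<Longrightarrow>
    norm (lyapunov_op A B C D Q R \<Theta> X Y - lyapunov_op A B C D Q' R' \<Theta>' X' Y')
      \<le> L2 * (norm (Q - Q') + norm (R - R') + norm (\<Theta> - \<Theta>') + norm (X - X') + norm (Y - Y'))"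
    by (rule lyapunov_op_Lipschitz[OF uniform_bound_nonneg], rule that)
  \<comment> \<open>The coefficient of the weighted supremum in the derivative of a difference: 1
    each for the unknown and \<open>Gam_tilde\<close>, \<open>L1\<close> for the gain.
    \<open>A\<close> below collects the terms in \<omega> and \<rho>.\<close>
  define a where "a = L2 * (L1 + 2)"
  \<comment> \<open>Makes a / \<nu> at most 1/4, so the two norms in \<open>e\<close> contribute M /
    4 each.\<close>
  define \<nu> where "\<nu> = 4 * a + 1"
  define A where "A = L2 * (2 + 4 * slope + L1 * (1 + 8 * slope))"
  have a: "0 \<le> a" and A: "0 \<le> A"
    using L1(1) L2(1) slope_nonneg by (simp_all add: a_def A_def)
  then have \<nu>: "0 < \<nu>" by (simp add: \<nu>_def)
  show ?thesis
  proof (rule that[of "exp (\<nu> * T) * (4 + 4 * A * T)"])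
    show "0 \<le> exp (\<nu> * T) * (4 + 4 * A * T)" using A T_pos by simp
  next
    fix \<rho> \<omega> N t S N' t' S' k j s
    assume md: "modulus \<rho> \<omega>" and \<omega>: "0 \<le> \<omega>" and \<rho>: "0 \<le> \<rho>"
      and p: "is_partition T N t" and S: "is_scheme d T N t S" and mesh: "mesh N t \<le> \<rho>"
      and p': "is_partition T N' t'" and S': "is_scheme d T N' t' S'" and mesh': "mesh N' t' \<le> \<rho>"
      and kjs: "k < N" "j < N'" "\<bar>t k - t' j\<bar> \<le> \<rho>" "t (Suc k) \<le> s" "t' (Suc j) \<le> s" "s \<le> T"
    define e where "e k j s = norm (Gam S k s - Gam S' j s) + norm (Gam_hat S k s - Gam_hat S' j s)" for k j s
    define w where "w s = exp (\<nu> * (T - s))" for s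
    define Adm where "Adm = {(k, j, s). k < N \<and> j < N' \<and> \<bar>t k - t' j\<bar> \<le> \<rho> \<and> t (Suc k) \<le> s \<and> t' (Suc j) \<le> s \<and> s \<le> T}"
    define M where "M = (SUP x\<in>Adm. case x of (k, j, s) \<Rightarrow> e k j s / w s)"
    have w1: "1 \<le> w s" if "s \<le> T" for s using that \<nu> by (simp add: w_def)
    have e0: "0 \<le> e k j s" for k j s by (simp add: e_def)
    have e4: "e k j s \<le> 4 * ?\<beta>" if "(k, j, s) \<in> Adm" for k j s
    proof -
      have "s \<in> {t (Suc k)..T}" "s \<in> {t' (Suc j)..T}" "k < N" "j < N'" using that by (auto simp: Adm_def)
      then have "norm (Gam S k s) \<le> ?\<beta>" "norm (Gam_hat S k s) \<le> ?\<beta>" "norm (Gam S' j s) \<le> ?\<beta>" "norm (Gam_hat S' j s) \<le> ?\<beta>"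
        using scheme_bounds(4,5)[OF p S] scheme_bounds(4,5)[OF p' S'] by auto
      then show ?thesis
        using norm_triangle_ineq4[of "Gam S k s" "Gam S' j s"] norm_triangle_ineq4[of "Gam_hat S k s" "Gam_hat S' j s"]
        unfolding e_def by linarith
    qed
    \<comment> \<open>The crude bound ensures that \<open>M\<close> is a genuine supremum; only then
      can M \<le> M / 2 + ... be solved for M.\<close>
    have bdd: "bdd_above ((\<lambda>x. case x of (k, j, s) \<Rightarrow> e k j s / w s) ` Adm)"
    proof (rule bdd_aboveI2)
      fix x assume x: "x \<in> Adm"
      obtain k j s where xe: "x = (k, j, s)" by (cases x)
      have "s \<le> T" using x by (simp add: xe Adm_def)
      then have "e k j s / w s \<le> e k j s / 1" using w1 e0 by (intro divide_left_mono) (auto simp: w_def)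
      also have "\<dots> \<le> 4 * ?\<beta>" using e4 x by (simp add: xe)
      finally show "(case x of (k, j, s) \<Rightarrow> e k j s / w s) \<le> 4 * ?\<beta>" by (simp add: xe)
    qed
    have upper: "e k j s \<le> M * w s" if "(k, j, s) \<in> Adm" for k j s
    proof -
      have "e k j s / w s \<le> M"
        unfolding M_def using cSUP_upper[OF that bdd] by simp
      then show ?thesis by (simp add: w_def pos_divide_le_eq)
    qed
    have adm0: "(0, 0, T) \<in> Adm"
      using partition_range[OF p, of "Suc 0"] partition_range[OF p', of "Suc 0"] partition_ends[OF p] partition_ends[OF p'] \<rho>
      by (auto simp: Adm_def)
    have M0: "0 \<le> M"
      using upper[OF adm0] e0[of 0 0 T] by (simp add: w_def)
    have gain: "norm (Th_hat S r - Th_hat S' r) \<le> L1 * (\<omega> + 8 * slope * \<rho> + M * w r)"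
      if i: "i < N" "r \<in> {t i<..<t (Suc i)}" and i': "i' < N'" "r \<in> {t' i'<..<t' (Suc i')}" for r i i'
    proof -
      \<comment> \<open>The kernels of both cells are defined only from the later right end on. Both
        cells contain r, so their left ends are \<rho>-close and (i, i', q) is admissible
        again.\<close>
      define q where "q = max (t (Suc i)) (t' (Suc i'))"
      have ti: "0 \<le> t i" "t (Suc i) \<le> T" "0 \<le> t' i'" "t' (Suc i') \<le> T" "t (Suc i) - t i \<le> \<rho>" "t' (Suc i') - t' i' \<le> \<rho>"
        using partition_range[OF p, of i] partition_range[OF p, of "Suc i"] partition_range[OF p', of i']
          partition_range[OF p', of "Suc i'"] i i' partition_mesh[OF i(1), of t] partition_mesh[OF i'(1), of t'] mesh mesh' by auto
      have q: "r \<le> q" "q \<le> T" "t (Suc i) \<le> q" "t' (Suc i') \<le> q" "q - t (Suc i) \<le> \<rho>" "q - t' (Suc i') \<le> \<rho>"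
        "\<bar>t i - t' i'\<bar> \<le> \<rho>"
        using i(2) i'(2) ti by (auto simp: q_def max_def abs_le_iff)
      have adm: "(i, i', q) \<in> Adm" using q i(1) i'(1) by (simp add: Adm_def)
      have r: "r \<in> {t i..t (Suc i)}" "r \<in> {t' i'..t' (Suc i')}" "r \<in> {t i..<t (Suc i)}" "r \<in> {t' i'..<t' (Suc i')}" "r \<in> {0..T}"
        "t i \<le> r" "t' i' \<le> r" "r \<le> T" "t i \<in> {0..T}" "t' i' \<in> {0..T}"
        using i(2) i'(2) ti by auto
      have sm: "slope * mesh N t \<le> slope * \<rho>" "slope * mesh N' t' \<le> slope * \<rho>"
        "slope * \<bar>q - t (Suc i)\<bar> \<le> slope * \<rho>" "slope * \<bar>q - t' (Suc i')\<bar> \<le> slope * \<rho>"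
        using mesh mesh' q slope_nonneg by (auto intro: mult_left_mono)
      have four: "norm (x1 - x4) \<le> norm (x2 - x3) + 4 * (slope * \<rho>)"
        if "norm (x1 - y1) \<le> slope * \<rho>" "norm (x2 - y1) \<le> slope * \<rho>" "norm (x4 - y4) \<le> slope * \<rho>" "norm (x3 - y4) \<le> slope * \<rho>"
        for x1 x2 x3 x4 y1 y4 :: "real^'n^'n"
      proof -
        show ?thesis
          using that dist_triangle[of x1 x4 y1] dist_triangle[of y1 x4 x2] dist_triangle[of x2 x4 x3] dist_triangle[of x3 x4 y4]
          unfolding dist_norm norm_minus_commute[of y1 x2] norm_minus_commute[of y4 x4] by linarith
      qed
      have P: "norm (Pk S i r - Pk S' i' r) \<le> norm (Gam S i q - Gam S' i' q) + 4 * (slope * \<rho>)"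
        using P_close(1)[OF p S i(1) r(1)] P_close(1)[OF p' S' i'(1) r(2)] sm
          Gam_Lipschitz(1)[OF p S i(1) order_refl ti(2) q(3,2)] Gam_Lipschitz(1)[OF p' S' i'(1) order_refl ti(4) q(4,2)]
        by (intro four[of _ "Gam S i (t (Suc i))" _ _ "Gam S' i' (t' (Suc i'))"]) linarith+
      have Ph: "norm (Pk_hat S i r - Pk_hat S' i' r) \<le> norm (Gam_hat S i q - Gam_hat S' i' q) + 4 * (slope * \<rho>)"
        using P_close(2)[OF p S i(1) r(1)] P_close(2)[OF p' S' i'(1) r(2)] sm
          Gam_Lipschitz(2)[OF p S i(1) order_refl ti(2) q(3,2)] Gam_Lipschitz(2)[OF p' S' i'(1) order_refl ti(4) q(4,2)]
        by (intro four[of _ "Gam_hat S i (t (Suc i))" _ _ "Gam_hat S' i' (t' (Suc i'))"]) linarith+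
      have R: "norm (hR d r (t i) - hR d r (t' i')) \<le> \<omega>"
        using md r q(7) unfolding modulus_def by blast
      \<comment> \<open>The weight decreases in time, so the bound at the later time q serves at r
        as well.\<close>
      have "w q \<le> w r" using q(1) \<nu> by (simp add: w_def)
      then have "M * w q \<le> M * w r" using M0 by (rule mult_left_mono)
      then have sum: "norm (hR d r (t i) - hR d r (t' i')) + norm (Pk_hat S i r - Pk_hat S' i' r) + norm (Pk S i r - Pk S' i' r)
          \<le> \<omega> + 8 * slope * \<rho> + M * w r"
        using P Ph R upper[OF adm] unfolding e_def by linarith
      have co: "coercive (\<delta> / 2) (hR d r (t i) + transpose (hD d r) ** Pk S i r ** hD d r)"
        "coercive (\<delta> / 2) (hR d r (t' i') + transpose (hD d r) ** Pk S' i' r ** hD d r)"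
        using gram_coercive_psd(2)[OF ti(1) r(6,8) is_scheme_psd(4)[OF p S i(1) r(1)]]
          gram_coercive_psd(2)[OF ti(3) r(7,8) is_scheme_psd(4)[OF p' S' i'(1) r(2)]] by auto
      note cb = coef_uniform_bound[OF r(5,9)]
      have "norm (Th_hat S r - Th_hat S' r) \<le> L1 * (norm (hR d r (t i) - hR d r (t' i'))
          + norm (Pk_hat S i r - Pk_hat S' i' r) + norm (Pk S i r - Pk S' i' r))"
        unfolding is_scheme_gain(2)[OF S i(1) r(3)] is_scheme_gain(2)[OF S' i'(1) r(4)]
        by (rule L1(2)[OF cb(6,7,8) scheme_bounds(2)[OF p' S' i'(1) r(2)] scheme_bounds(1)[OF p' S' i'(1) r(2)] co])
      also have "\<dots> \<le> L1 * (\<omega> + 8 * slope * \<rho> + M * w r)"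
        by (rule mult_left_mono[OF sum L1(1)])
      finally show ?thesis .
    qed
    have key: "e k j s / w s \<le> M / 2 + (2 + 2 * A * T) * (\<omega> + \<rho>)" if adm: "(k, j, s) \<in> Adm" for k j s
    proof -
      have kjs: "k < N" "j < N'" "\<bar>t k - t' j\<bar> \<le> \<rho>" "t (Suc k) \<le> s" "t' (Suc j) \<le> s" "s \<le> T"
        using adm by (auto simp: Adm_def)
      have Sk: "Suc k \<le> N" "Suc j \<le> N'" using kjs by auto
      define E where "E = t ` {..N} \<union> t' ` {..N'}"
      define \<phi> where "\<phi> r = - (a * M / \<nu> * w r) + A * (\<omega> + \<rho>) * r" for r
      have c\<phi>: "continuous_on {s..T} \<phi>" unfolding \<phi>_def w_def by (intro continuous_intros)
      have d\<phi>: "(\<phi> has_real_derivative a * M * w r + A * (\<omega> + \<rho>)) (at r)" for r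
        unfolding \<phi>_def w_def using \<nu> by (auto intro!: derivative_eq_intros)
      have tkj: "t k \<in> {0..T}" "t' j \<in> {0..T}"
        using partition_range[OF p, of k] partition_range[OF p', of j] kjs by auto
      have dif: "\<exists>D. ((\<lambda>r. Gam S k r - Gam S' j r) has_vector_derivative D) (at r) \<and> norm D \<le> a * M * w r + A * (\<omega> + \<rho>)"
        "\<exists>D. ((\<lambda>r. Gam_hat S k r - Gam_hat S' j r) has_vector_derivative D) (at r) \<and> norm D \<le> a * M * w r + A * (\<omega> + \<rho>)"
        if r: "r \<in> {s<..<T} - E" for r
      proof -
        have rk: "r \<in> {t (Suc k)..T}" "r \<in> {t' (Suc j)..T}" "r \<notin> t ` {..N}" "r \<notin> t' ` {..N'}" "r \<le> T"
          using r kjs by (auto simp: E_def)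
        obtain i where i: "Suc k \<le> i" "i < N" "r \<in> {t i<..<t (Suc i)}"
          by (rule partition_cell_open[OF p Sk(1) rk(1,3)])
        obtain i' where i': "Suc j \<le> i'" "i' < N'" "r \<in> {t' i'<..<t' (Suc i')}"
          by (rule partition_cell_open[OF p' Sk(2) rk(2,4)])
        note c = scheme_open_cell[OF p S kjs(1) i] and c' = scheme_open_cell[OF p' S' kjs(2) i']
        note b = scheme_bounds(3-5)[OF p S kjs(1) rk(1)] and b' = scheme_bounds(3-5)[OF p' S' kjs(2) rk(2)]
        note cb = coef_uniform_bound[OF c(5,6)] and cb' = coef_uniform_bound[OF c'(5,6)]
        have "(k, j, r) \<in> Adm" using kjs rk by (simp add: Adm_def)
        then have er: "norm (Gam S k r - Gam S' j r) \<le> M * w r" "norm (Gam_hat S k r - Gam_hat S' j r) \<le> M * w r"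
          using upper[of k j r] norm_ge_zero[of "Gam S k r - Gam S' j r"] norm_ge_zero[of "Gam_hat S k r - Gam_hat S' j r"]
          unfolding e_def by linarith+
        have md': "norm (cQ d r (t k) - cQ d r (t' j)) \<le> \<omega>" "norm (hQ d r (t k) - hQ d r (t' j)) \<le> \<omega>"
          "norm (cR d r (t k) - cR d r (t' j)) \<le> \<omega>" "norm (hR d r (t k) - hR d r (t' j)) \<le> \<omega>"
          using md c(5) tkj kjs(3) unfolding modulus_def by blast+
        have "2 * slope * mesh N t \<le> 2 * slope * \<rho>" "2 * slope * mesh N' t' \<le> 2 * slope * \<rho>"
          using mesh mesh' slope_nonneg by (auto intro: mult_left_mono)
        then have "norm (Gam_tilde S k r - Gam S k r) \<le> 2 * slope * \<rho>" "norm (Gam_tilde S' j r - Gam S' j r) \<le> 2 * slope * \<rho>"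
          using Gam_tilde_close[OF p S kjs(1) rk(1)] Gam_tilde_close[OF p' S' kjs(2) rk(2)] by linarith+
        moreover have "norm (Gam_tilde S k r - Gam_tilde S' j r)
            \<le> norm (Gam_tilde S k r - Gam S k r) + norm (Gam_tilde S' j r - Gam S' j r) + norm (Gam S k r - Gam S' j r)"
          by norm
        ultimately have gt: "norm (Gam_tilde S k r - Gam_tilde S' j r) \<le> M * w r + 4 * slope * \<rho>"
          using er(1) by linarith
        note g = gain[OF i(2,3) i'(2,3)]
        have tot: "L2 * (q1 + q2 + norm (Th_hat S r - Th_hat S' r) + q3 + norm (Gam_tilde S k r - Gam_tilde S' j r))
            \<le> a * M * w r + A * (\<omega> + \<rho>)" if "q1 \<le> \<omega>" "q2 \<le> \<omega>" "q3 \<le> M * w r" for q1 q2 q3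
        proof -
          have "L2 * (q1 + q2 + norm (Th_hat S r - Th_hat S' r) + q3 + norm (Gam_tilde S k r - Gam_tilde S' j r))
              \<le> L2 * (\<omega> + \<omega> + L1 * (\<omega> + 8 * slope * \<rho> + M * w r) + M * w r + (M * w r + 4 * slope * \<rho>))"
            by (intro mult_left_mono add_mono that g gt L2(1))
          also have "\<dots> = a * M * w r + L2 * ((2 + L1) * \<omega> + (4 * slope + 8 * L1 * slope) * \<rho>)"
            by (simp add: a_def algebra_simps)
          also have "\<dots> \<le> a * M * w r + L2 * ((2 + 4 * slope + L1 * (1 + 8 * slope)) * \<omega> + (2 + 4 * slope + L1 * (1 + 8 * slope)) * \<rho>)"
            using L1(1) slope_nonneg \<omega> \<rho>
            by (intro add_left_mono mult_left_mono add_mono mult_right_mono L2(1)) (auto simp: algebra_simps)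
          also have "\<dots> = a * M * w r + A * (\<omega> + \<rho>)" by (simp add: A_def algebra_simps)
          finally show ?thesis .
        qed
        show "\<exists>D. ((\<lambda>r. Gam S k r - Gam S' j r) has_vector_derivative D) (at r) \<and> norm D \<le> a * M * w r + A * (\<omega> + \<rho>)"
          by (intro exI conjI, rule has_vector_derivative_diff[OF c(2) c'(2)], unfold minus_diff_minus norm_minus_cancel)
            (rule order_trans[OF L2(2)[OF cb(5-8) cb'(11) c(8) c'(8) b(2) b'(2) b'(1)] tot[OF md'(1,3) er(1)]])
        show "\<exists>D. ((\<lambda>r. Gam_hat S k r - Gam_hat S' j r) has_vector_derivative D) (at r) \<and> norm D \<le> a * M * w r + A * (\<omega> + \<rho>)"
          by (intro exI conjI, rule has_vector_derivative_diff[OF c(3) c'(3)], unfold minus_diff_minus norm_minus_cancel)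
            (rule order_trans[OF L2(2)[OF cb(5-8) cb'(12) c(8) c'(8) b(3) b'(3) b'(1)] tot[OF md'(2,4) er(2)]])
      qed
      have "a * M / \<nu> \<le> M / 4"
        using M0 a \<nu> by (simp add: \<nu>_def field_simps)
      then have "a * M / \<nu> * w s \<le> M / 4 * w s" by (intro mult_right_mono) (simp_all add: w_def)
      moreover have "0 \<le> a * M / \<nu> * w T" using a M0 \<nu> by (simp add: w_def)
      moreover have "0 \<le> s" using kjs partition_range[OF p, of "Suc k"] by auto
      then have "A * (\<omega> + \<rho>) * (T - s) \<le> A * (\<omega> + \<rho>) * T" using A \<omega> \<rho> by (intro mult_left_mono) auto
      ultimately have \<phi>: "\<phi> T - \<phi> s \<le> M / 4 * w s + A * (\<omega> + \<rho>) * T"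
        by (simp add: \<phi>_def right_diff_distrib)
      have fin: "finite E" by (simp add: E_def)
      have sub: "{s..T} \<subseteq> {t (Suc k)..T}" "{s..T} \<subseteq> {t' (Suc j)..T}" using kjs by auto
      have inc: "norm (f T - f s) \<le> M / 4 * w s + A * (\<omega> + \<rho>) * T"
        if cf: "continuous_on {s..T} f" and df: "\<And>r. r \<in> {s<..<T} - E \<Longrightarrow>
          \<exists>D. (f has_vector_derivative D) (at r) \<and> norm D \<le> a * M * w r + A * (\<omega> + \<rho>)" for f :: "real \<Rightarrow> real^'n^'n"
      proof -
        obtain f' where f': "\<And>r. r \<in> {s<..<T} - E \<Longrightarrow> (f has_vector_derivative f' r) (at r) \<and> norm (f' r) \<le> a * M * w r + A * (\<omega> + \<rho>)"
          using df by metis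
        have "norm (f T - f s) \<le> \<phi> T - \<phi> s"
          by (rule norm_increment_bound[OF fin kjs(6) cf c\<phi> conjunct1[OF f'] d\<phi> conjunct2[OF f']])
        then show ?thesis using \<phi> by linarith
      qed
      have fT: "Gam S k T = cG d (t k)" "Gam_hat S k T = hG d (t k)" "Gam S' j T = cG d (t' j)" "Gam_hat S' j T = hG d (t' j)"
        using is_scheme_frozen_system[OF S kjs(1)] is_scheme_frozen_system[OF S' kjs(2)]
        by (simp_all add: frozen_system_def gamma_system_def)
      have G: "norm (cG d (t k) - cG d (t' j)) \<le> \<omega>" "norm (hG d (t k) - hG d (t' j)) \<le> \<omega>"
        using md tkj kjs(3) unfolding modulus_def by blast+
      have tri: "norm y \<le> norm x + norm (x - y)" for x y :: "real^'n^'n"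
        using norm_triangle_ineq4[of x "x - y"] by simp
      have e1: "norm (Gam S k s - Gam S' j s) \<le> \<omega> + (M / 4 * w s + A * (\<omega> + \<rho>) * T)"
        using inc[OF continuous_on_diff[OF continuous_on_subset[OF Gam_continuous(1)[OF S kjs(1)] sub(1)]
            continuous_on_subset[OF Gam_continuous(1)[OF S' kjs(2)] sub(2)]] dif(1)]
          tri[of "Gam S k s - Gam S' j s" "cG d (t k) - cG d (t' j)"] G(1)
        unfolding fT by linarith
      have e2: "norm (Gam_hat S k s - Gam_hat S' j s) \<le> \<omega> + (M / 4 * w s + A * (\<omega> + \<rho>) * T)"
        using inc[OF continuous_on_diff[OF continuous_on_subset[OF Gam_continuous(2)[OF S kjs(1)] sub(1)]
            continuous_on_subset[OF Gam_continuous(2)[OF S' kjs(2)] sub(2)]] dif(2)]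
          tri[of "Gam_hat S k s - Gam_hat S' j s" "hG d (t k) - hG d (t' j)"] G(2)
        unfolding fT by linarith
      have c0: "0 \<le> (2 + 2 * A * T) * (\<omega> + \<rho>)" using A T_pos \<omega> \<rho> by simp
      have "e k j s \<le> M / 2 * w s + (2 + 2 * A * T) * (\<omega> + \<rho>) * 1"
        using e1 e2 \<rho> by (simp add: e_def algebra_simps)
      also have "\<dots> \<le> M / 2 * w s + (2 + 2 * A * T) * (\<omega> + \<rho>) * w s"
        using mult_left_mono[OF w1[OF kjs(6)] c0] by simp
      finally show ?thesis by (simp add: w_def pos_divide_le_eq distrib_right)
    qed
    have "(SUP x\<in>Adm. case x of (k, j, s) \<Rightarrow> e k j s / w s) \<le> M / 2 + (2 + 2 * A * T) * (\<omega> + \<rho>)"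
      using adm0 key by (intro cSUP_least) auto
    then have "M \<le> M / 2 + (2 + 2 * A * T) * (\<omega> + \<rho>)" by (simp only: M_def)
    then have M: "M \<le> (4 + 4 * A * T) * (\<omega> + \<rho>)" by (simp add: algebra_simps)
    have adm: "(k, j, s) \<in> Adm" using kjs by (simp add: Adm_def)
    have "0 \<le> s" using kjs partition_range[OF p, of "Suc k"] by auto
    then have "w s \<le> exp (\<nu> * T)" using \<nu> by (simp add: w_def)
    then have "M * w s \<le> ((4 + 4 * A * T) * (\<omega> + \<rho>)) * exp (\<nu> * T)"
      using M M0 by (intro mult_mono) (auto simp: w_def)
    then show "norm (Gam S k s - Gam S' j s) + norm (Gam_hat S k s - Gam_hat S' j s)
        \<le> exp (\<nu> * T) * (4 + 4 * A * T) * (\<omega> + \<rho>)"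
      using upper[OF adm] by (simp add: e_def mult_ac)
  qed
qed

end

section \<open>The limit\<close>

lemma cell_props:
  assumes part: "is_partition T N t" and s: "s \<in> {0..T}"
  shows "cell t s < N" "s \<le> t (Suc (cell t s))" "t (cell t s) \<le> s"
    "cell t s \<noteq> 0 \<Longrightarrow> t (cell t s) < s"
proof -
  have last: "s \<le> t (Suc (N - 1))" using partition_ends[OF part] s by simp
  have "cell t s \<le> N - 1" unfolding cell_def by (rule Least_le[of "\<lambda>k. s \<le> t (Suc k)", OF last])
  then show "cell t s < N" using partition_ends(3)[OF part] by linarith
  show "s \<le> t (Suc (cell t s))" unfolding cell_def by (rule LeastI[of "\<lambda>k. s \<le> t (Suc k)", OF last])
  show less: "t (cell t s) < s" if ne: "cell t s \<noteq> 0"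
  proof -
    obtain c where c: "cell t s = Suc c" using ne by (cases "cell t s") auto
    have "\<not> s \<le> t (Suc c)" using c not_less_Least[of c "\<lambda>k. s \<le> t (Suc k)"] by (simp add: cell_def)
    then show ?thesis by (simp add: c)
  qed
  show "t (cell t s) \<le> s"
    using less s partition_ends(1)[OF part] by (cases "cell t s = 0") auto
qed

lemma cell_eq:
  assumes part: "is_partition T N t" and i: "i < N" "s \<in> {t i<..t (Suc i)}"
  shows "cell t s = i"
  unfolding cell_def
proof (rule Least_equality)
  show "s \<le> t (Suc i)" using i by simp
  fix j assume "s \<le> t (Suc j)"
  then have "\<not> Suc j \<le> i" using partition_le[OF part, of "Suc j" i] i by force
  then show "i \<le> j" by simp
qed

text \<open>This index merges the two branches of \<open>interp2\<close> into one formula, evaluated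
  at the maximum of s, \<tau> and t 1.\<close>

definition frozen_index :: "(nat \<Rightarrow> real) \<Rightarrow> real \<Rightarrow> nat" where
  "frozen_index t \<tau> = (if \<tau> \<le> t 1 then 0 else cell t \<tau> - 1)"

lemma interp2_eq: "interp2 t F s \<tau> = F (frozen_index t \<tau>) (max s (max \<tau> (t 1)))"
  by (auto simp: interp2_def frozen_index_def max_def)

lemma frozen_index_props:
  assumes part: "is_partition T N t" and \<tau>: "\<tau> \<in> {0..T}"
  shows "frozen_index t \<tau> < N" "t (Suc (frozen_index t \<tau>)) \<le> max \<tau> (t 1)"
    "\<bar>t (frozen_index t \<tau>) - \<tau>\<bar> \<le> 2 * mesh N t" "max \<tau> (t 1) \<le> \<tau> + mesh N t" "max \<tau> (t 1) \<le> T" "0 \<le> mesh N t"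
proof -
  have N: "0 < N" by (rule partition_ends(3)[OF part])
  have t1: "t 0 = 0" "t 1 - t 0 \<le> mesh N t" "0 \<le> t 1" "t 1 \<le> T"
    using partition_ends(1)[OF part] partition_mesh[OF N, of t] partition_range[OF part, of 1] N by auto
  show "0 \<le> mesh N t" "max \<tau> (t 1) \<le> \<tau> + mesh N t" "max \<tau> (t 1) \<le> T" using t1 \<tau> by auto
  show "frozen_index t \<tau> < N" using cell_props(1)[OF part \<tau>] N by (auto simp: frozen_index_def)
  show "t (Suc (frozen_index t \<tau>)) \<le> max \<tau> (t 1)" "\<bar>t (frozen_index t \<tau>) - \<tau>\<bar> \<le> 2 * mesh N t"
  proof -
    have "t (Suc (frozen_index t \<tau>)) \<le> max \<tau> (t 1) \<and> \<bar>t (frozen_index t \<tau>) - \<tau>\<bar> \<le> 2 * mesh N t"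
    proof (cases "\<tau> \<le> t 1")
      case True
      then show ?thesis using t1 \<tau> by (auto simp: frozen_index_def)
    next
      case False
      note c = cell_props[OF part \<tau>]
      have "cell t \<tau> \<noteq> 0" using False c(2) by (metis One_nat_def)
      then obtain c' where c': "cell t \<tau> = Suc c'" by (cases "cell t \<tau>") auto
      have "Suc c' < N" using c(1) c' by simp
      then have "t (Suc c') - t c' \<le> mesh N t" "t (Suc (Suc c')) - t (Suc c') \<le> mesh N t" "t c' \<le> t (Suc c')"
        using partition_mesh[of c' N t] partition_mesh[of "Suc c'" N t] partition_le[OF part, of c' "Suc c'"] by auto
      moreover have "frozen_index t \<tau> = c'" using False c' by (simp add: frozen_index_def)
      ultimately show ?thesis using c(2,3) c' by auto
    qed
    then show "t (Suc (frozen_index t \<tau>)) \<le> max \<tau> (t 1)" "\<bar>t (frozen_index t \<tau>) - \<tau>\<bar> \<le> 2 * mesh N t" by auto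
  qed
qed

lemma abs_max_diff_le: "\<bar>a - c\<bar> \<le> r \<Longrightarrow> \<bar>b - d\<bar> \<le> r \<Longrightarrow> \<bar>max a b - max c d\<bar> \<le> r"
  for a b c d r :: real
  by linarith

lemma uniform_partition:
  assumes "0 < T"
  shows "is_partition T (Suc n) (\<lambda>i. T * i / Suc n)" "mesh (Suc n) (\<lambda>i. T * i / Suc n) \<le> T / Suc n"
proof -
  show "is_partition T (Suc n) (\<lambda>i. T * i / Suc n)"
    using assms by (simp add: is_partition_def divide_strict_right_mono)
  show "mesh (Suc n) (\<lambda>i. T * i / Suc n) \<le> T / Suc n"
    unfolding mesh_def
  proof (rule Max.boundedI)
    fix x assume "x \<in> (\<lambda>k. T * real (Suc k) / real (Suc n) - T * real k / real (Suc n)) ` {..<Suc n}"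
    then show "x \<le> T / Suc n" by (auto simp: diff_divide_distrib[symmetric] algebra_simps)
  qed auto
qed

text \<open>A uniform limit of approximate solutions is a solution, because it equals the primitive of \<open>l\<close>.\<close>

lemma limit_of_approximate_solutions:
  fixes x l :: "real \<Rightarrow> 'a::banach"
  assumes "\<tau> \<le> T" and x: "continuous_on {\<tau>..T} x" and l: "continuous_on {\<tau>..T} l"
    and approx: "\<And>\<eta>. 0 < \<eta> \<Longrightarrow> \<exists>u g E. u \<le> \<tau> + \<eta> \<and> \<tau> \<le> u \<and> finite E \<and> continuous_on {u..T} g \<and>
      (\<forall>r\<in>{u..T}. norm (g r - x r) \<le> \<eta>) \<and>
      (\<forall>r\<in>{u<..<T} - E. \<exists>D. (g has_vector_derivative - D) (at r) \<and> norm (D - l r) \<le> \<eta>)"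
    and s: "s \<in> {\<tau>..T}"
  shows "(x has_vector_derivative - l s) (at s within {\<tau>..T})"
proof -
  \<comment> \<open>The primitive of - l that agrees with \<open>x\<close> at \<open>T\<close>; the
    equation for \<open>x\<close> follows once x = h.\<close>
  define h where "h s = x T + (integral {\<tau>..T} l - integral {\<tau>..s} l)" for s
  have h': "(h has_vector_derivative - l s) (at s within {\<tau>..T})" if "s \<in> {\<tau>..T}" for s
    unfolding h_def using integral_has_vector_derivative[OF l that]
    by (auto intro!: derivative_eq_intros)
  have ch: "continuous_on {\<tau>..T} h" using h' by (rule continuous_on_of_vector_derivative)
  have open_eq: "x s = h s" if s: "s \<in> {\<tau><..T}" for s
  proof -
    have "norm (x s - h s) \<le> 0 + e" if e: "e > 0" for e
    proof -
      \<comment> \<open>The first bound makes the approximation available at s. The second pays for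
        two errors in values and one derivative error integrated over at most T - \<tau>.\<close>
      define \<eta> where "\<eta> = min (s - \<tau>) (e / (2 + (T - \<tau>)))"
      have \<eta>: "0 < \<eta>" "\<eta> \<le> s - \<tau>" "\<eta> * (2 + (T - \<tau>)) \<le> e"
      proof -
        have q: "0 < 2 + (T - \<tau>)" using s by simp
        then show "0 < \<eta>" using s e by (simp add: \<eta>_def)
        show "\<eta> \<le> s - \<tau>" by (simp add: \<eta>_def)
        have "\<eta> \<le> e / (2 + (T - \<tau>))" by (simp add: \<eta>_def)
        then show "\<eta> * (2 + (T - \<tau>)) \<le> e" using q by (simp only: pos_le_divide_eq)
      qed
      obtain u g E where u: "u \<le> \<tau> + \<eta>" "\<tau> \<le> u" "finite E" "continuous_on {u..T} g"
        "\<And>r. r \<in> {u..T} \<Longrightarrow> norm (g r - x r) \<le> \<eta>"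
        "\<And>r. r \<in> {u<..<T} - E \<Longrightarrow> \<exists>D. (g has_vector_derivative - D) (at r) \<and> norm (D - l r) \<le> \<eta>"
        using approx[OF \<eta>(1)] by blast
      have su: "s \<in> {u..T}" "T \<in> {u..T}" "s \<le> T" using s u(1) \<eta>(2) by auto
      have "norm ((g T - h T) - (g s - h s)) \<le> \<eta> * (T - s)"
      proof (rule norm_increment_le[OF u(3) su(3), where f="\<lambda>r. g r - h r"])
        show "continuous_on {s..T} (\<lambda>r. g r - h r)"
          by (intro continuous_on_diff continuous_on_subset[OF u(4)] continuous_on_subset[OF ch]) (use su s in auto)
        fix r assume r: "r \<in> {s<..<T} - E"
        have ru: "r \<in> {u<..<T} - E" using r su by auto
        obtain D where D: "(g has_vector_derivative - D) (at r)" "norm (D - l r) \<le> \<eta>"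
          using u(6)[OF ru] by blast
        have "r \<in> {\<tau>..T}" "r \<in> {\<tau><..<T}" using r s by auto
        then have "(h has_vector_derivative - l r) (at r)"
          by (intro has_vector_derivative_at_of_within[OF h'])
        from has_vector_derivative_diff[OF D(1) this]
        show "\<exists>D. ((\<lambda>r. g r - h r) has_vector_derivative D) (at r) \<and> norm D \<le> \<eta>"
          using D(2) unfolding minus_diff_minus by (metis norm_minus_cancel)
      qed
      moreover have "\<eta> * (T - s) \<le> \<eta> * (T - \<tau>)" using \<eta>(1) s by (intro mult_left_mono) auto
      moreover have "h T = x T" by (simp add: h_def)
      moreover have "norm (x s - h s) \<le> norm (g T - x T) + norm (g s - x s) + norm ((g T - x T) - (g s - h s))"
        by norm
      ultimately have "norm (x s - h s) \<le> \<eta> * (2 + (T - \<tau>))"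
        using u(5)[OF su(1)] u(5)[OF su(2)] by (simp add: algebra_simps)
      then show ?thesis using \<eta>(3) by simp
    qed
    then have "norm (x s - h s) \<le> 0" by (rule field_le_epsilon)
    then show ?thesis by simp
  qed
  have eq: "x s = h s" if s: "s \<in> {\<tau>..T}" for s
  \<comment> \<open>The approximations may start strictly after \<tau>, so the left endpoint is
    reached by continuity.\<close>
  proof (cases "s = \<tau> \<and> \<tau> < T")
    case True
    have "((\<lambda>r. x r - h r) \<longlongrightarrow> x \<tau> - h \<tau>) (at \<tau> within {\<tau>..T})"
      using continuous_on_diff[OF x ch] True by (auto simp: continuous_on_def)
    then have lim: "((\<lambda>r. x r - h r) \<longlongrightarrow> x \<tau> - h \<tau>) (at_right \<tau>)"
      using True by (simp add: at_within_Icc_at_right)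
    have "\<forall>\<^sub>F r in at_right \<tau>. x r - h r = 0"
      unfolding eventually_at_right_field using True open_eq by (intro exI[of _ T]) auto
    then have "((\<lambda>r. x r - h r) \<longlongrightarrow> 0) (at_right \<tau>)"
      by (rule tendsto_eventually)
    from tendsto_unique[OF trivial_limit_at_right_real lim this] show ?thesis using True by simp
  next
    case False
    show ?thesis
    proof (cases "s = T")
      case True then show ?thesis by (simp add: h_def)
    qed (use False s open_eq in auto)
  qed
  show ?thesis
    by (rule has_vector_derivative_transform[OF s _ h'[OF s]]) (simp add: eq)
qed

context lq_problem
begin

section \<open>Uniform closeness of the interpolations\<close>

text \<open>Both kernels exist at the later of the two times, where \<open>scheme_stability\<close>
  applies, and moving there costs \<open>slope\<close> times the distance. The stability estimate is
  a hypothesis, so that its constant C stays fixed.\<close>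

lemma Gam_close:
  assumes C: "\<And>\<rho> \<omega> N t S N' t' S' k j s.
      modulus \<rho> \<omega> \<Longrightarrow> 0 \<le> \<omega> \<Longrightarrow> 0 \<le> \<rho> \<Longrightarrow>
      is_partition T N t \<Longrightarrow> is_scheme d T N t S \<Longrightarrow> mesh N t \<le> \<rho> \<Longrightarrow>
      is_partition T N' t' \<Longrightarrow> is_scheme d T N' t' S' \<Longrightarrow> mesh N' t' \<le> \<rho> \<Longrightarrow>
      k < N \<Longrightarrow> j < N' \<Longrightarrow> \<bar>t k - t' j\<bar> \<le> \<rho> \<Longrightarrow> t (Suc k) \<le> s \<Longrightarrow> t' (Suc j) \<le> s \<Longrightarrow> s \<le> T \<Longrightarrow>
      norm (Gam S k s - Gam S' j s) + norm (Gam_hat S k s - Gam_hat S' j s) \<le> C * (\<omega> + \<rho>)"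
    and pre: "modulus \<rho> \<omega>" "0 \<le> \<omega>" "0 \<le> \<rho>"
      "is_partition T N t" "is_scheme d T N t S" "mesh N t \<le> \<rho>"
      "is_partition T N' t'" "is_scheme d T N' t' S'" "mesh N' t' \<le> \<rho>"
      "k < N" "j < N'" "\<bar>t k - t' j\<bar> \<le> \<rho>"
    and s: "t (Suc k) \<le> s" "s \<le> T" "t' (Suc j) \<le> s'" "s' \<le> T"
  shows "norm (Gam S k s - Gam S' j s') \<le> C * (\<omega> + \<rho>) + slope * \<bar>s - s'\<bar>"
    "norm (Gam_hat S k s - Gam_hat S' j s') \<le> C * (\<omega> + \<rho>) + slope * \<bar>s - s'\<bar>"
proof -
  define q where "q = max s s'"
  have q: "t (Suc k) \<le> q" "t' (Suc j) \<le> q" "q \<le> T" using s by (auto simp: q_def)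
  have m: "slope * \<bar>q - s\<bar> + slope * \<bar>q - s'\<bar> = slope * \<bar>s - s'\<bar>"
    by (simp add: q_def max_def)
  note c = C[OF pre q]
  have tri: "norm (x - y) \<le> norm (x' - x) + norm (x' - y') + norm (y' - y)" for x y x' y' :: "real^'n^'n"
    by norm
  show "norm (Gam S k s - Gam S' j s') \<le> C * (\<omega> + \<rho>) + slope * \<bar>s - s'\<bar>"
    using tri[of "Gam S k s" "Gam S' j s'" "Gam S k q" "Gam S' j q"] c m norm_ge_zero[of "Gam_hat S k q - Gam_hat S' j q"]
      Gam_Lipschitz(1)[OF pre(4,5,10) s(1,2) q(1,3)] Gam_Lipschitz(1)[OF pre(7,8,11) s(3,4) q(2,3)] by linarith
  show "norm (Gam_hat S k s - Gam_hat S' j s') \<le> C * (\<omega> + \<rho>) + slope * \<bar>s - s'\<bar>"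
    using tri[of "Gam_hat S k s" "Gam_hat S' j s'" "Gam_hat S k q" "Gam_hat S' j q"] c m norm_ge_zero[of "Gam S k q - Gam S' j q"]
      Gam_Lipschitz(2)[OF pre(4,5,10) s(1,2) q(1,3)] Gam_Lipschitz(2)[OF pre(7,8,11) s(3,4) q(2,3)] by linarith
qed

definition fine_scheme where
  "fine_scheme \<rho> N t S \<longleftrightarrow> is_partition T N t \<and> is_scheme d T N t S \<and> mesh N t < \<rho>"

lemma fine_scheme_mono: "fine_scheme \<rho> N t S \<Longrightarrow> \<rho> \<le> \<rho>' \<Longrightarrow> fine_scheme \<rho>' N t S"
  by (simp add: fine_scheme_def)

text \<open>The arguments may differ by \<rho>, so that continuity of the limit comes out of the
  same estimate.\<close>

definition schemes_close where
  "schemes_close \<rho> \<epsilon> \<longleftrightarrow>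
    (\<forall>N t S N' t' S'. fine_scheme \<rho> N t S \<longrightarrow> fine_scheme \<rho> N' t' S' \<longrightarrow>
      (\<forall>s\<in>{0..T}. \<forall>\<tau>\<in>{0..T}. \<forall>s'\<in>{0..T}. \<forall>\<tau>'\<in>{0..T}. \<bar>s - s'\<bar> \<le> \<rho> \<longrightarrow> \<bar>\<tau> - \<tau>'\<bar> \<le> \<rho> \<longrightarrow>
        norm (interp2 t (Gam S) s \<tau> - interp2 t' (Gam S') s' \<tau>') \<le> \<epsilon> \<and>
        norm (interp2 t (Gam_hat S) s \<tau> - interp2 t' (Gam_hat S') s' \<tau>') \<le> \<epsilon>)) \<and>
    (\<forall>N t S. fine_scheme \<rho> N t S \<longrightarrow> (\<forall>s\<in>{0..T}. \<forall>\<tau>\<in>{0..T}.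
        norm (interp2 t (Gam_tilde S) s \<tau> - interp2 t (Gam S) s \<tau>) \<le> \<epsilon> \<and>
        norm (interp1 t (Pk S) s - interp2 t (Gam S) s s) \<le> \<epsilon> \<and>
        norm (interp1 t (Pk_hat S) s - interp2 t (Gam_hat S) s s) \<le> \<epsilon>))"

lemma schemes_closeD:
  assumes "schemes_close \<rho> \<epsilon>" "fine_scheme \<rho> N t S" "s \<in> {0..T}" "\<tau> \<in> {0..T}"
  shows "norm (interp2 t (Gam_tilde S) s \<tau> - interp2 t (Gam S) s \<tau>) \<le> \<epsilon>"
    "norm (interp1 t (Pk S) s - interp2 t (Gam S) s s) \<le> \<epsilon>"
    "norm (interp1 t (Pk_hat S) s - interp2 t (Gam_hat S) s s) \<le> \<epsilon>"
    and "fine_scheme \<rho> N' t' S' \<Longrightarrow> s' \<in> {0..T} \<Longrightarrow> \<tau>' \<in> {0..T} \<Longrightarrow> \<bar>s - s'\<bar> \<le> \<rho> \<Longrightarrow> \<bar>\<tau> - \<tau>'\<bar> \<le> \<rho> \<Longrightarrow>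
      norm (interp2 t (Gam S) s \<tau> - interp2 t' (Gam S') s' \<tau>') \<le> \<epsilon>"
    and "fine_scheme \<rho> N' t' S' \<Longrightarrow> s' \<in> {0..T} \<Longrightarrow> \<tau>' \<in> {0..T} \<Longrightarrow> \<bar>s - s'\<bar> \<le> \<rho> \<Longrightarrow> \<bar>\<tau> - \<tau>'\<bar> \<le> \<rho> \<Longrightarrow>
      norm (interp2 t (Gam_hat S) s \<tau> - interp2 t' (Gam_hat S') s' \<tau>') \<le> \<epsilon>"
  using assms(1)[unfolded schemes_close_def, THEN conjunct2, rule_format, OF assms(2-4)]
    assms(1)[unfolded schemes_close_def, THEN conjunct1, rule_format, OF assms(2) _ assms(3,4)]
  by blast+

lemma schemes_close_exists:
  assumes "0 < \<epsilon>"
  shows "\<exists>\<rho>>0. schemes_close \<rho> \<epsilon>"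
proof -
  obtain C where C: "0 \<le> C" "\<And>\<rho> \<omega> N t S N' t' S' k j s.
      modulus \<rho> \<omega> \<Longrightarrow> 0 \<le> \<omega> \<Longrightarrow> 0 \<le> \<rho> \<Longrightarrow>
      is_partition T N t \<Longrightarrow> is_scheme d T N t S \<Longrightarrow> mesh N t \<le> \<rho> \<Longrightarrow>
      is_partition T N' t' \<Longrightarrow> is_scheme d T N' t' S' \<Longrightarrow> mesh N' t' \<le> \<rho> \<Longrightarrow>
      k < N \<Longrightarrow> j < N' \<Longrightarrow> \<bar>t k - t' j\<bar> \<le> \<rho> \<Longrightarrow> t (Suc k) \<le> s \<Longrightarrow> t' (Suc j) \<le> s \<Longrightarrow> s \<le> T \<Longrightarrow>
      norm (Gam S k s - Gam S' j s) + norm (Gam_hat S k s - Gam_hat S' j s) \<le> C * (\<omega> + \<rho>)"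
    by (rule scheme_stability, rule that)
  \<comment> \<open>C + 1 replaces C because C may be 0. The modulus takes one quarter of \<epsilon>
    and the terms in \<rho> another.\<close>
  define \<omega> where "\<omega> = \<epsilon> / (4 * (C + 1))"
  have \<omega>: "0 < \<omega>" using C(1) assms by (simp add: \<omega>_def)
  have C\<omega>: "C * \<omega> \<le> \<epsilon> / 4" using C(1) assms by (simp add: \<omega>_def field_simps)
  obtain \<rho>0 where \<rho>0: "0 < \<rho>0" "modulus \<rho>0 \<omega>" using modulus_exists[OF \<omega>] by blast
  \<comment> \<open>Frozen times differ by up to 5 \<rho>: two meshes for each scheme and the
    distance of \<tau> and \<tau>'. The 8 \<open>slope\<close> covers shifts of the running time
    with room to spare.\<close>
  define B where "B = 5 * C + 8 * slope + 1"
  have B: "0 < B" using C(1) slope_nonneg by (simp add: B_def)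
  define \<rho> where "\<rho> = min (\<rho>0 / 5) (\<epsilon> / (4 * B))"
  have \<rho>: "0 < \<rho>" "5 * \<rho> \<le> \<rho>0" "\<rho> * B \<le> \<epsilon> / 4"
    using \<rho>0(1) assms B by (auto simp: \<rho>_def min_def field_simps)
  have md: "modulus (5 * \<rho>) \<omega>" by (rule modulus_mono[OF \<rho>0(2) \<rho>(2)])
  have sl: "slope * (8 * \<rho>) + C * (\<omega> + 5 * \<rho>) \<le> \<epsilon>"
  proof -
    have "slope * (8 * \<rho>) + C * (\<omega> + 5 * \<rho>) = C * \<omega> + (\<rho> * B - \<rho>)" by (simp add: B_def algebra_simps)
    then show ?thesis using C\<omega> \<rho> assms by linarith
  qed
  have main: "norm (interp2 t (Gam S) s \<tau> - interp2 t' (Gam S') s' \<tau>') \<le> \<epsilon> \<and>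
      norm (interp2 t (Gam_hat S) s \<tau> - interp2 t' (Gam_hat S') s' \<tau>') \<le> \<epsilon> \<and>
      norm (interp2 t (Gam_tilde S) s \<tau> - interp2 t (Gam S) s \<tau>) \<le> \<epsilon> \<and>
      norm (interp1 t (Pk S) s - interp2 t (Gam S) s s) \<le> \<epsilon> \<and>
      norm (interp1 t (Pk_hat S) s - interp2 t (Gam_hat S) s s) \<le> \<epsilon>"
    if f: "fine_scheme \<rho> N t S" and f': "fine_scheme \<rho> N' t' S'"
      and s: "s \<in> {0..T}" "\<tau> \<in> {0..T}" "s' \<in> {0..T}" "\<tau>' \<in> {0..T}" "\<bar>s - s'\<bar> \<le> \<rho>" "\<bar>\<tau> - \<tau>'\<bar> \<le> \<rho>"
    for N t S N' t' S' s \<tau> s' \<tau>'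
  proof (intro conjI)
    have p: "is_partition T N t" and S: "is_scheme d T N t S" and m: "mesh N t < \<rho>"
      using f by (auto simp: fine_scheme_def)
    have p': "is_partition T N' t'" and S': "is_scheme d T N' t' S'" and m': "mesh N' t' < \<rho>"
      using f' by (auto simp: fine_scheme_def)
    note i = frozen_index_props[OF p s(2)] and i' = frozen_index_props[OF p' s(4)] and ii = frozen_index_props[OF p s(1)]
    have m5: "mesh N t \<le> 5 * \<rho>" "mesh N' t' \<le> 5 * \<rho>" "0 \<le> 5 * \<rho>" using m m' \<rho>(1) by auto
    define v where "v = max \<tau> (t 1)"
    define v' where "v' = max \<tau>' (t' 1)"
    define w where "w = max s (t 1)"
    define u where "u = max s v"
    define u' where "u' = max s' v'"
    define us where "us = max s w"
    note i = i[folded v_def] and i' = i'[folded v'_def] and ii = ii[folded w_def]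
    have tu: "t (Suc (frozen_index t \<tau>)) \<le> u" "u \<le> T" "t' (Suc (frozen_index t' \<tau>')) \<le> u'" "u' \<le> T"
      using i(2,5) i'(2,5) s by (auto simp: u_def u'_def)
    have "\<tau> \<le> v" "\<tau>' \<le> v'" by (simp_all add: v_def v'_def)
    then have "\<bar>v - v'\<bar> \<le> 2 * \<rho>" using s(6) i(4) i'(4) m m' \<rho>(1) by linarith
    moreover have "\<bar>s - s'\<bar> \<le> 2 * \<rho>" using s(5) \<rho>(1) by linarith
    ultimately have uu: "\<bar>u - u'\<bar> \<le> 2 * \<rho>" unfolding u_def u'_def by (rule abs_max_diff_le[rotated])
    have "w = us" by (simp add: us_def w_def)
    note eqs = interp2_eq[of t _ s \<tau>, folded v_def, folded u_def] interp2_eq[of t' _ s' \<tau>', folded v'_def, folded u'_def]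
      interp2_eq[of t _ s s, folded w_def, folded us_def]
    have kk: "\<bar>t (frozen_index t \<tau>) - t' (frozen_index t' \<tau>')\<bar> \<le> 5 * \<rho>"
      using i(3) i'(3) m m' s(6) by linarith
    have sl2: "C * (\<omega> + 5 * \<rho>) + slope * x \<le> \<epsilon>" if "x \<le> 8 * \<rho>" for x
      using sl mult_left_mono[OF that slope_nonneg] by linarith
    have "\<bar>u - u'\<bar> \<le> 8 * \<rho>" using uu \<rho>(1) by linarith
    note sl3 = sl2[OF this]
    note close = Gam_close[OF C(2) md less_imp_le[OF \<omega>] m5(3) p S m5(1) p' S' m5(2) i(1) i'(1) kk tu]
    show "norm (interp2 t (Gam S) s \<tau> - interp2 t' (Gam S') s' \<tau>') \<le> \<epsilon>"
      unfolding eqs by (rule order_trans[OF close(1) sl3])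
    show "norm (interp2 t (Gam_hat S) s \<tau> - interp2 t' (Gam_hat S') s' \<tau>') \<le> \<epsilon>"
      unfolding eqs by (rule order_trans[OF close(2) sl3])
    have "u \<in> {t (Suc (frozen_index t \<tau>))..T}" using tu by auto
    from Gam_tilde_close[OF p S i(1) this]
    have "norm (interp2 t (Gam_tilde S) s \<tau> - interp2 t (Gam S) s \<tau>) \<le> slope * (2 * mesh N t)"
      unfolding eqs by (simp add: mult_ac)
    also have "\<dots> \<le> slope * (8 * \<rho>)" using m \<rho>(1) slope_nonneg by (intro mult_left_mono) auto
    also have "\<dots> \<le> \<epsilon>"
    proof -
      have "0 \<le> C * (\<omega> + 5 * \<rho>)" using C(1) \<omega> \<rho>(1) by (intro mult_nonneg_nonneg) auto
      then show ?thesis using sl by linarith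
    qed
    finally show "norm (interp2 t (Gam_tilde S) s \<tau> - interp2 t (Gam S) s \<tau>) \<le> \<epsilon>" .
    note c = cell_props[OF p s(1)]
    let ?k = "cell t s"
    have kc: "s \<in> {t ?k..t (Suc ?k)}" using c(2,3) by simp
    have mk: "t (Suc ?k) - t ?k \<le> mesh N t" by (rule partition_mesh[OF c(1)])
    have tk: "t (Suc ?k) \<le> T" using partition_range[OF p, of "Suc ?k"] c(1) by simp
    have us: "t (Suc (frozen_index t s)) \<le> us" "us \<le> T" using ii(2,5) s by (auto simp: us_def)
    have kks: "\<bar>t ?k - t (frozen_index t s)\<bar> \<le> 5 * \<rho>"
      using ii(3) m c(2,3) mk \<rho>(1) by linarith
    \<comment> \<open>\<open>Pk\<close> has the index of the cell of s, while the diagonal value of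
      \<open>interp2\<close> generally has the index before it. The scheme is therefore compared
      with itself at two nearby indices.\<close>
    note closeP = Gam_close[OF C(2) md less_imp_le[OF \<omega>] m5(3) p S m5(1) p S m5(1) c(1) ii(1) kks order_refl tk us]
    have "s \<le> w" by (simp add: w_def)
    moreover have "t ?k \<le> s" "s \<le> t (Suc ?k)" using kc by simp_all
    ultimately have du: "\<bar>t (Suc ?k) - us\<bar> \<le> 2 * \<rho>" using \<open>w = us\<close> ii(4) m mk \<rho>(1) by linarith
    have ms: "slope * mesh N t \<le> slope * \<rho>" using m slope_nonneg by (intro mult_left_mono) auto
    have sm: "slope * \<bar>t (Suc ?k) - us\<bar> \<le> slope * (2 * \<rho>)" by (rule mult_left_mono[OF du slope_nonneg])
    have fin: "slope * \<rho> + (C * (\<omega> + 5 * \<rho>) + slope * (2 * \<rho>)) \<le> \<epsilon>"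
    proof -
      have "slope * \<rho> + slope * (2 * \<rho>) \<le> slope * (8 * \<rho>)"
        using slope_nonneg \<rho>(1) by (simp flip: distrib_left add: mult_left_mono)
      then show ?thesis using sl by linarith
    qed
    have tri: "norm (x - z) \<le> norm (x - y) + norm (y - z)" for x y z :: "real^'n^'n" by norm
    have bound: "norm (x - z) \<le> \<epsilon>"
      if "norm (x - y) \<le> slope * mesh N t"
        "norm (y - z) \<le> C * (\<omega> + 5 * \<rho>) + slope * \<bar>t (Suc ?k) - us\<bar>" for x y z :: "real^'n^'n"
      using tri[of x z y] that ms sm fin by linarith
    show "norm (interp1 t (Pk S) s - interp2 t (Gam S) s s) \<le> \<epsilon>"
      unfolding eqs interp1_def by (rule bound[OF P_close(1)[OF p S c(1) kc] closeP(1)])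
    show "norm (interp1 t (Pk_hat S) s - interp2 t (Gam_hat S) s s) \<le> \<epsilon>"
      unfolding eqs interp1_def by (rule bound[OF P_close(2)[OF p S c(1) kc] closeP(2)])
  qed
  have "schemes_close \<rho> \<epsilon>"
    unfolding schemes_close_def
  proof (intro conjI allI impI ballI)
    fix N t S N' t' S' s \<tau> s' \<tau>'
    assume a: "fine_scheme \<rho> N t S" "fine_scheme \<rho> N' t' S'" "s \<in> {0..T}" "\<tau> \<in> {0..T}" "s' \<in> {0..T}" "\<tau>' \<in> {0..T}"
      "\<bar>s - s'\<bar> \<le> \<rho>" "\<bar>\<tau> - \<tau>'\<bar> \<le> \<rho>"
    note m = main[OF a]
    show "norm (interp2 t (Gam S) s \<tau> - interp2 t' (Gam S') s' \<tau>') \<le> \<epsilon>" by (rule conjunct1[OF m])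
    show "norm (interp2 t (Gam_hat S) s \<tau> - interp2 t' (Gam_hat S') s' \<tau>') \<le> \<epsilon>"
      by (rule conjunct1[OF conjunct2[OF m]])
  next
    fix N t S s \<tau>
    assume a: "fine_scheme \<rho> N t S" "s \<in> {0..T}" "\<tau> \<in> {0..T}"
    have z: "\<bar>s - s\<bar> \<le> \<rho>" "\<bar>\<tau> - \<tau>\<bar> \<le> \<rho>" using \<rho>(1) by auto
    note m = conjunct2[OF conjunct2[OF main[OF a(1,1,2,3,2,3) z]]]
    show "norm (interp2 t (Gam_tilde S) s \<tau> - interp2 t (Gam S) s \<tau>) \<le> \<epsilon>" by (rule conjunct1[OF m])
    show "norm (interp1 t (Pk S) s - interp2 t (Gam S) s s) \<le> \<epsilon>" by (rule conjunct1[OF conjunct2[OF m]])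
    show "norm (interp1 t (Pk_hat S) s - interp2 t (Gam_hat S) s s) \<le> \<epsilon>" by (rule conjunct2[OF conjunct2[OF m]])
  qed
  with \<rho>(1) show ?thesis by blast
qed

lemma fine_scheme_exists:
  assumes "0 < \<rho>"
  shows "\<exists>N t S. fine_scheme \<rho> N t S"
proof -
  obtain n where "T / \<rho> < real (Suc n)" using reals_Archimedean2[of "T / \<rho>"] by (metis less_Suc_eq less_trans of_nat_less_iff)
  then have "T / Suc n < \<rho>" using assms by (simp add: field_simps)
  then have "mesh (Suc n) (\<lambda>i. T * i / Suc n) < \<rho>" using uniform_partition(2)[OF T_pos, of n] by linarith
  moreover obtain S where "is_scheme d T (Suc n) (\<lambda>i. T * i / Suc n) S"
    using scheme_exists[OF uniform_partition(1)[OF T_pos]] by blast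
  ultimately show ?thesis
    unfolding fine_scheme_def using uniform_partition(1)[OF T_pos] by blast
qed

section \<open>Construction of the limit and its equations\<close>

definition limit_close where
  "limit_close \<Gamma> \<Gamma>h \<rho> \<epsilon> \<longleftrightarrow> (\<forall>N t S. fine_scheme \<rho> N t S \<longrightarrow>
    (\<forall>s\<in>{0..T}. \<forall>\<tau>\<in>{0..T}. \<forall>s'\<in>{0..T}. \<forall>\<tau>'\<in>{0..T}. \<bar>s - s'\<bar> \<le> \<rho> \<longrightarrow> \<bar>\<tau> - \<tau>'\<bar> \<le> \<rho> \<longrightarrow>
      norm (interp2 t (Gam S) s \<tau> - \<Gamma> s' \<tau>') \<le> \<epsilon> \<and> norm (interp2 t (Gam_hat S) s \<tau> - \<Gamma>h s' \<tau>') \<le> \<epsilon>))"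

lemma limit_closeD:
  assumes "limit_close \<Gamma> \<Gamma>h \<rho> \<epsilon>" "fine_scheme \<rho> N t S"
    "s \<in> {0..T}" "\<tau> \<in> {0..T}" "s' \<in> {0..T}" "\<tau>' \<in> {0..T}" "\<bar>s - s'\<bar> \<le> \<rho>" "\<bar>\<tau> - \<tau>'\<bar> \<le> \<rho>"
  shows "norm (interp2 t (Gam S) s \<tau> - \<Gamma> s' \<tau>') \<le> \<epsilon>" "norm (interp2 t (Gam_hat S) s \<tau> - \<Gamma>h s' \<tau>') \<le> \<epsilon>"
  using assms(1)[unfolded limit_close_def, rule_format, OF assms(2-8)] by blast+

text \<open>One sequence of schemes defines the limit. Sending only the second scheme in
  \<open>schemes_close\<close> along it bounds the distance to the limit for every sufficiently fine
  scheme.\<close>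

lemma limit_exists:
  "\<exists>\<Gamma> \<Gamma>h. \<forall>\<epsilon>>0. \<exists>\<rho>>0. limit_close \<Gamma> \<Gamma>h \<rho> \<epsilon>"
proof -
  have "\<forall>n. \<exists>N t S. fine_scheme (1 / Suc n) N t S"
    using fine_scheme_exists by simp
  then obtain N t S where fine: "\<And>n. fine_scheme (1 / Suc n) (N n) (t n) (S n)" by metis
  have ev: "\<exists>n0. \<forall>n\<ge>n0. fine_scheme \<rho> (N n) (t n) (S n)" if \<rho>: "0 < \<rho>" for \<rho>
  proof -
    obtain n0 where n0: "1 / Suc n0 < \<rho>" using nat_approx_posE[OF \<rho>] by blast
    have "fine_scheme \<rho> (N n) (t n) (S n)" if "n \<ge> n0" for n
    proof (rule fine_scheme_mono[OF fine])
      have "1 / real (Suc n) \<le> 1 / real (Suc n0)" using that by (simp add: frac_le)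
      then show "1 / real (Suc n) \<le> \<rho>" using n0 by linarith
    qed
    then show ?thesis by blast
  qed
  have cauchy: "Cauchy (\<lambda>n. interp2 (t n) (Gam (S n)) s \<tau>) \<and> Cauchy (\<lambda>n. interp2 (t n) (Gam_hat (S n)) s \<tau>)"
    if s: "s \<in> {0..T}" "\<tau> \<in> {0..T}" for s \<tau>
  proof -
    have "\<exists>M. \<forall>m\<ge>M. \<forall>n\<ge>M. norm (interp2 (t m) (Gam (S m)) s \<tau> - interp2 (t n) (Gam (S n)) s \<tau>) < e \<and>
        norm (interp2 (t m) (Gam_hat (S m)) s \<tau> - interp2 (t n) (Gam_hat (S n)) s \<tau>) < e" if "e > 0" for e
    proof -
      have "e / 2 > 0" using that by simp
      then obtain \<rho> where \<rho>: "0 < \<rho>" "schemes_close \<rho> (e / 2)" using schemes_close_exists by blast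
      obtain n0 where n0: "\<forall>n\<ge>n0. fine_scheme \<rho> (N n) (t n) (S n)" using ev[OF \<rho>(1)] by blast
      have "norm (interp2 (t m) (Gam (S m)) s \<tau> - interp2 (t n) (Gam (S n)) s \<tau>) < e \<and>
        norm (interp2 (t m) (Gam_hat (S m)) s \<tau> - interp2 (t n) (Gam_hat (S n)) s \<tau>) < e" if "m \<ge> n0" "n \<ge> n0" for m n
      proof -
        have f: "fine_scheme \<rho> (N m) (t m) (S m)" "fine_scheme \<rho> (N n) (t n) (S n)" using n0 that by blast+
        have "\<bar>s - s\<bar> \<le> \<rho>" "\<bar>\<tau> - \<tau>\<bar> \<le> \<rho>" using \<rho>(1) by auto
        from schemes_closeD(4,5)[OF \<rho>(2) f(1) s f(2) s this] show ?thesis using \<open>0 < e\<close> by linarith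
      qed
      then show ?thesis by blast
    qed
    then show ?thesis unfolding Cauchy_iff by blast
  qed
  define \<Gamma> where "\<Gamma> s \<tau> = lim (\<lambda>n. interp2 (t n) (Gam (S n)) s \<tau>)" for s \<tau>
  define \<Gamma>h where "\<Gamma>h s \<tau> = lim (\<lambda>n. interp2 (t n) (Gam_hat (S n)) s \<tau>)" for s \<tau>
  have lims: "(\<lambda>n. interp2 (t n) (Gam (S n)) s \<tau>) \<longlonglongrightarrow> \<Gamma> s \<tau>" "(\<lambda>n. interp2 (t n) (Gam_hat (S n)) s \<tau>) \<longlonglongrightarrow> \<Gamma>h s \<tau>"
    if "s \<in> {0..T}" "\<tau> \<in> {0..T}" for s \<tau>
    using cauchy[OF that] by (auto simp: \<Gamma>_def \<Gamma>h_def Cauchy_convergent_iff convergent_LIMSEQ_iff)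
  have "\<exists>\<rho>>0. limit_close \<Gamma> \<Gamma>h \<rho> \<epsilon>" if \<epsilon>: "0 < \<epsilon>" for \<epsilon>
  proof -
    obtain \<rho> where \<rho>: "0 < \<rho>" "schemes_close \<rho> \<epsilon>" using schemes_close_exists[OF \<epsilon>] by blast
    obtain n0 where n0: "\<forall>n\<ge>n0. fine_scheme \<rho> (N n) (t n) (S n)" using ev[OF \<rho>(1)] by blast
    have "limit_close \<Gamma> \<Gamma>h \<rho> \<epsilon>"
      unfolding limit_close_def
    proof (intro conjI allI impI ballI)
      fix N0 t0 S0 s \<tau> s' \<tau>'
      assume a: "fine_scheme \<rho> N0 t0 S0" "s \<in> {0..T}" "\<tau> \<in> {0..T}" "s' \<in> {0..T}" "\<tau>' \<in> {0..T}" "\<bar>s - s'\<bar> \<le> \<rho>" "\<bar>\<tau> - \<tau>'\<bar> \<le> \<rho>"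
      show "norm (interp2 t0 (Gam S0) s \<tau> - \<Gamma> s' \<tau>') \<le> \<epsilon>"
        using schemes_closeD(4)[OF \<rho>(2) a(1-3) _ a(4-7)] n0
        by (intro LIMSEQ_le_const2[OF tendsto_norm[OF tendsto_diff[OF tendsto_const lims(1)[OF a(4,5)]]]]) blast
      show "norm (interp2 t0 (Gam_hat S0) s \<tau> - \<Gamma>h s' \<tau>') \<le> \<epsilon>"
        using schemes_closeD(5)[OF \<rho>(2) a(1-3) _ a(4-7)] n0
        by (intro LIMSEQ_le_const2[OF tendsto_norm[OF tendsto_diff[OF tendsto_const lims(2)[OF a(4,5)]]]]) blast
    qed
    with \<rho>(1) show ?thesis by blast
  qed
  then show ?thesis by blast
qed

text \<open>Every property is read off one sufficiently fine scheme and transferred through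
  \<open>limit_close\<close>. For the equations this scheme is an approximate solution, with the
  gain evaluated near the diagonal, as \<open>limit_of_approximate_solutions\<close>
  demands.\<close>

lemma limit_solves:
  assumes lim: "\<forall>\<epsilon>>0. \<exists>\<rho>>0. limit_close \<Gamma> \<Gamma>h \<rho> \<epsilon>"
  shows "equilibrium_riccati d T \<Gamma> \<Gamma>h"
    "0 \<le> s \<Longrightarrow> s \<le> \<tau> \<Longrightarrow> \<tau> \<le> T \<Longrightarrow> \<Gamma> s \<tau> = \<Gamma> \<tau> \<tau> \<and> \<Gamma>h s \<tau> = \<Gamma>h \<tau> \<tau>"
proof -
  have zero: "x = y" if "\<And>e. 0 < e \<Longrightarrow> norm (x - y) \<le> e" for x y :: "real^'n^'n"
  proof -
    have "norm (x - y) \<le> 0 + e" if "0 < e" for e using \<open>\<And>e. 0 < e \<Longrightarrow> norm (x - y) \<le> e\<close>[OF that] by simp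
    then have "norm (x - y) \<le> 0" by (rule field_le_epsilon)
    then show ?thesis by simp
  qed
  have tri: "norm (x - z) \<le> norm (y - x) + norm (y - z)" for x y z :: "real^'n^'n" by norm
  have tri': "norm (x - z) \<le> norm (x - y) + norm (y - z)" for x y z :: "real^'n^'n" by norm
  show "\<Gamma> s \<tau> = \<Gamma> \<tau> \<tau> \<and> \<Gamma>h s \<tau> = \<Gamma>h \<tau> \<tau>" if st: "0 \<le> s" "s \<le> \<tau>" "\<tau> \<le> T" for s \<tau>
  proof -
    have "norm (\<Gamma> s \<tau> - \<Gamma> \<tau> \<tau>) \<le> e \<and> norm (\<Gamma>h s \<tau> - \<Gamma>h \<tau> \<tau>) \<le> e" if "0 < e" for e
    proof -
      have "0 < e / 2" using that by simp
      then obtain \<rho> where \<rho>: "0 < \<rho>" "limit_close \<Gamma> \<Gamma>h \<rho> (e / 2)" using lim by blast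
      obtain N t S where f: "fine_scheme \<rho> N t S" using fine_scheme_exists[OF \<rho>(1)] by blast
      have eq: "interp2 t F s \<tau> = interp2 t F \<tau> \<tau>" for F :: "nat \<Rightarrow> real \<Rightarrow> real^'n^'n"
        unfolding interp2_eq using st(2) by (simp add: max_def)
      have m: "s \<in> {0..T}" "\<tau> \<in> {0..T}" "\<bar>s - s\<bar> \<le> \<rho>" "\<bar>\<tau> - \<tau>\<bar> \<le> \<rho>" using st \<rho>(1) by auto
      show ?thesis
        using limit_closeD[OF \<rho>(2) f m(1,2,1,2,3,4)] limit_closeD[OF \<rho>(2) f m(2,2,2,2,4,4)] tri[of "\<Gamma> s \<tau>" "\<Gamma> \<tau> \<tau>" "interp2 t (Gam S) s \<tau>"]
          tri[of "\<Gamma>h s \<tau>" "\<Gamma>h \<tau> \<tau>" "interp2 t (Gam_hat S) s \<tau>"] unfolding eq by linarith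
    qed
    then show ?thesis using zero by blast
  qed
  \<comment> \<open>A single scheme value is close to the limit at both arguments, so the scheme
    need not be continuous itself.\<close>
  have cont2: "continuous_on ({0..T} \<times> {0..T}) (\<lambda>z. \<Gamma> (fst z) (snd z))" "continuous_on ({0..T} \<times> {0..T}) (\<lambda>z. \<Gamma>h (fst z) (snd z))"
  proof -
    have "\<exists>r>0. \<forall>z\<in>{0..T} \<times> {0..T}. \<forall>y\<in>{0..T} \<times> {0..T}. dist y z < r \<longrightarrow>
        norm (\<Gamma> (fst y) (snd y) - \<Gamma> (fst z) (snd z)) < e \<and> norm (\<Gamma>h (fst y) (snd y) - \<Gamma>h (fst z) (snd z)) < e" if "0 < e" for e
    proof -
      have e3: "0 < e / 3" using that by simp
      then obtain \<rho> where \<rho>: "0 < \<rho>" "limit_close \<Gamma> \<Gamma>h \<rho> (e / 3)" using lim by blast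
      obtain N t S where f: "fine_scheme \<rho> N t S" using fine_scheme_exists[OF \<rho>(1)] by blast
      show ?thesis
      proof (intro exI[of _ \<rho>] conjI ballI impI \<rho>(1))
        fix z y assume zy: "z \<in> {0..T} \<times> {0..T}" "y \<in> {0..T} \<times> {0..T}" "dist y z < \<rho>"
        have m: "fst y \<in> {0..T}" "snd y \<in> {0..T}" "fst z \<in> {0..T}" "snd z \<in> {0..T}"
          "\<bar>fst y - fst y\<bar> \<le> \<rho>" "\<bar>snd y - snd y\<bar> \<le> \<rho>" "\<bar>fst y - fst z\<bar> \<le> \<rho>" "\<bar>snd y - snd z\<bar> \<le> \<rho>"
          using zy \<rho>(1) dist_fst_le[of y z] dist_snd_le[of y z] by (auto simp: dist_real_def)
        show "norm (\<Gamma> (fst y) (snd y) - \<Gamma> (fst z) (snd z)) < e" "norm (\<Gamma>h (fst y) (snd y) - \<Gamma>h (fst z) (snd z)) < e"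
          using limit_closeD[OF \<rho>(2) f m(1,2,1,2,5,6)] limit_closeD[OF \<rho>(2) f m(1,2,3,4,7,8)] that
            tri[of "\<Gamma> (fst y) (snd y)" "\<Gamma> (fst z) (snd z)" "interp2 t (Gam S) (fst y) (snd y)"]
            tri[of "\<Gamma>h (fst y) (snd y)" "\<Gamma>h (fst z) (snd z)" "interp2 t (Gam_hat S) (fst y) (snd y)"] by linarith+
      qed
    qed
    then show "continuous_on ({0..T} \<times> {0..T}) (\<lambda>z. \<Gamma> (fst z) (snd z))" "continuous_on ({0..T} \<times> {0..T}) (\<lambda>z. \<Gamma>h (fst z) (snd z))"
      unfolding continuous_on_iff dist_norm[of "\<Gamma> _ _"] dist_norm[of "\<Gamma>h _ _"] by meson+
  qed
  have cdiag: "continuous_on {0..T} (\<lambda>r. (r, r))" "(\<lambda>r. (r, r)) ` {0..T} \<subseteq> {0..T} \<times> {0..T}"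
    by (auto intro!: continuous_intros)
  have diag: "continuous_on {0..T} (\<lambda>r. \<Gamma> r r)" "continuous_on {0..T} (\<lambda>r. \<Gamma>h r r)"
    using cont2[THEN continuous_on_compose2, OF cdiag] by simp_all
  have sect: "continuous_on {0..T} (\<lambda>r. \<Gamma> r \<tau>)" "continuous_on {0..T} (\<lambda>r. \<Gamma>h r \<tau>)" if "\<tau> \<in> {0..T}" for \<tau>
  proof -
    have c: "continuous_on {0..T} (\<lambda>r. (r, \<tau>))" "(\<lambda>r. (r, \<tau>)) ` {0..T} \<subseteq> {0..T} \<times> {0..T}"
      using that by (auto intro!: continuous_intros)
    show "continuous_on {0..T} (\<lambda>r. \<Gamma> r \<tau>)" "continuous_on {0..T} (\<lambda>r. \<Gamma>h r \<tau>)"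
      using cont2[THEN continuous_on_compose2, OF c] by simp_all
  qed
  \<comment> \<open>Needed for the limiting gain to be well defined: the cone is closed and every
    scheme kernel lies in it.\<close>
  have psd: "0 \<preceq> \<Gamma> s \<tau>" if s: "s \<in> {0..T}" "\<tau> \<in> {0..T}" for s \<tau>
  proof -
    have "\<exists>Y\<in>{M. 0 \<preceq> M}. dist Y (\<Gamma> s \<tau>) < e" if "0 < e" for e
    proof -
      have "0 < e / 2" using that by simp
      then obtain \<rho> where \<rho>: "0 < \<rho>" "limit_close \<Gamma> \<Gamma>h \<rho> (e / 2)" using lim by blast
      obtain N t S where f: "fine_scheme \<rho> N t S" using fine_scheme_exists[OF \<rho>(1)] by blast
      then have pS: "is_partition T N t" "is_scheme d T N t S" by (auto simp: fine_scheme_def)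
      note i = frozen_index_props[OF pS(1) s(2)]
      have "max s (max \<tau> (t 1)) \<in> {t (Suc (frozen_index t \<tau>))..T}" using i(2,5) s by auto
      then have "0 \<preceq> interp2 t (Gam S) s \<tau>"
        unfolding interp2_eq by (rule is_scheme_psd(2)[OF pS i(1)])
      moreover have "norm (interp2 t (Gam S) s \<tau> - \<Gamma> s \<tau>) \<le> e / 2"
        using limit_closeD[OF \<rho>(2) f s s] \<rho>(1) by simp
      ultimately show ?thesis using that by (intro bexI[of _ "interp2 t (Gam S) s \<tau>"]) (auto simp: dist_norm)
    qed
    then show ?thesis using closed_approachable[OF closed_psd, of "\<Gamma> s \<tau>"] by simp
  qed
  have fin: "\<Gamma> T \<tau> = cG d \<tau> \<and> \<Gamma>h T \<tau> = hG d \<tau>" if \<tau>: "\<tau> \<in> {0..T}" for \<tau>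
  proof -
    have "norm (\<Gamma> T \<tau> - cG d \<tau>) \<le> e \<and> norm (\<Gamma>h T \<tau> - hG d \<tau>) \<le> e" if "0 < e" for e
    proof -
      have e2: "0 < e / 2" using that by simp
      then obtain \<rho>1 where \<rho>1: "0 < \<rho>1" "limit_close \<Gamma> \<Gamma>h \<rho>1 (e / 2)" using lim by blast
      obtain \<rho>2 where \<rho>2: "0 < \<rho>2" "modulus \<rho>2 (e / 2)" using modulus_exists[OF e2] by blast
      have "0 < min \<rho>1 (\<rho>2 / 2)" using \<rho>1 \<rho>2 by simp
      then obtain N t S where f: "fine_scheme (min \<rho>1 (\<rho>2 / 2)) N t S" using fine_scheme_exists by blast
      then have f1: "fine_scheme \<rho>1 N t S" and pS: "is_partition T N t" "is_scheme d T N t S" and m: "mesh N t < \<rho>2 / 2"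
        by (auto simp: fine_scheme_def)
      note i = frozen_index_props[OF pS(1) \<tau>]
      have "interp2 t (Gam S) T \<tau> = Gam S (frozen_index t \<tau>) T" "interp2 t (Gam_hat S) T \<tau> = Gam_hat S (frozen_index t \<tau>) T"
        unfolding interp2_eq using i(5) by (simp_all add: max_def)
      moreover have "Gam S (frozen_index t \<tau>) T = cG d (t (frozen_index t \<tau>))" "Gam_hat S (frozen_index t \<tau>) T = hG d (t (frozen_index t \<tau>))"
        using is_scheme_frozen_system[OF pS(2) i(1)] by (simp_all add: frozen_system_def gamma_system_def)
      moreover have "t (frozen_index t \<tau>) \<in> {0..T}"
        using partition_range[OF pS(1), of "frozen_index t \<tau>"] i(1) by auto
      then have "norm (cG d (t (frozen_index t \<tau>)) - cG d \<tau>) \<le> e / 2" "norm (hG d (t (frozen_index t \<tau>)) - hG d \<tau>) \<le> e / 2"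
        using \<rho>2(2) i(3) m \<tau> unfolding modulus_def by (smt (verit, best) field_sum_of_halves)+
      moreover have "norm (interp2 t (Gam S) T \<tau> - \<Gamma> T \<tau>) \<le> e / 2 \<and> norm (interp2 t (Gam_hat S) T \<tau> - \<Gamma>h T \<tau>) \<le> e / 2"
        using limit_closeD[OF \<rho>1(2) f1 _ \<tau> _ \<tau>, of T T] \<rho>1(1) T_pos by simp
      ultimately show ?thesis
        using tri[of "\<Gamma> T \<tau>" "cG d \<tau>" "interp2 t (Gam S) T \<tau>"] tri[of "\<Gamma>h T \<tau>" "hG d \<tau>" "interp2 t (Gam_hat S) T \<tau>"]
        by simp
    qed
    then show ?thesis using zero by blast
  qed
  define \<theta> where "\<theta> = equilibrium_gain d \<Gamma> \<Gamma>h"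
  have \<delta>2: "0 < \<delta> / 2" using \<delta>_pos by simp
  have co: "coercive (\<delta> / 2) (hR d r r + transpose (hD d r) ** \<Gamma> r r ** hD d r)" if "r \<in> {0..T}" for r
    using gram_coercive_psd(2)[of r r "\<Gamma> r r"] psd[OF that that] that by auto
  have cR: "continuous_on {0..T} (\<lambda>r. hR d r r)"
    using weight_continuous(4)[THEN continuous_on_compose2, OF cdiag] by simp
  have c\<theta>: "continuous_on {0..T} \<theta>"
    unfolding \<theta>_def equilibrium_gain_def[abs_def]
    by (intro continuous_on_feedback_gain[OF \<delta>2 co] coef_continuous cR diag)
  have K: "compact ({0..T} \<times> {0..T})" by (intro compact_Times compact_Icc)
  \<comment> \<open>The Lipschitz lemmas need one constant for the schemes and for the limit
    together.\<close>
  have "\<forall>\<^sub>F c::real in at_top. uniform_bound \<le> c \<and> (\<forall>r\<in>{0..T}. norm (\<theta> r) \<le> c) \<and>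
      (\<forall>z\<in>{0..T} \<times> {0..T}. norm (\<Gamma> (fst z) (snd z)) \<le> c) \<and> (\<forall>z\<in>{0..T} \<times> {0..T}. norm (\<Gamma>h (fst z) (snd z)) \<le> c)"
    by (intro eventually_conj eventually_ge_at_top eventually_norm_bound compact_Icc K c\<theta> cont2)
  from eventually_happens'[OF trivial_limit_at_top_linorder this] obtain c
    where c: "uniform_bound \<le> c \<and> (\<forall>r\<in>{0..T}. norm (\<theta> r) \<le> c) \<and>
      (\<forall>z\<in>{0..T} \<times> {0..T}. norm (\<Gamma> (fst z) (snd z)) \<le> c) \<and> (\<forall>z\<in>{0..T} \<times> {0..T}. norm (\<Gamma>h (fst z) (snd z)) \<le> c)" ..
  have cb: "norm (\<theta> r) \<le> c" "norm (\<Gamma> r \<tau>) \<le> c" "norm (\<Gamma>h r \<tau>) \<le> c" if "r \<in> {0..T}" "\<tau> \<in> {0..T}" for r \<tau>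
    using c that by auto
  have uc: "x \<le> c" if "x \<le> uniform_bound" for x using that c by linarith
  have c0: "0 \<le> c" using uc[OF uniform_bound_nonneg] .
  obtain L1 where L1: "0 \<le> L1" "\<And>(B::real^'m^'n) C D R R' X X' Y Y'.
    norm B \<le> c \<Longrightarrow> norm C \<le> c \<Longrightarrow> norm D \<le> c \<Longrightarrow> norm X' \<le> c \<Longrightarrow> norm Y' \<le> c \<Longrightarrow>
    coercive (\<delta> / 2) (R + transpose D ** Y ** D) \<Longrightarrow> coercive (\<delta> / 2) (R' + transpose D ** Y' ** D) \<Longrightarrow>
    norm (feedback_gain B C D R X Y - feedback_gain B C D R' X' Y') \<le> L1 * (norm (R - R') + norm (X - X') + norm (Y - Y'))"
    by (rule feedback_gain_Lipschitz[OF \<delta>2 c0], rule that)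
  obtain L2 where L2: "0 \<le> L2" "\<And>(A::real^'n^'n) (B::real^'m^'n) C D Q Q' R R' \<Theta> \<Theta>' X X' Y Y'.
    norm A \<le> c \<Longrightarrow> norm B \<le> c \<Longrightarrow> norm C \<le> c \<Longrightarrow> norm D \<le> c \<Longrightarrow> norm R' \<le> c \<Longrightarrow> norm \<Theta> \<le> c \<Longrightarrow> norm \<Theta>' \<le> c \<Longrightarrow>
    norm X \<le> c \<Longrightarrow> norm X' \<le> c \<Longrightarrow> norm Y' \<le> c \<Longrightarrow>
    norm (lyapunov_op A B C D Q R \<Theta> X Y - lyapunov_op A B C D Q' R' \<Theta>' X' Y')
      \<le> L2 * (norm (Q - Q') + norm (R - R') + norm (\<Theta> - \<Theta>') + norm (X - X') + norm (Y - Y'))"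
    by (rule lyapunov_op_Lipschitz[OF c0], rule that)
  have ode: "((\<lambda>r. \<Gamma> r \<tau>) has_vector_derivative - lyapunov_op (hA d s) (hB d s) (hC d s) (hD d s) (cQ d s \<tau>) (cR d s \<tau>)
        (\<theta> s) (\<Gamma> s \<tau>) (\<Gamma> s \<tau>)) (at s within {\<tau>..T})"
    "((\<lambda>r. \<Gamma>h r \<tau>) has_vector_derivative - lyapunov_op (hA d s) (hB d s) (hC d s) (hD d s) (hQ d s \<tau>) (hR d s \<tau>)
        (\<theta> s) (\<Gamma>h s \<tau>) (\<Gamma> s \<tau>)) (at s within {\<tau>..T})"
    if \<tau>: "\<tau> \<in> {0..T}" and s: "s \<in> {\<tau>..T}" for s \<tau>
  proof -
    define l where "l r = lyapunov_op (hA d r) (hB d r) (hC d r) (hD d r) (cQ d r \<tau>) (cR d r \<tau>) (\<theta> r) (\<Gamma> r \<tau>) (\<Gamma> r \<tau>)" for r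
    define lh where "lh r = lyapunov_op (hA d r) (hB d r) (hC d r) (hD d r) (hQ d r \<tau>) (hR d r \<tau>) (\<theta> r) (\<Gamma>h r \<tau>) (\<Gamma> r \<tau>)" for r
    have sub: "{\<tau>..T} \<subseteq> {0..T}" and \<tau>T: "\<tau> \<le> T" using \<tau> by auto
    note cs = coef_continuous[THEN continuous_on_subset, OF sub] weight_continuous_on[OF sub \<tau>]
      c\<theta>[THEN continuous_on_subset, OF sub] sect[OF \<tau>, THEN continuous_on_subset, OF sub]
    have cl: "continuous_on {\<tau>..T} l" "continuous_on {\<tau>..T} lh"
      unfolding l_def lh_def by (intro continuous_on_lyapunov_op cs)+
    have approx: "\<exists>u \<ge> \<tau>. u \<le> \<tau> + \<eta> \<and> (\<exists>E g gh. finite E \<and> continuous_on {u..T} g \<and> continuous_on {u..T} gh \<and>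
        (\<forall>r\<in>{u..T}. norm (g r - \<Gamma> r \<tau>) \<le> \<eta> \<and> norm (gh r - \<Gamma>h r \<tau>) \<le> \<eta>) \<and>
        (\<forall>r\<in>{u<..<T} - E. (\<exists>D. (g has_vector_derivative - D) (at r) \<and> norm (D - l r) \<le> \<eta>) \<and>
          (\<exists>D. (gh has_vector_derivative - D) (at r) \<and> norm (D - lh r) \<le> \<eta>)))" if \<eta>: "0 < \<eta>" for \<eta>
    proof -
      \<comment> \<open>The error budget: 2 z for the weights, 5 L1 z for the gain (z for its
        weight, 2 z for each Riccati solution), z for the unknown and 2 z for
        \<open>Gam_tilde\<close>.\<close>
      define b where "b = L2 * (5 + 5 * L1) + 1"
      have b: "1 \<le> b" using L1(1) L2(1) by (simp add: b_def)
      define z where "z = \<eta> / b"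
      have z: "0 < z" "z \<le> \<eta>" "L2 * ((5 + 5 * L1) * z) \<le> \<eta>"
      proof -
        show "0 < z" using \<eta> b by (simp add: z_def)
        have bz: "b * z = \<eta>" using b by (simp add: z_def)
        have "1 * z \<le> b * z" using b \<open>0 < z\<close> by (intro mult_right_mono) auto
        then show "z \<le> \<eta>" using bz by simp
        show "L2 * ((5 + 5 * L1) * z) \<le> \<eta>" using bz \<open>0 < z\<close> unfolding b_def by (simp add: distrib_right mult.assoc)
      qed
      obtain \<rho>1 where \<rho>1: "0 < \<rho>1" "limit_close \<Gamma> \<Gamma>h \<rho>1 z" using lim z(1) by blast
      obtain \<rho>2 where \<rho>2: "0 < \<rho>2" "modulus \<rho>2 z" using modulus_exists[OF z(1)] by blast
      obtain \<rho>3 where \<rho>3: "0 < \<rho>3" "schemes_close \<rho>3 z" using schemes_close_exists[OF z(1)] by blast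
      define \<rho> where "\<rho> = min (min \<rho>1 (\<rho>2 / 2)) (min \<rho>3 \<eta>)"
      have \<rho>: "0 < \<rho>" "\<rho> \<le> \<rho>1" "\<rho> \<le> \<rho>2 / 2" "\<rho> \<le> \<rho>3" "\<rho> \<le> \<eta>" using \<rho>1 \<rho>2 \<rho>3 \<eta> by (auto simp: \<rho>_def)
      obtain N t S where f: "fine_scheme \<rho> N t S" using fine_scheme_exists[OF \<rho>(1)] by blast
      note f1 = fine_scheme_mono[OF f \<rho>(2)] and f3 = fine_scheme_mono[OF f \<rho>(4)]
      have p: "is_partition T N t" and S: "is_scheme d T N t S" and m: "mesh N t < \<rho>" using f by (auto simp: fine_scheme_def)
      note i = frozen_index_props[OF p \<tau>]
      define k where "k = frozen_index t \<tau>"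
      \<comment> \<open>From u on the interpolation at (r, \<tau>) is the kernel of index k itself,
        so its differential equation can be used; u exceeds \<tau> by at most the mesh.\<close>
      define u where "u = max \<tau> (t 1)"
      note k = i[folded k_def u_def]
      have Sk: "Suc k \<le> N" using k(1) by simp
      have uT: "{u..T} \<subseteq> {t (Suc k)..T}" "{u..T} \<subseteq> {0..T}" "\<tau> \<le> u" using k(2) \<tau> by (auto simp: u_def)
      have ip: "interp2 t F r \<tau> = F k r" if "r \<in> {u..T}" for r and F :: "nat \<Rightarrow> real \<Rightarrow> real^'n^'n"
      proof -
        have "max r u = r" using that by simp
        then show ?thesis unfolding interp2_eq k_def[symmetric] u_def[symmetric] by simp
      qed
      have close: "norm (Gam S k r - \<Gamma> r \<tau>) \<le> z" "norm (Gam_hat S k r - \<Gamma>h r \<tau>) \<le> z"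
        "norm (Gam_tilde S k r - \<Gamma> r \<tau>) \<le> 2 * z" if r: "r \<in> {u..T}" for r
      proof -
        have r0: "r \<in> {0..T}" using r uT by auto
        have a: "norm (Gam S k r - \<Gamma> r \<tau>) \<le> z \<and> norm (Gam_hat S k r - \<Gamma>h r \<tau>) \<le> z"
          using limit_closeD[OF \<rho>1(2) f1 r0 \<tau> r0 \<tau>] \<rho>1(1) unfolding ip[OF r] by simp
        then show "norm (Gam S k r - \<Gamma> r \<tau>) \<le> z" "norm (Gam_hat S k r - \<Gamma>h r \<tau>) \<le> z" by auto
        show "norm (Gam_tilde S k r - \<Gamma> r \<tau>) \<le> 2 * z"
          using schemes_closeD(1-3)[OF \<rho>3(2) f3 r0 \<tau>] a tri'[of "Gam_tilde S k r" "\<Gamma> r \<tau>" "Gam S k r"] unfolding ip[OF r] by linarith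
      qed
      have step: "(\<exists>D. (Gam S k has_vector_derivative - D) (at r) \<and> norm (D - l r) \<le> \<eta>) \<and>
          (\<exists>D. (Gam_hat S k has_vector_derivative - D) (at r) \<and> norm (D - lh r) \<le> \<eta>)" if r: "r \<in> {u<..<T} - t ` {..N}" for r
      proof -
        have ru: "r \<in> {u..T}" "r \<in> {t (Suc k)..T}" "r \<in> {0..T}" "r \<notin> t ` {..N}" using r uT by auto
        obtain j where j: "Suc k \<le> j" "j < N" "r \<in> {t j<..<t (Suc j)}"
          by (rule partition_cell_open[OF p Sk ru(2,4)])
        note o = scheme_open_cell[OF p S k(1) j]
        note bd = scheme_bounds(3-5)[OF p S k(1) ru(2)] and cf = coef_uniform_bound[OF ru(3) \<tau>]
        have j': "r \<in> {t j<..t (Suc j)}" "r \<in> {t j..t (Suc j)}" "r \<in> {t j..<t (Suc j)}" "t j \<le> r" "r \<le> T" using j(3) ru by auto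
        have tj: "0 \<le> t j" "t j \<in> {0..T}" using partition_range[OF p, of j] j(2) by auto
        have mj: "\<bar>t j - r\<bar> \<le> \<rho>2" using partition_mesh[OF j(2), of t] m \<rho>(3) j'(2) \<rho>2(1) by auto
        have mk: "\<bar>t k - \<tau>\<bar> \<le> \<rho>2" using k(3) m \<rho>(3) by linarith
        have R: "norm (hR d r (t j) - hR d r r) \<le> z"
          using \<rho>2(2) ru(3) tj(2) mj unfolding modulus_def by blast
        have W: "norm (cQ d r (t k) - cQ d r \<tau>) \<le> z" "norm (hQ d r (t k) - hQ d r \<tau>) \<le> z"
          "norm (cR d r (t k) - cR d r \<tau>) \<le> z" "norm (hR d r (t k) - hR d r \<tau>) \<le> z"
          using \<rho>2(2) ru(3) o(6) \<tau> mk unfolding modulus_def by blast+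
        \<comment> \<open>Hence \<open>interp1\<close> at r evaluates the very \<open>Pk\<close>
          from which the gain at r is formed.\<close>
        have ce: "cell t r = j" by (rule cell_eq[OF p j(2) j'(1)])
        have d1: "norm (interp2 t (Gam S) r r - \<Gamma> r r) \<le> z" "norm (interp2 t (Gam_hat S) r r - \<Gamma>h r r) \<le> z"
          using limit_closeD[OF \<rho>1(2) f1 ru(3) ru(3) ru(3) ru(3)] \<rho>1(1) by auto
        have P: "norm (Pk S j r - \<Gamma> r r) \<le> 2 * z" "norm (Pk_hat S j r - \<Gamma>h r r) \<le> 2 * z"
          using schemes_closeD(1-3)[OF \<rho>3(2) f3 ru(3) ru(3)] d1 tri'[of "Pk S j r" "\<Gamma> r r" "interp2 t (Gam S) r r"]
            tri'[of "Pk_hat S j r" "\<Gamma>h r r" "interp2 t (Gam_hat S) r r"]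
          unfolding interp1_def ce by linarith+
        have "norm (Th_hat S r - \<theta> r) \<le> L1 * (norm (hR d r (t j) - hR d r r) + norm (Pk_hat S j r - \<Gamma>h r r) + norm (Pk S j r - \<Gamma> r r))"
          unfolding is_scheme_gain(2)[OF S j(2) j'(3)] \<theta>_def equilibrium_gain_def
          by (rule L1(2)[OF uc[OF cf(6)] uc[OF cf(7)] uc[OF cf(8)] cb(3)[OF ru(3) ru(3)] cb(2)[OF ru(3) ru(3)]
              gram_coercive_psd(2)[OF tj(1) j'(4,5) is_scheme_psd(4)[OF p S j(2) j'(2)]] co[OF ru(3)]])
        also have "\<dots> \<le> L1 * (z + 2 * z + 2 * z)" by (intro mult_left_mono add_mono R P L1(1))
        finally have \<Theta>: "norm (Th_hat S r - \<theta> r) \<le> L1 * (5 * z)" by simp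
        have tot: "L2 * (q1 + q2 + norm (Th_hat S r - \<theta> r) + q3 + norm (Gam_tilde S k r - \<Gamma> r \<tau>)) \<le> \<eta>"
          if "q1 \<le> z" "q2 \<le> z" "q3 \<le> z" for q1 q2 q3
        proof -
          have "L2 * (q1 + q2 + norm (Th_hat S r - \<theta> r) + q3 + norm (Gam_tilde S k r - \<Gamma> r \<tau>))
              \<le> L2 * (z + z + L1 * (5 * z) + z + 2 * z)"
            by (intro mult_left_mono add_mono that \<Theta> close(3) ru L2(1))
          also have "\<dots> = L2 * ((5 + 5 * L1) * z)" by (simp add: algebra_simps)
          finally show ?thesis using z(3) by linarith
        qed
        note ucf = uc[OF cf(5)] uc[OF cf(6)] uc[OF cf(7)] uc[OF cf(8)]
        show ?thesis
        proof (intro conjI exI)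
          show "(Gam S k has_vector_derivative - lyapunov_op (hA d r) (hB d r) (hC d r) (hD d r) (cQ d r (t k)) (cR d r (t k))
              (Th_hat S r) (Gam S k r) (Gam_tilde S k r)) (at r)" by (rule o(2))
          show "norm (lyapunov_op (hA d r) (hB d r) (hC d r) (hD d r) (cQ d r (t k)) (cR d r (t k))
              (Th_hat S r) (Gam S k r) (Gam_tilde S k r) - l r) \<le> \<eta>"
            unfolding l_def
            by (rule order_trans[OF L2(2)[OF ucf uc[OF cf(11)] uc[OF o(8)] cb(1)[OF ru(3) \<tau>] uc[OF bd(2)] cb(2)[OF ru(3) \<tau>] cb(2)[OF ru(3) \<tau>]]
                tot[OF W(1,3) close(1)[OF ru(1)]]])
          show "(Gam_hat S k has_vector_derivative - lyapunov_op (hA d r) (hB d r) (hC d r) (hD d r) (hQ d r (t k)) (hR d r (t k))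
              (Th_hat S r) (Gam_hat S k r) (Gam_tilde S k r)) (at r)" by (rule o(3))
          show "norm (lyapunov_op (hA d r) (hB d r) (hC d r) (hD d r) (hQ d r (t k)) (hR d r (t k))
              (Th_hat S r) (Gam_hat S k r) (Gam_tilde S k r) - lh r) \<le> \<eta>"
            unfolding lh_def
            by (rule order_trans[OF L2(2)[OF ucf uc[OF cf(12)] uc[OF o(8)] cb(1)[OF ru(3) \<tau>] uc[OF bd(3)] cb(3)[OF ru(3) \<tau>] cb(2)[OF ru(3) \<tau>]]
                tot[OF W(2,4) close(2)[OF ru(1)]]])
        qed
      qed
      have u\<eta>: "u \<le> \<tau> + \<eta>" using k(4) m \<rho>(5) by linarith
      have E: "finite (t ` {..N})" by simp
      have cont: "continuous_on {u..T} (Gam S k)" "continuous_on {u..T} (Gam_hat S k)"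
        by (rule continuous_on_subset[OF Gam_continuous(1)[OF S k(1)] uT(1)]
            continuous_on_subset[OF Gam_continuous(2)[OF S k(1)] uT(1)])+
      have near: "\<forall>r\<in>{u..T}. norm (Gam S k r - \<Gamma> r \<tau>) \<le> \<eta> \<and> norm (Gam_hat S k r - \<Gamma>h r \<tau>) \<le> \<eta>"
      proof (intro ballI conjI)
        fix r assume "r \<in> {u..T}"
        from close(1,2)[OF this] z(2)
        show "norm (Gam S k r - \<Gamma> r \<tau>) \<le> \<eta>" "norm (Gam_hat S k r - \<Gamma>h r \<tau>) \<le> \<eta>" by linarith+
      qed
      show ?thesis
        by (rule exI[of _ u], rule conjI[OF uT(3)], rule conjI[OF u\<eta>], rule exI[of _ "t ` {..N}"],
            rule exI[of _ "Gam S k"], rule exI[of _ "Gam_hat S k"],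
            rule conjI[OF E conjI[OF cont(1) conjI[OF cont(2) conjI[OF near ballI]]]], rule step)
    qed
    show "((\<lambda>r. \<Gamma> r \<tau>) has_vector_derivative - lyapunov_op (hA d s) (hB d s) (hC d s) (hD d s) (cQ d s \<tau>) (cR d s \<tau>)
        (\<theta> s) (\<Gamma> s \<tau>) (\<Gamma> s \<tau>)) (at s within {\<tau>..T})"
      unfolding l_def[symmetric]
    proof (rule limit_of_approximate_solutions[OF \<tau>T _ cl(1) _ s])
      show "continuous_on {\<tau>..T} (\<lambda>r. \<Gamma> r \<tau>)" by (rule sect(1)[OF \<tau>, THEN continuous_on_subset, OF sub])
      show "\<exists>u g E. u \<le> \<tau> + \<eta> \<and> \<tau> \<le> u \<and> finite E \<and> continuous_on {u..T} g \<and> (\<forall>r\<in>{u..T}. norm (g r - \<Gamma> r \<tau>) \<le> \<eta>) \<and>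
          (\<forall>r\<in>{u<..<T} - E. \<exists>D. (g has_vector_derivative - D) (at r) \<and> norm (D - l r) \<le> \<eta>)" if "0 < \<eta>" for \<eta>
        using approx[OF that] by meson
    qed
    show "((\<lambda>r. \<Gamma>h r \<tau>) has_vector_derivative - lyapunov_op (hA d s) (hB d s) (hC d s) (hD d s) (hQ d s \<tau>) (hR d s \<tau>)
        (\<theta> s) (\<Gamma>h s \<tau>) (\<Gamma> s \<tau>)) (at s within {\<tau>..T})"
      unfolding lh_def[symmetric]
    proof (rule limit_of_approximate_solutions[OF \<tau>T _ cl(2) _ s])
      show "continuous_on {\<tau>..T} (\<lambda>r. \<Gamma>h r \<tau>)" by (rule sect(2)[OF \<tau>, THEN continuous_on_subset, OF sub])
      show "\<exists>u g E. u \<le> \<tau> + \<eta> \<and> \<tau> \<le> u \<and> finite E \<and> continuous_on {u..T} g \<and> (\<forall>r\<in>{u..T}. norm (g r - \<Gamma>h r \<tau>) \<le> \<eta>) \<and>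
          (\<forall>r\<in>{u<..<T} - E. \<exists>D. (g has_vector_derivative - D) (at r) \<and> norm (D - lh r) \<le> \<eta>)" if "0 < \<eta>" for \<eta>
        using approx[OF that] by meson
    qed
  qed
  show "equilibrium_riccati d T \<Gamma> \<Gamma>h"
    unfolding equilibrium_riccati_def \<theta>_def[symmetric]
    using coercive_invertible[OF \<delta>2 co] fin ode by blast
qed

end

theorem theorem6p5:
  fixes d :: "('n::finite, 'm::finite) lq_data" and T :: real
  assumes "0 < T" and "H1 T d" and "H2 T d" and "H3 T d"
  shows
    "(\<forall>N t. is_partition T N t \<longrightarrow> (\<exists>S. is_scheme d T N t S)) \<and>
     (\<exists>\<Gamma> \<Gamma>h :: real \<Rightarrow> real \<Rightarrow> real^'n^'n.
        equilibrium_riccati d T \<Gamma> \<Gamma>h \<and>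
        (\<forall>s \<tau>. 0 \<le> s \<and> s \<le> \<tau> \<and> \<tau> \<le> T \<longrightarrow> \<Gamma> s \<tau> = \<Gamma> \<tau> \<tau> \<and> \<Gamma>h s \<tau> = \<Gamma>h \<tau> \<tau>) \<and>
        (\<forall>\<epsilon>>0. \<exists>\<eta>>0. \<forall>N t S.
           is_partition T N t \<and> mesh N t < \<eta> \<and> is_scheme d T N t S \<longrightarrow>
           (\<forall>s\<in>{0..T}. \<forall>\<tau>\<in>{0..T}.
              norm (interp2 t (Gam_tilde S) s \<tau> - \<Gamma> s \<tau>)
              + norm (interp2 t (Gam S) s \<tau> - \<Gamma> s \<tau>)
              + norm (interp2 t (Gam_hat S) s \<tau> - \<Gamma>h s \<tau>)
              + norm (interp1 t (Pk S) s - \<Gamma> s s)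
              + norm (interp1 t (Pk_hat S) s - \<Gamma>h s s) < \<epsilon>)))"
proof -
  obtain \<kappa> \<delta> where "lq_problem d T \<kappa> \<delta>" using lq_problem_exists[OF assms] by blast
  then interpret lq_problem d T \<kappa> \<delta> .
  obtain \<Gamma> \<Gamma>h where lim: "\<forall>\<epsilon>>0. \<exists>\<rho>>0. limit_close \<Gamma> \<Gamma>h \<rho> \<epsilon>"
    using limit_exists by blast
  have conv: "\<exists>\<eta>>0. \<forall>N t S. is_partition T N t \<and> mesh N t < \<eta> \<and> is_scheme d T N t S \<longrightarrow>
      (\<forall>s\<in>{0..T}. \<forall>\<tau>\<in>{0..T}.
        norm (interp2 t (Gam_tilde S) s \<tau> - \<Gamma> s \<tau>) + norm (interp2 t (Gam S) s \<tau> - \<Gamma> s \<tau>)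
        + norm (interp2 t (Gam_hat S) s \<tau> - \<Gamma>h s \<tau>) + norm (interp1 t (Pk S) s - \<Gamma> s s)
        + norm (interp1 t (Pk_hat S) s - \<Gamma>h s s) < \<epsilon>)" if "0 < \<epsilon>" for \<epsilon>
  proof -
    \<comment> \<open>The five terms cost 2 + 1 + 1 + 2 + 2 = 8 multiples of e; the ninth makes the
      inequality strict.\<close>
    define e where "e = \<epsilon> / 9"
    have e: "0 < e" "\<epsilon> = 9 * e" using that by (simp_all add: e_def)
    obtain \<rho>1 where \<rho>1: "0 < \<rho>1" "limit_close \<Gamma> \<Gamma>h \<rho>1 e" using lim e(1) by blast
    obtain \<rho>2 where \<rho>2: "0 < \<rho>2" "schemes_close \<rho>2 e" using schemes_close_exists[OF e(1)] by blast
    have tri: "norm (x - z) \<le> norm (x - y) + norm (y - z)" for x y z :: "real^'n^'n" by norm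
    show ?thesis
    proof (intro exI[of _ "min \<rho>1 \<rho>2"] conjI allI impI ballI)
      show "0 < min \<rho>1 \<rho>2" using \<rho>1 \<rho>2 by simp
      fix N t S s \<tau>
      assume a: "is_partition T N t \<and> mesh N t < min \<rho>1 \<rho>2 \<and> is_scheme d T N t S" and s: "s \<in> {0..T}" "\<tau> \<in> {0..T}"
      have f: "fine_scheme \<rho>1 N t S" "fine_scheme \<rho>2 N t S" using a by (auto simp: fine_scheme_def)
      have z: "\<bar>s - s\<bar> \<le> \<rho>1" "\<bar>\<tau> - \<tau>\<bar> \<le> \<rho>1" using \<rho>1(1) by auto
      show "norm (interp2 t (Gam_tilde S) s \<tau> - \<Gamma> s \<tau>) + norm (interp2 t (Gam S) s \<tau> - \<Gamma> s \<tau>)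
        + norm (interp2 t (Gam_hat S) s \<tau> - \<Gamma>h s \<tau>) + norm (interp1 t (Pk S) s - \<Gamma> s s)
        + norm (interp1 t (Pk_hat S) s - \<Gamma>h s s) < \<epsilon>"
        using limit_closeD[OF \<rho>1(2) f(1) s s z] limit_closeD[OF \<rho>1(2) f(1) s(1,1,1,1) z(1,1)]
          schemes_closeD(1-3)[OF \<rho>2(2) f(2) s] e
          tri[of "interp2 t (Gam_tilde S) s \<tau>" "\<Gamma> s \<tau>" "interp2 t (Gam S) s \<tau>"]
          tri[of "interp1 t (Pk S) s" "\<Gamma> s s" "interp2 t (Gam S) s s"]
          tri[of "interp1 t (Pk_hat S) s" "\<Gamma>h s s" "interp2 t (Gam_hat S) s s"]
        by linarith
    qed
  qed
  show ?thesis
    using scheme_exists limit_solves[OF lim] conv by blast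
qed

end
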